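(* Let $\Omega\subset\mathbb C$ be a (bounded) Jordan domain with boundary $\Gamma=\partial\Omega$, let $\omega$ be some conformal mapping from the unit disk $\mathbb D$ onto $\Omega$ (extended to a homeomorphism $\overline{\mathbb D}\to\overline\Omega$), and let $h\in C(\Gamma)$ be a complex-valued function. Suppose that $\Omega$ and $h$ are such that $h\circ\omega\in C^\alpha(\mathbb T)$ for some $1/2<\alpha<1$. Define functions $F_n$ on $\mathbb D$, $n\ge 0$, recursively by $$F_0=\mathcal P[h\circ\omega],\qquad F_n=\mathcal K\left[\frac{\overline{\omega'}}{\omega'}\,\partial F_{n-1}\right],\quad n\geqslant 1,$$ (extended by continuity to $\overline{\mathbb D}$), and put $f_n=F_n\circ\omega^{-1}$, $n\ge 0$. Then for every $\tau\in[0,1)$ the series $$\sum_{n=0}^\infty f_n\tau^n$$ converges uniformly on $\overline\Omega$ to a function $f\in C(\overline\Omega)$ that satisfies the equation $\mathcal L f=0$ in $\Omega$, where $\mathcal L=\partial\overline\partial+\tau\partial^2$, and coincides with $h$ on $\Gamma$.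
   Context: $\mathbb D=\{z\in\mathbb C:|z|<1\}$, $\mathbb T=\partial\mathbb D$ (oriented counterclockwise), and $\mu$ is planar Lebesgue measure. A Jordan domain is a bounded domain whose boundary is a Jordan curve; by Carath\'eodory's theorem, a conformal map $\omega:\mathbb D\to\Omega$ onto such a domain extends to a homeomorphism of $\overline{\mathbb D}$ onto $\overline\Omega$, denoted by the same letter. All functions are complex-valued functions of $z=x+iy$, and $$\overline\partial=\tfrac12\left(\tfrac{\partial}{\partial x}+i\tfrac{\partial}{\partial y}\right),\qquad \partial=\tfrac12\left(\tfrac{\partial}{\partial x}-i\tfrac{\partial}{\partial y}\right).$$ The equation $\mathcal Lf=0$ in $\Omega$ is understood in the classical sense. $C^\alpha(\mathbb T)$ is the H\"older class of functions $\varphi$ on $\mathbb T$ with $\sup_{\zeta_1\neq\zeta_2}|\varphi(\zeta_1)-\varphi(\zeta_2)|/|\zeta_1-\zeta_2|^\alpha<\infty$. Let $G(\zeta,z)=\frac{2}{\pi}\log\left|\frac{\zeta-z}{1-\zeta\overline z}\right|$ be the Green's function of the operator $\partial\overline\partial=\Delta/4$ in $\mathbb D$. For $\varphi\in C(\mathbb T)$ and $z\in\mathbb D$, $$\mathcal P[\varphi](z)=\frac{1}{2i}\int_{\mathbb T}\partial_\zeta G(\zeta,z)\varphi(\zeta)\,d\zeta=\frac{1}{2\pi i}\int_{\mathbb T}\left(\frac{1}{\zeta-z}+\frac{\overline z}{1-\zeta\overline z}\right)\varphi(\zeta)\,d\zeta$$ (the Poisson integral of $\varphi$). For $\varphi\in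 L_p(\mathbb D)$, $$\mathcal K[\varphi](z)=\int_{\mathbb D}\partial_\zeta G(\zeta,z)\varphi(\zeta)\,d\mu(\zeta)=\frac1\pi\int_{\mathbb D}\left(\frac{1}{\zeta-z}+\frac{\overline z}{1-\zeta\overline z}\right)\varphi(\zeta)\,d\mu(\zeta).$$ *)

theory Defs
  imports "HOL-Complex_Analysis.Complex_Analysis"
begin

definition jordan_domain :: "complex set \<Rightarrow> bool" where
  "jordan_domain \<Omega> \<longleftrightarrow>
     open \<Omega> \<and> connected \<Omega> \<and> \<Omega> \<noteq> {} \<and> bounded \<Omega> \<and>
     (\<exists>\<gamma>. simple_path \<gamma> \<and> pathfinish \<gamma> = pathstart \<gamma> \<and> path_image \<gamma> = frontier \<Omega>)"

definition holder_on :: "real \<Rightarrow> complex set \<Rightarrow> (complex \<Rightarrow> complex) \<Rightarrow> bool" where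
  "holder_on \<alpha> S \<phi> \<longleftrightarrow>
     bdd_above {cmod (\<phi> u - \<phi> v) / cmod (u - v) powr \<alpha> | u v. u \<in> S \<and> v \<in> S \<and> u \<noteq> v}"

definition partial_x :: "(complex \<Rightarrow> complex) \<Rightarrow> complex \<Rightarrow> complex" where
  "partial_x f z = vector_derivative (\<lambda>t::real. f (z + of_real t)) (at 0)"

definition partial_y :: "(complex \<Rightarrow> complex) \<Rightarrow> complex \<Rightarrow> complex" where
  "partial_y f z = vector_derivative (\<lambda>t::real. f (z + \<i> * of_real t)) (at 0)"

definition d_z :: "(complex \<Rightarrow> complex) \<Rightarrow> complex \<Rightarrow> complex" where
  "d_z f z = (partial_x f z - \<i> * partial_y f z) / 2"

definition d_zbar :: "(complex \<Rightarrow> complex) \<Rightarrow> complex \<Rightarrow> complex" where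
  "d_zbar f z = (partial_x f z + \<i> * partial_y f z) / 2"

definition C1_on :: "(complex \<Rightarrow> complex) \<Rightarrow> complex set \<Rightarrow> bool" where
  "C1_on f S \<longleftrightarrow>
     (\<forall>z\<in>S. (\<lambda>t::real. f (z + of_real t)) differentiable (at 0) \<and>
            (\<lambda>t::real. f (z + \<i> * of_real t)) differentiable (at 0)) \<and>
     continuous_on S (partial_x f) \<and> continuous_on S (partial_y f)"

definition C2_on :: "(complex \<Rightarrow> complex) \<Rightarrow> complex set \<Rightarrow> bool" where
  "C2_on f S \<longleftrightarrow> C1_on f S \<and> C1_on (partial_x f) S \<and> C1_on (partial_y f) S"

definition L_op :: "real \<Rightarrow> (complex \<Rightarrow> complex) \<Rightarrow> complex \<Rightarrow> complex" where
  "L_op \<tau> f z = d_z (d_zbar f) z + of_real \<tau> * d_z (d_z f) z"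

definition classical_solution :: "real \<Rightarrow> complex set \<Rightarrow> (complex \<Rightarrow> complex) \<Rightarrow> bool" where
  "classical_solution \<tau> \<Omega> f \<longleftrightarrow> C2_on f \<Omega> \<and> (\<forall>z\<in>\<Omega>. L_op \<tau> f z = 0)"

definition green :: "complex \<Rightarrow> complex \<Rightarrow> real" where
  "green \<zeta> z = 2 / pi * ln (cmod ((\<zeta> - z) / (1 - \<zeta> * cnj z)))"

text \<open>
  \<open>\<pi>\<close> times the \<open>\<partial>\<close>-derivative of \<open>green\<close> in its first argument, in closed form
  (see \<open>d_z_green\<close>).
\<close>

definition kern :: "complex \<Rightarrow> complex \<Rightarrow> complex" where
  "kern \<zeta> z = 1 / (\<zeta> - z) + cnj z / (1 - \<zeta> * cnj z)"

lemma vector_derivative_ln_cmod: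
  fixes g :: "complex \<Rightarrow> complex" and c w :: complex
  assumes g: "(g has_field_derivative g') (at w)" and nz: "g w \<noteq> 0"
  shows "((\<lambda>t::real. complex_of_real (ln (cmod (g (w + c * of_real t)))))
           has_vector_derivative of_real (Re (g' * c / g w))) (at 0)"
proof -
  define q where "q = (\<lambda>t::real. g (w + c * of_real t))"
  have 1: "((\<lambda>t::real. w + c * of_real t) has_vector_derivative c) (at 0)"
    by (auto intro!: derivative_eq_intros)
  have q: "(q has_vector_derivative c * g') (at 0)"
    unfolding q_def using field_vector_diff_chain_at[OF 1, of g g'] g
    by (simp add: o_def)
  have q0: "q 0 = g w" "q 0 \<noteq> 0" using nz by (auto simp: q_def)
  have qd: "(q has_derivative (\<lambda>t. t *\<^sub>R (c * g'))) (at 0)"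
    using q by (simp add: has_vector_derivative_def)
  have n: "((\<lambda>t. cmod (q t)) has_derivative (\<lambda>t. (t *\<^sub>R (c * g')) \<bullet> sgn (q 0))) (at 0)"
    using has_derivative_compose[OF qd has_derivative_norm[OF q0(2)]]
    by (simp add: inner_commute)
  have "(\<lambda>t. (t *\<^sub>R (c * g')) \<bullet> sgn (q 0)) = (*) ((c * g') \<bullet> sgn (q 0))"
    by (rule ext) (simp only: inner_scaleR_left mult.commute)
  hence "((\<lambda>t. cmod (q t)) has_real_derivative ((c * g') \<bullet> sgn (q 0))) (at 0)"
    using n by (simp only: has_field_derivative_def)
  hence "((\<lambda>t. ln (cmod (q t))) has_real_derivative ((c * g') \<bullet> sgn (q 0)) / cmod (q 0)) (at 0)"
    using q0 by (auto intro!: derivative_eq_intros)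
  moreover have "((c * g') \<bullet> sgn (q 0)) / cmod (q 0) = Re (g' * c / g w)"
  proof -
    have "Re (g' * c / g w) = Re (g' * c * cnj (g w)) / (cmod (g w))\<^sup>2"
      by (subst complex_div_cnj) (simp add: Re_divide_of_real flip: of_real_power)
    also have "Re (g' * c * cnj (g w)) = (c * g') \<bullet> g w"
      by (simp add: inner_complex_def algebra_simps)
    finally show ?thesis
      by (simp add: q0 sgn_div_norm inner_scaleR_right power2_eq_square divide_simps)
  qed
  ultimately have "((\<lambda>t. ln (cmod (q t))) has_real_derivative Re (g' * c / g w)) (at 0)"
    by simp
  from has_vector_derivative_of_real[OF this] show ?thesis
    by (simp add: q_def)
qed

lemma d_z_green:
  assumes z: "cmod z < 1" and \<zeta>: "cmod \<zeta> \<le> 1" and ne: "\<zeta> \<noteq> z"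
  shows "d_z (\<lambda>\<zeta>. of_real (green \<zeta> z)) \<zeta> = kern \<zeta> z / of_real pi"
proof -
  have nz: "1 - \<zeta> * cnj z \<noteq> 0"
  proof
    assume "1 - \<zeta> * cnj z = 0"
    hence "cmod \<zeta> * cmod z = 1"
      by (metis complex_mod_cnj eq_iff_diff_eq_0 norm_mult norm_one)
    moreover have "cmod \<zeta> * cmod z < 1"
      using z \<zeta> by (meson less_1_mult mult_left_le_one_le norm_ge_zero order_le_less_trans)
    ultimately show False by simp
  qed
  define g where "g = (\<lambda>\<zeta>. (\<zeta> - z) / (1 - \<zeta> * cnj z))"
  define g' where "g' = (1 - \<zeta> * cnj z + (\<zeta> - z) * cnj z) / (1 - \<zeta> * cnj z)\<^sup>2"
  have g: "(g has_field_derivative g') (at \<zeta>)"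
    unfolding g_def g'_def using nz
    by (auto intro!: derivative_eq_intros simp: power2_eq_square)
  have g0: "g \<zeta> \<noteq> 0" using nz ne by (simp add: g_def)
  have K: "g' / g \<zeta> = kern \<zeta> z"
    using nz ne by (simp add: g_def g'_def kern_def divide_simps power2_eq_square)
  have vd: "vector_derivative (\<lambda>t::real. complex_of_real (green (\<zeta> + c * of_real t) z)) (at 0)
        = of_real (2 / pi * Re (kern \<zeta> z * c))" for c
  proof -
    have "((\<lambda>t::real. of_real (2/pi) * complex_of_real (ln (cmod (g (\<zeta> + c * of_real t)))))
           has_vector_derivative of_real (2/pi) * of_real (Re (g' * c / g \<zeta>))) (at 0)"
      by (intro has_vector_derivative_mult_right vector_derivative_ln_cmod g g0)
    moreover have "g' * c / g \<zeta> = kern \<zeta> z * c" using K by (metis times_divide_eq_left)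
    ultimately show ?thesis
      by (intro vector_derivative_at) (simp add: green_def g_def)
  qed
  have "partial_x (\<lambda>\<zeta>. of_real (green \<zeta> z)) \<zeta> = of_real (2 / pi * Re (kern \<zeta> z))"
    using vd[of 1] by (simp add: partial_x_def)
  moreover have "partial_y (\<lambda>\<zeta>. of_real (green \<zeta> z)) \<zeta> = of_real (2 / pi * - Im (kern \<zeta> z))"
    using vd[of \<i>] by (simp add: partial_y_def)
  ultimately show ?thesis
    by (simp add: d_z_def complex_eq_iff)
qed

text \<open>Only the values of \<open>\<phi>\<close> on the unit circle (respectively in the unit disk) enter.\<close>

definition poisson :: "(complex \<Rightarrow> complex) \<Rightarrow> complex \<Rightarrow> complex" where
  "poisson \<phi> z =
     1 / (2 * of_real pi * \<i>) * contour_integral (circlepath 0 1) (\<lambda>\<zeta>. kern \<zeta> z * \<phi> \<zeta>)"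

definition K_op :: "(complex \<Rightarrow> complex) \<Rightarrow> complex \<Rightarrow> complex" where
  "K_op \<phi> z =
     1 / of_real pi * set_lebesgue_integral lebesgue (ball 0 1) (\<lambda>\<zeta>. kern \<zeta> z * \<phi> \<zeta>)"

definition beltrami_dz :: "(complex \<Rightarrow> complex) \<Rightarrow> (complex \<Rightarrow> complex) \<Rightarrow> complex \<Rightarrow> complex" where
  "beltrami_dz \<omega> F \<zeta> = cnj (deriv \<omega> \<zeta>) / deriv \<omega> \<zeta> * d_z F \<zeta>"

primrec F_seq :: "(complex \<Rightarrow> complex) \<Rightarrow> (complex \<Rightarrow> complex) \<Rightarrow> nat \<Rightarrow> complex \<Rightarrow> complex" where
  "F_seq \<omega> h 0 = poisson (h \<circ> \<omega>)"
| "F_seq \<omega> h (Suc n) = K_op (beltrami_dz \<omega> (F_seq \<omega> h n))"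

text \<open>
  The recursion is only meaningful in the open disk; values on the unit circle are the limits
  from inside. \<open>Lim\<close> is total, so the existence of these limits (equivalently, continuity of
  \<open>F_ext\<close> on the closed disk) is not implied by the definition.
\<close>

definition F_ext :: "(complex \<Rightarrow> complex) \<Rightarrow> (complex \<Rightarrow> complex) \<Rightarrow> nat \<Rightarrow> complex \<Rightarrow> complex" where
  "F_ext \<omega> h n z =
     (if z \<in> ball 0 1 then F_seq \<omega> h n z else Lim (at z within ball 0 1) (F_seq \<omega> h n))"

end

theory Submission
  imports Defs
begin

text \<open>
  Write \<open>\<phi>\<^sub>n = (cnj \<omega>' / \<omega>') \<partial>F\<^sub>n\<close>. The kernel of \<open>K_op\<close> is the derivative of the Green
  function, so \<open>F\<^sub>n\<^sub>+\<^sub>1 = K_op \<phi>\<^sub>n\<close> vanishes on the circle and \<open>dbar F\<^sub>n\<^sub>+\<^sub>1 + \<phi>\<^sub>n\<close> is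
  antiholomorphic. Transported to \<open>\<Omega>\<close>, where the factor \<open>cnj \<omega>' / \<omega>'\<close> disappears, this says that
  \<open>(dbar + \<tau> \<partial>) f\<close> is formally antiholomorphic for \<open>f = \<Sum> \<tau>\<^sup>n f\<^sub>n\<close>, which is \<open>L f = 0\<close>; only \<open>f\<^sub>0\<close>
  contributes to the boundary values. What has to be shown is that the series converges uniformly
  and that the formal computation survives the limit.

  As \<open>|\<phi>\<^sub>n| = |\<partial>F\<^sub>n|\<close>, an \<open>L\<^sup>2\<close> bound \<open>\<parallel>\<partial>(K_op \<phi>)\<parallel> \<le> \<parallel>\<phi>\<parallel>\<close> would keep the
  energies of all \<open>F\<^sub>n\<close> bounded, but a bound of the energy does not bound \<open>F\<^sub>n\<close> itself. Both
  become available at once if \<open>L\<^sup>2\<close> is weighted by a small negative power \<open>-2\<delta>\<close> of the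
  pseudohyperbolic distance to a point \<open>a\<close>, uniformly in \<open>a\<close> (\<open>wnorm\<close>). In the coordinate \<open>w\<close> in
  which the disk punctured at \<open>a\<close> is a half cylinder, the kernel with pole \<open>a\<close> becomes the constant
  1 and the weight becomes \<open>exp (-2\<delta> Re w)\<close>. The Cauchy--Schwarz inequality bounds
  \<open>K_op \<phi> a\<close> (\<open>K_op_bound\<close>), and the energy inequality splits into one elementary inequality for
  every Fourier mode (\<open>weighted_mode_inequality\<close>), at the price of the constant
  \<open>(1 + 2\<delta>) / (1 - 2\<delta>)\<close> (\<open>disk_energy\<close>). For small \<open>\<delta>\<close> a factor \<open>\<tau> < 1\<close> outweighs this
  constant, so the series converges geometrically.

  The iteration starts from \<open>\<partial>F\<^sub>0\<close>, which is the derivative of the Cauchy integral of \<open>h \<circ> \<omega>\<close>, hence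
  \<open>O((1 - |z|) powr (\<alpha> - 1))\<close>. Its square has an exponent larger than \<open>-1\<close> exactly if
  \<open>\<alpha> > 1/2\<close>, and this leaves room for the weight (\<open>wnorm_boundary_power\<close>).

  The iterates are smooth for an algebraic reason: all \<open>F\<^sub>n\<close> are polynomials in \<open>cnj \<omega>\<close> with
  holomorphic coefficients plus an antiholomorphic function (\<open>polyan\<close>). Therefore \<open>\<phi>\<^sub>n\<close> has an
  explicit primitive with respect to \<open>dbar\<close>, which reduces \<open>K_op \<phi>\<^sub>n\<close> to the Cauchy--Pompeiu formula (\<open>polyan_K_op\<close>).

  The equation is obtained as follows. In the coordinate \<open>\<xi> = z - \<tau> cnj z\<close> the operator
  \<open>dbar + \<tau> \<partial>\<close> is a multiple of \<open>\<partial>/\<partial>cnj \<xi>\<close>. After removal of the antiholomorphic parts, it maps the partial sums to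
  \<open>\<tau>\<^sup>N\<^sup>+\<^sup>1 \<partial>f\<^sub>N\<close>, which tends to 0 in \<open>L\<^sup>1\<close> by the energy bound. A locally uniform limit of such
  functions is holomorphic in \<open>\<xi>\<close> (\<open>dbar_L1_limit_holomorphic\<close>), so that
  \<open>f = cnj b(z) + s(z - \<tau> cnj z)\<close> with \<open>b\<close> and \<open>s\<close> holomorphic, and such functions are classical
  solutions (\<open>classical_solution_split\<close>).
\<close>

section \<open>Injective holomorphic changes of variables\<close>

lemma borel_measurable_if_continuous:
  fixes f :: "complex \<Rightarrow> complex"
  assumes "open S" "continuous_on S f"
  shows "(\<lambda>z. if z \<in> S then f z else 0) \<in> borel_measurable borel"
  using borel_measurable_continuous_on_if[of S f "\<lambda>_. 0"] assms by auto

text \<open>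
  Fubini arguments need Lebesgue measure on \<open>complex\<close> as a product of two one-dimensional ones.
\<close>

lemma lborel_complex_prod:
  "(lborel :: complex measure) = distr (lborel \<Otimes>\<^sub>M lborel) borel (\<lambda>(x, y). Complex x y)"
proof (rule lborel_eqI)
  have m[measurable]: "(\<lambda>(x, y). Complex x y) \<in> borel_measurable (lborel \<Otimes>\<^sub>M lborel)"
    by (simp add: Complex_eq split_beta)
  fix l u :: complex
  assume lu: "\<And>b. b \<in> Basis \<Longrightarrow> l \<bullet> b \<le> u \<bullet> b"
  have le: "Re l \<le> Re u" "Im l \<le> Im u"
    using lu[of 1] lu[of \<i>] by (auto simp: Basis_complex_def)
  have "(\<lambda>(x, y). Complex x y) -` box l u = {Re l<..<Re u} \<times> {Im l<..<Im u}"
    by (auto simp: box_def Basis_complex_def)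
  with le show "emeasure (distr (lborel \<Otimes>\<^sub>M lborel) borel (\<lambda>(x, y). Complex x y)) (box l u)
      = ennreal (\<Prod>b\<in>Basis. (u - l) \<bullet> b)"
    by (simp add: emeasure_distr space_pair_measure lborel.emeasure_pair_measure_Times
        Basis_complex_def ennreal_mult)
qed simp

lemma nn_integral_complex_prod:
  fixes f :: "complex \<Rightarrow> ennreal"
  assumes [measurable]: "f \<in> borel_measurable borel"
  shows "(\<integral>\<^sup>+z. f z \<partial>lborel) = (\<integral>\<^sup>+x. \<integral>\<^sup>+y. f (Complex x y) \<partial>lborel \<partial>lborel)"
proof -
  have m[measurable]: "(\<lambda>(x, y). Complex x y) \<in> borel_measurable (lborel \<Otimes>\<^sub>M lborel)"
    by (simp add: Complex_eq split_beta)
  show ?thesis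
    by (subst lborel_complex_prod)
       (simp add: nn_integral_distr lborel.nn_integral_fst[symmetric] case_prod_unfold)
qed

lemma integral_complex_prod:
  fixes f :: "complex \<Rightarrow> complex"
  assumes f: "integrable lborel f"
  shows "(\<integral>z. f z \<partial>lborel) = (\<integral>y. \<integral>x. f (Complex x y) \<partial>lborel \<partial>lborel)"
    and "(\<integral>z. f z \<partial>lborel) = (\<integral>x. \<integral>y. f (Complex x y) \<partial>lborel \<partial>lborel)"
proof -
  have m[measurable]: "(\<lambda>(x, y). Complex x y) \<in> borel_measurable (lborel \<Otimes>\<^sub>M lborel)"
    by (simp add: Complex_eq split_beta)
  have [measurable]: "f \<in> borel_measurable borel"
    using f by (simp add: borel_measurable_integrable)
  have i: "integrable (lborel \<Otimes>\<^sub>M lborel) (\<lambda>(x, y). f (Complex x y))"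
    using f by (subst (asm) lborel_complex_prod) (simp add: integrable_distr_eq case_prod_unfold)
  have e: "(\<integral>z. f z \<partial>lborel) = (\<integral>p. f (Complex (fst p) (snd p)) \<partial>(lborel \<Otimes>\<^sub>M lborel))"
    by (subst lborel_complex_prod) (simp add: integral_distr case_prod_unfold)
  show "(\<integral>z. f z \<partial>lborel) = (\<integral>y. \<integral>x. f (Complex x y) \<partial>lborel \<partial>lborel)"
    using lborel_pair.integral_snd[OF i] e by (simp add: case_prod_unfold)
  show "(\<integral>z. f z \<partial>lborel) = (\<integral>x. \<integral>y. f (Complex x y) \<partial>lborel \<partial>lborel)"
    using lborel_pair.integral_fst[OF i] e by (simp add: case_prod_unfold)
qed

text \<open>
  Determinants refer to \<open>real ^ 2\<close>; \<open>vec_complex\<close> and \<open>complex_vec\<close> carry the Jacobian formula over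
  to \<open>complex\<close>.
\<close>

definition vec_complex :: "real^2 \<Rightarrow> complex" where
  "vec_complex v = Complex (v $ 1) (v $ 2)"

definition complex_vec :: "complex \<Rightarrow> real^2" where
  "complex_vec z = vector [Re z, Im z]"

lemma vec_complex_inverse [simp]: "vec_complex (complex_vec z) = z"
  and complex_vec_inverse [simp]: "complex_vec (vec_complex v) = v"
  by (auto simp: vec_complex_def complex_vec_def vec_eq_iff forall_2)

lemma bounded_linear_vec_complex: "bounded_linear vec_complex"
  unfolding linear_conv_bounded_linear[symmetric]
  by (rule linearI) (auto simp: vec_complex_def complex_eq_iff)

lemma bounded_linear_complex_vec: "bounded_linear complex_vec"
  unfolding linear_conv_bounded_linear[symmetric]
  by (rule linearI) (auto simp: complex_vec_def vec_eq_iff forall_2)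

lemma vec_complex_measurable [measurable]: "vec_complex \<in> borel_measurable borel"
  by (intro borel_measurable_continuous_onI linear_continuous_on bounded_linear_vec_complex)

lemma Basis_vec2: "(Basis :: (real^2) set) = {axis 1 1, axis 2 1}"
  by (auto simp: Basis_vec_def UNIV_2)

lemma distr_vec_complex: "distr lborel borel vec_complex = lborel"
proof (rule lborel_eqI[symmetric])
  fix l u :: complex
  assume lu: "\<And>b. b \<in> Basis \<Longrightarrow> l \<bullet> b \<le> u \<bullet> b"
  have le: "Re l \<le> Re u" "Im l \<le> Im u"
    using lu[of 1] lu[of \<i>] by (auto simp: Basis_complex_def)
  have "vec_complex -` box l u = box (complex_vec l) (complex_vec u)"
    by (auto simp: box_def Basis_complex_def Basis_vec2 vec_complex_def complex_vec_def inner_axis)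
  with le show "emeasure (distr lborel borel vec_complex) (box l u)
      = ennreal (\<Prod>b\<in>Basis. (u - l) \<bullet> b)"
    by (simp add: emeasure_distr Basis_complex_def emeasure_lborel_box_eq Basis_vec2 inner_axis
         complex_vec_def axis_eq_axis)
qed simp

lemma emeasure_vec_complex:
  assumes "A \<in> sets borel"
  shows "emeasure lborel A = emeasure lborel (vec_complex -` A)"
  by (subst distr_vec_complex[symmetric]) (simp add: emeasure_distr assms)

text \<open>
  The real Jacobian of a holomorphic map is the square of the modulus of its derivative.
\<close>

lemma det_complex_mult: "det (matrix (\<lambda>v. complex_vec (c * vec_complex v))) = (cmod c)\<^sup>2"
  by (simp add: det_2 matrix_def complex_vec_def vec_complex_def axis_def cmod_power2 flip: power2_eq_square)

text \<open>
  This is the Jacobian formula for measures of images, read through the identification with \<open>real ^ 2\<close>.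
  The case of infinite measure is included, because the formula for images holds as an equivalence
  of measurability and integrability.
\<close>

lemma emeasure_holomorphic_image:
  assumes S: "open S" and g: "g holomorphic_on S" and inj: "inj_on g S"
    and X: "X \<in> sets borel" "X \<subseteq> S"
  shows "g ` X \<in> sets borel"
    and "emeasure lborel (g ` X) = (\<integral>\<^sup>+z. ennreal ((cmod (deriv g z))\<^sup>2) * indicator X z \<partial>lborel)"
proof -
  obtain h where h: "h holomorphic_on (g ` S)" "\<And>z. z \<in> S \<Longrightarrow> h (g z) = z"
    using holomorphic_has_inverse[OF g S inj] by metis
  have op: "open (g ` S)"
    using open_mapping_thm3[OF g S inj] .
  have hc: "continuous_on (g ` S) h"
    using h holomorphic_on_imp_continuous_on by blast
  have "g ` X = (\<lambda>w. if w \<in> g ` S then h w else undefined) -` X \<inter> g ` S"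
    using h X by auto
  moreover have "(\<lambda>w. if w \<in> g ` S then h w else undefined) \<in> borel_measurable borel"
    using borel_measurable_continuous_on_if[OF _ hc, of "\<lambda>_. undefined"] op by auto
  ultimately show gX: "g ` X \<in> sets borel"
    using measurable_sets_borel[of _ borel X] X(1) borel_open[OF op] by (simp add: sets.Int)
  define Y where "Y = vec_complex -` X"
  define f where "f = (\<lambda>v. complex_vec (g (vec_complex v)))"
  define f' where "f' = (\<lambda>v h. complex_vec (deriv g (vec_complex v) * vec_complex h))"
  have Y: "Y \<in> sets borel"
    unfolding Y_def using measurable_sets_borel[OF vec_complex_measurable X(1)] .
  have der: "(f has_derivative f' v) (at v within Y)" if "v \<in> Y" for v
  proof -
    have "vec_complex v \<in> S" using that X by (auto simp: Y_def)
    hence "(g has_derivative (*) (deriv g (vec_complex v))) (at (vec_complex v))"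
      using g S holomorphic_derivI has_field_derivative_imp_has_derivative by blast
    hence "((\<lambda>v. g (vec_complex v)) has_derivative (\<lambda>h. deriv g (vec_complex v) * vec_complex h)) (at v)"
      using has_derivative_compose[OF bounded_linear_imp_has_derivative[OF bounded_linear_vec_complex]] by blast
    from bounded_linear.has_derivative[OF bounded_linear_complex_vec this]
    show ?thesis unfolding f_def f'_def by (rule has_derivative_at_withinI)
  qed
  have finj: "inj_on f Y"
    using inj X unfolding inj_on_def f_def Y_def
    by (metis complex_vec_inverse subsetD vec_complex_inverse vimage_eq)
  have det: "\<bar>det (matrix (f' v))\<bar> = (cmod (deriv g (vec_complex v)))\<^sup>2" for v
    unfolding f'_def by (simp add: det_complex_mult)
  have fY: "f ` Y = vec_complex -` (g ` X)"
  proof -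
    have "v \<in> f ` Y" if v: "vec_complex v \<in> g ` X" for v
    proof -
      from v obtain x where x: "x \<in> X" "vec_complex v = g x" by (rule imageE)
      have "f (complex_vec x) = complex_vec (vec_complex v)" by (simp add: f_def x)
      hence "v = f (complex_vec x)" by simp
      moreover have "complex_vec x \<in> Y" using x by (simp add: Y_def)
      ultimately show ?thesis by blast
    qed
    hence "vec_complex -` (g ` X) \<subseteq> f ` Y" by blast
    moreover have "f ` Y \<subseteq> vec_complex -` (g ` X)" by (auto simp: f_def Y_def)
    ultimately show ?thesis by blast
  qed
  have fYb: "f ` Y \<in> sets borel"
    unfolding fY using measurable_sets_borel[OF vec_complex_measurable gX] .
  have dm: "(\<lambda>z. if z \<in> S then deriv g z else 0) \<in> borel_measurable borel"
    using S g by (intro borel_measurable_if_continuous holomorphic_on_imp_continuous_on holomorphic_deriv)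
  define J where "J = (\<lambda>z. (cmod (deriv g z))\<^sup>2 * indicator X z)"
  have Jm: "J \<in> borel_measurable borel"
  proof -
    have "J = (\<lambda>z. (cmod (if z \<in> S then deriv g z else 0))\<^sup>2 * indicator X z)"
      using X by (auto simp: J_def fun_eq_iff indicator_def)
    thus ?thesis using dm X by simp
  qed
  have eqJ: "(\<integral>\<^sup>+z. ennreal ((cmod (deriv g z))\<^sup>2) * indicator X z \<partial>lborel) = (\<integral>\<^sup>+v. ennreal (J (vec_complex v)) \<partial>lborel)"
  proof -
    have "(\<integral>\<^sup>+z. ennreal ((cmod (deriv g z))\<^sup>2) * indicator X z \<partial>lborel) = (\<integral>\<^sup>+z. ennreal (J z) \<partial>lborel)"
      by (intro nn_integral_cong) (auto simp: J_def indicator_def)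
    also have "\<dots> = (\<integral>\<^sup>+v. ennreal (J (vec_complex v)) \<partial>lborel)"
      using Jm by (subst distr_vec_complex[symmetric]) (simp add: nn_integral_distr)
    finally show ?thesis .
  qed
  have ind: "J (vec_complex v) = (if v \<in> Y then \<bar>det (matrix (f' v))\<bar> else 0)" for v
    by (simp add: det J_def Y_def)
  have iff: "f ` Y \<in> lmeasurable \<and> measure lebesgue (f ` Y) = m
     \<longleftrightarrow> ((\<lambda>v. J (vec_complex v)) has_integral m) UNIV" for m
    using has_measure_differentiable_image[OF _ der finj, of m] Y
    by (simp add: ind has_integral_restrict_UNIV)
  have "emeasure lborel (f ` Y) = (\<integral>\<^sup>+v. ennreal (J (vec_complex v)) \<partial>lborel)"
  proof (cases "f ` Y \<in> lmeasurable")
    case True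
    have J0: "\<And>v. 0 \<le> J (vec_complex v)" by (simp add: J_def)
    have "((\<lambda>v. J (vec_complex v)) has_integral measure lebesgue (f ` Y)) UNIV"
      using iff True by blast
    hence "(\<integral>\<^sup>+v. ennreal (J (vec_complex v)) \<partial>lborel) = ennreal (measure lebesgue (f ` Y))"
      using Jm J0 by (intro nn_integral_has_integral_lborel) auto
    also have "\<dots> = emeasure lebesgue (f ` Y)"
      using True by (simp add: emeasure_eq_measure2 fmeasurableD2)
    finally show ?thesis using fYb by simp
  next
    case False
    have "(\<integral>\<^sup>+v. ennreal (J (vec_complex v)) \<partial>lborel) = \<infinity>"
    proof (rule ccontr)
      assume "\<not> ?thesis"
      then obtain r where "0 \<le> r" "(\<integral>\<^sup>+v. ennreal (J (vec_complex v)) \<partial>lborel) = ennreal r"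
        by (metis ennreal_cases infinity_ennreal_def)
      hence "((\<lambda>v. J (vec_complex v)) has_integral r) UNIV"
        using Jm by (intro nn_integral_has_integral) (auto simp: J_def)
      with iff False show False by blast
    qed
    moreover have "emeasure lborel (f ` Y) = \<infinity>"
      using False fYb by (auto simp: fmeasurable_def less_top[symmetric])
    ultimately show ?thesis by simp
  qed
  thus "emeasure lborel (g ` X) = (\<integral>\<^sup>+z. ennreal ((cmod (deriv g z))\<^sup>2) * indicator X z \<partial>lborel)"
    using emeasure_vec_complex[OF gX] eqJ fY by simp
qed

text \<open>
  Stating the change of variables as an equality of two measures makes the versions for nonnegative
  and for complex integrands below immediate. The map is cut off outside \<open>S\<close> only to be measurable
  on the whole plane.
\<close>

lemma holomorphic_image_measure:
  assumes S: "open S" and g: "g holomorphic_on S" and inj: "inj_on g S"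
  shows "distr (density lborel (\<lambda>z. ennreal ((cmod (deriv g z))\<^sup>2 * indicator S z))) borel
            (\<lambda>z. if z \<in> S then g z else 0)
       = density lborel (\<lambda>w. indicator (g ` S) w)" (is "?M = ?N")
    and "(\<lambda>z. if z \<in> S then g z else 0) \<in> borel_measurable borel"
    and "(\<lambda>z. (cmod (deriv g z))\<^sup>2 * indicator S z) \<in> borel_measurable borel"
proof -
  show gm: "(\<lambda>z. if z \<in> S then g z else 0) \<in> borel_measurable borel"
    using S g by (intro borel_measurable_if_continuous holomorphic_on_imp_continuous_on holomorphic_deriv)
  have "(\<lambda>z. if z \<in> S then deriv g z else 0) \<in> borel_measurable borel"
    using S g by (intro borel_measurable_if_continuous holomorphic_on_imp_continuous_on holomorphic_deriv)
  moreover have "(\<lambda>z. (cmod (deriv g z))\<^sup>2 * indicator S z) = (\<lambda>z. (cmod (if z \<in> S then deriv g z else 0))\<^sup>2)"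
    by (auto simp: fun_eq_iff indicator_def)
  ultimately show dm: "(\<lambda>z. (cmod (deriv g z))\<^sup>2 * indicator S z) \<in> borel_measurable borel"
    by simp
  have op: "open (g ` S)"
    using open_mapping_thm3[OF g S inj] .
  show "?M = ?N"
  proof (rule measure_eqI)
    fix A assume "A \<in> sets ?M"
    hence A: "A \<in> sets borel" by simp
    define X where "X = (\<lambda>z. if z \<in> S then g z else 0) -` A \<inter> S"
    have X: "X \<in> sets borel" "X \<subseteq> S"
      unfolding X_def using gm A S by (auto intro!: sets.Int measurable_sets_borel)
    have gX: "g ` X = A \<inter> g ` S" by (auto simp: X_def)
    have "emeasure ?M A = (\<integral>\<^sup>+z. ennreal ((cmod (deriv g z))\<^sup>2 * indicator S z)
                 * indicator ((\<lambda>z. if z \<in> S then g z else 0) -` A) z \<partial>lborel)"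
      using gm dm A by (subst emeasure_distr) (auto simp: emeasure_density measurable_sets_borel)
    also have "\<dots> = (\<integral>\<^sup>+z. ennreal ((cmod (deriv g z))\<^sup>2) * indicator X z \<partial>lborel)"
      by (intro nn_integral_cong) (auto simp: X_def indicator_def)
    also have "\<dots> = emeasure lborel (A \<inter> g ` S)"
      using emeasure_holomorphic_image(2)[OF S g inj X] gX by simp
    also have "\<dots> = emeasure ?N A"
      using A op by (subst emeasure_density) (auto simp: Int_commute nn_integral_indicator simp flip: indicator_inter_arith)
    finally show "emeasure ?M A = emeasure ?N A" .
  qed simp
qed

lemma nn_integral_holomorphic_subst:
  fixes f :: "complex \<Rightarrow> ennreal"
  assumes S: "open S" and g: "g holomorphic_on S" and inj: "inj_on g S"
    and f: "f \<in> borel_measurable borel"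
  shows "(\<integral>\<^sup>+w\<in>g ` S. f w \<partial>lborel) = (\<integral>\<^sup>+z\<in>S. f (g z) * ennreal ((cmod (deriv g z))\<^sup>2) \<partial>lborel)"
proof -
  note m = holomorphic_image_measure[OF S g inj]
  have op: "open (g ` S)"
    using open_mapping_thm3[OF g S inj] .
  have "(\<integral>\<^sup>+w\<in>g ` S. f w \<partial>lborel) = (\<integral>\<^sup>+w. f w \<partial>density lborel (\<lambda>w. indicator (g ` S) w))"
    using f op by (subst nn_integral_density) (auto simp: mult.commute)
  also have "\<dots> = (\<integral>\<^sup>+z. ennreal ((cmod (deriv g z))\<^sup>2 * indicator S z) * f (if z \<in> S then g z else 0) \<partial>lborel)"
    using f m(2,3) by (subst m(1)[symmetric]) (simp add: nn_integral_distr nn_integral_density)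
  also have "\<dots> = (\<integral>\<^sup>+z\<in>S. f (g z) * ennreal ((cmod (deriv g z))\<^sup>2) \<partial>lborel)"
    by (intro nn_integral_cong) (auto simp: indicator_def mult.commute)
  finally show ?thesis .
qed

lemma integral_holomorphic_subst:
  fixes f :: "complex \<Rightarrow> complex"
  assumes S: "open S" and g: "g holomorphic_on S" and inj: "inj_on g S"
    and f: "f \<in> borel_measurable borel"
  shows "set_lebesgue_integral lborel (g ` S) f
          = set_lebesgue_integral lborel S (\<lambda>z. (cmod (deriv g z))\<^sup>2 *\<^sub>R f (g z))"
    and "set_integrable lborel (g ` S) f
          \<longleftrightarrow> set_integrable lborel S (\<lambda>z. (cmod (deriv g z))\<^sup>2 *\<^sub>R f (g z))"
proof -
  note m = holomorphic_image_measure[OF S g inj]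
  have op: "open (g ` S)"
    using open_mapping_thm3[OF g S inj] .
  have e: "density lborel (\<lambda>w. indicator (g ` S) w) = density lborel (\<lambda>w. ennreal (indicator (g ` S) w))"
    by (simp add: ennreal_indicator)
  have s: "(\<lambda>z. ((cmod (deriv g z))\<^sup>2 * indicator S z) *\<^sub>R f (if z \<in> S then g z else 0))
      = (\<lambda>z. indicator S z *\<^sub>R ((cmod (deriv g z))\<^sup>2 *\<^sub>R f (g z)))"
    by (auto simp: fun_eq_iff indicator_def)
  have gm: "(\<lambda>z. f (if z \<in> S then g z else 0)) \<in> borel_measurable borel"
    using m(2) f by measurable
  have "set_lebesgue_integral lborel (g ` S) f = (\<integral>w. f w \<partial>density lborel (\<lambda>w. indicator (g ` S) w))"
    using f op unfolding set_lebesgue_integral_def e by (subst integral_density) auto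
  also have "\<dots> = (\<integral>z. ((cmod (deriv g z))\<^sup>2 * indicator S z) *\<^sub>R f (if z \<in> S then g z else 0) \<partial>lborel)"
    using f m(2,3) gm by (subst m(1)[symmetric]) (simp add: integral_distr integral_density)
  finally show "set_lebesgue_integral lborel (g ` S) f
          = set_lebesgue_integral lborel S (\<lambda>z. (cmod (deriv g z))\<^sup>2 *\<^sub>R f (g z))"
    by (simp only: s set_lebesgue_integral_def)
  have "set_integrable lborel (g ` S) f \<longleftrightarrow> integrable (density lborel (\<lambda>w. indicator (g ` S) w)) f"
    using f op unfolding set_integrable_def e by (subst integrable_density) auto
  also have "\<dots> \<longleftrightarrow> integrable lborel (\<lambda>z. ((cmod (deriv g z))\<^sup>2 * indicator S z) *\<^sub>R f (if z \<in> S then g z else 0))"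
    using f m(2,3) gm by (subst m(1)[symmetric]) (simp add: integrable_distr_eq integrable_density)
  finally show "set_integrable lborel (g ` S) f
          \<longleftrightarrow> set_integrable lborel S (\<lambda>z. (cmod (deriv g z))\<^sup>2 *\<^sub>R f (g z))"
    by (simp only: s set_integrable_def)
qed

section \<open>Logarithmic polar coordinates in the plane and in the disk\<close>

text \<open>
  The image of \<open>strip\<close> under \<open>exp\<close> is the plane without a half line; it misses only reals.
\<close>

lemma AE_not_real: "AE z in lborel. (z::complex) \<notin> \<real>"
proof (rule AE_I'[OF null_setsI])
  have c: "closed (\<real> :: complex set)" by (rule closed_complex_Reals)
  have *: "(\<integral>\<^sup>+y. indicator (\<real>::complex set) (Complex x y) \<partial>lborel) = 0" for x
  proof -
    have "(\<integral>\<^sup>+y. indicator (\<real>::complex set) (Complex x y) \<partial>lborel) = (\<integral>\<^sup>+y. indicator {0::real} y \<partial>lborel)"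
      by (intro nn_integral_cong) (auto simp: indicator_def complex_is_Real_iff)
    thus ?thesis by simp
  qed
  have "emeasure lborel (\<real>::complex set) = (\<integral>\<^sup>+z. indicator (\<real>::complex set) z \<partial>lborel)"
    using c by (subst nn_integral_indicator) auto
  also have "\<dots> = 0"
    using c by (subst nn_integral_complex_prod) (auto simp: *)
  finally show "emeasure lborel (\<real>::complex set) = 0" .
  show "(\<real> :: complex set) \<in> sets lborel" using c by simp
qed auto

text \<open>
  Logarithmic polar coordinates \<open>w = t + \<i> \<theta>\<close> around \<open>z\<close> are given by \<open>\<zeta> = z + exp w\<close>. The map is
  holomorphic and injective on the open strip, so that polar coordinates are a special case of the
  holomorphic change of variables.
\<close>

definition strip :: "complex set" where
  "strip = {w. - pi < Im w \<and> Im w < pi}"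

definition half_strip :: "complex set" where
  "half_strip = {w. Re w < 0 \<and> - pi < Im w \<and> Im w < pi}"

lemma open_strip: "open strip" and open_half_strip: "open half_strip"
  unfolding strip_def half_strip_def
  by (auto intro!: open_Collect_conj open_Collect_less continuous_intros)

lemma strip_sets [measurable]: "strip \<in> sets borel" "half_strip \<in> sets borel"
  using open_strip open_half_strip by auto

lemma inj_on_exp_strip: "inj_on exp strip"
  unfolding inj_on_def strip_def using complex_eqI exp_complex_eqI
  by (smt (verit) mem_Collect_eq)

lemma exp_strip: "z \<notin> \<real> \<Longrightarrow> z \<in> exp ` strip"
proof -
  assume z: "z \<notin> \<real>"
  hence "z \<noteq> 0" by auto
  moreover have "Im (Ln z) \<noteq> pi"
    using z Im_Ln_eq_pi[of z] \<open>z \<noteq> 0\<close> by (auto simp: complex_is_Real_iff)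
  ultimately have "Ln z \<in> strip"
    using mpi_less_Im_Ln[of z] Im_Ln_le_pi[of z] by (auto simp: strip_def)
  thus ?thesis using \<open>z \<noteq> 0\<close> by (metis exp_Ln imageI)
qed

lemma AE_exp_strip: "AE \<zeta> in lborel. \<zeta> \<in> (\<lambda>w. z + exp w) ` strip"
proof -
  have "AE \<zeta> in distr lborel borel ((+) z). \<zeta> \<in> (\<lambda>w. z + exp w) ` strip"
    (is "AE \<zeta> in ?M. ?P \<zeta>")
  proof (subst AE_distr_iff)
    have "open ((\<lambda>w. z + exp w) ` strip)"
      using inj_on_exp_strip by (intro open_mapping_thm3 open_strip) (auto intro!: holomorphic_intros simp: inj_on_def)
    thus "{x \<in> space borel. x \<in> (\<lambda>w. z + exp w) ` strip} \<in> sets borel"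
      by simp
    show "AE x in lborel. z + x \<in> (\<lambda>w. z + exp w) ` strip"
      using AE_not_real
    proof eventually_elim
      case (elim x)
      from exp_strip[OF this] show ?case by (auto simp: image_iff)
    qed
  qed auto
  moreover have "?M = lborel" by (rule lborel_distr_plus)
  ultimately show ?thesis by metis
qed

lemma deriv_plus_exp: "deriv (\<lambda>w. z + exp w) w = exp w"
  by (rule DERIV_imp_deriv) (auto intro!: derivative_eq_intros)

lemma
  fixes z :: complex
  shows plus_exp_inj: "inj_on (\<lambda>w. z + exp w) strip"
    and plus_exp_hol: "(\<lambda>w. z + exp w) holomorphic_on strip"
  using inj_on_exp_strip by (auto intro!: holomorphic_intros simp: inj_on_def)

lemma nn_integral_polar:
  assumes f: "f \<in> borel_measurable borel"
  shows "(\<integral>\<^sup>+\<zeta>. f \<zeta> \<partial>lborel) = (\<integral>\<^sup>+w\<in>strip. f (z + exp w) * ennreal (exp (2 * Re w)) \<partial>lborel)"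
proof -
  have "(\<integral>\<^sup>+\<zeta>. f \<zeta> \<partial>lborel) = (\<integral>\<^sup>+\<zeta>\<in>(\<lambda>w. z + exp w) ` strip. f \<zeta> \<partial>lborel)"
    using AE_exp_strip[of z] by (intro nn_integral_cong_AE) (auto elim!: eventually_mono)
  also have "\<dots> = (\<integral>\<^sup>+w\<in>strip. f (z + exp w) * ennreal (exp (2 * Re w)) \<partial>lborel)"
    by (subst nn_integral_holomorphic_subst[OF open_strip plus_exp_hol plus_exp_inj f])
       (simp add: deriv_plus_exp exp_double)
  finally show ?thesis .
qed

lemma integral_polar:
  fixes f :: "complex \<Rightarrow> complex"
  assumes f: "integrable lborel f"
  shows "set_integrable lborel strip (\<lambda>w. exp (2 * Re w) *\<^sub>R f (z + exp w))"
    and "(\<integral>\<zeta>. f \<zeta> \<partial>lborel) = set_lebesgue_integral lborel strip (\<lambda>w. exp (2 * Re w) *\<^sub>R f (z + exp w))"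
proof -
  have fm: "f \<in> borel_measurable borel"
    using f by (simp add: borel_measurable_integrable)
  have op: "open ((\<lambda>w. z + exp w) ` strip)"
    by (intro open_mapping_thm3 open_strip plus_exp_inj plus_exp_hol)
  have e: "(cmod (deriv (\<lambda>w. z + exp w) w))\<^sup>2 = exp (2 * Re w)" for w
    by (simp add: deriv_plus_exp exp_double)
  have "set_integrable lborel ((\<lambda>w. z + exp w) ` strip) f"
    unfolding set_integrable_def using op f by (intro integrable_mult_indicator) auto
  with integral_holomorphic_subst(2)[OF open_strip plus_exp_hol plus_exp_inj fm, of z]
  show "set_integrable lborel strip (\<lambda>w. exp (2 * Re w) *\<^sub>R f (z + exp w))"
    by (simp add: e)
  have "(\<integral>\<zeta>. f \<zeta> \<partial>lborel) = set_lebesgue_integral lborel ((\<lambda>w. z + exp w) ` strip) f"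
    unfolding set_lebesgue_integral_def using AE_exp_strip[of z] op fm
    by (intro integral_cong_AE) (auto elim!: eventually_mono intro!: borel_measurable_scaleR)
  also have "\<dots> = set_lebesgue_integral lborel strip (\<lambda>w. exp (2 * Re w) *\<^sub>R f (z + exp w))"
    by (subst integral_holomorphic_subst(1)[OF open_strip plus_exp_hol plus_exp_inj fm]) (simp only: e)
  finally show "(\<integral>\<zeta>. f \<zeta> \<partial>lborel) = set_lebesgue_integral lborel strip (\<lambda>w. exp (2 * Re w) *\<^sub>R f (z + exp w))" .
qed

text \<open>
  The automorphism of the disk that maps 0 to \<open>a\<close>.
\<close>

definition mob :: "complex \<Rightarrow> complex \<Rightarrow> complex" where
  "mob a u = (u + a) / (1 + cnj a * u)"

text \<open>
  The pseudohyperbolic distance: the modulus of the image of \<open>z\<close> under the inverse of \<open>mob a\<close>.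
\<close>

definition pdist :: "complex \<Rightarrow> complex \<Rightarrow> real" where
  "pdist a z = cmod ((z - a) / (1 - z * cnj a))"

text \<open>
  Logarithmic polar coordinates that are adapted to the disk with centre \<open>a\<close>: the open left half
  plane, taken modulo \<open>2 \<pi> \<i>\<close>, is mapped conformally onto the disk without \<open>a\<close>.
\<close>

definition disk_polar :: "complex \<Rightarrow> complex \<Rightarrow> complex" where
  "disk_polar a w = mob a (exp w)"

lemma one_plus_mult_nz: "cmod a < 1 \<Longrightarrow> cmod u \<le> 1 \<Longrightarrow> 1 + a * u \<noteq> 0"
proof
  assume "cmod a < 1" "cmod u \<le> 1" "1 + a * u = 0"
  hence "a * u = -1" by (simp add: add_eq_0_iff)
  hence "cmod a * cmod u = 1" by (metis norm_minus_cancel norm_mult norm_one)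
  moreover have "cmod a * cmod u \<le> cmod a * 1"
    using \<open>cmod u \<le> 1\<close> by (intro mult_left_mono) auto
  ultimately show False using \<open>cmod a < 1\<close> by simp
qed

lemma one_minus_mult_nz: "cmod a < 1 \<Longrightarrow> cmod u \<le> 1 \<Longrightarrow> 1 - u * cnj a \<noteq> 0"
  using one_plus_mult_nz[of "- cnj a" u] by (simp add: mult.commute)

lemma mob_norm_identity:
  "(cmod (1 + cnj a * u))\<^sup>2 - (cmod (u + a))\<^sup>2 = (1 - (cmod a)\<^sup>2) * (1 - (cmod u)\<^sup>2)"
  by (simp only: cmod_power2) (simp add: power2_eq_square algebra_simps)

lemma mob_norm:
  assumes a: "cmod a < 1" and u: "cmod u \<le> 1"
  shows "1 - (cmod (mob a u))\<^sup>2 = (1 - (cmod a)\<^sup>2) * (1 - (cmod u)\<^sup>2) / (cmod (1 + cnj a * u))\<^sup>2"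
proof -
  have nz: "1 + cnj a * u \<noteq> 0" using one_plus_mult_nz[of "cnj a" u] a u by simp
  hence "1 - (cmod (mob a u))\<^sup>2 = ((cmod (1 + cnj a * u))\<^sup>2 - (cmod (u + a))\<^sup>2) / (cmod (1 + cnj a * u))\<^sup>2"
    by (simp add: mob_def norm_divide power_divide diff_divide_distrib)
  thus ?thesis by (simp only: mob_norm_identity)
qed

lemma mob_in_disk:
  assumes a: "cmod a < 1" and u: "cmod u < 1"
  shows "cmod (mob a u) < 1"
proof -
  have nz: "1 + cnj a * u \<noteq> 0" using one_plus_mult_nz[of "cnj a" u] a u by simp
  have "0 < 1 - (cmod (mob a u))\<^sup>2"
    using a u nz by (subst mob_norm) (auto intro!: divide_pos_pos mult_pos_pos simp: abs_square_less_1)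
  thus ?thesis by (simp add: abs_square_less_1)
qed

lemma mob_inverse:
  assumes a: "cmod a < 1" and u: "cmod u < 1"
  shows "(mob a u - a) / (1 - mob a u * cnj a) = u"
proof -
  have nz: "1 + cnj a * u \<noteq> 0" using one_plus_mult_nz[of "cnj a" u] a u by simp
  have az: "1 - a * cnj a \<noteq> 0" using one_minus_mult_nz[of a a] a by simp
  have 1: "mob a u - a = u * (1 - a * cnj a) / (1 + cnj a * u)"
    using nz by (simp add: mob_def field_simps)
  have 2: "1 - mob a u * cnj a = (1 - a * cnj a) / (1 + cnj a * u)"
    using nz by (simp add: mob_def field_simps)
  show ?thesis using nz az by (simp only: 1 2) simp
qed

lemma mob_surj:
  assumes a: "cmod a < 1" and z: "cmod z < 1"
  defines "u \<equiv> (z - a) / (1 - z * cnj a)"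
  shows "mob a u = z" "cmod u < 1"
proof -
  have "u = mob (- a) z" by (simp add: u_def mob_def mult.commute)
  thus u1: "cmod u < 1" using mob_in_disk[of "- a" z] a z by simp
  have nz: "1 - z * cnj a \<noteq> 0" using one_minus_mult_nz[of a z] a z by simp
  have az: "1 - a * cnj a \<noteq> 0" using one_minus_mult_nz[of a a] a by simp
  have 1: "u + a = z * (1 - a * cnj a) / (1 - z * cnj a)"
    using nz by (simp add: u_def field_simps)
  have 2: "1 + cnj a * u = (1 - a * cnj a) / (1 - z * cnj a)"
    using nz by (simp add: u_def field_simps)
  show "mob a u = z"
    unfolding mob_def 1 2 using nz az by simp
qed

lemma mob_has_field_derivative:
  assumes a: "cmod a < 1" and u: "cmod u < 1"
  shows "(mob a has_field_derivative (1 - a * cnj a) / (1 + cnj a * u)\<^sup>2) (at u)"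
proof -
  have nz: "1 + cnj a * u \<noteq> 0" using one_plus_mult_nz[of "cnj a" u] a u by simp
  show ?thesis unfolding mob_def[abs_def]
    using nz by (auto intro!: derivative_eq_intros simp: power2_eq_square) (simp add: algebra_simps)
qed

lemma mob_inj: "cmod a < 1 \<Longrightarrow> inj_on (mob a) (ball 0 1)"
  by (rule inj_onI) (metis mob_inverse mem_ball_0)

lemma mob_holomorphic: "cmod a < 1 \<Longrightarrow> mob a holomorphic_on ball 0 1"
  using mob_has_field_derivative unfolding holomorphic_on_def
  by (meson field_differentiable_at_within field_differentiable_def mem_ball_0)

lemma AE_disk_polar:
  assumes a: "cmod a < 1"
  shows "AE \<zeta> in lborel. \<zeta> \<in> ball 0 1 \<longrightarrow> \<zeta> \<in> disk_polar a ` half_strip"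
proof (rule AE_I'[OF null_setsI])
  define X where "X = (\<real> :: complex set) \<inter> ball 0 1"
  have X: "X \<in> sets borel" "X \<subseteq> ball 0 1"
    using closed_complex_Reals by (auto simp: X_def)
  note im = emeasure_holomorphic_image[OF open_ball mob_holomorphic[OF a] mob_inj[OF a] X]
  have "AE z in lborel. z \<notin> X" using AE_not_real by eventually_elim (auto simp: X_def)
  hence "AE z in lborel. ennreal ((cmod (deriv (mob a) z))\<^sup>2) * indicator X z = 0"
    by eventually_elim auto
  hence "(\<integral>\<^sup>+z. ennreal ((cmod (deriv (mob a) z))\<^sup>2) * indicator X z \<partial>lborel) = (\<integral>\<^sup>+z. 0 \<partial>(lborel :: complex measure))"
    by (intro nn_integral_cong_AE)
  thus "emeasure lborel (mob a ` X) = 0" using im by simp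
  show "mob a ` X \<in> sets lborel" using im by simp
  show "{\<zeta> \<in> space lborel. \<not> (\<zeta> \<in> ball 0 1 \<longrightarrow> \<zeta> \<in> disk_polar a ` half_strip)} \<subseteq> mob a ` X"
  proof
    fix \<zeta> assume "\<zeta> \<in> {\<zeta> \<in> space lborel. \<not> (\<zeta> \<in> ball 0 1 \<longrightarrow> \<zeta> \<in> disk_polar a ` half_strip)}"
    hence z: "\<zeta> \<in> ball 0 1" "\<zeta> \<notin> disk_polar a ` half_strip" by auto
    define u where "u = (\<zeta> - a) / (1 - \<zeta> * cnj a)"
    have u: "mob a u = \<zeta>" "cmod u < 1" using mob_surj[of a \<zeta>] a z by (auto simp: u_def)
    have "u \<in> \<real>"
    proof (rule ccontr)
      assume "u \<notin> \<real>"
      then obtain w where w: "w \<in> strip" "u = exp w" using exp_strip by blast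
      with u have "w \<in> half_strip" by (auto simp: half_strip_def strip_def)
      with z w u show False by (auto simp: disk_polar_def)
    qed
    thus "\<zeta> \<in> mob a ` X" using u by (auto simp: X_def)
  qed
qed

text \<open>
  These formulas are the reason for the choice of the coordinate: the distance to \<open>a\<close> becomes \<open>exp (Re w)\<close>,
  and the kernel \<open>kern \<sqdot> a\<close>, regarded as a differential form, becomes \<open>dw\<close>.
\<close>

lemma disk_polar_facts:
  assumes a: "cmod a < 1" and w: "Re w < 0"
  shows "cmod (disk_polar a w) < 1"
    and "pdist a (disk_polar a w) = exp (Re w)"
    and "(disk_polar a has_field_derivative deriv (disk_polar a) w) (at w)"
    and "deriv (disk_polar a) w = exp w * (1 - a * cnj a) / (1 + cnj a * exp w)\<^sup>2"
    and "kern (disk_polar a w) a * deriv (disk_polar a) w = 1"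
    and "1 - (cmod (disk_polar a w))\<^sup>2 = (1 - (cmod a)\<^sup>2) * (1 - exp (2 * Re w)) / (cmod (1 + cnj a * exp w))\<^sup>2"
proof -
  have e: "cmod (exp w) < 1" using w by simp
  show "cmod (disk_polar a w) < 1" unfolding disk_polar_def by (rule mob_in_disk[OF a e])
  show "pdist a (disk_polar a w) = exp (Re w)"
    unfolding disk_polar_def pdist_def mob_inverse[OF a e] by simp
  have "((\<lambda>w. mob a (exp w)) has_field_derivative (1 - a * cnj a) / (1 + cnj a * exp w)\<^sup>2 * exp w) (at w)"
    using DERIV_chain2[OF mob_has_field_derivative[OF a e] DERIV_exp] .
  hence d: "(disk_polar a has_field_derivative exp w * (1 - a * cnj a) / (1 + cnj a * exp w)\<^sup>2) (at w)"
    by (simp add: disk_polar_def[abs_def] mult.commute)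
  show "deriv (disk_polar a) w = exp w * (1 - a * cnj a) / (1 + cnj a * exp w)\<^sup>2"
    using d by (rule DERIV_imp_deriv)
  with d show "(disk_polar a has_field_derivative deriv (disk_polar a) w) (at w)" by simp
  have nz: "1 + cnj a * exp w \<noteq> 0" using one_plus_mult_nz[of "cnj a" "exp w"] a e by simp
  have az: "1 - a * cnj a \<noteq> 0" using one_minus_mult_nz[of a a] a by simp
  have 1: "mob a (exp w) - a = exp w * (1 - a * cnj a) / (1 + cnj a * exp w)"
    using nz by (simp add: mob_def field_simps)
  have 2: "1 - mob a (exp w) * cnj a = (1 - a * cnj a) / (1 + cnj a * exp w)"
    using nz by (simp add: mob_def field_simps)
  have "kern (disk_polar a w) a = (1 + cnj a * exp w)\<^sup>2 / (exp w * (1 - a * cnj a))"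
    unfolding kern_def disk_polar_def 1 2 using nz az
    by (simp add: divide_simps) (simp add: power2_eq_square algebra_simps)
  thus "kern (disk_polar a w) a * deriv (disk_polar a) w = 1"
    using nz az by (simp add: DERIV_imp_deriv[OF d])
  show "1 - (cmod (disk_polar a w))\<^sup>2 = (1 - (cmod a)\<^sup>2) * (1 - exp (2 * Re w)) / (cmod (1 + cnj a * exp w))\<^sup>2"
    unfolding disk_polar_def using mob_norm[OF a, of "exp w"] e
    by (simp add: exp_double)
qed

lemma nn_integral_disk_polar:
  assumes a: "cmod a < 1" and f: "f \<in> borel_measurable borel"
  shows "(\<integral>\<^sup>+\<zeta>\<in>ball 0 1. f \<zeta> \<partial>lborel)
       = (\<integral>\<^sup>+w\<in>half_strip. f (disk_polar a w) * ennreal ((cmod (deriv (disk_polar a) w))\<^sup>2) \<partial>lborel)"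
proof -
  have sub: "disk_polar a ` half_strip \<subseteq> ball 0 1"
    using disk_polar_facts(1)[OF a] by (auto simp: half_strip_def)
  have hol: "disk_polar a holomorphic_on half_strip"
    unfolding holomorphic_on_def half_strip_def using disk_polar_facts(3)[OF a]
    by (metis (mono_tags, lifting) field_differentiable_at_within field_differentiable_def mem_Collect_eq)
  have inj: "inj_on (disk_polar a) half_strip"
  proof (rule inj_onI)
    fix x y assume xy: "x \<in> half_strip" "y \<in> half_strip" "disk_polar a x = disk_polar a y"
    hence "cmod (exp x) < 1" "cmod (exp y) < 1" by (auto simp: half_strip_def)
    hence "exp x = exp y" using xy(3) mob_inj[OF a] by (auto simp: disk_polar_def inj_on_def)
    thus "x = y" using xy inj_on_exp_strip by (auto simp: inj_on_def half_strip_def strip_def)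
  qed
  have "(\<integral>\<^sup>+\<zeta>\<in>ball 0 1. f \<zeta> \<partial>lborel) = (\<integral>\<^sup>+\<zeta>\<in>disk_polar a ` half_strip. f \<zeta> \<partial>lborel)"
    using AE_disk_polar[OF a] sub by (intro nn_integral_cong_AE) (auto elim!: eventually_mono simp: indicator_def)
  thus ?thesis
    using nn_integral_holomorphic_subst[OF open_half_strip hol inj f] by simp
qed

section \<open>Wirtinger derivatives\<close>

text \<open>
  \<open>G\<close> and \<open>D\<close> are the two Wirtinger derivatives of \<open>F\<close> at \<open>z\<close>. As a statement about the total
  derivative this is stable under sums, products and composition, which the partial derivatives
  behind \<open>d_z\<close> and \<open>d_zbar\<close> are not.
\<close>

definition wderiv :: "(complex \<Rightarrow> complex) \<Rightarrow> complex \<Rightarrow> complex \<Rightarrow> complex \<Rightarrow> bool" where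
  "wderiv F G D z \<longleftrightarrow> (F has_derivative (\<lambda>h. G * h + D * cnj h)) (at z)"

lemma wderiv_const: "wderiv (\<lambda>z. c) 0 0 z"
  by (simp add: wderiv_def)

lemma wderiv_holomorphic: "(f has_field_derivative f') (at z) \<Longrightarrow> wderiv f f' 0 z"
  by (simp add: wderiv_def has_field_derivative_def)

lemma wderiv_add: "wderiv F G D z \<Longrightarrow> wderiv F' G' D' z \<Longrightarrow> wderiv (\<lambda>z. F z + F' z) (G + G') (D + D') z"
  unfolding wderiv_def
  by (erule has_derivative_eq_rhs[OF has_derivative_add]) (auto simp: fun_eq_iff algebra_simps)

lemma wderiv_diff: "wderiv F G D z \<Longrightarrow> wderiv F' G' D' z \<Longrightarrow> wderiv (\<lambda>z. F z - F' z) (G - G') (D - D') z"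
  unfolding wderiv_def
  by (erule has_derivative_eq_rhs[OF has_derivative_diff]) (auto simp: fun_eq_iff algebra_simps)

lemma wderiv_sum:
  "(\<And>i. i \<in> I \<Longrightarrow> wderiv (F i) (G i) (D i) z) \<Longrightarrow>
     wderiv (\<lambda>z. \<Sum>i\<in>I. F i z) (\<Sum>i\<in>I. G i) (\<Sum>i\<in>I. D i) z"
  by (induction I rule: infinite_finite_induct) (auto intro!: wderiv_add wderiv_const)

lemma wderiv_mult:
  "wderiv F G D z \<Longrightarrow> wderiv F' G' D' z \<Longrightarrow>
    wderiv (\<lambda>z. F z * F' z) (F z * G' + G * F' z) (F z * D' + D * F' z) z"
  unfolding wderiv_def
  by (erule has_derivative_eq_rhs[OF has_derivative_mult]) (auto simp: fun_eq_iff algebra_simps)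

lemma wderiv_cnj: "wderiv F G D z \<Longrightarrow> wderiv (\<lambda>z. cnj (F z)) (cnj D) (cnj G) z"
  unfolding wderiv_def
  by (rule has_derivative_eq_rhs[OF has_derivative_cnj]) (auto simp: fun_eq_iff algebra_simps)

lemma wderiv_compose:
  assumes "wderiv F G D (m z)" "(m has_field_derivative m') (at z)"
  shows "wderiv (\<lambda>z. F (m z)) (G * m') (D * cnj m') z"
  using has_derivative_compose[OF assms(2)[unfolded has_field_derivative_def] assms(1)[unfolded wderiv_def]]
  unfolding wderiv_def by (rule has_derivative_eq_rhs) (auto simp: fun_eq_iff algebra_simps)

lemma wderiv_transform:
  assumes "wderiv F G D z" "open S" "z \<in> S" "\<And>x. x \<in> S \<Longrightarrow> F x = H x"
  shows "wderiv H G D z"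
  using has_derivative_transform_within_open[OF assms(1)[unfolded wderiv_def] assms(2,3,4)]
  unfolding wderiv_def .

lemma wderiv_cong: "wderiv F G D z \<Longrightarrow> G = G' \<Longrightarrow> D = D' \<Longrightarrow> wderiv F G' D' z"
  by simp

lemma wderiv_unique:
  assumes "wderiv F G D z" "wderiv F G' D' z"
  shows "G = G'" "D = D'"
proof -
  have e: "(\<lambda>h. G * h + D * cnj h) = (\<lambda>h. G' * h + D' * cnj h)"
    using assms unfolding wderiv_def by (rule has_derivative_unique)
  have "G + D = G' + D'" using fun_cong[OF e, of 1] by simp
  moreover have "\<i> * G - \<i> * D = \<i> * G' - \<i> * D'" using fun_cong[OF e, of \<i>] by (simp add: algebra_simps)
  hence "G - D = G' - D'" by (simp flip: right_diff_distrib)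
  ultimately show "G = G'" "D = D'" by algebra+
qed

lemma wderiv_line:
  assumes "wderiv F G D (a + c * of_real t)"
  shows "((\<lambda>s::real. F (a + c * of_real s)) has_vector_derivative (G * c + D * cnj c)) (at t)"
proof -
  have "((\<lambda>s::real. a + c * of_real s) has_derivative (\<lambda>s. c * of_real s)) (at t)"
    by (auto intro!: derivative_eq_intros)
  from has_derivative_compose[OF this, of F "\<lambda>h. G * h + D * cnj h"] assms
  have "((\<lambda>s::real. F (a + c * of_real s)) has_derivative (\<lambda>t. G * (c * of_real t) + D * cnj (c * of_real t))) (at t)"
    by (simp add: wderiv_def)
  thus ?thesis unfolding has_vector_derivative_def
    by (rule has_derivative_eq_rhs) (auto simp: fun_eq_iff scaleR_conv_of_real algebra_simps)
qed

lemma wderiv_partial: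
  assumes "wderiv F G D z"
  shows "partial_x F z = G + D" "partial_y F z = \<i> * (G - D)" "d_z F z = G" "d_zbar F z = D"
    "(\<lambda>t::real. F (z + of_real t)) differentiable (at 0)"
    "(\<lambda>t::real. F (z + \<i> * of_real t)) differentiable (at 0)"
proof -
  have "((\<lambda>t::real. F (z + c * of_real t)) has_vector_derivative (G * c + D * cnj c)) (at 0)" for c
    by (rule wderiv_line) (use assms in simp)
  note 1 = this[of 1] and 2 = this[of \<i>]
  show x: "partial_x F z = G + D"
    unfolding partial_x_def using 1 by (intro vector_derivative_at) simp
  show y: "partial_y F z = \<i> * (G - D)"
    unfolding partial_y_def using 2 by (intro vector_derivative_at) (simp add: algebra_simps)
  show "d_z F z = G" "d_zbar F z = D"
    by (simp_all add: d_z_def d_zbar_def x y algebra_simps)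
  show "(\<lambda>t::real. F (z + of_real t)) differentiable (at 0)"
    "(\<lambda>t::real. F (z + \<i> * of_real t)) differentiable (at 0)"
    using 1 2 by (auto simp: has_vector_derivative_def differentiable_def)
qed

lemma wderiv_differentiable_on:
  "(\<And>z. z \<in> S \<Longrightarrow> wderiv F (G z) (D z) z) \<Longrightarrow> F differentiable_on S"
  unfolding differentiable_on_def wderiv_def
  by (meson differentiable_at_withinI differentiable_def)

lemma wderiv_continuous_on:
  "(\<And>z. z \<in> S \<Longrightarrow> wderiv F (G z) (D z) z) \<Longrightarrow> continuous_on S F"
  using wderiv_differentiable_on differentiable_imp_continuous_on by blast

text \<open>
  The square of the positive part is continuously differentiable; this is the smoothness that the
  cut-off functions below need.
\<close>

lemma wderiv_sq_max:
  assumes "wderiv (\<lambda>z. of_real (u z)) G D z"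
  shows "wderiv (\<lambda>z. of_real ((max 0 (u z))\<^sup>2)) (2 * of_real (max 0 (u z)) * G) (2 * of_real (max 0 (u z)) * D) z"
proof -
  define q where "q = (\<lambda>x::real. (max 0 x)\<^sup>2)"
  have q: "(q has_real_derivative 2 * max 0 x) (at x)" for x
  proof (cases "x = 0")
    case True
    have "((\<lambda>h. q h / h) \<longlongrightarrow> 0) (at 0)"
    proof (rule Lim_null_comparison[OF always_eventually])
      show "\<forall>h. norm (q h / h) \<le> \<bar>h\<bar>"
        by (auto simp: q_def max_def power2_eq_square)
      show "((\<lambda>h::real. \<bar>h\<bar>) \<longlongrightarrow> 0) (at 0)" by (intro tendsto_eq_intros) auto
    qed
    thus ?thesis using True by (simp add: DERIV_def q_def)
  next
    case False
    show ?thesis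
    proof (cases "x < 0")
      case True
      have "((\<lambda>x. 0) has_real_derivative 2 * max 0 x) (at x)" using True by simp
      thus ?thesis by (rule has_field_derivative_transform_within_open[of _ _ _ "{..<0}"])
          (use True in \<open>auto simp: q_def\<close>)
    next
      case F2: False
      have "((\<lambda>x. x\<^sup>2) has_real_derivative 2 * max 0 x) (at x)" using F2 by (auto intro!: derivative_eq_intros)
      thus ?thesis by (rule has_field_derivative_transform_within_open[of _ _ _ "{0<..}"])
          (use False F2 in \<open>auto simp: q_def\<close>)
    qed
  qed
  have "((\<lambda>z. Re (of_real (u z))) has_derivative (\<lambda>h. Re (G * h + D * cnj h))) (at z)"
    using assms unfolding wderiv_def by (rule has_derivative_Re)
  hence "((\<lambda>z. q (u z)) has_derivative (\<lambda>h. 2 * max 0 (u z) * Re (G * h + D * cnj h))) (at z)"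
    using has_derivative_compose[of u _ z UNIV q "(*) (2 * max 0 (u z))"] q[of "u z"]
    by (simp add: has_field_derivative_def)
  hence d: "((\<lambda>z. complex_of_real (q (u z))) has_derivative (\<lambda>h. of_real (2 * max 0 (u z) * Re (G * h + D * cnj h)))) (at z)"
    by (rule has_derivative_of_real)
  have "((\<lambda>z. Im (of_real (u z))) has_derivative (\<lambda>h. Im (G * h + D * cnj h))) (at z)"
    using assms unfolding wderiv_def by (rule has_derivative_Im)
  hence "((\<lambda>z. 0::real) has_derivative (\<lambda>h. Im (G * h + D * cnj h))) (at z)" by simp
  from has_derivative_unique[OF this has_derivative_const]
  have "(\<lambda>h. Im (G * h + D * cnj h)) = (\<lambda>h. 0)" .
  hence "Im (G * h + D * cnj h) = 0" for h by meson
  hence e: "of_real (Re (G * h + D * cnj h)) = G * h + D * cnj h" for h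
    by (metis complex_is_Real_iff of_real_Re)
  have "(\<lambda>h. complex_of_real (2 * max 0 (u z) * Re (G * h + D * cnj h)))
      = (\<lambda>h. 2 * of_real (max 0 (u z)) * G * h + 2 * of_real (max 0 (u z)) * D * cnj h)"
    by (rule ext) (simp only: of_real_mult e, simp add: algebra_simps)
  thus ?thesis using d unfolding wderiv_def q_def by simp
qed

lemma wderiv_inverse:
  assumes "wderiv F G D z" "F z \<noteq> 0"
  shows "wderiv (\<lambda>z. inverse (F z)) (- G / (F z)\<^sup>2) (- D / (F z)\<^sup>2) z"
proof -
  have "((\<lambda>z. inverse (F z)) has_derivative (\<lambda>h. - (inverse (F z) ^ Suc (Suc 0)) * (G * h + D * cnj h))) (at z)"
    using has_derivative_compose[OF assms(1)[unfolded wderiv_def]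
        DERIV_inverse[OF assms(2), unfolded has_field_derivative_def]] .
  thus ?thesis unfolding wderiv_def
    by (rule has_derivative_eq_rhs) (use assms(2) in \<open>auto simp: fun_eq_iff field_simps power2_eq_square\<close>)
qed

text \<open>
  With \<open>u\<close> affine in \<open>|z - z0|\<^sup>2\<close>, \<open>u \<ge> 1\<close> on the inner and \<open>u \<le> 0\<close> outside the outer disk, the
  quotient \<open>P / (P + Q)\<close> of the squared positive parts of \<open>u\<close> and \<open>1 - u\<close> is a cut-off function of
  class \<open>C\<^sup>1\<close>. Being constant on the two regions, it has vanishing derivatives there.
\<close>

lemma cutoff_exists:
  fixes z0 :: complex
  assumes r: "0 < r1" "r1 < r2"
  obtains ct G D where "\<And>z. wderiv ct (G z) (D z) z" "continuous_on UNIV G" "continuous_on UNIV D"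
    "\<And>z. z \<in> cball z0 r1 \<Longrightarrow> ct z = 1" "\<And>z. z \<in> ball z0 r1 \<Longrightarrow> D z = 0"
    "\<And>z. z \<notin> cball z0 r2 \<Longrightarrow> ct z = 0 \<and> G z = 0 \<and> D z = 0"
proof -
  define c where "c = r2\<^sup>2 - r1\<^sup>2"
  have c: "c > 0" using r by (simp add: c_def power2_eq_square mult_strict_mono)
  define u where "u = (\<lambda>z. (r2\<^sup>2 - (cmod (z - z0))\<^sup>2) / c)"
  define v where "v = (\<lambda>z. 1 - u z)"
  define Gu where "Gu = (\<lambda>z. - cnj (z - z0) / of_real c)"
  have u_alt: "of_real (u z) = (of_real (r2\<^sup>2) - (z - z0) * cnj (z - z0)) / of_real c" for z
    unfolding u_def of_real_divide of_real_diff complex_norm_square ..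
  have wz: "wderiv (\<lambda>z. z - z0) 1 0 z" for z
    by (rule wderiv_holomorphic) (auto intro!: derivative_eq_intros)
  have wu: "wderiv (\<lambda>z. of_real (u z)) (Gu z) (cnj (Gu z)) z" for z
    unfolding u_alt divide_inverse Gu_def
    by (rule wderiv_cong[OF wderiv_mult[OF wderiv_diff[OF wderiv_const wderiv_mult[OF wz wderiv_cnj[OF wz]]] wderiv_const]])
       (auto simp: divide_inverse)
  have wv: "wderiv (\<lambda>z. of_real (v z)) (- Gu z) (- cnj (Gu z)) z" for z
    unfolding v_def of_real_diff by (rule wderiv_cong[OF wderiv_diff[OF wderiv_const wu]]) auto
  define P where "P = (\<lambda>z. complex_of_real ((max 0 (u z))\<^sup>2))"
  define Q where "Q = (\<lambda>z. complex_of_real ((max 0 (v z))\<^sup>2))"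
  have PQ: "P z + Q z \<noteq> 0" for z
  proof -
    have "(max 0 (u z))\<^sup>2 + (max 0 (v z))\<^sup>2 > 0"
    proof (cases "u z > 0")
      case True thus ?thesis by (intro add_pos_nonneg) auto
    next
      case False hence "v z > 0" by (simp add: v_def)
      thus ?thesis by (intro add_nonneg_pos) auto
    qed
    hence "complex_of_real ((max 0 (u z))\<^sup>2 + (max 0 (v z))\<^sup>2) \<noteq> 0" by (metis less_irrefl of_real_eq_0_iff)
    thus ?thesis by (simp add: P_def Q_def)
  qed
  define Gp where "Gp = (\<lambda>z. 2 * of_real (max 0 (u z)) * Gu z)"
  define Dp where "Dp = (\<lambda>z. 2 * of_real (max 0 (u z)) * cnj (Gu z))"
  define Gq where "Gq = (\<lambda>z. 2 * of_real (max 0 (v z)) * - Gu z)"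
  define Dq where "Dq = (\<lambda>z. 2 * of_real (max 0 (v z)) * - cnj (Gu z))"
  have wP: "wderiv P (Gp z) (Dp z) z" and wQ: "wderiv Q (Gq z) (Dq z) z" for z
    using wderiv_sq_max[OF wu] wderiv_sq_max[OF wv] by (auto simp: P_def Q_def Gp_def Dp_def Gq_def Dq_def)
  define ct where "ct = (\<lambda>z. P z * inverse (P z + Q z))"
  define G where "G = (\<lambda>z. P z * (- (Gp z + Gq z) / (P z + Q z)\<^sup>2) + Gp z * inverse (P z + Q z))"
  define D where "D = (\<lambda>z. P z * (- (Dp z + Dq z) / (P z + Q z)\<^sup>2) + Dp z * inverse (P z + Q z))"
  have w: "wderiv ct (G z) (D z) z" for z
    unfolding ct_def G_def D_def
    by (rule wderiv_mult[OF wP wderiv_inverse[OF wderiv_add[OF wP wQ] PQ]])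
  have cc: "continuous_on UNIV u" "continuous_on UNIV v" "continuous_on UNIV Gu"
    unfolding u_def v_def Gu_def using c by (auto intro!: continuous_intros)
  have cP: "continuous_on UNIV P" "continuous_on UNIV Q"
    unfolding P_def Q_def using cc by (auto intro!: continuous_intros)
  have "continuous_on UNIV Gp" "continuous_on UNIV Gq" "continuous_on UNIV Dp" "continuous_on UNIV Dq"
    unfolding Gp_def Gq_def Dp_def Dq_def using cc by (auto intro!: continuous_intros)
  hence cGD: "continuous_on UNIV G" "continuous_on UNIV D"
    unfolding G_def D_def using cP PQ by (auto intro!: continuous_intros)
  have one: "ct z = 1" if "z \<in> cball z0 r1" for z
  proof -
    have "(cmod (z - z0))\<^sup>2 \<le> r1\<^sup>2" using that by (intro power_mono) (auto simp: dist_norm norm_minus_commute)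
    hence "u z \<ge> 1" using c by (simp add: u_def c_def)
    hence "v z \<le> 0" "u z > 0" by (auto simp: v_def)
    hence "Q z = 0" by (simp add: Q_def)
    thus ?thesis using PQ[of z] by (simp add: ct_def)
  qed
  have zero: "ct z = 0" if "z \<notin> ball z0 r2" for z
  proof -
    have "(cmod (z - z0))\<^sup>2 \<ge> r2\<^sup>2" using that r by (intro power_mono) (auto simp: dist_norm norm_minus_commute)
    hence "u z \<le> 0" using c by (simp add: u_def divide_nonpos_pos)
    thus ?thesis by (simp add: ct_def P_def)
  qed
  have D0: "D z = 0" if "z \<in> ball z0 r1" for z
  proof -
    have "wderiv (\<lambda>z. 1) (G z) (D z) z"
      by (rule wderiv_transform[OF w, of "ball z0 r1"]) (use that in \<open>auto intro!: one\<close>)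
    from wderiv_unique[OF this wderiv_const] show ?thesis by simp
  qed
  have out: "ct z = 0 \<and> G z = 0 \<and> D z = 0" if "z \<notin> cball z0 r2" for z
  proof -
    have "wderiv (\<lambda>z. 0) (G z) (D z) z"
      by (rule wderiv_transform[OF w, of "- cball z0 r2"]) (use that in \<open>auto intro!: zero\<close>)
    from wderiv_unique[OF this wderiv_const] show ?thesis using that zero[of z] by auto
  qed
  show ?thesis by (rule that[OF w cGD one D0 out])
qed

section \<open>The Cauchy--Pompeiu formula\<close>

lemma nn_integral_exp_lessThan:
  fixes c T :: real
  assumes c: "c > 0"
  shows "(\<integral>\<^sup>+t\<in>{..<T}. ennreal (exp (c * t)) \<partial>lborel) = ennreal (exp (c * T) / c)"
proof -
  have "(\<integral>\<^sup>+t\<in>{..<T}. ennreal (exp (c * t)) \<partial>lborel) = (\<integral>\<^sup>+t\<in>{..T}. ennreal (exp (c * t)) \<partial>lborel)"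
    by (rule nn_integral_cong_AE) (use AE_lborel_singleton[of T] in \<open>auto elim!: eventually_mono simp: indicator_def\<close>)
  also have "\<dots> = (\<integral>\<^sup>+t. ennreal (exp (c * (0 + (-1) * t))) * indicator {..T} (0 + (-1) * t) \<partial>lborel)"
    by (subst nn_integral_real_affine[where c="-1" and t=0]) auto
  also have "\<dots> = (\<integral>\<^sup>+t. ennreal (exp (- c * t)) * indicator {-T..} t \<partial>lborel)"
    by (intro nn_integral_cong) (auto simp: indicator_def)
  also have "\<dots> = ennreal (0 - (- exp (- c * (-T)) / c))"
  proof (rule nn_integral_FTC_atLeast)
    show "((\<lambda>t. - exp (- c * t) / c) \<longlongrightarrow> 0) at_top"
    proof -
      have "filterlim (\<lambda>t. c * t) at_top at_top"
        using c by (intro filterlim_tendsto_pos_mult_at_top[OF tendsto_const]) (auto simp: filterlim_ident)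
      hence "((\<lambda>t. exp (- (c * t))) \<longlongrightarrow> 0) at_top"
        by (intro filterlim_compose[OF exp_at_bot]) (simp add: filterlim_uminus_at_bot)
      from tendsto_divide[OF tendsto_minus[OF this] tendsto_const[of c]] c show ?thesis by simp
    qed
  qed (use c in \<open>auto intro!: derivative_eq_intros\<close>)
  also have "\<dots> = ennreal (exp (c * T) / c)" by simp
  finally show ?thesis .
qed

lemma nn_integral_strip:
  assumes [measurable]: "f \<in> borel_measurable borel"
  shows "(\<integral>\<^sup>+w\<in>strip. f w \<partial>lborel) = (\<integral>\<^sup>+t. (\<integral>\<^sup>+\<theta>\<in>{-pi<..<pi}. f (Complex t \<theta>) \<partial>lborel) \<partial>lborel)"
  by (subst nn_integral_complex_prod)
     (auto intro!: nn_integral_cong simp: indicator_def strip_def)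

lemma nn_integral_half_strip:
  assumes [measurable]: "f \<in> borel_measurable borel"
  shows "(\<integral>\<^sup>+w\<in>half_strip. f w \<partial>lborel)
    = (\<integral>\<^sup>+t\<in>{..<0}. (\<integral>\<^sup>+\<theta>\<in>{-pi<..<pi}. f (Complex t \<theta>) \<partial>lborel) \<partial>lborel)"
  by (subst nn_integral_complex_prod)
     (auto intro!: nn_integral_cong simp: indicator_def half_strip_def)

lemma nn_integral_strip_exp:
  assumes c: "c > 0"
  shows "(\<integral>\<^sup>+w\<in>strip. ennreal (exp (c * Re w)) * indicator {..<T} (Re w) \<partial>lborel) = ennreal (2 * pi * exp (c * T) / c)"
proof -
  have "(\<integral>\<^sup>+w\<in>strip. ennreal (exp (c * Re w)) * indicator {..<T} (Re w) \<partial>lborel)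
     = (\<integral>\<^sup>+t. (\<integral>\<^sup>+\<theta>\<in>{-pi<..<pi}. ennreal (exp (c * t)) * indicator {..<T} t \<partial>lborel) \<partial>lborel)"
    by (subst nn_integral_strip) auto
  also have "\<dots> = (\<integral>\<^sup>+t. ennreal (exp (c * t)) * indicator {..<T} t * ennreal (2 * pi) \<partial>lborel)"
    by (intro nn_integral_cong) (subst nn_integral_cmult, auto)
  also have "\<dots> = (\<integral>\<^sup>+t\<in>{..<T}. ennreal (exp (c * t)) \<partial>lborel) * ennreal (2 * pi)"
    by (subst nn_integral_multc) auto
  also have "\<dots> = ennreal (2 * pi * exp (c * T) / c)"
    using c by (subst nn_integral_exp_lessThan) (auto simp: ennreal_mult[symmetric] mult_ac)
  finally show ?thesis .
qed

text \<open>
  The singularity is integrable because the area element contributes \<open>exp (2 Re w)\<close> in logarithmic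
  polar coordinates.
\<close>

lemma nn_integral_ball_powr:
  assumes s: "s < 2" and R: "R > 0"
  shows "(\<integral>\<^sup>+\<zeta>\<in>ball z R. ennreal (cmod (\<zeta> - z) powr (- s)) \<partial>lborel) = ennreal (2 * pi * R powr (2 - s) / (2 - s))"
proof -
  have [measurable]: "ball z R \<in> sets borel" by simp
  have "(\<lambda>\<zeta>. ennreal (cmod (\<zeta> - z) powr (- s)) * indicator (ball z R) \<zeta>) \<in> borel_measurable borel"
    by measurable
  hence "(\<integral>\<^sup>+\<zeta>\<in>ball z R. ennreal (cmod (\<zeta> - z) powr (- s)) \<partial>lborel)
     = (\<integral>\<^sup>+w\<in>strip. (ennreal (cmod (exp w) powr (- s)) * indicator (ball z R) (z + exp w)) * ennreal (exp (2 * Re w)) \<partial>lborel)"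
    by (subst nn_integral_polar[where z=z]) simp_all
  also have "\<dots> = (\<integral>\<^sup>+w\<in>strip. ennreal (exp ((2 - s) * Re w)) * indicator {..<ln R} (Re w) \<partial>lborel)"
  proof (rule nn_integral_cong)
    fix w :: complex
    have "exp (Re w) powr (- s) * exp (2 * Re w) = exp ((2 - s) * Re w)"
      by (simp add: powr_def exp_add[symmetric] algebra_simps)
    moreover have "exp (Re w) < R \<longleftrightarrow> Re w < ln R" using R by (metis exp_less_cancel_iff exp_ln)
    ultimately show "ennreal (cmod (exp w) powr (- s)) * indicator (ball z R) (z + exp w) * ennreal (exp (2 * Re w)) * indicator strip w
      = ennreal (exp ((2 - s) * Re w)) * indicator {..<ln R} (Re w) * indicator strip w"
      by (auto simp: indicator_def dist_norm ennreal_mult[symmetric])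
  qed
  also have "\<dots> = ennreal (2 * pi * R powr (2 - s) / (2 - s))"
    using s R by (subst nn_integral_strip_exp) (auto simp: powr_def)
  finally show ?thesis .
qed

lemma integrable_ball_inverse: "integrable lborel (\<lambda>\<zeta>. indicator (ball z R) \<zeta> * (1 / cmod (\<zeta> - z)))"
proof (cases "R > 0")
  case True
  have [measurable]: "ball z R \<in> sets borel" by simp
  show ?thesis
  proof (rule integrableI_bounded)
    show "(\<lambda>\<zeta>. indicator (ball z R) \<zeta> * (1 / cmod (\<zeta> - z))) \<in> borel_measurable lborel" by measurable
    have "(\<integral>\<^sup>+\<zeta>. ennreal (norm (indicator (ball z R) \<zeta> * (1 / cmod (\<zeta> - z)))) \<partial>lborel)
       = (\<integral>\<^sup>+\<zeta>\<in>ball z R. ennreal (cmod (\<zeta> - z) powr (- 1)) \<partial>lborel)"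
      by (intro nn_integral_cong) (auto simp: indicator_def powr_minus divide_inverse)
    thus "(\<integral>\<^sup>+\<zeta>. ennreal (norm (indicator (ball z R) \<zeta> * (1 / cmod (\<zeta> - z)))) \<partial>lborel) < \<infinity>"
      using nn_integral_ball_powr[of 1 R z] True by simp
  qed
next
  case False
  hence e: "ball z R = {}" by auto
  show ?thesis unfolding e by simp
qed

text \<open>
  In logarithmic polar coordinates around \<open>z\<close> the function \<open>U = \<Psi> (z + exp w)\<close> satisfies \<open>2 dbar U = \<partial>\<^sub>t U + \<i> \<partial>\<^sub>\<theta> U\<close>,
  and \<open>dbar U\<close> is exactly the integrand \<open>D \<zeta> / (\<zeta> - z)\<close> times the area density. The angular part
  integrates to 0 by periodicity, the radial part to \<open>- \<Psi> z\<close> on every ray.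
\<close>

lemma pompeiu:
  assumes w: "\<And>\<zeta>. wderiv \<Psi> (G \<zeta>) (D \<zeta>) \<zeta>"
    and G: "continuous_on UNIV G" and D: "continuous_on UNIV D"
    and supp: "\<And>\<zeta>. \<zeta> \<notin> ball 0 R \<Longrightarrow> \<Psi> \<zeta> = 0"
  shows "integrable lborel (\<lambda>\<zeta>. D \<zeta> / (\<zeta> - z))"
    and "\<Psi> z = - (1 / of_real pi) * (\<integral>\<zeta>. D \<zeta> / (\<zeta> - z) \<partial>lborel)"
proof -
  define R' where "R' = \<bar>R\<bar> + cmod z + 1"
  have R': "R' > 0" using norm_ge_zero[of z] abs_ge_zero[of R] unfolding R'_def by linarith
  have GD0: "G \<zeta> = 0" "D \<zeta> = 0" if "cmod (\<zeta> - z) \<ge> R'" for \<zeta>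
  proof -
    have "cmod \<zeta> > R" using that norm_triangle_ineq4[of \<zeta> z] by (simp add: R'_def)
    hence "wderiv (\<lambda>z. 0) (G \<zeta>) (D \<zeta>) \<zeta>"
      by (intro wderiv_transform[OF w, of "- cball 0 R"]) (auto intro!: supp)
    from wderiv_unique[OF this wderiv_const] show "G \<zeta> = 0" "D \<zeta> = 0" by auto
  qed
  have Psi0: "\<Psi> \<zeta> = 0" if "cmod (\<zeta> - z) \<ge> R'" for \<zeta>
  proof -
    have "cmod \<zeta> > R" using that norm_triangle_ineq4[of \<zeta> z] by (simp add: R'_def)
    thus ?thesis by (intro supp) auto
  qed
  have "compact ((\<lambda>\<zeta>. cmod (G \<zeta>) + cmod (D \<zeta>)) ` cball z R')"
    using G D by (intro compact_continuous_image continuous_intros)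
       (auto intro: continuous_on_subset)
  hence "bdd_above ((\<lambda>\<zeta>. cmod (G \<zeta>) + cmod (D \<zeta>)) ` cball z R')"
    by (intro bounded_imp_bdd_above compact_imp_bounded)
  then obtain M0 where M0: "\<And>\<zeta>. \<zeta> \<in> cball z R' \<Longrightarrow> cmod (G \<zeta>) + cmod (D \<zeta>) \<le> M0"
    unfolding bdd_above_def by blast
  define M where "M = max M0 0"
  have M: "cmod (G \<zeta>) + cmod (D \<zeta>) \<le> M * indicator (ball z R') \<zeta>" for \<zeta>
  proof (cases "cmod (\<zeta> - z) \<ge> R'")
    case True thus ?thesis using GD0[OF True] by (simp add: M_def indicator_def)
  next
    case False
    hence "\<zeta> \<in> ball z R'" by (simp add: dist_norm norm_minus_commute)
    thus ?thesis using M0[of \<zeta>] by (auto simp: M_def)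
  qed
  have [measurable]: "G \<in> borel_measurable borel" "D \<in> borel_measurable borel"
    using G D by (auto intro: borel_measurable_continuous_onI)
  have DM: "cmod (D \<zeta>) \<le> M * indicator (ball z R') \<zeta>" for \<zeta>
    using M[of \<zeta>] norm_ge_zero[of "G \<zeta>"] by linarith
  show int: "integrable lborel (\<lambda>\<zeta>. D \<zeta> / (\<zeta> - z))"
  proof (rule Bochner_Integration.integrable_bound)
    show "integrable lborel (\<lambda>\<zeta>. M * (indicator (ball z R') \<zeta> * (1 / cmod (\<zeta> - z))))"
      by (intro integrable_mult_right integrable_ball_inverse)
    show "AE \<zeta> in lborel. norm (D \<zeta> / (\<zeta> - z)) \<le> norm (M * (indicator (ball z R') \<zeta> * (1 / cmod (\<zeta> - z))))"
    proof (intro AE_I2)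
      fix \<zeta>
      have "cmod (D \<zeta>) / cmod (\<zeta> - z) \<le> (M * indicator (ball z R') \<zeta>) / cmod (\<zeta> - z)"
        by (intro divide_right_mono DM) simp
      hence "norm (D \<zeta> / (\<zeta> - z)) \<le> M * (indicator (ball z R') \<zeta> * (1 / cmod (\<zeta> - z)))"
        by (simp add: norm_divide)
      thus "norm (D \<zeta> / (\<zeta> - z)) \<le> norm (M * (indicator (ball z R') \<zeta> * (1 / cmod (\<zeta> - z))))"
        unfolding real_norm_def by (rule order_trans[OF _ abs_ge_self])
    qed
  qed measurable
  define T where "T = ln R'"
  have expT: "exp t < R' \<longleftrightarrow> t < T" for t using R' unfolding T_def by (metis exp_less_cancel_iff exp_ln)
  define Ut where "Ut = (\<lambda>w. G (z + exp w) * exp w + D (z + exp w) * cnj (exp w))"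
  define Uy where "Uy = (\<lambda>w. \<i> * (G (z + exp w) * exp w - D (z + exp w) * cnj (exp w)))"
  have bnd: "cmod (G (z + exp w)) * cmod (exp w) + cmod (D (z + exp w)) * cmod (exp w) \<le> M * (exp (Re w) * indicator {..<T} (Re w))" for w
  proof -
    have "(cmod (G (z + exp w)) + cmod (D (z + exp w))) * exp (Re w) \<le> (M * indicator (ball z R') (z + exp w)) * exp (Re w)"
      by (intro mult_right_mono M) auto
    moreover have "indicator (ball z R') (z + exp w) = (indicator {..<T} (Re w) :: real)"
      using expT[of "Re w"] by (auto simp: indicator_def dist_norm)
    ultimately show ?thesis by (simp add: algebra_simps)
  qed
  have Ut_bd: "cmod (Ut w) \<le> M * (exp (Re w) * indicator {..<T} (Re w))" for w
    unfolding Ut_def by (rule order_trans[OF norm_triangle_ineq]) (use bnd[of w] in \<open>simp add: norm_mult\<close>)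
  have Uy_bd: "cmod (Uy w) \<le> M * (exp (Re w) * indicator {..<T} (Re w))" for w
    unfolding Uy_def norm_mult norm_ii mult_1
    by (rule order_trans[OF norm_triangle_ineq4]) (use bnd[of w] in \<open>simp add: norm_mult\<close>)
  have cU: "continuous_on UNIV Ut" "continuous_on UNIV Uy"
    unfolding Ut_def Uy_def
    by (intro continuous_intros continuous_on_compose2[OF G] continuous_on_compose2[OF D]; simp)+
  have [measurable]: "Ut \<in> borel_measurable borel" "Uy \<in> borel_measurable borel"
    using cU by (auto intro: borel_measurable_continuous_onI)
  have bi: "integrable lborel (\<lambda>w. indicator strip w * (M * (exp (Re w) * indicator {..<T} (Re w))))"
  proof (rule integrableI_bounded)
    have "(\<integral>\<^sup>+w. ennreal (norm (indicator strip w * (M * (exp (Re w) * indicator {..<T} (Re w))))) \<partial>lborel)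
       = (\<integral>\<^sup>+w. ennreal M * ((ennreal (exp (1 * Re w)) * indicator {..<T} (Re w)) * indicator strip w) \<partial>lborel)"
      by (intro nn_integral_cong) (auto simp: indicator_def M_def ennreal_mult')
    also have "\<dots> = ennreal M * ennreal (2 * pi * exp (1 * T) / 1)"
      by (subst nn_integral_cmult) (auto simp: nn_integral_strip_exp[of 1, simplified])
    also have "\<dots> < \<infinity>" by (simp add: ennreal_mult_less_top)
    finally show "(\<integral>\<^sup>+w. ennreal (norm (indicator strip w * (M * (exp (Re w) * indicator {..<T} (Re w))))) \<partial>lborel) < \<infinity>" .
  qed measurable
  have istrip: "integrable lborel (\<lambda>w. indicator strip w *\<^sub>R V w)"
    if [measurable]: "V \<in> borel_measurable borel"
      and V: "\<And>w. cmod (V w) \<le> M * (exp (Re w) * indicator {..<T} (Re w))" for V :: "complex \<Rightarrow> complex"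
  proof (rule Bochner_Integration.integrable_bound[OF bi])
    show "AE w in lborel. norm (indicator strip w *\<^sub>R V w) \<le> norm (indicator strip w * (M * (exp (Re w) * indicator {..<T} (Re w))))"
    proof (intro AE_I2)
      fix w :: complex
      have "indicator strip w * cmod (V w) \<le> indicator strip w * (M * (exp (Re w) * indicator {..<T} (Re w)))"
        by (intro mult_left_mono V) simp
      thus "norm (indicator strip w *\<^sub>R V w) \<le> norm (indicator strip w * (M * (exp (Re w) * indicator {..<T} (Re w))))"
        by (simp add: order_trans[OF _ abs_ge_self])
    qed
  qed measurable
  have iUt: "integrable lborel (\<lambda>w. indicator strip w *\<^sub>R Ut w)" and iUy: "integrable lborel (\<lambda>w. indicator strip w *\<^sub>R Uy w)"
    by (rule istrip; use Ut_bd Uy_bd in simp)+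
  have bt: "integrable lborel (\<lambda>t. M * (exp t * indicator {..<T} t))"
  proof (rule integrableI_bounded)
    have "(\<integral>\<^sup>+t. ennreal (norm (M * (exp t * indicator {..<T} t))) \<partial>lborel)
       = (\<integral>\<^sup>+t. ennreal M * ((ennreal (exp (1 * t)) * indicator {..<T} t)) \<partial>lborel)"
      by (intro nn_integral_cong) (auto simp: indicator_def M_def ennreal_mult')
    also have "\<dots> = ennreal M * ennreal (exp (1 * T) / 1)"
      by (subst nn_integral_cmult) (auto simp: nn_integral_exp_lessThan[of 1, simplified])
    also have "\<dots> < \<infinity>" by (simp add: ennreal_mult_less_top)
    finally show "(\<integral>\<^sup>+t. ennreal (norm (M * (exp t * indicator {..<T} t))) \<partial>lborel) < \<infinity>" .
  qed measurable
  have wU: "wderiv (\<lambda>w. \<Psi> (z + exp w)) (G (z + exp w) * exp w) (D (z + exp w) * cnj (exp w)) w" for w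
    by (rule wderiv_compose[OF w]) (auto intro!: derivative_eq_intros)
  have dt: "((\<lambda>t. \<Psi> (z + exp (Complex t \<theta>))) has_vector_derivative Ut (Complex t \<theta>)) (at t)" for t \<theta>
  proof -
    have "Complex 0 \<theta> + 1 * of_real s = Complex s \<theta>" for s by (simp add: complex_eq_iff)
    with wderiv_line[OF wU, of "Complex 0 \<theta>" 1 t] show ?thesis by (simp add: Ut_def)
  qed
  have dy: "((\<lambda>\<theta>. \<Psi> (z + exp (Complex t \<theta>))) has_vector_derivative Uy (Complex t \<theta>)) (at \<theta>)" for t \<theta>
  proof -
    have "Complex t 0 + \<i> * of_real s = Complex t s" for s by (simp add: complex_eq_iff)
    with wderiv_line[OF wU, of "Complex t 0" \<i> \<theta>] show ?thesis by (simp add: Uy_def algebra_simps)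
  qed
  have cC1: "isCont (\<lambda>s. Complex s \<theta>) t" and cC2: "isCont (\<lambda>s. Complex t s) \<theta>" for t \<theta>
    unfolding Complex_eq by (auto intro!: continuous_intros)
  have cUt: "isCont (\<lambda>s. Ut (Complex s \<theta>)) t" for t \<theta>
    using isCont_o2[OF cC1] cU(1) by (auto simp: continuous_on_eq_continuous_at)
  have cUy: "isCont (\<lambda>s. Uy (Complex t s)) \<theta>" for t \<theta>
    using isCont_o2[OF cC2] cU(2) by (auto simp: continuous_on_eq_continuous_at)
  have it: "(\<integral>t. Ut (Complex t \<theta>) \<partial>lborel) = - \<Psi> z" for \<theta>
  proof -
    have lim: "((\<lambda>t. \<Psi> (z + exp (Complex t \<theta>))) \<longlongrightarrow> \<Psi> z) at_bot"
    proof -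
      have "((\<lambda>t. exp (Complex t \<theta>)) \<longlongrightarrow> 0) at_bot"
        by (rule tendsto_norm_zero_cancel) (simp add: exp_at_bot)
      hence "((\<lambda>t. z + exp (Complex t \<theta>)) \<longlongrightarrow> z + 0) at_bot" by (intro tendsto_intros)
      moreover have "isCont \<Psi> z" using w[of z] unfolding wderiv_def by (rule has_derivative_continuous)
      ultimately show ?thesis using isCont_tendsto_compose by fastforce
    qed
    have lim2: "((\<lambda>t. \<Psi> (z + exp (Complex t \<theta>))) \<longlongrightarrow> 0) at_top"
    proof (rule tendsto_eventually)
      show "\<forall>\<^sub>F t in at_top. \<Psi> (z + exp (Complex t \<theta>)) = 0"
        using eventually_ge_at_top[of T]
      proof eventually_elim
        case (elim t)
        thus ?case using expT[of t] by (intro Psi0) simp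
      qed
    qed
    have "(LBINT t=-\<infinity>..\<infinity>. Ut (Complex t \<theta>)) = 0 - \<Psi> z"
    proof (rule interval_integral_FTC_integrable[OF _ dt cUt])
      show "set_integrable lborel (einterval (- \<infinity>) \<infinity>) (\<lambda>x. Ut (Complex x \<theta>))"
        unfolding set_integrable_def
      proof (rule Bochner_Integration.integrable_bound[OF bt])
        show "(\<lambda>x. indicator (einterval (- \<infinity>) \<infinity>) x *\<^sub>R Ut (Complex x \<theta>)) \<in> borel_measurable lborel"
          unfolding Complex_eq by measurable
        show "AE x in lborel. norm (indicator (einterval (- \<infinity>) \<infinity>) x *\<^sub>R Ut (Complex x \<theta>)) \<le> norm (M * (exp x * indicator {..<T} x))"
          using Ut_bd[of "Complex _ \<theta>"] by (intro AE_I2) (simp add: einterval_def order_trans[OF _ abs_ge_self])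
      qed
      show "(((\<lambda>t. \<Psi> (z + exp (Complex t \<theta>))) \<circ> real_of_ereal) \<longlongrightarrow> \<Psi> z) (at_right (- \<infinity>))"
        using lim by (simp add: ereal_tendsto_simps)
      show "(((\<lambda>t. \<Psi> (z + exp (Complex t \<theta>))) \<circ> real_of_ereal) \<longlongrightarrow> 0) (at_left \<infinity>)"
        using lim2 by (simp add: ereal_tendsto_simps)
    qed auto
    thus ?thesis by (simp add: interval_lebesgue_integral_def set_lebesgue_integral_def einterval_def)
  qed
  have iy: "(\<integral>\<theta>. indicator {-pi<..<pi} \<theta> *\<^sub>R Uy (Complex t \<theta>) \<partial>lborel) = 0" for t
  proof -
    have "continuous_on {-pi..pi} (\<lambda>\<theta>. Uy (Complex t \<theta>))"
      by (intro continuous_at_imp_continuous_on ballI cUy)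
    hence i1: "set_integrable lborel {-pi..pi} (\<lambda>\<theta>. Uy (Complex t \<theta>))"
      by (rule borel_integrable_atLeastAtMost')
    have "(LBINT \<theta>:{-pi..pi}. Uy (Complex t \<theta>)) = \<Psi> (z + exp (Complex t pi)) - \<Psi> (z + exp (Complex t (-pi)))"
      unfolding set_lebesgue_integral_def
      by (rule integral_FTC_atLeastAtMost[OF _ has_vector_derivative_at_within[OF dy]])
         (auto intro!: continuous_at_imp_continuous_on cUy)
    moreover have "exp (Complex t pi) = exp (Complex t (-pi))" by (simp add: complex_eq_iff Re_exp Im_exp)
    moreover have "(\<integral>\<theta>. indicator {-pi<..<pi} \<theta> *\<^sub>R Uy (Complex t \<theta>) \<partial>lborel) = (LBINT \<theta>:{-pi..pi}. Uy (Complex t \<theta>))"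
      unfolding set_lebesgue_integral_def
      using AE_lborel_singleton[of pi] AE_lborel_singleton[of "-pi"] i1
      by (intro integral_cong_AE) (auto simp: set_integrable_def Complex_eq indicator_def elim: eventually_elim2)
    ultimately show ?thesis by simp
  qed
  have e1: "(\<integral>w. indicator strip w *\<^sub>R Ut w \<partial>lborel) = - (2 * of_real pi) * \<Psi> z"
  proof -
    have "(\<integral>w. indicator strip w *\<^sub>R Ut w \<partial>lborel)
        = (\<integral>\<theta>. \<integral>t. indicator strip (Complex t \<theta>) *\<^sub>R Ut (Complex t \<theta>) \<partial>lborel \<partial>lborel)"
      by (rule integral_complex_prod(1)[OF iUt])
    also have "\<dots> = (\<integral>\<theta>. indicator {-pi<..<pi} \<theta> *\<^sub>R (- \<Psi> z) \<partial>lborel)"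
    proof (rule Bochner_Integration.integral_cong[OF refl])
      fix \<theta> :: real
      have "(\<lambda>t. indicator strip (Complex t \<theta>) *\<^sub>R Ut (Complex t \<theta>)) = (\<lambda>t. indicator {-pi<..<pi} \<theta> *\<^sub>R Ut (Complex t \<theta>))"
        by (auto simp: strip_def indicator_def)
      thus "(\<integral>t. indicator strip (Complex t \<theta>) *\<^sub>R Ut (Complex t \<theta>) \<partial>lborel) = indicator {-pi<..<pi} \<theta> *\<^sub>R (- \<Psi> z)"
        using it by simp
    qed
    also have "\<dots> = - (2 * of_real pi) * \<Psi> z" by (simp add: scaleR_conv_of_real)
    finally show ?thesis .
  qed
  have e2: "(\<integral>w. indicator strip w *\<^sub>R Uy w \<partial>lborel) = 0"
  proof -
    have "(\<integral>w. indicator strip w *\<^sub>R Uy w \<partial>lborel)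
        = (\<integral>t. \<integral>\<theta>. indicator strip (Complex t \<theta>) *\<^sub>R Uy (Complex t \<theta>) \<partial>lborel \<partial>lborel)"
      by (rule integral_complex_prod(2)[OF iUy])
    also have "\<dots> = (\<integral>t. 0 \<partial>(lborel :: real measure))"
    proof (rule Bochner_Integration.integral_cong[OF refl])
      fix t :: real
      have "(\<lambda>\<theta>. indicator strip (Complex t \<theta>) *\<^sub>R Uy (Complex t \<theta>)) = (\<lambda>\<theta>. indicator {-pi<..<pi} \<theta> *\<^sub>R Uy (Complex t \<theta>))"
        by (auto simp: strip_def indicator_def)
      thus "(\<integral>\<theta>. indicator strip (Complex t \<theta>) *\<^sub>R Uy (Complex t \<theta>) \<partial>lborel) = 0"
        using iy by simp
    qed
    finally show ?thesis by simp
  qed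
  have "(\<integral>\<zeta>. D \<zeta> / (\<zeta> - z) \<partial>lborel) = (\<integral>w. indicator strip w *\<^sub>R (exp (2 * Re w) *\<^sub>R (D (z + exp w) / exp w)) \<partial>lborel)"
    using integral_polar(2)[OF int, of z] by (simp add: set_lebesgue_integral_def)
  also have "\<dots> = (\<integral>w. (1/2) * (indicator strip w *\<^sub>R Ut w) + (\<i>/2) * (indicator strip w *\<^sub>R Uy w) \<partial>lborel)"
  proof (rule Bochner_Integration.integral_cong[OF refl])
    fix w :: complex
    have "of_real (exp (2 * Re w)) = exp w * cnj (exp w)"
      by (simp add: complex_norm_square[symmetric] exp_double del: of_real_exp)
    hence "exp (2 * Re w) *\<^sub>R (D (z + exp w) / exp w) = D (z + exp w) * cnj (exp w)"
      unfolding scaleR_conv_of_real by simp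
    also have "\<dots> = (1/2) * Ut w + (\<i>/2) * Uy w" by (simp add: Ut_def Uy_def field_simps)
    finally show "indicator strip w *\<^sub>R (exp (2 * Re w) *\<^sub>R (D (z + exp w) / exp w))
       = (1/2) * (indicator strip w *\<^sub>R Ut w) + (\<i>/2) * (indicator strip w *\<^sub>R Uy w)"
      by (simp add: indicator_def)
  qed
  also have "\<dots> = (1/2) * (\<integral>w. indicator strip w *\<^sub>R Ut w \<partial>lborel) + (\<i>/2) * (\<integral>w. indicator strip w *\<^sub>R Uy w \<partial>lborel)"
    using Bochner_Integration.integral_add[OF integrable_mult_right[OF iUt, of "1/2"] integrable_mult_right[OF iUy, of "\<i>/2"]]
    by (simp only: integral_mult_right_zero)
  also have "\<dots> = - (of_real pi) * \<Psi> z" by (simp add: e1 e2)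
  finally show "\<Psi> z = - (1 / of_real pi) * (\<integral>\<zeta>. D \<zeta> / (\<zeta> - z) \<partial>lborel)" by simp
qed

section \<open>The operator K on polynomials in the conjugate of a conformal map\<close>

text \<open>
  Differentiation under the integral sign; the general denominator \<open>c \<zeta> - d \<zeta> * z\<close> covers the Cauchy
  kernel away from its pole (\<open>c \<zeta> = \<zeta>\<close>, \<open>d \<zeta> = 1\<close>) and the regular kernel \<open>1 / (1 - \<zeta> z)\<close> (\<open>c \<zeta> = 1\<close>,
  \<open>d \<zeta> = \<zeta>\<close>).
\<close>

lemma kernel_integral_holomorphic:
  fixes N c d :: "complex \<Rightarrow> complex"
  assumes N: "integrable lborel N"
    and [measurable]: "c \<in> borel_measurable borel" "d \<in> borel_measurable borel"
    and d: "\<And>\<zeta>. N \<zeta> \<noteq> 0 \<Longrightarrow> cmod (d \<zeta>) \<le> 1"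
    and e: "e > 0" "\<And>\<zeta> z. N \<zeta> \<noteq> 0 \<Longrightarrow> z \<in> ball z0 r \<Longrightarrow> e \<le> cmod (c \<zeta> - d \<zeta> * z)"
  shows "\<And>z. z \<in> ball z0 r \<Longrightarrow> integrable lborel (\<lambda>\<zeta>. N \<zeta> / (c \<zeta> - d \<zeta> * z))"
    and "(\<lambda>z. \<integral>\<zeta>. N \<zeta> / (c \<zeta> - d \<zeta> * z) \<partial>lborel) holomorphic_on ball z0 r"
proof -
  have [measurable]: "N \<in> borel_measurable lborel" using N by (rule borel_measurable_integrable)
  have nN: "integrable lborel (\<lambda>\<zeta>. cmod (N \<zeta>))" using N by (rule integrable_norm)
  show i1: "integrable lborel (\<lambda>\<zeta>. N \<zeta> / (c \<zeta> - d \<zeta> * z))" if z: "z \<in> ball z0 r" for z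
  proof (rule Bochner_Integration.integrable_bound)
    show "integrable lborel (\<lambda>\<zeta>. cmod (N \<zeta>) * (1 / e))" using nN by (rule integrable_mult_left)
    show "AE \<zeta> in lborel. norm (N \<zeta> / (c \<zeta> - d \<zeta> * z)) \<le> norm (cmod (N \<zeta>) * (1 / e))"
    proof (intro AE_I2)
      fix \<zeta>
      show "norm (N \<zeta> / (c \<zeta> - d \<zeta> * z)) \<le> norm (cmod (N \<zeta>) * (1 / e))"
        using e(1) e(2)[OF _ z, of \<zeta>] by (cases "N \<zeta> = 0") (auto simp: norm_divide frac_le)
    qed
  qed measurable
  have i2: "integrable lborel (\<lambda>\<zeta>. N \<zeta> * d \<zeta> / (c \<zeta> - d \<zeta> * z)\<^sup>2)" if z: "z \<in> ball z0 r" for z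
  proof (rule Bochner_Integration.integrable_bound)
    show "integrable lborel (\<lambda>\<zeta>. cmod (N \<zeta>) * (1 / e\<^sup>2))" using nN by (rule integrable_mult_left)
    show "AE \<zeta> in lborel. norm (N \<zeta> * d \<zeta> / (c \<zeta> - d \<zeta> * z)\<^sup>2) \<le> norm (cmod (N \<zeta>) * (1 / e\<^sup>2))"
    proof (intro AE_I2)
      fix \<zeta>
      show "norm (N \<zeta> * d \<zeta> / (c \<zeta> - d \<zeta> * z)\<^sup>2) \<le> norm (cmod (N \<zeta>) * (1 / e\<^sup>2))"
      proof (cases "N \<zeta> = 0")
        case False
        have "e\<^sup>2 \<le> (cmod (c \<zeta> - d \<zeta> * z))\<^sup>2" using e(1) e(2)[OF False z] by (intro power_mono) auto
        moreover have "cmod (N \<zeta>) * cmod (d \<zeta>) \<le> cmod (N \<zeta>)" using d[OF False] by (simp add: mult_left_le)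
        ultimately show ?thesis using e(1) by (simp add: norm_divide norm_mult norm_power frac_le)
      qed simp
    qed
  qed measurable
  define I where "I = (\<lambda>z. \<integral>\<zeta>. N \<zeta> / (c \<zeta> - d \<zeta> * z) \<partial>lborel)"
  have "(I has_field_derivative (\<integral>\<zeta>. N \<zeta> * d \<zeta> / (c \<zeta> - d \<zeta> * z)\<^sup>2 \<partial>lborel)) (at z)" if z: "z \<in> ball z0 r" for z
    unfolding DERIV_def
  proof (rule LIM_zero_cancel, rule Lim_null_comparison)
    define J where "J = (\<integral>\<zeta>. N \<zeta> * d \<zeta> / (c \<zeta> - d \<zeta> * z)\<^sup>2 \<partial>lborel)"
    define K where "K = (\<integral>\<zeta>. cmod (N \<zeta>) \<partial>lborel) / e ^ 3"
    have "eventually (\<lambda>w. w \<in> ball z0 r) (nhds z)" using z by (intro eventually_nhds_in_open) auto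
    hence "eventually (\<lambda>h. z + h \<in> ball z0 r) (nhds 0)"
      by (simp add: eventually_nhds_metric) (metis add.commute add_diff_cancel_left' dist_norm norm_minus_commute diff_zero)
    hence "eventually (\<lambda>h. z + h \<in> ball z0 r) (at 0)" by (simp add: eventually_nhds_conv_at)
    thus "\<forall>\<^sub>F h in at 0. norm ((I (z + h) - I z) / h - (\<integral>\<zeta>. N \<zeta> * d \<zeta> / (c \<zeta> - d \<zeta> * z)\<^sup>2 \<partial>lborel)) \<le> cmod h * K"
      using eventually_neq_at_within[of 0]
    proof eventually_elim
      case (elim h)
      have pt: "(N \<zeta> / (c \<zeta> - d \<zeta> * (z + h)) - N \<zeta> / (c \<zeta> - d \<zeta> * z)) / h - N \<zeta> * d \<zeta> / (c \<zeta> - d \<zeta> * z)\<^sup>2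
         = N \<zeta> * (d \<zeta>)\<^sup>2 * h / ((c \<zeta> - d \<zeta> * z)\<^sup>2 * (c \<zeta> - d \<zeta> * (z + h)))" for \<zeta>
      proof (cases "N \<zeta> = 0")
        case False
        define A where "A = c \<zeta> - d \<zeta> * z"
        have A: "A \<noteq> 0" "A - d \<zeta> * h \<noteq> 0" using e(1) e(2)[OF False z] e(2)[OF False elim(1)]
          by (auto simp: A_def algebra_simps)
        have "(N \<zeta> / (A - d \<zeta> * h) - N \<zeta> / A) / h - N \<zeta> * d \<zeta> / A\<^sup>2
         = N \<zeta> * (d \<zeta>)\<^sup>2 * h / (A\<^sup>2 * (A - d \<zeta> * h))"
          using A elim(2) by (simp add: divide_simps) (simp add: power2_eq_square algebra_simps)
        moreover have "c \<zeta> - d \<zeta> * (z + h) = A - d \<zeta> * h" by (simp add: A_def algebra_simps)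
        ultimately show ?thesis by (simp only: A_def[symmetric])
      qed simp
      have "(I (z + h) - I z) / h - J = (\<integral>\<zeta>. (N \<zeta> / (c \<zeta> - d \<zeta> * (z + h)) - N \<zeta> / (c \<zeta> - d \<zeta> * z)) / h - N \<zeta> * d \<zeta> / (c \<zeta> - d \<zeta> * z)\<^sup>2 \<partial>lborel)"
        unfolding I_def J_def using i1[OF z] i1[OF elim(1)] i2[OF z] by simp
      also have "\<dots> = (\<integral>\<zeta>. N \<zeta> * (d \<zeta>)\<^sup>2 * h / ((c \<zeta> - d \<zeta> * z)\<^sup>2 * (c \<zeta> - d \<zeta> * (z + h))) \<partial>lborel)"
        by (simp only: pt)
      also have "cmod \<dots> \<le> (\<integral>\<zeta>. cmod (N \<zeta>) * (cmod h / e ^ 3) \<partial>lborel)"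
      proof (rule Bochner_Integration.integral_norm_bound_integral)
        show "integrable lborel (\<lambda>\<zeta>. cmod (N \<zeta>) * (cmod h / e ^ 3))" using nN by (rule integrable_mult_left)
        show "integrable lborel (\<lambda>\<zeta>. N \<zeta> * (d \<zeta>)\<^sup>2 * h / ((c \<zeta> - d \<zeta> * z)\<^sup>2 * (c \<zeta> - d \<zeta> * (z + h))))"
          unfolding pt[symmetric] using i1[OF z] i1[OF elim(1)] i2[OF z] by simp
        fix \<zeta> show "norm (N \<zeta> * (d \<zeta>)\<^sup>2 * h / ((c \<zeta> - d \<zeta> * z)\<^sup>2 * (c \<zeta> - d \<zeta> * (z + h)))) \<le> cmod (N \<zeta>) * (cmod h / e ^ 3)"
        proof (cases "N \<zeta> = 0")
          case False
          have "e\<^sup>2 * e \<le> (cmod (c \<zeta> - d \<zeta> * z))\<^sup>2 * cmod (c \<zeta> - d \<zeta> * (z + h))"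
            using e(1) e(2)[OF False z] e(2)[OF False elim(1)] by (intro mult_mono power_mono) auto
          moreover have "(cmod (d \<zeta>))\<^sup>2 \<le> 1" using d[OF False] by (simp add: abs_square_le_1)
          hence "cmod (N \<zeta>) * (cmod (d \<zeta>))\<^sup>2 * cmod h \<le> cmod (N \<zeta>) * 1 * cmod h"
            by (intro mult_right_mono mult_left_mono) auto
          ultimately have "cmod (N \<zeta>) * (cmod (d \<zeta>))\<^sup>2 * cmod h / ((cmod (c \<zeta> - d \<zeta> * z))\<^sup>2 * cmod (c \<zeta> - d \<zeta> * (z + h)))
              \<le> cmod (N \<zeta>) * 1 * cmod h / (e\<^sup>2 * e)"
            using e(1) by (intro frac_le) auto
          thus ?thesis by (simp add: norm_divide norm_mult norm_power power2_eq_square power3_eq_cube)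
        qed simp
      qed
      also have "\<dots> = cmod h * K" by (simp add: K_def)
      finally show ?case by (simp add: J_def)
    qed
    show "((\<lambda>h. cmod h * K) \<longlongrightarrow> 0) (at 0)" by (intro tendsto_mult_left_zero tendsto_norm_zero tendsto_ident_at)
  qed
  thus "(\<lambda>z. \<integral>\<zeta>. N \<zeta> / (c \<zeta> - d \<zeta> * z) \<partial>lborel) holomorphic_on ball z0 r"
    unfolding I_def[symmetric] holomorphic_on_open[OF open_ball] by blast
qed

lemma continuous_on_UNIV_cutoff:
  fixes f :: "complex \<Rightarrow> complex"
  assumes "open S" "continuous_on S f" "closed C" "C \<subseteq> S" "\<And>x. x \<in> S - C \<Longrightarrow> f x = 0"
  shows "continuous_on UNIV (\<lambda>x. if x \<in> S then f x else 0)"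
proof -
  have "continuous_on S (\<lambda>x. if x \<in> S then f x else 0)" using assms(2) by (simp cong: continuous_on_cong)
  moreover have "continuous_on (- C) (\<lambda>x. if x \<in> S then f x else 0)"
    by (rule continuous_on_eq[OF continuous_on_const[of _ 0]]) (use assms(5) in auto)
  ultimately have "continuous_on (S \<union> - C) (\<lambda>x. if x \<in> S then f x else 0)"
    using assms(1,3) by (intro continuous_on_open_Un) auto
  moreover have "S \<union> - C = UNIV" using assms(4) by auto
  ultimately show ?thesis by simp
qed

lemma wderiv_cutoff_product:
  assumes U: "open U" and w: "\<And>z. z \<in> U \<Longrightarrow> wderiv \<Phi> (G z) (\<phi> z) z"
    and G: "continuous_on U G" and \<phi>: "continuous_on U \<phi>" and C: "closed C" "C \<subseteq> U"
    and ct: "\<And>z. wderiv ct (Gc z) (Dc z) z" "continuous_on UNIV Gc" "continuous_on UNIV Dc"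
    and out: "\<And>z. z \<notin> C \<Longrightarrow> ct z = 0 \<and> Gc z = 0 \<and> Dc z = 0"
  shows "wderiv (\<lambda>z. if z \<in> U then \<Phi> z * ct z else 0) (if z \<in> U then \<Phi> z * Gc z + G z * ct z else 0)
           (if z \<in> U then \<Phi> z * Dc z + \<phi> z * ct z else 0) z"
    and "continuous_on UNIV (\<lambda>z. if z \<in> U then \<Phi> z * Gc z + G z * ct z else 0)"
    and "continuous_on UNIV (\<lambda>z. if z \<in> U then \<Phi> z * Dc z + \<phi> z * ct z else 0)"
proof -
  show "wderiv (\<lambda>z. if z \<in> U then \<Phi> z * ct z else 0) (if z \<in> U then \<Phi> z * Gc z + G z * ct z else 0)
           (if z \<in> U then \<Phi> z * Dc z + \<phi> z * ct z else 0) z"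
  proof (cases "z \<in> U")
    case True
    have "wderiv (\<lambda>z. \<Phi> z * ct z) (\<Phi> z * Gc z + G z * ct z) (\<Phi> z * Dc z + \<phi> z * ct z) z"
      by (rule wderiv_mult[OF w[OF True] ct(1)])
    hence "wderiv (\<lambda>z. if z \<in> U then \<Phi> z * ct z else 0) (\<Phi> z * Gc z + G z * ct z) (\<Phi> z * Dc z + \<phi> z * ct z) z"
      by (rule wderiv_transform[OF _ U True]) simp
    thus ?thesis using True by simp
  next
    case False
    hence "z \<in> - C" using C by blast
    hence "wderiv (\<lambda>z. if z \<in> U then \<Phi> z * ct z else 0) 0 0 z"
      by (rule wderiv_transform[OF wderiv_const open_Compl[OF C(1)]]) (use out in auto)
    thus ?thesis using False by simp
  qed
  have c: "continuous_on U \<Phi>" "continuous_on U ct" "continuous_on U Gc" "continuous_on U Dc"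
    using wderiv_continuous_on[of U \<Phi> G \<phi>] wderiv_continuous_on[of U ct Gc Dc] w ct continuous_on_subset by blast+
  show "continuous_on UNIV (\<lambda>z. if z \<in> U then \<Phi> z * Gc z + G z * ct z else 0)"
  proof (rule continuous_on_UNIV_cutoff[OF U _ C])
    show "continuous_on U (\<lambda>z. \<Phi> z * Gc z + G z * ct z)" by (intro continuous_on_add continuous_on_mult c G)
    show "\<Phi> z * Gc z + G z * ct z = 0" if "z \<in> U - C" for z using out[of z] that by simp
  qed
  show "continuous_on UNIV (\<lambda>z. if z \<in> U then \<Phi> z * Dc z + \<phi> z * ct z else 0)"
  proof (rule continuous_on_UNIV_cutoff[OF U _ C])
    show "continuous_on U (\<lambda>z. \<Phi> z * Dc z + \<phi> z * ct z)" by (intro continuous_on_add continuous_on_mult c \<phi>)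
    show "\<Phi> z * Dc z + \<phi> z * ct z = 0" if "z \<in> U - C" for z using out[of z] that by simp
  qed
qed

lemma integrable_continuous_compact_support:
  fixes f :: "complex \<Rightarrow> complex"
  assumes f: "continuous_on UNIV f" and C: "compact C" and out: "\<And>z. z \<notin> C \<Longrightarrow> f z = 0"
  shows "integrable lborel f"
proof -
  have "integrable lborel (\<lambda>z. indicator C z *\<^sub>R f z)"
    by (rule borel_integrable_compact[OF C]) (rule continuous_on_subset[OF f], simp)
  moreover have "(\<lambda>z. indicator C z *\<^sub>R f z) = f" using out by (auto simp: fun_eq_iff indicator_def)
  ultimately show ?thesis by simp
qed

text \<open>
  A function \<open>\<Phi>\<close> with \<open>dbar \<Phi> = N\<close> on \<open>U\<close> and minus the Cauchy transform of \<open>N\<close> (over \<open>\<pi>\<close>) solve the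
  same equation, so that their difference is holomorphic. Locally, \<open>N\<close> is split into \<open>dbar\<close> of a
  cut-off multiple of \<open>\<Phi>\<close>, to which the Cauchy--Pompeiu formula applies, and a remainder that
  vanishes near the point considered and has a holomorphic Cauchy transform there.
\<close>

lemma cauchy_transform_structure:
  assumes U: "open U"
    and w: "\<And>z. z \<in> U \<Longrightarrow> wderiv \<Phi> (G z) (\<phi> z) z"
    and G: "continuous_on U G" and \<phi>: "continuous_on U \<phi>"
    and N: "integrable lborel N" and N\<phi>: "\<And>z. z \<in> U \<Longrightarrow> N z = \<phi> z"
  shows "\<And>z. z \<in> U \<Longrightarrow> integrable lborel (\<lambda>\<zeta>. N \<zeta> / (\<zeta> - z))"
    and "(\<lambda>z. (\<integral>\<zeta>. N \<zeta> / (\<zeta> - z) \<partial>lborel) / of_real pi + \<Phi> z) holomorphic_on U"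
proof -
  have loc: "\<exists>r>0. ball z0 r \<subseteq> U \<and> (\<forall>z\<in>ball z0 r. integrable lborel (\<lambda>\<zeta>. N \<zeta> / (\<zeta> - z))) \<and>
     (\<lambda>z. (\<integral>\<zeta>. N \<zeta> / (\<zeta> - z) \<partial>lborel) / of_real pi + \<Phi> z) holomorphic_on ball z0 r" if z0: "z0 \<in> U" for z0
  proof -
    obtain r2 where r2: "r2 > 0" "cball z0 r2 \<subseteq> U" using U z0 open_contains_cball by blast
    define r1 where "r1 = r2 / 2"
    have r1: "0 < r1" "r1 < r2" using r2 by (auto simp: r1_def)
    obtain ct Gc Dc where ct: "\<And>z. wderiv ct (Gc z) (Dc z) z" "continuous_on UNIV Gc" "continuous_on UNIV Dc"
      "\<And>z. z \<in> cball z0 r1 \<Longrightarrow> ct z = 1" "\<And>z. z \<in> ball z0 r1 \<Longrightarrow> Dc z = 0"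
      "\<And>z. z \<notin> cball z0 r2 \<Longrightarrow> ct z = 0 \<and> Gc z = 0 \<and> Dc z = 0"
      using cutoff_exists[OF r1] by metis
    define \<Psi> where "\<Psi> = (\<lambda>z. if z \<in> U then \<Phi> z * ct z else 0)"
    define G\<Psi> where "G\<Psi> = (\<lambda>z. if z \<in> U then \<Phi> z * Gc z + G z * ct z else 0)"
    define D\<Psi> where "D\<Psi> = (\<lambda>z. if z \<in> U then \<Phi> z * Dc z + \<phi> z * ct z else 0)"
    note cp = wderiv_cutoff_product[OF U w G \<phi> closed_cball r2(2) ct(1-3,6)]
    have w\<Psi>: "wderiv \<Psi> (G\<Psi> z) (D\<Psi> z) z" for z unfolding \<Psi>_def G\<Psi>_def D\<Psi>_def by (rule cp(1))
    have contG: "continuous_on UNIV G\<Psi>" unfolding G\<Psi>_def by (rule cp(2))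
    have contD: "continuous_on UNIV D\<Psi>" unfolding D\<Psi>_def by (rule cp(3))
    define R where "R = cmod z0 + r2 + 1"
    have supp: "\<Psi> z = 0" "D\<Psi> z = 0" if "z \<notin> ball 0 R" for z
    proof -
      have "z \<notin> cball z0 r2" using that norm_triangle_ineq2[of z z0]
        by (auto simp: R_def dist_norm norm_minus_commute)
      thus "\<Psi> z = 0" "D\<Psi> z = 0" using ct(6) by (simp_all add: \<Psi>_def D\<Psi>_def)
    qed
    note pom = pompeiu[OF w\<Psi> contG contD supp(1)]
    have iD: "integrable lborel D\<Psi>"
      by (rule integrable_continuous_compact_support[OF contD compact_cball[of 0 R]]) (use supp(2) in auto)
    define N' where "N' = (\<lambda>\<zeta>. N \<zeta> - D\<Psi> \<zeta>)"
    have iN': "integrable lborel N'" unfolding N'_def using N iD by (rule Bochner_Integration.integrable_diff)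
    have N'0: "N' \<zeta> = 0" if "\<zeta> \<in> ball z0 r1" for \<zeta>
    proof -
      have "\<zeta> \<in> U" using that r1 r2 by (auto simp: subset_iff)
      thus ?thesis using that ct(5)[OF that] ct(4)[of \<zeta>] by (simp add: N'_def D\<Psi>_def N\<phi>)
    qed
    have ke: "r1 / 2 \<le> cmod (\<zeta> - 1 * z)" if "N' \<zeta> \<noteq> 0" "z \<in> ball z0 (r1 / 2)" for \<zeta> z
    proof -
      have "\<zeta> \<notin> ball z0 r1" using that N'0 by blast
      thus ?thesis using that dist_triangle[of z0 \<zeta> z] by (auto simp: dist_norm norm_minus_commute)
    qed
    have k1: "integrable lborel (\<lambda>\<zeta>. N' \<zeta> / (\<zeta> - 1 * z))" if "z \<in> ball z0 (r1 / 2)" for z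
      by (rule kernel_integral_holomorphic(1)[OF iN' _ _ _ _ ke that]) (use r1 in auto)
    have k2: "(\<lambda>z. \<integral>\<zeta>. N' \<zeta> / (\<zeta> - 1 * z) \<partial>lborel) holomorphic_on ball z0 (r1 / 2)"
      by (rule kernel_integral_holomorphic(2)[OF iN' _ _ _ _ ke]) (use r1 in auto)
    have sub: "ball z0 (r1 / 2) \<subseteq> U" using r1 r2 by (auto simp: subset_iff)
    have i: "integrable lborel (\<lambda>\<zeta>. N \<zeta> / (\<zeta> - z))"
      and eq: "(\<integral>\<zeta>. N \<zeta> / (\<zeta> - z) \<partial>lborel) / of_real pi + \<Phi> z = (\<integral>\<zeta>. N' \<zeta> / (\<zeta> - z) \<partial>lborel) / of_real pi"
      if z: "z \<in> ball z0 (r1 / 2)" for z :: complex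
    proof -
      have e: "N \<zeta> / (\<zeta> - z) = N' \<zeta> / (\<zeta> - z) + D\<Psi> \<zeta> / (\<zeta> - z)" for \<zeta>
        by (simp add: N'_def diff_divide_distrib)
      have k: "integrable lborel (\<lambda>\<zeta>. N' \<zeta> / (\<zeta> - z))" using k1[OF z] by simp
      show "integrable lborel (\<lambda>\<zeta>. N \<zeta> / (\<zeta> - z))" unfolding e using k pom(1) by (rule Bochner_Integration.integrable_add)
      have "\<Psi> z = \<Phi> z" using z sub ct(4)[of z] r1 by (auto simp: \<Psi>_def subset_iff)
      with pom(2)[where z=z] have "\<Phi> z = - (\<integral>\<zeta>. D\<Psi> \<zeta> / (\<zeta> - z) \<partial>lborel) / of_real pi" by simp
      moreover have "(\<integral>\<zeta>. N \<zeta> / (\<zeta> - z) \<partial>lborel) = (\<integral>\<zeta>. N' \<zeta> / (\<zeta> - z) \<partial>lborel) + (\<integral>\<zeta>. D\<Psi> \<zeta> / (\<zeta> - z) \<partial>lborel)"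
        unfolding e using k pom(1) by (rule Bochner_Integration.integral_add)
      ultimately show "(\<integral>\<zeta>. N \<zeta> / (\<zeta> - z) \<partial>lborel) / of_real pi + \<Phi> z = (\<integral>\<zeta>. N' \<zeta> / (\<zeta> - z) \<partial>lborel) / of_real pi"
        by (simp add: add_divide_distrib)
    qed
    have "(\<lambda>z. (\<integral>\<zeta>. N' \<zeta> / (\<zeta> - z) \<partial>lborel) / of_real pi) holomorphic_on ball z0 (r1 / 2)"
      using k2 by (auto intro!: holomorphic_intros)
    hence "(\<lambda>z. (\<integral>\<zeta>. N \<zeta> / (\<zeta> - z) \<partial>lborel) / of_real pi + \<Phi> z) holomorphic_on ball z0 (r1 / 2)"
      by (rule holomorphic_transform) (simp add: eq)
    with i sub r1 show ?thesis by (intro exI[of _ "r1 / 2"]) auto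
  qed
  show "\<And>z. z \<in> U \<Longrightarrow> integrable lborel (\<lambda>\<zeta>. N \<zeta> / (\<zeta> - z))"
    using loc by (metis centre_in_ball)
  show "(\<lambda>z. (\<integral>\<zeta>. N \<zeta> / (\<zeta> - z) \<partial>lborel) / of_real pi + \<Phi> z) holomorphic_on U"
    unfolding holomorphic_on_def
  proof
    fix z0 assume "z0 \<in> U"
    from loc[OF this] obtain r where "r > 0"
      "(\<lambda>z. (\<integral>\<zeta>. N \<zeta> / (\<zeta> - z) \<partial>lborel) / of_real pi + \<Phi> z) holomorphic_on ball z0 r" by blast
    hence "(\<lambda>z. (\<integral>\<zeta>. N \<zeta> / (\<zeta> - z) \<partial>lborel) / of_real pi + \<Phi> z) field_differentiable at z0"
      by (intro holomorphic_on_imp_differentiable_at[OF _ open_ball]) auto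
    thus "(\<lambda>z. (\<integral>\<zeta>. N \<zeta> / (\<zeta> - z) \<partial>lborel) / of_real pi + \<Phi> z) field_differentiable at z0 within U"
      by (rule field_differentiable_at_within)
  qed
qed

definition disk_cut :: "(complex \<Rightarrow> complex) \<Rightarrow> complex \<Rightarrow> complex" where
  "disk_cut \<phi> \<zeta> = (if \<zeta> \<in> ball 0 1 then \<phi> \<zeta> else 0)"

text \<open>
  The contribution of the second term of \<open>kern\<close> to \<open>K_op \<phi>\<close> is antiholomorphic; \<open>antihol_part \<phi>\<close> is
  its complex conjugate.
\<close>

definition antihol_part :: "(complex \<Rightarrow> complex) \<Rightarrow> complex \<Rightarrow> complex" where
  "antihol_part \<phi> z = cnj (cnj z * ((\<integral>\<zeta>. disk_cut \<phi> \<zeta> / (1 - \<zeta> * cnj z) \<partial>lborel) / of_real pi))"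

lemma holomorphic_cnj_cnj:
  assumes "f holomorphic_on ball 0 1"
  shows "(\<lambda>z. cnj (f (cnj z))) holomorphic_on ball 0 1"
proof -
  have "((\<lambda>z. cnj (f (cnj z))) has_field_derivative cnj (deriv f (cnj z))) (at z)" if "z \<in> ball 0 1" for z
  proof -
    have "(f has_field_derivative deriv f (cnj z)) (at (cnj z))"
      using assms that by (intro holomorphic_derivI[of f "ball 0 1"]) auto
    from has_field_derivative_cnj_cnj[OF this] show ?thesis by (simp add: o_def)
  qed
  thus ?thesis unfolding holomorphic_on_open[OF open_ball] by blast
qed

lemma one_minus_mult_norm_ge:
  assumes "cmod a \<le> 1" "cmod b \<le> r"
  shows "1 - r \<le> cmod (1 - a * b)"
proof -
  have "cmod (a * b) \<le> 1 * r" unfolding norm_mult using assms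
    by (intro mult_mono) auto
  thus ?thesis using norm_triangle_ineq2[of 1 "a * b"] by simp
qed

lemma antihol_part_facts:
  assumes N: "integrable lborel (disk_cut \<phi>)"
  shows "antihol_part \<phi> holomorphic_on ball 0 1"
    and "z \<in> ball 0 1 \<Longrightarrow> integrable lborel (\<lambda>\<zeta>. disk_cut \<phi> \<zeta> / (1 - \<zeta> * cnj z))"
    and "z \<in> ball 0 1 \<Longrightarrow> cmod (antihol_part \<phi> z) \<le> (\<integral>\<zeta>. cmod (disk_cut \<phi> \<zeta>) \<partial>lborel) / (1 - cmod z)"
proof -
  define J where "J = (\<lambda>z. \<integral>\<zeta>. disk_cut \<phi> \<zeta> / (1 - \<zeta> * z) \<partial>lborel)"
  have ke: "1 - r \<le> cmod (1 - \<zeta> * z)" if "disk_cut \<phi> \<zeta> \<noteq> 0" "z \<in> ball 0 r" for \<zeta> z r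
    using that by (intro one_minus_mult_norm_ge) (auto simp: disk_cut_def split: if_splits)
  have int: "integrable lborel (\<lambda>\<zeta>. disk_cut \<phi> \<zeta> / (1 - \<zeta> * z))"
    and hol: "J field_differentiable at z" if z: "cmod z < 1" for z
  proof -
    define r where "r = (1 + cmod z) / 2"
    have r: "r < 1" "z \<in> ball 0 r" using z by (auto simp: r_def)
    show "integrable lborel (\<lambda>\<zeta>. disk_cut \<phi> \<zeta> / (1 - \<zeta> * z))"
      by (rule kernel_integral_holomorphic(1)[OF N, where c="\<lambda>_. 1" and d="\<lambda>\<zeta>. \<zeta>" and r=r and ?z0.0=0, OF _ _ _ _ ke])
         (use r in \<open>auto simp: disk_cut_def split: if_splits\<close>)
    have "J holomorphic_on ball 0 r" unfolding J_def
      by (rule kernel_integral_holomorphic(2)[OF N, where c="\<lambda>_. 1" and d="\<lambda>\<zeta>. \<zeta>" and r=r and ?z0.0=0, OF _ _ _ _ ke])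
         (use r in \<open>auto simp: disk_cut_def split: if_splits\<close>)
    thus "J field_differentiable at z" using r by (meson holomorphic_on_imp_differentiable_at open_ball)
  qed
  show "z \<in> ball 0 1 \<Longrightarrow> integrable lborel (\<lambda>\<zeta>. disk_cut \<phi> \<zeta> / (1 - \<zeta> * cnj z))"
    using int[of "cnj z"] by simp
  have "J holomorphic_on ball 0 1"
    unfolding holomorphic_on_def using hol by (auto intro: field_differentiable_at_within)
  hence "(\<lambda>z. z * (J z / of_real pi)) holomorphic_on ball 0 1" by (auto intro!: holomorphic_intros)
  from holomorphic_cnj_cnj[OF this]
  show "antihol_part \<phi> holomorphic_on ball 0 1" by (simp add: antihol_part_def[abs_def] J_def)
  show "cmod (antihol_part \<phi> z) \<le> (\<integral>\<zeta>. cmod (disk_cut \<phi> \<zeta>) \<partial>lborel) / (1 - cmod z)" if z: "z \<in> ball 0 1"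
  proof -
    have z1: "cmod z < 1" using z by simp
    define I where "I = (\<integral>\<zeta>. cmod (disk_cut \<phi> \<zeta>) \<partial>lborel)"
    have I0: "I \<ge> 0" by (simp add: I_def)
    have "cmod (\<integral>\<zeta>. disk_cut \<phi> \<zeta> / (1 - \<zeta> * cnj z) \<partial>lborel) \<le> (\<integral>\<zeta>. cmod (disk_cut \<phi> \<zeta>) * (1 / (1 - cmod z)) \<partial>lborel)"
    proof (rule Bochner_Integration.integral_norm_bound_integral)
      show "integrable lborel (\<lambda>\<zeta>. disk_cut \<phi> \<zeta> / (1 - \<zeta> * cnj z))" using int[of "cnj z"] z by simp
      show "integrable lborel (\<lambda>\<zeta>. cmod (disk_cut \<phi> \<zeta>) * (1 / (1 - cmod z)))"
        using N by (intro integrable_mult_left integrable_norm)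
      fix \<zeta>
      show "cmod (disk_cut \<phi> \<zeta> / (1 - \<zeta> * cnj z)) \<le> cmod (disk_cut \<phi> \<zeta>) * (1 / (1 - cmod z))"
      proof (cases "\<zeta> \<in> ball 0 1")
        case True
        hence "1 - cmod z \<le> cmod (1 - \<zeta> * cnj z)" by (intro one_minus_mult_norm_ge) auto
        thus ?thesis using z1 by (simp add: norm_divide frac_le)
      qed (simp add: disk_cut_def)
    qed
    also have "\<dots> = I / (1 - cmod z)" by (simp add: I_def)
    finally have 1: "cmod (\<integral>\<zeta>. disk_cut \<phi> \<zeta> / (1 - \<zeta> * cnj z) \<partial>lborel) \<le> I / (1 - cmod z)" .
    have "cmod (antihol_part \<phi> z) = cmod z * cmod (\<integral>\<zeta>. disk_cut \<phi> \<zeta> / (1 - \<zeta> * cnj z) \<partial>lborel) / pi"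
      by (simp add: antihol_part_def norm_mult norm_divide)
    also have "\<dots> \<le> 1 * (I / (1 - cmod z)) / 1"
      using 1 z1 pi_gt3 I0 by (intro frac_le mult_mono mult_nonneg_nonneg divide_nonneg_pos) auto
    finally show ?thesis by (simp add: I_def)
  qed
qed

lemma K_op_eq:
  assumes \<phi>: "continuous_on (ball 0 1) \<phi>" and N: "integrable lborel (disk_cut \<phi>)"
    and i: "integrable lborel (\<lambda>\<zeta>. disk_cut \<phi> \<zeta> / (\<zeta> - z))" and z: "z \<in> ball 0 1"
  shows "set_integrable lebesgue (ball 0 1) (\<lambda>\<zeta>. kern \<zeta> z * \<phi> \<zeta>)"
    and "K_op \<phi> z = (\<integral>\<zeta>. disk_cut \<phi> \<zeta> / (\<zeta> - z) \<partial>lborel) / of_real pi + cnj (antihol_part \<phi> z)"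
proof -
  note i2 = antihol_part_facts(2)[OF N z]
  have e: "(\<lambda>\<zeta>. indicator (ball 0 1) \<zeta> *\<^sub>R (kern \<zeta> z * \<phi> \<zeta>))
     = (\<lambda>\<zeta>. disk_cut \<phi> \<zeta> / (\<zeta> - z) + cnj z * (disk_cut \<phi> \<zeta> / (1 - \<zeta> * cnj z)))"
    by (auto simp: fun_eq_iff indicator_def disk_cut_def kern_def ring_distribs)
  have int: "integrable lborel (\<lambda>\<zeta>. indicator (ball 0 1) \<zeta> *\<^sub>R (kern \<zeta> z * \<phi> \<zeta>))"
    unfolding e using i i2 by (intro Bochner_Integration.integrable_add integrable_mult_right)
  hence m: "(\<lambda>\<zeta>. indicator (ball 0 1) \<zeta> *\<^sub>R (kern \<zeta> z * \<phi> \<zeta>)) \<in> borel_measurable lborel"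
    by (rule borel_measurable_integrable)
  show "set_integrable lebesgue (ball 0 1) (\<lambda>\<zeta>. kern \<zeta> z * \<phi> \<zeta>)"
    unfolding set_integrable_def using int m by (simp only: integrable_completion)
  have "set_lebesgue_integral lebesgue (ball 0 1) (\<lambda>\<zeta>. kern \<zeta> z * \<phi> \<zeta>)
     = (\<integral>\<zeta>. indicator (ball 0 1) \<zeta> *\<^sub>R (kern \<zeta> z * \<phi> \<zeta>) \<partial>lborel)"
    unfolding set_lebesgue_integral_def by (rule integral_completion[OF m])
  also have "\<dots> = (\<integral>\<zeta>. disk_cut \<phi> \<zeta> / (\<zeta> - z) \<partial>lborel) + cnj z * (\<integral>\<zeta>. disk_cut \<phi> \<zeta> / (1 - \<zeta> * cnj z) \<partial>lborel)"
    unfolding e using Bochner_Integration.integral_add[OF i integrable_mult_right[OF i2, of "cnj z"]]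
    by (simp only: integral_mult_right_zero)
  finally show "K_op \<phi> z = (\<integral>\<zeta>. disk_cut \<phi> \<zeta> / (\<zeta> - z) \<partial>lborel) / of_real pi + cnj (antihol_part \<phi> z)"
    by (simp add: K_op_def antihol_part_def add_divide_distrib)
qed

text \<open>
  The class that contains all iterates. The conjugated conformal map \<open>cnj \<omega>\<close> plays the role of the
  second variable.
\<close>

definition polyan :: "(complex \<Rightarrow> complex) \<Rightarrow> (complex \<Rightarrow> complex) \<Rightarrow> bool" where
  "polyan \<omega> F \<longleftrightarrow> (\<exists>n A B. (\<forall>k\<le>n. A k holomorphic_on ball 0 1) \<and> B holomorphic_on ball 0 1 \<and>
      (\<forall>z\<in>ball 0 1. F z = (\<Sum>k\<le>(n::nat). cnj (\<omega> z) ^ k * A k z) + cnj (B z)))"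

lemma wderiv_power: "wderiv F G D z \<Longrightarrow> wderiv (\<lambda>z. F z ^ n) (of_nat n * F z ^ (n - 1) * G) (of_nat n * F z ^ (n - 1) * D) z"
proof (induction n)
  case 0 thus ?case by (simp add: wderiv_const)
next
  case (Suc n)
  have "wderiv (\<lambda>z. F z * F z ^ n) (F z * (of_nat n * F z ^ (n - 1) * G) + G * F z ^ n)
      (F z * (of_nat n * F z ^ (n - 1) * D) + D * F z ^ n) z"
    by (rule wderiv_mult[OF Suc.prems Suc.IH[OF Suc.prems]])
  moreover have "F z * (of_nat n * F z ^ (n - 1) * X) + X * F z ^ n = of_nat (Suc n) * F z ^ (Suc n - 1) * X" for X
    by (cases n) (auto simp: algebra_simps)
  ultimately show ?case by simp
qed

lemma polyan_term_wderiv: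
  assumes \<omega>: "\<omega> holomorphic_on ball 0 1" and A: "A holomorphic_on ball 0 1" and z: "z \<in> ball 0 1"
  shows "wderiv (\<lambda>z. cnj (\<omega> z) ^ k * A z) (cnj (\<omega> z) ^ k * deriv A z)
     (of_nat k * cnj (\<omega> z) ^ (k - 1) * cnj (deriv \<omega> z) * A z) z"
proof -
  have 1: "wderiv \<omega> (deriv \<omega> z) 0 z" "wderiv A (deriv A z) 0 z"
    using \<omega> A z by (auto intro!: wderiv_holomorphic holomorphic_derivI[of _ "ball 0 1"])
  show ?thesis
    by (rule wderiv_cong[OF wderiv_mult[OF wderiv_power[OF wderiv_cnj[OF 1(1)], of k] 1(2)]]) auto
qed

lemma polyan_wderiv:
  assumes \<omega>: "\<omega> holomorphic_on ball 0 1" and F: "polyan \<omega> F"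
  shows "\<And>z. z \<in> ball 0 1 \<Longrightarrow> wderiv F (d_z F z) (d_zbar F z) z"
    and "continuous_on (ball 0 1) (d_z F)" and "continuous_on (ball 0 1) (d_zbar F)"
proof -
  from F obtain n A B where A: "\<And>k. k \<le> n \<Longrightarrow> A k holomorphic_on ball 0 1" and B: "B holomorphic_on ball 0 1"
    and FF: "\<And>z. z \<in> ball 0 1 \<Longrightarrow> F z = (\<Sum>k\<le>(n::nat). cnj (\<omega> z) ^ k * A k z) + cnj (B z)"
    unfolding polyan_def by blast
  define G where "G = (\<lambda>z. \<Sum>k\<le>n. cnj (\<omega> z) ^ k * deriv (A k) z)"
  define D where "D = (\<lambda>z. (\<Sum>k\<le>n. of_nat k * cnj (\<omega> z) ^ (k - 1) * cnj (deriv \<omega> z) * A k z) + cnj (deriv B z))"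
  have w: "wderiv F (G z) (D z) z" if z: "z \<in> ball 0 1" for z
  proof -
    have "wderiv (\<lambda>z. cnj (B z)) (cnj 0) (cnj (deriv B z)) z"
      using B z by (intro wderiv_cnj wderiv_holomorphic holomorphic_derivI[of _ "ball 0 1"]) auto
    hence "wderiv (\<lambda>z. (\<Sum>k\<le>(n::nat). cnj (\<omega> z) ^ k * A k z) + cnj (B z)) (G z + cnj 0) (D z) z"
      unfolding G_def D_def using \<omega> A z
      by (intro wderiv_add wderiv_sum polyan_term_wderiv) auto
    thus ?thesis using FF z by (auto intro: wderiv_transform[OF _ open_ball z])
  qed
  have c\<omega>: "continuous_on (ball 0 1) \<omega>" "continuous_on (ball 0 1) (deriv \<omega>)" "continuous_on (ball 0 1) (deriv B)"
    using \<omega> B by (auto intro!: holomorphic_on_imp_continuous_on holomorphic_deriv)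
  have cA: "continuous_on (ball 0 1) (A k)" "continuous_on (ball 0 1) (deriv (A k))" if "k \<le> n" for k
    using A[OF that] by (auto intro!: holomorphic_on_imp_continuous_on holomorphic_deriv)
  have c: "continuous_on (ball 0 1) G" "continuous_on (ball 0 1) D"
    unfolding G_def D_def using c\<omega> cA by (auto intro!: continuous_intros)
  have eq: "d_z F z = G z" "d_zbar F z = D z" if "z \<in> ball 0 1" for z
    using wderiv_partial[OF w[OF that]] by auto
  show "wderiv F (d_z F z) (d_zbar F z) z" if "z \<in> ball 0 1" for z using w[OF that] eq[OF that] by simp
  show "continuous_on (ball 0 1) (d_z F)" by (rule continuous_on_eq[OF c(1)]) (simp add: eq)
  show "continuous_on (ball 0 1) (d_zbar F)" by (rule continuous_on_eq[OF c(2)]) (simp add: eq)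
qed

text \<open>
  As \<open>dbar (cnj \<omega> ^ Suc k) = Suc k * cnj \<omega> ^ k * cnj \<omega>'\<close>, the factor \<open>cnj \<omega>'\<close> in \<open>beltrami_dz\<close> is
  what is needed to integrate termwise, and the factor \<open>1 / \<omega>'\<close> goes into the holomorphic
  coefficients.
\<close>

lemma polyan_beltrami_primitive:
  assumes \<omega>: "\<omega> holomorphic_on ball 0 1" "\<And>z. z \<in> ball 0 1 \<Longrightarrow> deriv \<omega> z \<noteq> 0" and F: "polyan \<omega> F"
  shows "\<exists>\<Phi> G (n::nat) A. (\<forall>z\<in>ball 0 1. wderiv \<Phi> (G z) (beltrami_dz \<omega> F z) z) \<and>
    continuous_on (ball 0 1) G \<and> (\<forall>k\<le>n. A k holomorphic_on ball 0 1) \<and>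
    (\<forall>z. \<Phi> z = (\<Sum>k\<le>n. cnj (\<omega> z) ^ (Suc k) * A k z))"
proof -
  from F obtain n A B where A: "\<And>k. k \<le> n \<Longrightarrow> A k holomorphic_on ball 0 1" and B: "B holomorphic_on ball 0 1"
    and FF: "\<And>z. z \<in> ball 0 1 \<Longrightarrow> F z = (\<Sum>k\<le>(n::nat). cnj (\<omega> z) ^ k * A k z) + cnj (B z)"
    unfolding polyan_def by blast
  have dF: "d_z F z = (\<Sum>k\<le>n. cnj (\<omega> z) ^ k * deriv (A k) z)" if z: "z \<in> ball 0 1" for z
  proof -
    have "wderiv (\<lambda>z. cnj (B z)) (cnj 0) (cnj (deriv B z)) z"
      using B z by (intro wderiv_cnj wderiv_holomorphic holomorphic_derivI[of _ "ball 0 1"]) auto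
    hence "wderiv (\<lambda>z. (\<Sum>k\<le>(n::nat). cnj (\<omega> z) ^ k * A k z) + cnj (B z)) ((\<Sum>k\<le>n. cnj (\<omega> z) ^ k * deriv (A k) z) + cnj 0)
       ((\<Sum>k\<le>n. of_nat k * cnj (\<omega> z) ^ (k - 1) * cnj (deriv \<omega> z) * A k z) + cnj (deriv B z)) z"
      using \<omega> A z by (intro wderiv_add wderiv_sum polyan_term_wderiv) auto
    hence "wderiv F ((\<Sum>k\<le>n. cnj (\<omega> z) ^ k * deriv (A k) z) + cnj 0)
       ((\<Sum>k\<le>n. of_nat k * cnj (\<omega> z) ^ (k - 1) * cnj (deriv \<omega> z) * A k z) + cnj (deriv B z)) z"
      using FF z by (auto intro: wderiv_transform[OF _ open_ball z])
    from wderiv_partial(3)[OF this] show ?thesis by simp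
  qed
  define A' where "A' = (\<lambda>k z. deriv (A k) z / (of_nat (Suc k) * deriv \<omega> z))"
  define \<Phi> where "\<Phi> = (\<lambda>z. \<Sum>k\<le>n. cnj (\<omega> z) ^ (Suc k) * A' k z)"
  define G where "G = (\<lambda>z. \<Sum>k\<le>n. cnj (\<omega> z) ^ (Suc k) * deriv (A' k) z)"
  have A': "A' k holomorphic_on ball 0 1" if "k \<le> n" for k
    unfolding A'_def using A[OF that] \<omega> by (auto intro!: holomorphic_intros simp del: of_nat_Suc)
  show ?thesis
  proof (rule exI[of _ \<Phi>], rule exI[of _ G], rule exI[of _ n], rule exI[of _ A'], intro conjI ballI)
    fix z :: complex assume z: "z \<in> ball 0 1"
    show "wderiv \<Phi> (G z) (beltrami_dz \<omega> F z) z"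
    proof -
      have "wderiv \<Phi> (G z) (\<Sum>k\<le>n. of_nat (Suc k) * cnj (\<omega> z) ^ (Suc k - 1) * cnj (deriv \<omega> z) * A' k z) z"
        unfolding \<Phi>_def G_def using \<omega>(1) A' z by (intro wderiv_sum polyan_term_wderiv) auto
      moreover have "(\<Sum>k\<le>n. of_nat (Suc k) * cnj (\<omega> z) ^ (Suc k - 1) * cnj (deriv \<omega> z) * A' k z) = beltrami_dz \<omega> F z"
        unfolding beltrami_dz_def dF[OF z] sum_distrib_left
        by (intro sum.cong refl) (simp add: A'_def \<omega>(2)[OF z] field_simps del: of_nat_Suc)
      ultimately show ?thesis by simp
    qed
  next
    have c\<omega>: "continuous_on (ball 0 1) \<omega>" using \<omega> by (auto intro!: holomorphic_on_imp_continuous_on)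
    have "continuous_on (ball 0 1) (deriv (A' k))" if "k \<le> n" for k
      using A'[OF that] by (auto intro!: holomorphic_on_imp_continuous_on holomorphic_deriv)
    thus "continuous_on (ball 0 1) G" unfolding G_def using c\<omega> by (auto intro!: continuous_intros simp del: power_Suc)
  qed (use A' in \<open>auto simp: \<Phi>_def\<close>)
qed

text \<open>
  By \<open>cauchy_transform_structure\<close>, \<open>K_op \<phi> = h - \<Phi> + cnj (antihol_part \<phi>)\<close> with \<open>h\<close> holomorphic and
  \<open>\<Phi>\<close> the explicit primitive of \<open>\<phi>\<close>; all assertions can be read off from this decomposition.
\<close>

lemma polyan_K_op:
  assumes \<omega>: "\<omega> holomorphic_on ball 0 1" "\<And>z. z \<in> ball 0 1 \<Longrightarrow> deriv \<omega> z \<noteq> 0" and F: "polyan \<omega> F"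
  defines "\<phi> \<equiv> beltrami_dz \<omega> F"
  assumes N: "integrable lborel (disk_cut \<phi>)"
  shows "polyan \<omega> (K_op \<phi>)"
    and "\<And>z. z \<in> ball 0 1 \<Longrightarrow> set_integrable lebesgue (ball 0 1) (\<lambda>\<zeta>. kern \<zeta> z * \<phi> \<zeta>)"
    and "\<And>z. z \<in> ball 0 1 \<Longrightarrow> d_zbar (K_op \<phi>) z + \<phi> z = cnj (deriv (antihol_part \<phi>) z)"
proof -
  obtain \<Phi> G n A where w: "\<And>z. z \<in> ball 0 1 \<Longrightarrow> wderiv \<Phi> (G z) (\<phi> z) z"
    and G: "continuous_on (ball 0 1) G" and A: "\<And>k. k \<le> n \<Longrightarrow> A k holomorphic_on ball 0 1"
    and \<Phi>: "\<And>z. \<Phi> z = (\<Sum>k\<le>n. cnj (\<omega> z) ^ (Suc k) * A k z)"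
    using polyan_beltrami_primitive[OF \<omega> F] unfolding \<phi>_def by blast
  have "continuous_on (ball 0 1) (d_z F)" by (rule polyan_wderiv(2)[OF \<omega>(1) F])
  hence \<phi>c: "continuous_on (ball 0 1) \<phi>"
    unfolding \<phi>_def beltrami_dz_def[abs_def] using \<omega>
    by (intro continuous_intros holomorphic_on_imp_continuous_on[OF holomorphic_deriv[OF \<omega>(1) open_ball]]) auto
  note ct = cauchy_transform_structure[OF open_ball w G \<phi>c N]
  define h where "h = (\<lambda>z. (\<integral>\<zeta>. disk_cut \<phi> \<zeta> / (\<zeta> - z) \<partial>lborel) / of_real pi + \<Phi> z)"
  have h: "h holomorphic_on ball 0 1" unfolding h_def by (rule ct(2)) (auto simp: disk_cut_def)
  note K = K_op_eq[OF \<phi>c N ct(1)]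
  show "\<And>z. z \<in> ball 0 1 \<Longrightarrow> set_integrable lebesgue (ball 0 1) (\<lambda>\<zeta>. kern \<zeta> z * \<phi> \<zeta>)"
    by (rule K(1)) (auto simp: disk_cut_def)
  have Kz: "K_op \<phi> z = h z - \<Phi> z + cnj (antihol_part \<phi> z)" if z: "z \<in> ball 0 1" for z
    using K(2)[of z] z by (simp add: h_def disk_cut_def)
  have B: "antihol_part \<phi> holomorphic_on ball 0 1" by (rule antihol_part_facts(1)[OF N])
  define A' where "A' = (\<lambda>k. if k = 0 then h else (\<lambda>z. - A (k - 1) z))"
  have "polyan \<omega> (K_op \<phi>)"
    unfolding polyan_def
  proof (intro exI[of _ "Suc n"] exI[of _ A'] exI[of _ "antihol_part \<phi>"] conjI allI impI ballI B)
    fix k assume "k \<le> Suc n" thus "A' k holomorphic_on ball 0 1"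
      using h A by (auto simp: A'_def intro!: holomorphic_intros)
  next
    fix z :: complex assume z: "z \<in> ball 0 1"
    have "(\<Sum>k\<le>Suc n. cnj (\<omega> z) ^ k * A' k z) = h z - \<Phi> z"
      unfolding \<Phi> sum.atMost_Suc_shift by (simp add: A'_def sum_negf)
    thus "K_op \<phi> z = (\<Sum>k\<le>Suc n. cnj (\<omega> z) ^ k * A' k z) + cnj (antihol_part \<phi> z)"
      using Kz[OF z] by simp
  qed
  thus "polyan \<omega> (K_op \<phi>)" .
  fix z :: complex assume z: "z \<in> ball 0 1"
  have "wderiv (\<lambda>z. h z - \<Phi> z + cnj (antihol_part \<phi> z)) (deriv h z - G z + cnj 0) (0 - \<phi> z + cnj (deriv (antihol_part \<phi>) z)) z"
    using h B z by (intro wderiv_add wderiv_diff wderiv_cnj w wderiv_holomorphic holomorphic_derivI[of _ "ball 0 1"]) auto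
  hence "wderiv (K_op \<phi>) (deriv h z - G z + cnj 0) (0 - \<phi> z + cnj (deriv (antihol_part \<phi>) z)) z"
    by (rule wderiv_transform[OF _ open_ball z]) (use Kz in auto)
  from wderiv_partial(4)[OF this] show "d_zbar (K_op \<phi>) z + \<phi> z = cnj (deriv (antihol_part \<phi>) z)" by simp
qed

section \<open>Fourier modes and Parseval identity\<close>

text \<open>
  Fourier coefficients over the period \<open>{-pi..pi}\<close>, which matches the strip on which \<open>exp\<close> is
  injective.
\<close>

definition fmode :: "int \<Rightarrow> (real \<Rightarrow> complex) \<Rightarrow> complex" where
  "fmode k v = integral {-pi..pi} (\<lambda>\<theta>. cis (- (of_int k * \<theta>)) * v \<theta>) / of_real (2 * pi)"

lemma fmode_integrable:
  "continuous_on {-pi..pi} v \<Longrightarrow> (\<lambda>\<theta>. cis (- (of_int k * \<theta>)) * v \<theta>) integrable_on {-pi..pi}"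
  by (intro integrable_continuous_interval continuous_intros)

lemma fmode_cong: "(\<And>\<theta>. \<theta> \<in> {-pi..pi} \<Longrightarrow> u \<theta> = v \<theta>) \<Longrightarrow> fmode k u = fmode k v"
  unfolding fmode_def by (intro arg_cong2[where f="(/)"] Henstock_Kurzweil_Integration.integral_cong) auto

lemma fmode_add: "continuous_on {-pi..pi} u \<Longrightarrow> continuous_on {-pi..pi} v \<Longrightarrow>
    fmode k (\<lambda>\<theta>. u \<theta> + v \<theta>) = fmode k u + fmode k v"
  unfolding fmode_def using fmode_integrable[of u k] fmode_integrable[of v k]
  by (simp add: ring_distribs Henstock_Kurzweil_Integration.integral_add add_divide_distrib)

lemma fmode_cmult: "continuous_on {-pi..pi} u \<Longrightarrow> fmode k (\<lambda>\<theta>. c * u \<theta>) = c * fmode k u"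
  unfolding fmode_def using fmode_integrable[of u k]
  by (simp add: mult.left_commute[of _ c])

lemma fmode_diff: "continuous_on {-pi..pi} u \<Longrightarrow> continuous_on {-pi..pi} v \<Longrightarrow>
    fmode k (\<lambda>\<theta>. u \<theta> - v \<theta>) = fmode k u - fmode k v"
  unfolding fmode_def using fmode_integrable[of u k] fmode_integrable[of v k]
  by (simp add: ring_distribs Henstock_Kurzweil_Integration.integral_diff diff_divide_distrib)

lemma fmode_norm_le:
  assumes "continuous_on {-pi..pi} u" "\<And>\<theta>. \<theta> \<in> {-pi..pi} \<Longrightarrow> cmod (u \<theta>) \<le> B"
  shows "cmod (fmode k u) \<le> B"
proof -
  have "cmod (integral {-pi..pi} (\<lambda>\<theta>. cis (- (of_int k * \<theta>)) * u \<theta>)) \<le> B * (pi - - pi)"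
    using assms by (intro integral_bound continuous_intros) (auto simp: norm_mult)
  thus ?thesis by (simp add: fmode_def norm_divide field_simps)
qed

lemma cis_int_pi: "cis (of_int m * pi) = cis (of_int m * (- pi))"
proof -
  have "sin (of_int m * pi) = 0" by (subst sin_zero_iff_int2) blast
  thus ?thesis by (simp add: complex_eq_iff)
qed

lemma fmode_cis: "fmode k (\<lambda>\<theta>. cis (of_int j * \<theta>)) = (if j = k then 1 else 0)"
proof (cases "j = k")
  case True
  have "fmode k (\<lambda>\<theta>. cis (of_int j * \<theta>)) = integral {-pi..pi} (\<lambda>\<theta>. 1) / of_real (2 * pi)"
    unfolding fmode_def True by (simp add: cis_mult)
  thus ?thesis using True by (simp add: scaleR_conv_of_real)
next
  case False
  define m where "m = real_of_int (j - k)"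
  have m: "m \<noteq> 0" using False by (simp add: m_def)
  have "((\<lambda>\<theta>. cis (m * \<theta>)) has_integral (cis (m * pi) / (\<i> * of_real m) - cis (m * (-pi)) / (\<i> * of_real m))) {-pi..pi}"
  proof (rule fundamental_theorem_of_calculus)
    fix x :: real
    have "((\<lambda>\<theta>. exp (\<i> * of_real m * of_real \<theta>) / (\<i> * of_real m)) has_vector_derivative
        (exp (\<i> * of_real m * of_real x) * (\<i> * of_real m)) / (\<i> * of_real m)) (at x within {-pi..pi})"
      by (auto intro!: derivative_eq_intros has_vector_derivative_real_field simp: m)
    thus "((\<lambda>\<theta>. cis (m * \<theta>) / (\<i> * of_real m)) has_vector_derivative cis (m * x)) (at x within {-pi..pi})"
      using m by (simp add: cis_conv_exp mult_ac)
  qed simp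
  moreover have "cis (m * pi) = cis (m * (-pi))"
    unfolding m_def by (rule cis_int_pi)
  ultimately have "((\<lambda>\<theta>. cis (m * \<theta>)) has_integral 0) {-pi..pi}" by simp
  hence "integral {-pi..pi} (\<lambda>\<theta>. cis (m * \<theta>)) = 0" by (rule integral_unique)
  thus ?thesis using False by (simp add: fmode_def cis_mult m_def algebra_simps)
qed

definition trig_poly :: "(real \<Rightarrow> complex) \<Rightarrow> bool" where
  "trig_poly h \<longleftrightarrow> (\<exists>K a. finite K \<and> (\<forall>\<theta>. h \<theta> = (\<Sum>k\<in>K. a k * cis (of_int k * \<theta>))))"

lemma trig_poly_term: "trig_poly (\<lambda>\<theta>. c * cis (of_int k * \<theta>))"
  unfolding trig_poly_def by (rule exI[of _ "{k}"]) auto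

lemma trig_poly_const: "trig_poly (\<lambda>\<theta>. c)"
  using trig_poly_term[of c 0] by simp

lemma trig_poly_add:
  assumes "trig_poly f" "trig_poly g"
  shows "trig_poly (\<lambda>\<theta>. f \<theta> + g \<theta>)"
proof -
  from assms obtain K a L b where K: "finite K" "\<And>\<theta>. f \<theta> = (\<Sum>k\<in>K. a k * cis (of_int k * \<theta>))"
    and L: "finite L" "\<And>\<theta>. g \<theta> = (\<Sum>k\<in>L. b k * cis (of_int k * \<theta>))"
    unfolding trig_poly_def by blast
  define c where "c = (\<lambda>k. (if k \<in> K then a k else 0) + (if k \<in> L then b k else 0))"
  have "f \<theta> + g \<theta> = (\<Sum>k\<in>K \<union> L. c k * cis (of_int k * \<theta>))" for \<theta>
  proof -
    have "f \<theta> = (\<Sum>k\<in>K \<union> L. (if k \<in> K then a k else 0) * cis (of_int k * \<theta>))"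
      unfolding K(2) using K(1) L(1) by (intro sum.mono_neutral_cong_left) auto
    moreover have "g \<theta> = (\<Sum>k\<in>K \<union> L. (if k \<in> L then b k else 0) * cis (of_int k * \<theta>))"
      unfolding L(2) using K(1) L(1) by (intro sum.mono_neutral_cong_left) auto
    ultimately show ?thesis by (simp add: c_def sum.distrib ring_distribs)
  qed
  thus ?thesis unfolding trig_poly_def using K(1) L(1) by blast
qed

lemma trig_poly_sum: "(\<And>i. i \<in> I \<Longrightarrow> trig_poly (f i)) \<Longrightarrow> trig_poly (\<lambda>\<theta>. \<Sum>i\<in>I. f i \<theta>)"
  by (induction I rule: infinite_finite_induct) (auto intro: trig_poly_const trig_poly_add)

lemma trig_poly_mult:
  assumes "trig_poly f" "trig_poly g"
  shows "trig_poly (\<lambda>\<theta>. f \<theta> * g \<theta>)"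
proof -
  from assms obtain K a L b where K: "\<And>\<theta>. f \<theta> = (\<Sum>k\<in>K. a k * cis (of_int k * \<theta>))"
    and L: "\<And>\<theta>. g \<theta> = (\<Sum>k\<in>L. b k * cis (of_int k * \<theta>))"
    unfolding trig_poly_def by blast
  have e: "(\<lambda>\<theta>. f \<theta> * g \<theta>) = (\<lambda>\<theta>. \<Sum>k\<in>K. \<Sum>l\<in>L. (a k * b l) * cis (of_int (k + l) * \<theta>))"
    unfolding K L sum_product by (intro ext sum.cong refl) (simp add: cis_mult[symmetric] ring_distribs mult_ac)
  show ?thesis unfolding e by (intro trig_poly_sum trig_poly_term)
qed

lemma trig_poly_real_polynomial:
  assumes "real_polynomial_function (p :: complex \<Rightarrow> real)"
  shows "trig_poly (\<lambda>\<theta>. of_real (p (cis \<theta>)))"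
  using assms
proof (induction rule: real_polynomial_function.induct)
  case (linear f)
  have "f (cis \<theta>) = cos \<theta> * f 1 + sin \<theta> * f \<i>" for \<theta>
  proof -
    have "cis \<theta> = cos \<theta> *\<^sub>R 1 + sin \<theta> *\<^sub>R \<i>" by (simp add: complex_eq_iff)
    thus ?thesis using linear by (simp add: linear_simps)
  qed
  moreover have "complex_of_real (cos \<theta>) = (1/2) * cis (of_int 1 * \<theta>) + (1/2) * cis (of_int (-1) * \<theta>)"
    "complex_of_real (sin \<theta>) = (-\<i>/2) * cis (of_int 1 * \<theta>) + (\<i>/2) * cis (of_int (-1) * \<theta>)" for \<theta>
    by (auto simp: complex_eq_iff)
  ultimately have "(\<lambda>\<theta>. complex_of_real (f (cis \<theta>))) = (\<lambda>\<theta>. ((1/2) * cis (of_int 1 * \<theta>) + (1/2) * cis (of_int (-1) * \<theta>)) * of_real (f 1)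
      + ((-\<i>/2) * cis (of_int 1 * \<theta>) + (\<i>/2) * cis (of_int (-1) * \<theta>)) * of_real (f \<i>))"
    by (simp only: of_real_add of_real_mult)
  thus ?case by (simp only:) (intro trig_poly_add trig_poly_mult trig_poly_term trig_poly_const)
qed (auto intro: trig_poly_const trig_poly_add trig_poly_mult)

text \<open>
  Stone--Weierstrass on the circle: polynomials in \<open>Re\<close> and \<open>Im\<close> restrict to trigonometric
  polynomials.
\<close>

lemma trig_poly_dense:
  assumes g: "continuous_on (sphere 0 1) g" and e: "e > 0"
  obtains h where "trig_poly h" "\<And>\<theta>. cmod (g (cis \<theta>) - h \<theta>) < e"
proof -
  obtain p where p: "polynomial_function p" "\<And>x. x \<in> sphere 0 1 \<Longrightarrow> cmod (g x - p x) < e"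
    using Stone_Weierstrass_polynomial_function[OF compact_sphere g e] by blast
  have "real_polynomial_function (\<lambda>x. Re (p x))" "real_polynomial_function (\<lambda>x. Im (p x))"
    using p(1) bounded_linear_Re bounded_linear_Im unfolding polynomial_function_def o_def by blast+
  hence "trig_poly (\<lambda>\<theta>. of_real (Re (p (cis \<theta>))) + \<i> * of_real (Im (p (cis \<theta>))))"
    by (intro trig_poly_add trig_poly_mult trig_poly_const trig_poly_real_polynomial)
  moreover have "of_real (Re (p (cis \<theta>))) + \<i> * of_real (Im (p (cis \<theta>))) = p (cis \<theta>)" for \<theta>
    by (simp add: complex_eq_iff)
  ultimately have "trig_poly (\<lambda>\<theta>. p (cis \<theta>))" by simp
  thus ?thesis using p(2) by (intro that[of "\<lambda>\<theta>. p (cis \<theta>)"]) auto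
qed

text \<open>
  The orthogonal projection in coordinates: the distance to a trigonometric polynomial is smallest
  if its coefficients are the Fourier coefficients. Bessel inequality and Parseval identity follow
  from it.
\<close>

lemma mean_square_distance:
  assumes v: "continuous_on {-pi..pi} v" and K: "finite K"
  shows "integral {-pi..pi} (\<lambda>\<theta>. (cmod (v \<theta> - (\<Sum>k\<in>K. a k * cis (of_int k * \<theta>))))\<^sup>2)
    = integral {-pi..pi} (\<lambda>\<theta>. (cmod (v \<theta>))\<^sup>2) - 2 * pi * (\<Sum>k\<in>K. (cmod (fmode k v))\<^sup>2)
      + 2 * pi * (\<Sum>k\<in>K. (cmod (a k - fmode k v))\<^sup>2)"
proof -
  define T where "T = (\<lambda>\<theta>. \<Sum>k\<in>K. a k * cis (of_int k * \<theta>))"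
  have T: "continuous_on {-pi..pi} T" unfolding T_def by (intro continuous_intros)
  have modeT: "fmode k T = (if k \<in> K then a k else 0)" for k
  proof -
    have "fmode k T = (\<Sum>j\<in>K. a j * fmode k (\<lambda>\<theta>. cis (of_int j * \<theta>)))"
      unfolding T_def using K
    proof (induction K)
      case empty show ?case by (simp add: fmode_def)
    next
      case (insert j K)
      thus ?case by (simp add: fmode_add fmode_cmult continuous_intros)
    qed
    also have "\<dots> = (\<Sum>j\<in>K. if j = k then a j else 0)" by (intro sum.cong) (auto simp: fmode_cis)
    also have "\<dots> = (if k \<in> K then a k else 0)" using K by simp
    finally show ?thesis .
  qed
  have inner: "integral {-pi..pi} (\<lambda>\<theta>. cnj (T \<theta>) * u \<theta>) = 2 * of_real pi * (\<Sum>k\<in>K. cnj (a k) * fmode k u)"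
    if u: "continuous_on {-pi..pi} u" for u
  proof -
    have "integral {-pi..pi} (\<lambda>\<theta>. cnj (T \<theta>) * u \<theta>) = integral {-pi..pi} (\<lambda>\<theta>. \<Sum>k\<in>K. cnj (a k) * (cis (- (of_int k * \<theta>)) * u \<theta>))"
      by (simp add: T_def sum_distrib_right mult.assoc cis_cnj)
    also have "\<dots> = (\<Sum>k\<in>K. cnj (a k) * integral {-pi..pi} (\<lambda>\<theta>. cis (- (of_int k * \<theta>)) * u \<theta>))"
      using K fmode_integrable[OF u]
      by (subst Henstock_Kurzweil_Integration.integral_sum) (auto intro!: integrable_on_mult_right)
    also have "\<dots> = 2 * of_real pi * (\<Sum>k\<in>K. cnj (a k) * fmode k u)"
      by (simp add: fmode_def sum_distrib_left)
    finally show ?thesis .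
  qed
  have ev: "(cmod (v \<theta> - T \<theta>))\<^sup>2 = (cmod (v \<theta>))\<^sup>2 - 2 * Re (cnj (T \<theta>) * v \<theta>) + Re (cnj (T \<theta>) * T \<theta>)" for \<theta>
    by (simp only: cmod_power2) (simp add: power2_eq_square algebra_simps)
  have iR: "integral {-pi..pi} (\<lambda>\<theta>. Re (cnj (T \<theta>) * u \<theta>)) = 2 * pi * (\<Sum>k\<in>K. Re (cnj (a k) * fmode k u))"
    and iI: "(\<lambda>\<theta>. Re (cnj (T \<theta>) * u \<theta>)) integrable_on {-pi..pi}"
    if u: "continuous_on {-pi..pi} u" for u
  proof -
    have "(\<lambda>\<theta>. cnj (T \<theta>) * u \<theta>) integrable_on {-pi..pi}"
      using T u by (intro integrable_continuous_interval continuous_intros)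
    hence "((\<lambda>\<theta>. cnj (T \<theta>) * u \<theta>) has_integral 2 * of_real pi * (\<Sum>k\<in>K. cnj (a k) * fmode k u)) {-pi..pi}"
      using inner[OF u] by (metis integrable_integral)
    from has_integral_linear[OF this bounded_linear_Re]
    have "((\<lambda>\<theta>. Re (cnj (T \<theta>) * u \<theta>)) has_integral 2 * pi * (\<Sum>k\<in>K. Re (cnj (a k) * fmode k u))) {-pi..pi}"
      by (simp add: o_def)
    thus "integral {-pi..pi} (\<lambda>\<theta>. Re (cnj (T \<theta>) * u \<theta>)) = 2 * pi * (\<Sum>k\<in>K. Re (cnj (a k) * fmode k u))"
      "(\<lambda>\<theta>. Re (cnj (T \<theta>) * u \<theta>)) integrable_on {-pi..pi}"
      by (auto simp: has_integral_iff)
  qed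
  have iv: "(\<lambda>\<theta>. (cmod (v \<theta>))\<^sup>2) integrable_on {-pi..pi}"
    using v by (intro integrable_continuous_interval continuous_intros)
  have "integral {-pi..pi} (\<lambda>\<theta>. (cmod (v \<theta> - T \<theta>))\<^sup>2) =
     integral {-pi..pi} (\<lambda>\<theta>. (cmod (v \<theta>))\<^sup>2) - 2 * integral {-pi..pi} (\<lambda>\<theta>. Re (cnj (T \<theta>) * v \<theta>)) + integral {-pi..pi} (\<lambda>\<theta>. Re (cnj (T \<theta>) * T \<theta>))"
    unfolding ev
    using Henstock_Kurzweil_Integration.integral_add[OF Henstock_Kurzweil_Integration.integrable_diff[OF iv
        integrable_on_mult_right[OF iI[OF v], of 2]] iI[OF T]]
      Henstock_Kurzweil_Integration.integral_diff[OF iv integrable_on_mult_right[OF iI[OF v], of 2]]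
    by (simp only: Henstock_Kurzweil_Integration.integral_mult_right)
  also have "\<dots> = integral {-pi..pi} (\<lambda>\<theta>. (cmod (v \<theta>))\<^sup>2) + 2 * pi * (\<Sum>k\<in>K. Re (cnj (a k) * a k) - 2 * Re (cnj (a k) * fmode k v))"
    unfolding iR[OF v] iR[OF T] by (simp add: modeT sum_subtractf sum_distrib_left algebra_simps)
  also have "(\<Sum>k\<in>K. Re (cnj (a k) * a k) - 2 * Re (cnj (a k) * fmode k v))
     = (\<Sum>k\<in>K. (cmod (a k - fmode k v))\<^sup>2 - (cmod (fmode k v))\<^sup>2)"
    by (intro sum.cong refl) (simp only: cmod_power2, simp add: power2_eq_square algebra_simps)
  finally show ?thesis by (simp add: T_def sum_subtractf algebra_simps)
qed

lemma bessel:
  assumes v: "continuous_on {-pi..pi} v" and K: "finite K"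
  shows "2 * pi * (\<Sum>k\<in>K. (cmod (fmode k v))\<^sup>2) \<le> integral {-pi..pi} (\<lambda>\<theta>. (cmod (v \<theta>))\<^sup>2)"
proof -
  have "0 \<le> integral {-pi..pi} (\<lambda>\<theta>. (cmod (v \<theta> - (\<Sum>k\<in>K. fmode k v * cis (of_int k * \<theta>))))\<^sup>2)"
    using v by (intro Henstock_Kurzweil_Integration.integral_nonneg integrable_continuous_interval continuous_intros) auto
  thus ?thesis unfolding mean_square_distance[OF assms] by simp
qed

lemma parseval_approx:
  assumes g: "continuous_on (sphere 0 1) g" and e: "e > 0"
  obtains K where "finite K"
    "integral {-pi..pi} (\<lambda>\<theta>. (cmod (g (cis \<theta>)))\<^sup>2) \<le> 2 * pi * (\<Sum>k\<in>K. (cmod (fmode k (\<lambda>\<theta>. g (cis \<theta>))))\<^sup>2) + e"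
proof -
  define d where "d = sqrt (e / (2 * pi))"
  have d: "d > 0" using e by (simp add: d_def)
  obtain h where h: "trig_poly h" "\<And>\<theta>. cmod (g (cis \<theta>) - h \<theta>) < d"
    using trig_poly_dense[OF g d] by blast
  then obtain K a where K: "finite K" "\<And>\<theta>. h \<theta> = (\<Sum>k\<in>K. a k * cis (of_int k * \<theta>))"
    unfolding trig_poly_def by blast
  define v where "v = (\<lambda>\<theta>. g (cis \<theta>))"
  have v: "continuous_on {-pi..pi} v" unfolding v_def
    by (rule continuous_on_compose2[OF g]) (auto intro!: continuous_intros)
  have "integral {-pi..pi} (\<lambda>\<theta>. (cmod (v \<theta> - (\<Sum>k\<in>K. a k * cis (of_int k * \<theta>))))\<^sup>2) \<le> integral {-pi..pi} (\<lambda>\<theta>. d\<^sup>2)"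
  proof (rule integral_le)
    show "(\<lambda>\<theta>. (cmod (v \<theta> - (\<Sum>k\<in>K. a k * cis (of_int k * \<theta>))))\<^sup>2) integrable_on {-pi..pi}"
      using v by (intro integrable_continuous_interval continuous_intros)
    fix \<theta> show "(cmod (v \<theta> - (\<Sum>k\<in>K. a k * cis (of_int k * \<theta>))))\<^sup>2 \<le> d\<^sup>2"
      using h(2)[of \<theta>] unfolding K(2) v_def by (rule power_mono[OF less_imp_le norm_ge_zero])
  qed (intro integrable_continuous_interval continuous_intros)
  also have "\<dots> = e" using e by (simp add: d_def)
  moreover have "2 * pi * (\<Sum>k\<in>K. (cmod (a k - fmode k v))\<^sup>2) \<ge> 0" by (intro mult_nonneg_nonneg sum_nonneg) auto
  ultimately have "integral {-pi..pi} (\<lambda>\<theta>. (cmod (v \<theta>))\<^sup>2) \<le> 2 * pi * (\<Sum>k\<in>K. (cmod (fmode k v))\<^sup>2) + e"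
    unfolding mean_square_distance[OF v K(1)] by simp
  thus ?thesis using K(1) by (intro that[of K]) (auto simp: v_def)
qed

lemma nn_integral_circle:
  assumes v: "continuous_on {-pi..pi} v"
  shows "(\<integral>\<^sup>+\<theta>\<in>{-pi<..<pi}. ennreal ((cmod (v \<theta>))\<^sup>2) \<partial>lborel) = ennreal (integral {-pi..pi} (\<lambda>\<theta>. (cmod (v \<theta>))\<^sup>2))"
proof -
  have i: "((\<lambda>\<theta>. (cmod (v \<theta>))\<^sup>2) has_integral integral {-pi..pi} (\<lambda>\<theta>. (cmod (v \<theta>))\<^sup>2)) {-pi..pi}"
    using v by (intro integrable_integral integrable_continuous_interval continuous_intros)
  have "(\<integral>\<^sup>+\<theta>\<in>{-pi<..<pi}. ennreal ((cmod (v \<theta>))\<^sup>2) \<partial>lborel) = (\<integral>\<^sup>+\<theta>. ennreal (indicator {-pi..pi} \<theta> * (cmod (v \<theta>))\<^sup>2) \<partial>lborel)"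
  proof (rule nn_integral_cong_AE)
    show "AE \<theta> in lborel. ennreal ((cmod (v \<theta>))\<^sup>2) * indicator {-pi<..<pi} \<theta> = ennreal (indicator {-pi..pi} \<theta> * (cmod (v \<theta>))\<^sup>2)"
      using AE_lborel_singleton[of pi] AE_lborel_singleton[of "-pi"]
    proof eventually_elim
      case (elim \<theta>)
      thus ?case by (auto simp: indicator_def)
    qed
  qed
  also have "\<dots> = ennreal (integral {-pi..pi} (\<lambda>\<theta>. (cmod (v \<theta>))\<^sup>2))"
    using i by (intro nn_integral_has_integral_lebesgue) auto
  finally show ?thesis .
qed

text \<open>
  The modes are enumerated by \<open>int_decode\<close>, so that the sum is one over \<open>nat\<close> and can be
  interchanged with integrals.
\<close>

lemma parseval:
  assumes g: "continuous_on (sphere 0 1) g"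
  shows "(\<integral>\<^sup>+\<theta>\<in>{-pi<..<pi}. ennreal ((cmod (g (cis \<theta>)))\<^sup>2) \<partial>lborel)
     = (\<Sum>n. ennreal (2 * pi * (cmod (fmode (int_decode n) (\<lambda>\<theta>. g (cis \<theta>))))\<^sup>2))"
proof -
  define v where "v = (\<lambda>\<theta>. g (cis \<theta>))"
  have v: "continuous_on {-pi..pi} v" unfolding v_def
    by (rule continuous_on_compose2[OF g]) (auto intro!: continuous_intros)
  define I where "I = integral {-pi..pi} (\<lambda>\<theta>. (cmod (v \<theta>))\<^sup>2)"
  define c where "c = (\<lambda>n. 2 * pi * (cmod (fmode (int_decode n) v))\<^sup>2)"
  have c0: "c n \<ge> 0" for n by (simp add: c_def)
  have part: "sum c {..<n} \<le> I" for n
  proof -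
    have "sum c {..<n} = 2 * pi * (\<Sum>k\<in>int_decode ` {..<n}. (cmod (fmode k v))\<^sup>2)"
      unfolding c_def sum_distrib_left[symmetric]
      by (subst sum.reindex) (auto intro: inj_on_subset[OF inj_int_decode])
    also have "\<dots> \<le> I" unfolding I_def by (rule bessel[OF v]) simp
    finally show ?thesis .
  qed
  have sm: "summable c"
  proof (rule bounded_imp_summable[OF c0])
    show "sum c {..n} \<le> I" for n using part[of "Suc n"] by (simp only: lessThan_Suc_atMost)
  qed
  have "suminf c \<le> I" using sm part by (intro suminf_le_const) auto
  moreover have "I \<le> suminf c"
  proof (rule field_le_epsilon)
    fix e :: real assume "e > 0"
    then obtain K where K: "finite K" "I \<le> 2 * pi * (\<Sum>k\<in>K. (cmod (fmode k v))\<^sup>2) + e"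
      using parseval_approx[OF g] unfolding I_def v_def by blast
    have "2 * pi * (\<Sum>k\<in>K. (cmod (fmode k v))\<^sup>2) = sum c (int_encode ` K)"
      unfolding c_def sum_distrib_left
      by (subst sum.reindex) (auto intro: inj_on_subset[OF inj_int_encode])
    also have "\<dots> \<le> suminf c" using sm c0 K(1) by (intro sum_le_suminf) auto
    finally show "I \<le> suminf c + e" using K(2) by simp
  qed
  ultimately have "ennreal I = (\<Sum>n. ennreal (c n))"
    using suminf_ennreal2[OF c0 sm] by simp
  thus ?thesis using nn_integral_circle[OF v] by (simp add: I_def c_def v_def)
qed

lemma fmode_has_derivative:
  assumes U: "convex U" "t \<in> U" "open U"
    and d: "\<And>t \<theta>. t \<in> U \<Longrightarrow> ((\<lambda>s. V s \<theta>) has_vector_derivative V' t \<theta>) (at t)"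
    and c: "continuous_on (U \<times> {-pi..pi}) (\<lambda>(t, \<theta>). V' t \<theta>)"
    and cV: "\<And>t. t \<in> U \<Longrightarrow> continuous_on {-pi..pi} (V t)"
  shows "((\<lambda>t. fmode k (V t)) has_vector_derivative fmode k (V' t)) (at t)"
proof -
  have "((\<lambda>t. integral (cbox (-pi) pi) (\<lambda>\<theta>. cis (- (of_int k * \<theta>)) * V t \<theta>)) has_vector_derivative
      integral (cbox (-pi) pi) (\<lambda>\<theta>. cis (- (of_int k * \<theta>)) * V' t \<theta>)) (at t within U)"
  proof (rule leibniz_rule_vector_derivative[OF _ _ _ U(2,1)])
    fix s \<theta> assume "s \<in> U" "\<theta> \<in> cbox (- pi) pi"
    thus "((\<lambda>t. cis (- (of_int k * \<theta>)) * V t \<theta>) has_vector_derivative cis (- (of_int k * \<theta>)) * V' s \<theta>) (at s within U)"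
      by (intro has_vector_derivative_mult_right has_vector_derivative_at_within[OF d])
  next
    fix s assume "s \<in> U" thus "(\<lambda>\<theta>. cis (- (of_int k * \<theta>)) * V s \<theta>) integrable_on cbox (- pi) pi"
      using fmode_integrable[OF cV] by simp
  next
    have "continuous_on (U \<times> {-pi..pi}) (\<lambda>x. cis (- (of_int k * snd x)) * (\<lambda>(t, \<theta>). V' t \<theta>) x)"
      by (intro continuous_on_mult c) (auto intro!: continuous_intros)
    thus "continuous_on (U \<times> cbox (- pi) pi) (\<lambda>(x, \<theta>). cis (- (of_int k * \<theta>)) * V' x \<theta>)"
      by (simp add: case_prod_unfold)
  qed
  hence "((\<lambda>t. integral {-pi..pi} (\<lambda>\<theta>. cis (- (of_int k * \<theta>)) * V t \<theta>)) has_vector_derivative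
      integral {-pi..pi} (\<lambda>\<theta>. cis (- (of_int k * \<theta>)) * V' t \<theta>)) (at t)"
    unfolding at_within_open[OF U(2,3)] box_real .
  from has_vector_derivative_mult_left[OF this, of "1 / of_real (2 * pi)"]
  show ?thesis by (simp add: fmode_def)
qed

text \<open>
  Integration by parts; the boundary terms cancel by periodicity.
\<close>

lemma fmode_angular_derivative:
  assumes d: "\<And>\<theta>. (v has_vector_derivative v' \<theta>) (at \<theta>)" and c: "continuous_on {-pi..pi} v'"
    and per: "v (-pi) = v pi"
  shows "fmode k v' = \<i> * of_int k * fmode k v"
proof -
  have cv: "continuous_on {-pi..pi} v"
    using d by (meson continuous_at_imp_continuous_on has_vector_derivative_continuous)
  have dc: "((\<lambda>\<theta>. cis (- (of_int k * \<theta>))) has_vector_derivative (- \<i> * of_int k * cis (- (of_int k * \<theta>)))) (at \<theta>)" for \<theta>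
  proof -
    have "((\<lambda>\<theta>. exp (- \<i> * of_int k * of_real \<theta>)) has_vector_derivative
        (exp (- \<i> * of_int k * of_real \<theta>) * (- \<i> * of_int k))) (at \<theta>)"
      by (auto intro!: derivative_eq_intros has_vector_derivative_real_field)
    thus ?thesis by (simp add: cis_conv_exp mult_ac)
  qed
  have "((\<lambda>\<theta>. cis (- (of_int k * \<theta>)) * v' \<theta> + (- \<i> * of_int k * cis (- (of_int k * \<theta>))) * v \<theta>) has_integral
      (cis (- (of_int k * pi)) * v pi - cis (- (of_int k * (-pi))) * v (-pi))) {-pi..pi}"
    by (intro fundamental_theorem_of_calculus
          has_vector_derivative_mult[OF has_vector_derivative_at_within[OF dc] has_vector_derivative_at_within[OF d]]) simp
  moreover have "cis (- (of_int k * pi)) = cis (- (of_int k * (-pi)))"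
    using cis_int_pi[of "- k"] by simp
  ultimately have "integral {-pi..pi} (\<lambda>\<theta>. cis (- (of_int k * \<theta>)) * v' \<theta> + (- \<i> * of_int k) * (cis (- (of_int k * \<theta>)) * v \<theta>)) = 0"
    using per by (intro integral_unique) (simp add: mult_ac)
  hence "integral {-pi..pi} (\<lambda>\<theta>. cis (- (of_int k * \<theta>)) * v' \<theta>)
     + (- \<i> * of_int k) * integral {-pi..pi} (\<lambda>\<theta>. cis (- (of_int k * \<theta>)) * v \<theta>) = 0"
    using Henstock_Kurzweil_Integration.integral_add[OF fmode_integrable[OF c, of k]
        integrable_on_mult_right[OF fmode_integrable[OF cv, of k], of "- \<i> * of_int k"]]
    by simp
  hence "integral {-pi..pi} (\<lambda>\<theta>. cis (- (of_int k * \<theta>)) * v' \<theta>)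
     = \<i> * of_int k * integral {-pi..pi} (\<lambda>\<theta>. cis (- (of_int k * \<theta>)) * v \<theta>)"
    by (simp add: add_eq_0_iff)
  thus ?thesis by (simp add: fmode_def)
qed

section \<open>The weighted energy inequality on the half cylinder\<close>

text \<open>
  Monotone convergence, in the form used for bounds on compact subintervals of the negative half
  line.
\<close>

lemma nn_integral_negative_axis_limit:
  fixes f :: "real \<Rightarrow> ennreal"
  assumes [measurable]: "f \<in> borel_measurable borel"
    and b: "\<And>n::nat. (\<integral>\<^sup>+t\<in>{- real n - 1..- 1 / (real n + 1)}. f t \<partial>lborel) \<le> B"
  shows "(\<integral>\<^sup>+t\<in>{..<0}. f t \<partial>lborel) \<le> B"
proof -
  define A where "A = (\<lambda>n::nat. {- real n - 1..- 1 / (real n + 1)})"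
  have inc: "incseq A"
    unfolding A_def incseq_def by (auto intro: order_trans simp: frac_le)
  have un: "(\<Union>n. A n) = {..<0}"
  proof (intro equalityI subsetI)
    fix t assume "t \<in> (\<Union>n. A n)"
    then obtain n where "t \<le> - (1 / (real n + 1))" by (auto simp: A_def)
    moreover have "0 < 1 / (real n + 1)" by simp
    ultimately have "t < 0" by linarith
    thus "t \<in> {..<0}" by simp
  next
    fix t :: real assume t: "t \<in> {..<0}"
    obtain n :: nat where n: "max (- t) (- 1 / t) < real n" using reals_Archimedean2 by blast
    hence "- real n - 1 \<le> t" by simp
    moreover have "t \<le> - 1 / (real n + 1)"
    proof -
      have "- 1 / t < real n + 1" using n by simp
      hence "1 < (real n + 1) * (- t)" using t by (simp add: field_simps)
      thus ?thesis by (simp add: field_simps)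
    qed
    ultimately show "t \<in> (\<Union>n. A n)" by (auto simp: A_def)
  qed
  have e: "(\<integral>\<^sup>+t\<in>X. f t \<partial>lborel) = emeasure (density lborel f) X" if "X \<in> sets borel" for X
    using that by (subst emeasure_density) auto
  have "(\<integral>\<^sup>+t\<in>{..<0}. f t \<partial>lborel) = (SUP n. emeasure (density lborel f) (A n))"
  proof -
    have "range A \<subseteq> sets (density lborel f)" by (auto simp: A_def)
    from SUP_emeasure_incseq[OF this inc] show ?thesis by (simp add: un e)
  qed
  also have "\<dots> \<le> B"
    using b by (intro SUP_least) (auto simp: A_def e)
  finally show ?thesis .
qed

text \<open>
  The heart of the convergence proof, for one Fourier mode \<open>k \<noteq> 0\<close>. With \<open>q = g + p\<close> and \<open>q' = k (g - p)\<close>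
  one has \<open>(|q|\<^sup>2)' = 2 k (|g|\<^sup>2 - |p|\<^sup>2)\<close>, so that \<open>|g|\<^sup>2 - |p|\<^sup>2\<close> is a total derivative and,
  without a weight, the two integrals agree up to boundary terms of a favourable sign. The weight
  \<open>exp (-2\<delta>t)\<close> adds the term \<open>(\<delta>/k) |q|\<^sup>2 \<le> 2\<delta> (|g|\<^sup>2 + |p|\<^sup>2)\<close>, which accounts for the two
  constants. At \<open>-\<infinity>\<close> the boundary term vanishes because \<open>q = O(exp t)\<close> and \<open>\<delta> < 1\<close>; at 0 it has the
  right sign if \<open>k < 0\<close> and vanishes by assumption if \<open>k > 0\<close>.
\<close>

lemma weighted_mode_inequality:
  fixes g p q :: "real \<Rightarrow> complex" and k \<delta> C :: real
  assumes q: "\<And>t. t < 0 \<Longrightarrow> q t = g t + p t"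
    and q': "\<And>t. t < 0 \<Longrightarrow> (q has_vector_derivative of_real k * (g t - p t)) (at t)"
    and gc: "continuous_on {..<0} g" and pc: "continuous_on {..<0} p"
    and k: "\<bar>k\<bar> \<ge> 1" and \<delta>: "0 < \<delta>" "\<delta> < 1/2"
    and C: "\<And>t. t \<le> -1 \<Longrightarrow> cmod (q t) \<le> C * exp t"
    and q0: "k > 0 \<Longrightarrow> (q \<longlongrightarrow> 0) (at_left 0)"
  shows "ennreal (1 - 2 * \<delta>) * (\<integral>\<^sup>+t\<in>{..<0}. ennreal ((cmod (g t))\<^sup>2 * exp (- 2 * \<delta> * t)) \<partial>lborel)
    \<le> ennreal (1 + 2 * \<delta>) * (\<integral>\<^sup>+t\<in>{..<0}. ennreal ((cmod (p t))\<^sup>2 * exp (- 2 * \<delta> * t)) \<partial>lborel)"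
proof -
  define wg where "wg = (\<lambda>t. (cmod (g t))\<^sup>2 * exp (- 2 * \<delta> * t))"
  define wp where "wp = (\<lambda>t. (cmod (p t))\<^sup>2 * exp (- 2 * \<delta> * t))"
  have wgc: "continuous_on {..<0} wg" and wpc: "continuous_on {..<0} wp"
    unfolding wg_def wp_def using gc pc by (auto intro!: continuous_intros)
  have w0: "wg t \<ge> 0" "wp t \<ge> 0" for t by (auto simp: wg_def wp_def)
  define P where "P = (\<integral>\<^sup>+t\<in>{..<0}. ennreal (wp t) \<partial>lborel)"
  \<comment> \<open>\<open>Q\<close> is the primitive whose derivative contains the difference of the two weighted energies.\<close>
  define Q where "Q = (\<lambda>t. (cmod (q t))\<^sup>2 * exp (- 2 * \<delta> * t) / (2 * k))"
  define Q' where "Q' = (\<lambda>t. wg t - wp t - \<delta> / k * (cmod (q t))\<^sup>2 * exp (- 2 * \<delta> * t))"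
  have k0: "k \<noteq> 0" using k by auto
  have dQ: "(Q has_real_derivative Q' t) (at t)" if t: "t < 0" for t
  proof -
    define x where "x = of_real k * (g t - p t)"
    have gen: "((\<lambda>t. ((a t)\<^sup>2 + (b t)\<^sup>2) * exp (- 2 * \<delta> * t) / (2 * k)) has_real_derivative
       ((2 * a t * a' + 2 * b t * b') * exp (- 2 * \<delta> * t)
          + ((a t)\<^sup>2 + (b t)\<^sup>2) * (exp (- 2 * \<delta> * t) * (- 2 * \<delta>))) / (2 * k)) (at t)"
      if "(a has_real_derivative a') (at t)" "(b has_real_derivative b') (at t)" for a b :: "real \<Rightarrow> real" and a' b'
      using that by (auto intro!: derivative_eq_intros simp: k0 field_simps)
    have "((\<lambda>t. Re (q t)) has_real_derivative Re x) (at t)" "((\<lambda>t. Im (q t)) has_real_derivative Im x) (at t)"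
      using bounded_linear.has_vector_derivative[OF bounded_linear_Re q'[OF t]]
        bounded_linear.has_vector_derivative[OF bounded_linear_Im q'[OF t]]
      by (simp_all add: has_real_derivative_iff_has_vector_derivative x_def)
    hence "((\<lambda>t. ((Re (q t))\<^sup>2 + (Im (q t))\<^sup>2) * exp (- 2 * \<delta> * t) / (2 * k)) has_real_derivative
       ((2 * Re (q t) * Re x + 2 * Im (q t) * Im x) * exp (- 2 * \<delta> * t)
          + ((Re (q t))\<^sup>2 + (Im (q t))\<^sup>2) * (exp (- 2 * \<delta> * t) * (- 2 * \<delta>))) / (2 * k)) (at t)"
      by (rule gen)
    moreover have "((2 * Re (q t) * Re x + 2 * Im (q t) * Im x) * exp (- 2 * \<delta> * t)
          + ((Re (q t))\<^sup>2 + (Im (q t))\<^sup>2) * (exp (- 2 * \<delta> * t) * (- 2 * \<delta>))) / (2 * k) = Q' t"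
    proof -
      have "Re (q t) * Re x + Im (q t) * Im x = k * ((cmod (g t))\<^sup>2 - (cmod (p t))\<^sup>2)"
        by (simp only: cmod_power2) (simp add: x_def q[OF t] power2_eq_square algebra_simps)
      hence eq: "2 * Re (q t) * Re x + 2 * Im (q t) * Im x = 2 * k * ((cmod (g t))\<^sup>2 - (cmod (p t))\<^sup>2)"
        by simp
      show ?thesis unfolding eq Q'_def wg_def wp_def cmod_power2[symmetric] using k0
        by (simp add: field_simps)
    qed
    ultimately show ?thesis by (simp add: Q_def cmod_power2)
  qed
  have pt: "(1 - 2 * \<delta>) * wg t \<le> (1 + 2 * \<delta>) * wp t + Q' t" if t: "t < 0" for t
  proof -
    have "(cmod (q t))\<^sup>2 \<le> (cmod (g t) + cmod (p t))\<^sup>2"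
      unfolding q[OF t] by (intro power_mono norm_triangle_ineq) auto
    also have "\<dots> \<le> 2 * ((cmod (g t))\<^sup>2 + (cmod (p t))\<^sup>2)"
      using sum_squares_bound[of "cmod (g t)" "cmod (p t)"] by (simp add: power2_sum)
    finally have 1: "(cmod (q t))\<^sup>2 \<le> 2 * ((cmod (g t))\<^sup>2 + (cmod (p t))\<^sup>2)" .
    have "\<delta> / k \<le> \<delta>"
    proof (cases "k > 0")
      case True thus ?thesis using k \<delta> by (simp add: field_simps)
    next
      case False
      hence "\<delta> / k \<le> 0" using \<delta> by (simp add: divide_nonneg_nonpos)
      thus ?thesis using \<delta> by simp
    qed
    hence "\<delta> / k * (cmod (q t))\<^sup>2 \<le> \<delta> * (cmod (q t))\<^sup>2" by (intro mult_right_mono) auto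
    also have "\<dots> \<le> \<delta> * (2 * ((cmod (g t))\<^sup>2 + (cmod (p t))\<^sup>2))" using 1 \<delta> by (intro mult_left_mono) auto
    finally have "\<delta> / k * (cmod (q t))\<^sup>2 * exp (- 2 * \<delta> * t) \<le> \<delta> * (2 * ((cmod (g t))\<^sup>2 + (cmod (p t))\<^sup>2)) * exp (- 2 * \<delta> * t)"
      by (intro mult_right_mono) auto
    also have "\<dots> = 2 * \<delta> * wg t + 2 * \<delta> * wp t" by (simp add: wg_def wp_def algebra_simps)
    finally show ?thesis by (simp add: Q'_def algebra_simps)
  qed
  define s where "s = (\<lambda>n::nat. - real n - 1)"
  define T where "T = (\<lambda>n::nat. - 1 / (real n + 1))"
  have sT: "s n \<le> T n" "T n < 0" "s n \<le> -1" for n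
    by (auto simp: s_def T_def field_simps)
  have sub: "{s n..T n} \<subseteq> {..<0}" for n using sT[of n] by auto
  have iQ: "(Q' has_integral (Q (T n) - Q (s n))) {s n..T n}" for n
    using sT sub[of n] by (intro fundamental_theorem_of_calculus)
      (auto simp: has_real_derivative_iff_has_vector_derivative[symmetric] intro!: has_field_derivative_at_within dQ)
  have ig: "wg integrable_on {s n..T n}" and ip: "wp integrable_on {s n..T n}" for n
    using wgc wpc sub[of n] by (auto intro!: integrable_continuous_interval intro: continuous_on_subset)
  have main: "(1 - 2 * \<delta>) * integral {s n..T n} wg \<le> (1 + 2 * \<delta>) * integral {s n..T n} wp + (Q (T n) - Q (s n))" for n
  proof -
    have "((\<lambda>t. (1 - 2 * \<delta>) * wg t) has_integral (1 - 2 * \<delta>) * integral {s n..T n} wg) {s n..T n}"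
      using ig by (intro has_integral_mult_right integrable_integral)
    moreover have "((\<lambda>t. (1 + 2 * \<delta>) * wp t + Q' t) has_integral (1 + 2 * \<delta>) * integral {s n..T n} wp + (Q (T n) - Q (s n))) {s n..T n}"
      using ip iQ by (intro has_integral_mult_right has_integral_add integrable_integral)
    ultimately show ?thesis by (rule has_integral_le) (use pt sub[of n] in auto)
  qed
  have nn: "(\<integral>\<^sup>+t\<in>{s n..T n}. ennreal (w t) \<partial>lborel) = ennreal (integral {s n..T n} w)"
    if "\<And>t. w t \<ge> 0" "w integrable_on {s n..T n}" for w n
  proof -
    have "(\<integral>\<^sup>+t\<in>{s n..T n}. ennreal (w t) \<partial>lborel) = (\<integral>\<^sup>+t. ennreal (indicator {s n..T n} t * w t) \<partial>lborel)"
      by (intro nn_integral_cong) (auto simp: indicator_def)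
    thus ?thesis using that nn_integral_has_integral_lebesgue[OF _ integrable_integral[OF that(2)]] by simp
  qed
  show ?thesis
  proof (cases "P = \<infinity>")
    case True
    have "ennreal (1 + 2 * \<delta>) * P = \<infinity>" using True \<delta> by (simp add: ennreal_mult_eq_top_iff)
    thus ?thesis by (simp add: P_def wp_def)
  next
    case False
    define r where "r = enn2real P"
    have r: "P = ennreal r" "r \<ge> 0" using False by (auto simp: r_def less_top)
    have ipr: "integral {s n..T n} wp \<le> r" for n
    proof -
      have "ennreal (integral {s n..T n} wp) \<le> P"
        unfolding P_def nn[OF w0(2) ip, symmetric] using sub[of n]
        by (intro nn_integral_mono) (auto simp: indicator_def)
      thus ?thesis using r by simp
    qed
    \<comment> \<open>The contribution of the end point near 0 is dropped if \<open>k < 0\<close>, where \<open>Q \<le> 0\<close>.\<close>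
    define err where "err = (\<lambda>n. (if k > 0 then Q (T n) else 0) + C\<^sup>2 * exp (2 * (1 - \<delta>) * s n))"
    have errb: "Q (T n) - Q (s n) \<le> err n" for n
    proof -
      have "- Q (s n) \<le> (cmod (q (s n)))\<^sup>2 * exp (- 2 * \<delta> * s n) * 1"
      proof -
        have "- (1 / (2 * k)) \<le> 1" using k by (cases "k > 0") (auto simp: field_simps)
        hence "(cmod (q (s n)))\<^sup>2 * exp (- 2 * \<delta> * s n) * (- (1 / (2 * k))) \<le> (cmod (q (s n)))\<^sup>2 * exp (- 2 * \<delta> * s n) * 1"
          by (intro mult_left_mono) auto
        thus ?thesis by (simp add: Q_def)
      qed
      also have "\<dots> \<le> (C * exp (s n))\<^sup>2 * exp (- 2 * \<delta> * s n) * 1"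
        using C[OF sT(3)] by (intro mult_right_mono power_mono) auto
      also have "\<dots> = C\<^sup>2 * exp (2 * (1 - \<delta>) * s n)"
        by (simp add: power_mult_distrib exp_double[symmetric] exp_add[symmetric] algebra_simps)
      finally have 1: "- Q (s n) \<le> C\<^sup>2 * exp (2 * (1 - \<delta>) * s n)" .
      have 2: "Q (T n) \<le> (if k > 0 then Q (T n) else 0)"
        using k by (auto simp: Q_def intro!: divide_nonneg_neg divide_nonneg_nonpos)
      show ?thesis using 1 2 by (simp add: err_def)
    qed
    have sn: "filterlim s at_bot sequentially"
      unfolding s_def filterlim_at_bot_mirror filterlim_uminus_at_bot
      by (simp add: filterlim_at_top_add_at_top filterlim_real_sequentially
          filterlim_tendsto_add_at_top[OF tendsto_const filterlim_real_sequentially, of 1] add.commute)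
    have "(\<lambda>n. exp (2 * (1 - \<delta>) * s n)) \<longlonglongrightarrow> 0"
      by (rule filterlim_compose[OF exp_at_bot], rule filterlim_tendsto_pos_mult_at_bot[OF tendsto_const _ sn]) (use \<delta> in auto)
    hence e1: "(\<lambda>n. C\<^sup>2 * exp (2 * (1 - \<delta>) * s n)) \<longlonglongrightarrow> 0" by (rule tendsto_mult_right_zero)
    have "T \<longlonglongrightarrow> 0"
    proof -
      have "(\<lambda>n. - (1 / real (Suc n))) \<longlonglongrightarrow> - 0" by (intro tendsto_minus LIMSEQ_Suc[OF lim_1_over_n])
      thus ?thesis by (simp add: T_def[abs_def] add.commute)
    qed
    hence T0: "filterlim T (at_left 0) sequentially"
      using less_imp_neq[OF sT(2)] sT(2) by (auto simp: filterlim_at intro!: always_eventually)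
    have e2: "(\<lambda>n. if k > 0 then Q (T n) else 0) \<longlonglongrightarrow> 0"
    proof (cases "k > 0")
      case True
      have "(\<lambda>n. (cmod (q (T n)))\<^sup>2 * exp (- 2 * \<delta> * T n) / (2 * k)) \<longlonglongrightarrow> (cmod 0)\<^sup>2 * exp (- 2 * \<delta> * 0) / (2 * k)"
        using filterlim_compose[OF q0[OF True] T0] \<open>T \<longlonglongrightarrow> 0\<close> k0 by (intro tendsto_intros) auto
      thus ?thesis using True by (simp add: Q_def)
    qed simp
    have err0: "err \<longlonglongrightarrow> 0" unfolding err_def using tendsto_add[OF e2 e1] by simp
    have fin: "(1 - 2 * \<delta>) * integral {s m..T m} wg \<le> (1 + 2 * \<delta>) * r" for m
    proof (rule LIMSEQ_le_const)
      show "(\<lambda>n. (1 + 2 * \<delta>) * r + err n) \<longlonglongrightarrow> (1 + 2 * \<delta>) * r"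
        using tendsto_add[OF tendsto_const err0] by simp
      show "\<exists>N. \<forall>n\<ge>N. (1 - 2 * \<delta>) * integral {s m..T m} wg \<le> (1 + 2 * \<delta>) * r + err n"
      proof (intro exI allI impI)
        fix n assume "m \<le> n"
        hence ss: "{s m..T m} \<subseteq> {s n..T n}" by (auto simp: s_def T_def frac_le intro: order_trans)
        have "(1 - 2 * \<delta>) * integral {s m..T m} wg \<le> (1 - 2 * \<delta>) * integral {s n..T n} wg"
          using \<delta> w0 by (intro mult_left_mono integral_subset_le[OF ss ig ig]) auto
        also have "\<dots> \<le> (1 + 2 * \<delta>) * integral {s n..T n} wp + (Q (T n) - Q (s n))" by (rule main)
        also have "\<dots> \<le> (1 + 2 * \<delta>) * r + err n"
          using ipr[of n] errb[of n] \<delta> by (intro add_mono mult_left_mono) auto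
        finally show "(1 - 2 * \<delta>) * integral {s m..T m} wg \<le> (1 + 2 * \<delta>) * r + err n" .
      qed
    qed
    define R where "R = (1 + 2 * \<delta>) * r / (1 - 2 * \<delta>)"
    have wgm: "(\<integral>\<^sup>+t\<in>{..<0}. ennreal (wg t) \<partial>lborel) \<le> ennreal R"
    proof -
      have "(\<lambda>t. if t \<in> {..<0} then wg t else 0) \<in> borel_measurable borel"
        using borel_measurable_continuous_on_if[OF _ wgc, of "\<lambda>_. 0"] by auto
      hence "(\<integral>\<^sup>+t\<in>{..<0}. ennreal (if t \<in> {..<0} then wg t else 0) \<partial>lborel) \<le> ennreal R"
      proof (intro nn_integral_negative_axis_limit)
        fix n :: nat
        have "(\<integral>\<^sup>+t\<in>{s n..T n}. ennreal (if t \<in> {..<0} then wg t else 0) \<partial>lborel) = (\<integral>\<^sup>+t\<in>{s n..T n}. ennreal (wg t) \<partial>lborel)"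
          using sub[of n] by (intro nn_integral_cong) (auto simp: indicator_def)
        also have "\<dots> \<le> ennreal R"
          unfolding nn[OF w0(1) ig] using fin[of n] \<delta> by (intro ennreal_leI) (simp add: R_def field_simps)
        finally show "(\<integral>\<^sup>+t\<in>{- real n - 1..- 1 / (real n + 1)}. ennreal (if t \<in> {..<0} then wg t else 0) \<partial>lborel) \<le> ennreal R"
          by (simp add: s_def T_def)
      qed auto
      moreover have "(\<integral>\<^sup>+t\<in>{..<0}. ennreal (if t \<in> {..<0} then wg t else 0) \<partial>lborel) = (\<integral>\<^sup>+t\<in>{..<0}. ennreal (wg t) \<partial>lborel)"
        by (intro nn_integral_cong) (auto simp: indicator_def)
      ultimately show ?thesis by simp
    qed
    have "ennreal (1 - 2 * \<delta>) * (\<integral>\<^sup>+t\<in>{..<0}. ennreal (wg t) \<partial>lborel) \<le> ennreal (1 - 2 * \<delta>) * ennreal R"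
      using wgm by (intro mult_left_mono) auto
    also have "\<dots> = ennreal (1 + 2 * \<delta>) * P"
    proof -
      have "(1 - 2 * \<delta>) * R = (1 + 2 * \<delta>) * r" using \<delta> by (simp add: R_def)
      thus ?thesis unfolding r(1) using \<delta> ennreal_mult'[of "1 - 2 * \<delta>" R] ennreal_mult'[of "1 + 2 * \<delta>" r] by simp
    qed
    finally show ?thesis by (simp add: P_def wp_def wg_def)
  qed
qed

text \<open>
  On the cylinder \<open>\<partial>\<^sub>t = \<partial> + dbar\<close> and \<open>\<partial>\<^sub>\<theta> = \<i> (\<partial> - dbar)\<close>; the angular derivative acts on the mode
  \<open>k\<close> as multiplication by \<open>\<i> k\<close>.
\<close>

lemma cylinder_modes:
  fixes U g d :: "complex \<Rightarrow> complex"
  assumes w: "\<And>w. Re w < 0 \<Longrightarrow> wderiv U (g w) (d w) w"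
    and c: "continuous_on {w. Re w < 0} g" "continuous_on {w. Re w < 0} d"
    and per: "\<And>t. U (Complex t (-pi)) = U (Complex t pi)" and t: "t < 0"
  shows "((\<lambda>t. fmode k (\<lambda>\<theta>. U (Complex t \<theta>))) has_vector_derivative
            fmode k (\<lambda>\<theta>. g (Complex t \<theta>)) + fmode k (\<lambda>\<theta>. d (Complex t \<theta>))) (at t)"
    and "of_int k * fmode k (\<lambda>\<theta>. U (Complex t \<theta>)) = fmode k (\<lambda>\<theta>. g (Complex t \<theta>)) - fmode k (\<lambda>\<theta>. d (Complex t \<theta>))"
proof -
  have cC: "continuous_on {-pi..pi} (\<lambda>\<theta>. V (Complex t \<theta>))" if "continuous_on {w. Re w < 0} V" "t < 0" for V :: "complex \<Rightarrow> complex" and t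
    by (rule continuous_on_compose2[OF that(1)]) (use that(2) in \<open>auto simp: Complex_eq intro!: continuous_intros\<close>)
  have cU: "continuous_on {w. Re w < 0} U" using w by (intro wderiv_continuous_on) auto
  have dt: "((\<lambda>s. U (Complex s \<theta>)) has_vector_derivative (g (Complex t \<theta>) + d (Complex t \<theta>))) (at t)" if "t < 0" for t \<theta>
  proof -
    have e: "Complex 0 \<theta> + 1 * of_real s = Complex s \<theta>" for s by (simp add: complex_eq_iff)
    have "wderiv U (g (Complex t \<theta>)) (d (Complex t \<theta>)) (Complex 0 \<theta> + 1 * of_real t)"
      unfolding e using w[of "Complex t \<theta>"] that by simp
    from wderiv_line[OF this] show ?thesis by (simp only: e) simp
  qed
  have dy: "((\<lambda>s. U (Complex t s)) has_vector_derivative (\<i> * (g (Complex t \<theta>) - d (Complex t \<theta>)))) (at \<theta>)" for \<theta>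
  proof -
    have e: "Complex t 0 + \<i> * of_real s = Complex t s" for s by (simp add: complex_eq_iff)
    have "wderiv U (g (Complex t \<theta>)) (d (Complex t \<theta>)) (Complex t 0 + \<i> * of_real \<theta>)"
      unfolding e using w[of "Complex t \<theta>"] t by simp
    from wderiv_line[OF this] show ?thesis by (simp only: e) (simp add: algebra_simps)
  qed
  have "((\<lambda>t. fmode k (\<lambda>\<theta>. U (Complex t \<theta>))) has_vector_derivative fmode k (\<lambda>\<theta>. g (Complex t \<theta>) + d (Complex t \<theta>))) (at t)"
  proof (rule fmode_has_derivative[of "{..<0}"])
    have "continuous_on ({..<0} \<times> {-pi..pi}) (\<lambda>x. (\<lambda>w. g w + d w) (Complex (fst x) (snd x)))"
      by (rule continuous_on_compose2[of "{w. Re w < 0}" "\<lambda>w. g w + d w"])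
         (auto simp: Complex_eq intro!: continuous_intros c)
    thus "continuous_on ({..<0} \<times> {-pi..pi}) (\<lambda>(t, \<theta>). g (Complex t \<theta>) + d (Complex t \<theta>))"
      by (simp add: case_prod_unfold)
  qed (use t dt cC[OF cU] in auto)
  thus "((\<lambda>t. fmode k (\<lambda>\<theta>. U (Complex t \<theta>))) has_vector_derivative
            fmode k (\<lambda>\<theta>. g (Complex t \<theta>)) + fmode k (\<lambda>\<theta>. d (Complex t \<theta>))) (at t)"
    using cC[OF c(1) t] cC[OF c(2) t] by (simp add: fmode_add)
  have "fmode k (\<lambda>\<theta>. \<i> * (g (Complex t \<theta>) - d (Complex t \<theta>))) = \<i> * of_int k * fmode k (\<lambda>\<theta>. U (Complex t \<theta>))"
    by (rule fmode_angular_derivative[OF dy]) (use per in \<open>auto intro!: continuous_intros cC c t\<close>)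
  moreover have "fmode k (\<lambda>\<theta>. \<i> * (g (Complex t \<theta>) - d (Complex t \<theta>))) = \<i> * (fmode k (\<lambda>\<theta>. g (Complex t \<theta>)) - fmode k (\<lambda>\<theta>. d (Complex t \<theta>)))"
    using cC[OF c(1) t] cC[OF c(2) t] by (subst fmode_cmult) (auto intro!: continuous_intros simp: fmode_diff)
  ultimately have "\<i> * (of_int k * fmode k (\<lambda>\<theta>. U (Complex t \<theta>))) = \<i> * (fmode k (\<lambda>\<theta>. g (Complex t \<theta>)) - fmode k (\<lambda>\<theta>. d (Complex t \<theta>)))"
    by (simp add: mult.assoc)
  thus "of_int k * fmode k (\<lambda>\<theta>. U (Complex t \<theta>)) = fmode k (\<lambda>\<theta>. g (Complex t \<theta>)) - fmode k (\<lambda>\<theta>. d (Complex t \<theta>))"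
    by (simp only: mult_left_cancel[OF complex_i_not_zero])
qed

lemma fmode_tendsto_0:
  assumes "\<And>e. e > 0 \<Longrightarrow> \<forall>\<^sub>F t in F. \<forall>\<theta>\<in>{-pi..pi}. cmod (V t \<theta>) \<le> e"
    and "\<forall>\<^sub>F t in F. continuous_on {-pi..pi} (V t)"
  shows "((\<lambda>t. fmode k (V t)) \<longlongrightarrow> 0) F"
proof (rule tendstoI)
  fix e :: real assume e: "e > 0"
  from assms(1)[of "e/2"] e have "\<forall>\<^sub>F t in F. \<forall>\<theta>\<in>{-pi..pi}. cmod (V t \<theta>) \<le> e / 2" by simp
  with assms(2) show "\<forall>\<^sub>F t in F. dist (fmode k (V t)) 0 < e"
  proof eventually_elim
    case (elim t)
    hence "cmod (fmode k (V t)) \<le> e / 2" by (intro fmode_norm_le) auto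
    thus ?case using e by simp
  qed
qed

text \<open>
  Here \<open>g = \<partial>u\<close>, \<open>d = dbar u\<close>, and \<open>e = d + p\<close> is antiholomorphic. Its modes are multiples of \<open>exp (- k t)\<close>,
  and the decay at \<open>-\<infinity>\<close> leaves only those with \<open>k < 0\<close>. For every mode the combination \<open>q = k u + e\<close>
  then satisfies the hypotheses of \<open>weighted_mode_inequality\<close>, with boundary value 0 for \<open>k > 0\<close>, as
  there \<open>q = k u\<close>; for \<open>k = 0\<close> simply \<open>g = - p\<close>. Parseval identity puts the modes together.
\<close>

lemma cylinder_energy:
  fixes u g d p W :: "complex \<Rightarrow> complex" and \<delta> C :: real
  assumes w: "\<And>w. Re w < 0 \<Longrightarrow> wderiv u (g w) (d w) w"
    and c: "continuous_on {w. Re w < 0} g" "continuous_on {w. Re w < 0} d" "continuous_on {w. Re w < 0} p"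
    and W: "W holomorphic_on {w. Re w < 0}" "\<And>w. Re w < 0 \<Longrightarrow> d w + p w = cnj (W w)"
    and circ: "\<And>t. t < 0 \<Longrightarrow> \<exists>G. continuous_on (sphere 0 1) G \<and> (\<forall>\<theta>. g (Complex t \<theta>) = G (cis \<theta>))"
      "\<And>t. t < 0 \<Longrightarrow> \<exists>P. continuous_on (sphere 0 1) P \<and> (\<forall>\<theta>. p (Complex t \<theta>) = P (cis \<theta>))"
    and per: "\<And>t. u (Complex t (-pi)) = u (Complex t pi)" "\<And>t. W (Complex t (-pi)) = W (Complex t pi)"
    and C: "\<And>w. Re w \<le> -1 \<Longrightarrow> cmod (g w) \<le> C * exp (Re w)" "\<And>w. Re w \<le> -1 \<Longrightarrow> cmod (p w) \<le> C * exp (Re w)"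
      "\<And>w. Re w \<le> -1 \<Longrightarrow> cmod (W w) \<le> C * exp (Re w)"
    and bd: "\<And>e. e > 0 \<Longrightarrow> \<forall>\<^sub>F t in at_left 0. \<forall>\<theta>\<in>{-pi..pi}. cmod (u (Complex t \<theta>)) \<le> e"
    and \<delta>: "0 < \<delta>" "\<delta> < 1/2"
  shows "ennreal (1 - 2 * \<delta>) * (\<integral>\<^sup>+w\<in>half_strip. ennreal ((cmod (g w))\<^sup>2 * exp (- 2 * \<delta> * Re w)) \<partial>lborel)
    \<le> ennreal (1 + 2 * \<delta>) * (\<integral>\<^sup>+w\<in>half_strip. ennreal ((cmod (p w))\<^sup>2 * exp (- 2 * \<delta> * Re w)) \<partial>lborel)"
proof -
  have cC: "continuous_on {-pi..pi} (\<lambda>\<theta>. V (Complex t \<theta>))" if "continuous_on {w. Re w < 0} V" "t < 0" for V :: "complex \<Rightarrow> complex" and t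
    by (rule continuous_on_compose2[OF that(1)]) (use that(2) in \<open>auto simp: Complex_eq intro!: continuous_intros\<close>)
  have op: "open {w::complex. Re w < 0}" by (auto intro!: open_Collect_less continuous_intros)
  define m where "m = (\<lambda>V k t. fmode k (\<lambda>\<theta>. (V :: complex \<Rightarrow> complex) (Complex t \<theta>)))"
  have cu: "continuous_on {w. Re w < 0} u" using w by (intro wderiv_continuous_on) auto
  have mb: "cmod (m V k t) \<le> C * exp t" if "\<And>w. Re w \<le> -1 \<Longrightarrow> cmod (V w) \<le> C * exp (Re w)" "t \<le> -1" "continuous_on {w. Re w < 0} V" for V k t
    unfolding m_def
  proof (intro fmode_norm_le cC)
    fix \<theta> show "cmod (V (Complex t \<theta>)) \<le> C * exp t" using that(1)[of "Complex t \<theta>"] that(2) by simp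
  qed (use that in auto)
  define e where "e = (\<lambda>w. d w + p w)"
  have we: "wderiv (\<lambda>w. cnj (W w)) 0 (cnj (deriv W w)) w" if "Re w < 0" for w
    using wderiv_cnj[OF wderiv_holomorphic[OF holomorphic_derivI[OF W(1) op]], of w] that by simp
  have cW: "continuous_on {w. Re w < 0} (\<lambda>w. cnj (W w))" "continuous_on {w. Re w < 0} (\<lambda>w. cnj (deriv W w))"
    by (intro continuous_on_cnj holomorphic_on_imp_continuous_on holomorphic_deriv W(1) op)+
  have Cc: "cmod (cnj (W w)) \<le> C * exp (Re w)" if "Re w \<le> -1" for w using C(3)[OF that] by simp
  define ek where "ek = m (\<lambda>w. cnj (W w))"
  have ek: "ek k t = m d k t + m p k t" if "t < 0" for k t
  proof -
    have "ek k t = m (\<lambda>w. d w + p w) k t"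
      unfolding ek_def m_def by (rule fmode_cong) (use W(2) that in auto)
    thus ?thesis using that c unfolding m_def by (subst (asm) fmode_add) (auto intro!: cC)
  qed
  have ek': "(ek k has_vector_derivative - of_int k * ek k t) (at t)" if t: "t < 0" for k t
  proof -
    have z: "fmode k (\<lambda>\<theta>. 0) = 0" by (simp add: fmode_def)
    note cm = cylinder_modes[OF we continuous_on_const cW(2) _ t, of k, unfolded z]
    have "(ek k has_vector_derivative 0 + fmode k (\<lambda>\<theta>. cnj (deriv W (Complex t \<theta>)))) (at t)"
      unfolding ek_def m_def by (rule cm(1)) (use per in auto)
    moreover have "of_int k * ek k t = 0 - fmode k (\<lambda>\<theta>. cnj (deriv W (Complex t \<theta>)))"
      unfolding ek_def m_def by (rule cm(2)) (use per in auto)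
    ultimately show ?thesis by simp
  qed
  \<comment> \<open>Antiholomorphic modes are multiples of \<open>exp (- k t)\<close>; the decay at \<open>-\<infinity>\<close> excludes \<open>k \<ge> 0\<close>.\<close>
  have ek0: "ek k t = 0" if k: "k \<ge> 0" and t: "t < 0" for k t
  proof -
    define y where "y = (\<lambda>t. exp (of_int k * t) *\<^sub>R ek k t)"
    have dy: "(y has_vector_derivative 0) (at t)" if "t < 0" for t
    proof -
      have "(y has_vector_derivative (exp (of_int k * t) *\<^sub>R (- of_int k * ek k t) + (exp (of_int k * t) * of_int k) *\<^sub>R ek k t)) (at t)"
        unfolding y_def by (rule has_vector_derivative_scaleR[OF _ ek'[OF that]]) (auto intro!: derivative_eq_intros)
      thus ?thesis by (simp add: scaleR_conv_of_real)
    qed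
    obtain c where c: "\<And>s. s \<in> {..<0} \<Longrightarrow> y s = c"
    proof (rule has_vector_derivative_zero_constant[of "{..<0}" y])
      show "(y has_vector_derivative 0) (at x within {..<0})" if "x \<in> {..<0}" for x
        using dy[of x] that by (auto intro: has_vector_derivative_at_within)
    qed auto
    have const: "y s = y t" if "s < 0" for s using c[of s] c[of t] that t by simp
    have "(y \<longlongrightarrow> 0) at_bot"
    proof (rule Lim_null_comparison)
      show "\<forall>\<^sub>F s in at_bot. norm (y s) \<le> C * exp s"
        using eventually_le_at_bot[of "-1::real"]
      proof eventually_elim
        case (elim s)
        have "exp (of_int k * s) \<le> 1" using k elim by (simp add: mult_nonneg_nonpos)
        hence "norm (y s) \<le> 1 * cmod (ek k s)" unfolding y_def norm_scaleR by (intro mult_right_mono) auto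
        also have "cmod (ek k s) \<le> C * exp s" unfolding ek_def by (rule mb[OF Cc elim cW(1)])
        finally show ?case by simp
      qed
      show "((\<lambda>s. C * exp s) \<longlongrightarrow> 0) at_bot" by (intro tendsto_mult_right_zero exp_at_bot)
    qed
    moreover have "\<forall>\<^sub>F s in at_bot. y s = y t"
      using eventually_le_at_bot[of "-1::real"] by eventually_elim (auto intro: const)
    hence "(y \<longlongrightarrow> y t) at_bot" by (rule tendsto_eventually)
    ultimately have "y t = 0" using tendsto_unique[of at_bot y] by (simp add: trivial_limit_at_bot_linorder)
    thus ?thesis by (simp add: y_def)
  qed
  define q where "q = (\<lambda>k t. of_int k * m u k t + ek k t)"
  have cm: "(m u k has_vector_derivative m g k t + m d k t) (at t)" "of_int k * m u k t = m g k t - m d k t" if "t < 0" for k t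
    using cylinder_modes[OF w c(1,2) per(1) that, of k] by (auto simp: m_def)
  have q: "q k t = m g k t + m p k t" if "t < 0" for k t
    using cm(2)[OF that] ek[OF that] by (simp add: q_def)
  have q': "(q k has_vector_derivative of_real (of_int k) * (m g k t - m p k t)) (at t)" if "t < 0" for k t
  proof -
    have "(q k has_vector_derivative of_int k * (m g k t + m d k t) + (- of_int k * ek k t)) (at t)"
      unfolding q_def by (intro has_vector_derivative_add has_vector_derivative_mult_right cm(1) ek' that)
    thus ?thesis using ek[OF that] by (simp add: algebra_simps)
  qed
  have mc: "continuous_on {..<0} (m V k)" if V: "continuous_on {w. Re w < 0} V" for V k
  proof -
    have "continuous_on {..<0} (\<lambda>t. integral {-pi..pi} (\<lambda>\<theta>. cis (- (of_int k * \<theta>)) * V (Complex t \<theta>)))"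
    proof -
      have "continuous_on {..<0} (\<lambda>t. integral (cbox (-pi) pi) (\<lambda>\<theta>. cis (- (of_int k * \<theta>)) * V (Complex t \<theta>)))"
      proof (rule integral_continuous_on_param)
        have "continuous_on ({..<0} \<times> {-pi..pi}) (\<lambda>x. V (Complex (fst x) (snd x)))"
          by (rule continuous_on_compose2[OF V]) (auto simp: Complex_eq intro!: continuous_intros)
        thus "continuous_on ({..<0} \<times> cbox (-pi) pi) (\<lambda>(t, \<theta>). cis (- (of_int k * \<theta>)) * V (Complex t \<theta>))"
          unfolding case_prod_unfold box_real by (intro continuous_intros)
      qed
      thus ?thesis by simp
    qed
    thus ?thesis unfolding m_def fmode_def by (intro continuous_intros) auto
  qed
  have mode: "ennreal (1 - 2 * \<delta>) * (\<integral>\<^sup>+t\<in>{..<0}. ennreal ((cmod (m g k t))\<^sup>2 * exp (- 2 * \<delta> * t)) \<partial>lborel)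
    \<le> ennreal (1 + 2 * \<delta>) * (\<integral>\<^sup>+t\<in>{..<0}. ennreal ((cmod (m p k t))\<^sup>2 * exp (- 2 * \<delta> * t)) \<partial>lborel)" for k
  proof (cases "k = 0")
    case True
    have "cmod (m g k t) = cmod (m p k t)" if "t < 0" for t
    proof -
      have "m g k t + m p k t = 0" using q[OF that, of k] ek0[of k t] that True by (simp add: q_def)
      hence "m g k t = - m p k t" by (simp add: add_eq_0_iff)
      thus ?thesis by simp
    qed
    hence "(\<integral>\<^sup>+t\<in>{..<0}. ennreal ((cmod (m g k t))\<^sup>2 * exp (- 2 * \<delta> * t)) \<partial>lborel)
        = (\<integral>\<^sup>+t\<in>{..<0}. ennreal ((cmod (m p k t))\<^sup>2 * exp (- 2 * \<delta> * t)) \<partial>lborel)"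
      by (intro nn_integral_cong) (auto simp: indicator_def)
    moreover have "ennreal (1 - 2 * \<delta>) \<le> ennreal (1 + 2 * \<delta>)" using \<delta> by (intro ennreal_leI) simp
    ultimately show ?thesis by (simp only: mult_right_mono[OF _ zero_le])
  next
    case False
    show ?thesis
    proof (rule weighted_mode_inequality[where q="q k" and k="of_int k" and C="2 * C"])
      show "1 \<le> \<bar>real_of_int k\<bar>" using False by linarith
      show "cmod (q k t) \<le> 2 * C * exp t" if "t \<le> -1" for t
      proof -
        have "q k t = m g k t + m p k t" using q[of t k] that by simp
        also have "cmod \<dots> \<le> C * exp t + C * exp t"
          by (intro order_trans[OF norm_triangle_ineq] add_mono mb C that c)
        finally show ?thesis by simp
      qed
      show "(q k \<longlongrightarrow> 0) (at_left 0)" if "0 < real_of_int k"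
      proof -
        have "(m u k \<longlongrightarrow> 0) (at_left 0)"
          unfolding m_def
        proof (rule fmode_tendsto_0[OF bd])
          show "\<forall>\<^sub>F t in at_left 0. continuous_on {-pi..pi} (\<lambda>\<theta>. u (Complex t \<theta>))"
            unfolding eventually_at_filter by (auto intro!: always_eventually cC[OF cu])
        qed
        hence "((\<lambda>t. of_int k * m u k t) \<longlongrightarrow> 0) (at_left 0)" by (rule tendsto_mult_right_zero)
        moreover have "\<forall>\<^sub>F t in at_left 0. of_int k * m u k t = q k t"
          unfolding eventually_at_filter using that by (auto intro!: always_eventually simp: q_def ek0)
        ultimately show ?thesis by (rule Lim_transform_eventually)
      qed
    qed (use q q' mc c \<delta> in auto)
  qed
  have sum: "(\<integral>\<^sup>+w\<in>half_strip. ennreal ((cmod (V w))\<^sup>2 * exp (- 2 * \<delta> * Re w)) \<partial>lborel)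
     = (\<Sum>n. ennreal (2 * pi) * (\<integral>\<^sup>+t\<in>{..<0}. ennreal ((cmod (m V (int_decode n) t))\<^sup>2 * exp (- 2 * \<delta> * t)) \<partial>lborel))"
    if V: "continuous_on {w. Re w < 0} V" and Vc: "\<And>t. t < 0 \<Longrightarrow> \<exists>G. continuous_on (sphere 0 1) G \<and> (\<forall>\<theta>. V (Complex t \<theta>) = G (cis \<theta>))" for V
  proof -
    define V0 where "V0 = (\<lambda>w. if w \<in> {w. Re w < 0} then V w else 0)"
    have [measurable]: "V0 \<in> borel_measurable borel" unfolding V0_def by (rule borel_measurable_if_continuous[OF op V])
    have mm[measurable]: "(\<lambda>t. if t \<in> {..<0} then m V k t else 0) \<in> borel_measurable borel" for k
      using borel_measurable_continuous_on_if[OF _ mc[OF V], of "\<lambda>_. 0" k] by auto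
    have "(\<integral>\<^sup>+w\<in>half_strip. ennreal ((cmod (V w))\<^sup>2 * exp (- 2 * \<delta> * Re w)) \<partial>lborel)
      = (\<integral>\<^sup>+w\<in>half_strip. ennreal ((cmod (V0 w))\<^sup>2 * exp (- 2 * \<delta> * Re w)) \<partial>lborel)"
      by (intro nn_integral_cong) (auto simp: V0_def half_strip_def indicator_def)
    also have "\<dots> = (\<integral>\<^sup>+t\<in>{..<0}. (\<integral>\<^sup>+\<theta>\<in>{-pi<..<pi}. ennreal ((cmod (V0 (Complex t \<theta>)))\<^sup>2 * exp (- 2 * \<delta> * t)) \<partial>lborel) \<partial>lborel)"
      by (subst nn_integral_half_strip) auto
    also have "\<dots> = (\<integral>\<^sup>+t. (\<Sum>n. ennreal (2 * pi) * (ennreal ((cmod (if t \<in> {..<0} then m V (int_decode n) t else 0))\<^sup>2 * exp (- 2 * \<delta> * t)) * indicator {..<0} t)) \<partial>lborel)"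
    proof (intro nn_integral_cong)
      fix t :: real
      show "(\<integral>\<^sup>+\<theta>\<in>{-pi<..<pi}. ennreal ((cmod (V0 (Complex t \<theta>)))\<^sup>2 * exp (- 2 * \<delta> * t)) \<partial>lborel) * indicator {..<0} t
         = (\<Sum>n. ennreal (2 * pi) * (ennreal ((cmod (if t \<in> {..<0} then m V (int_decode n) t else 0))\<^sup>2 * exp (- 2 * \<delta> * t)) * indicator {..<0} t))"
      proof (cases "t < 0")
        case True
        then obtain G where G: "continuous_on (sphere 0 1) G" "\<And>\<theta>. V (Complex t \<theta>) = G (cis \<theta>)" using Vc by blast
        have V0G: "V0 (Complex t \<theta>) = G (cis \<theta>)" for \<theta> using True G by (simp add: V0_def)
        have mV: "m V k t = fmode k (\<lambda>\<theta>. G (cis \<theta>))" for k by (simp add: m_def G(2))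
        have Gm: "(\<lambda>\<theta>. ennreal ((cmod (G (cis \<theta>)))\<^sup>2) * indicator {-pi<..<pi} \<theta>) \<in> borel_measurable lborel"
        proof -
          have "continuous_on UNIV (\<lambda>\<theta>. G (cis \<theta>))"
            by (rule continuous_on_compose2[OF G(1)]) (auto intro!: continuous_intros)
          hence "(\<lambda>\<theta>. G (cis \<theta>)) \<in> borel_measurable borel" by (rule borel_measurable_continuous_onI)
          thus ?thesis by measurable
        qed
        have "(\<integral>\<^sup>+\<theta>\<in>{-pi<..<pi}. ennreal ((cmod (V0 (Complex t \<theta>)))\<^sup>2 * exp (- 2 * \<delta> * t)) \<partial>lborel)
           = (\<integral>\<^sup>+\<theta>. ennreal (exp (- 2 * \<delta> * t)) * (ennreal ((cmod (G (cis \<theta>)))\<^sup>2) * indicator {-pi<..<pi} \<theta>) \<partial>lborel)"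
          by (intro nn_integral_cong) (auto simp: V0G ennreal_mult' mult_ac)
        also have "\<dots> = ennreal (exp (- 2 * \<delta> * t)) * (\<integral>\<^sup>+\<theta>\<in>{-pi<..<pi}. ennreal ((cmod (G (cis \<theta>)))\<^sup>2) \<partial>lborel)"
          by (rule nn_integral_cmult[OF Gm])
        also have "\<dots> = (\<Sum>n. ennreal (exp (- 2 * \<delta> * t)) * ennreal (2 * pi * (cmod (fmode (int_decode n) (\<lambda>\<theta>. G (cis \<theta>))))\<^sup>2))"
          unfolding parseval[OF G(1)] by (rule ennreal_suminf_cmult[symmetric])
        also have "\<dots> = (\<Sum>n. ennreal (2 * pi) * ennreal ((cmod (m V (int_decode n) t))\<^sup>2 * exp (- 2 * \<delta> * t)))"
          unfolding mV by (intro suminf_cong) (simp add: ennreal_mult'[symmetric] mult_ac)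
        finally show ?thesis using True by simp
      qed simp
    qed
    also have "\<dots> = (\<Sum>n. \<integral>\<^sup>+t. ennreal (2 * pi) * (ennreal ((cmod (if t \<in> {..<0} then m V (int_decode n) t else 0))\<^sup>2 * exp (- 2 * \<delta> * t)) * indicator {..<0} t) \<partial>lborel)"
      by (rule nn_integral_suminf) measurable
    also have "\<dots> = (\<Sum>n. ennreal (2 * pi) * (\<integral>\<^sup>+t. (ennreal ((cmod (if t \<in> {..<0} then m V (int_decode n) t else 0))\<^sup>2 * exp (- 2 * \<delta> * t)) * indicator {..<0} t) \<partial>lborel))"
      by (intro suminf_cong nn_integral_cmult) measurable
    also have "\<dots> = (\<Sum>n. ennreal (2 * pi) * (\<integral>\<^sup>+t\<in>{..<0}. ennreal ((cmod (m V (int_decode n) t))\<^sup>2 * exp (- 2 * \<delta> * t)) \<partial>lborel))"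
    proof (rule suminf_cong, rule arg_cong2[where f="(*)", OF refl], rule nn_integral_cong)
      fix n and t :: real
      show "ennreal ((cmod (if t \<in> {..<0} then m V (int_decode n) t else 0))\<^sup>2 * exp (- 2 * \<delta> * t)) * indicator {..<0} t
         = ennreal ((cmod (m V (int_decode n) t))\<^sup>2 * exp (- 2 * \<delta> * t)) * indicator {..<0} t"
        by (cases "t < 0") simp_all
    qed
    finally show ?thesis .
  qed
  define Ig where "Ig = (\<lambda>n. ennreal (2 * pi) * (\<integral>\<^sup>+t\<in>{..<0}. ennreal ((cmod (m g (int_decode n) t))\<^sup>2 * exp (- 2 * \<delta> * t)) \<partial>lborel))"
  define Ip where "Ip = (\<lambda>n. ennreal (2 * pi) * (\<integral>\<^sup>+t\<in>{..<0}. ennreal ((cmod (m p (int_decode n) t))\<^sup>2 * exp (- 2 * \<delta> * t)) \<partial>lborel))"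
  have "ennreal (1 - 2 * \<delta>) * suminf Ig = (\<Sum>n. ennreal (1 - 2 * \<delta>) * Ig n)" by (rule ennreal_suminf_cmult[symmetric])
  also have "\<dots> \<le> (\<Sum>n. ennreal (1 + 2 * \<delta>) * Ip n)"
  proof (rule suminf_le)
    show "ennreal (1 - 2 * \<delta>) * Ig n \<le> ennreal (1 + 2 * \<delta>) * Ip n" for n
      using mult_left_mono[OF mode[of "int_decode n"], of "ennreal (2 * pi)"] unfolding Ig_def Ip_def
      by (simp only: mult.left_commute) auto
  qed auto
  also have "\<dots> = ennreal (1 + 2 * \<delta>) * suminf Ip" by (rule ennreal_suminf_cmult)
  finally show ?thesis using sum[OF c(1) circ(1)] sum[OF c(3) circ(2)] by (simp add: Ig_def Ip_def)
qed

section \<open>Weighted energy and pointwise bounds in the disk\<close>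

lemma pdist_less_1: "cmod a < 1 \<Longrightarrow> cmod z < 1 \<Longrightarrow> pdist a z < 1"
  using mob_surj(2)[of a z] by (simp add: pdist_def)

lemma pdist_measurable [measurable]: "pdist a \<in> borel_measurable borel"
  unfolding pdist_def[abs_def] by measurable

lemma disk_cut_measurable: "continuous_on (ball 0 1) \<phi> \<Longrightarrow> disk_cut \<phi> \<in> borel_measurable borel"
  unfolding disk_cut_def[abs_def] by (rule borel_measurable_if_continuous) auto

text \<open>
  The \<open>L\<^sup>2\<close> norm, squared, of \<open>\<phi>\<close> on the disk with a weight that blows up at \<open>a\<close>. It enters through
  bounds that are uniform in \<open>a\<close>.
\<close>

definition wnorm :: "real \<Rightarrow> (complex \<Rightarrow> complex) \<Rightarrow> complex \<Rightarrow> ennreal" where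
  "wnorm \<delta> \<phi> a = (\<integral>\<^sup>+\<zeta>\<in>ball 0 1. ennreal ((cmod (\<phi> \<zeta>))\<^sup>2 * pdist a \<zeta> powr (- 2 * \<delta>)) \<partial>lborel)"

lemma wnorm_cong: "(\<And>z. z \<in> ball 0 1 \<Longrightarrow> cmod (\<phi> z) = cmod (\<psi> z)) \<Longrightarrow> wnorm \<delta> \<phi> a = wnorm \<delta> \<psi> a"
  unfolding wnorm_def by (intro nn_integral_cong) (auto simp: indicator_def)

text \<open>
  A form of type \<open>(1,0)\<close> or \<open>(0,1)\<close> has a conformally invariant \<open>L\<^sup>2\<close> norm.
\<close>

lemma wnorm_polar:
  assumes a: "cmod a < 1" and \<phi>: "continuous_on (ball 0 1) \<phi>"
  shows "wnorm \<delta> \<phi> a = (\<integral>\<^sup>+w\<in>half_strip. ennreal ((cmod (\<phi> (disk_polar a w) * deriv (disk_polar a) w))\<^sup>2 * exp (- 2 * \<delta> * Re w)) \<partial>lborel)"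
proof -
  have [measurable]: "disk_cut \<phi> \<in> borel_measurable borel" by (rule disk_cut_measurable[OF \<phi>])
  have "wnorm \<delta> \<phi> a = (\<integral>\<^sup>+\<zeta>\<in>ball 0 1. ennreal ((cmod (disk_cut \<phi> \<zeta>))\<^sup>2 * pdist a \<zeta> powr (- 2 * \<delta>)) \<partial>lborel)"
    unfolding wnorm_def by (intro nn_integral_cong) (auto simp: indicator_def disk_cut_def)
  also have "\<dots> = (\<integral>\<^sup>+w\<in>half_strip. ennreal ((cmod (disk_cut \<phi> (disk_polar a w)))\<^sup>2 * pdist a (disk_polar a w) powr (- 2 * \<delta>))
       * ennreal ((cmod (deriv (disk_polar a) w))\<^sup>2) \<partial>lborel)"
    by (rule nn_integral_disk_polar[OF a]) measurable
  also have "\<dots> = (\<integral>\<^sup>+w\<in>half_strip. ennreal ((cmod (\<phi> (disk_polar a w) * deriv (disk_polar a) w))\<^sup>2 * exp (- 2 * \<delta> * Re w)) \<partial>lborel)"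
  proof (rule nn_integral_cong)
    fix w :: complex
    show "ennreal ((cmod (disk_cut \<phi> (disk_polar a w)))\<^sup>2 * pdist a (disk_polar a w) powr (- 2 * \<delta>))
       * ennreal ((cmod (deriv (disk_polar a) w))\<^sup>2) * indicator half_strip w
       = ennreal ((cmod (\<phi> (disk_polar a w) * deriv (disk_polar a) w))\<^sup>2 * exp (- 2 * \<delta> * Re w)) * indicator half_strip w"
    proof (cases "w \<in> half_strip")
      case True
      hence w: "Re w < 0" by (simp add: half_strip_def)
      have "pdist a (disk_polar a w) powr (- 2 * \<delta>) = exp (- 2 * \<delta> * Re w)"
        unfolding disk_polar_facts(2)[OF a w] by (simp add: powr_def)
      moreover have "disk_cut \<phi> (disk_polar a w) = \<phi> (disk_polar a w)"
        using disk_polar_facts(1)[OF a w] by (simp add: disk_cut_def)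
      ultimately show ?thesis by (simp add: norm_mult power_mult_distrib ennreal_mult'[symmetric] mult_ac)
    qed simp
  qed
  finally show ?thesis .
qed

text \<open>
  In the coordinate \<open>disk_polar a\<close> the integrand is \<open>exp (2\<delta> Re w)\<close> on \<open>half_strip\<close>.
\<close>

lemma kern_weighted_norm:
  assumes a: "cmod a < 1" and \<delta>: "\<delta> > 0"
  shows "(\<integral>\<^sup>+\<zeta>\<in>ball 0 1. ennreal ((cmod (kern \<zeta> a))\<^sup>2 * pdist a \<zeta> powr (2 * \<delta>)) \<partial>lborel) = ennreal (pi / \<delta>)"
proof -
  have [measurable]: "(\<lambda>\<zeta>. kern \<zeta> a) \<in> borel_measurable borel" unfolding kern_def by measurable
  have "(\<integral>\<^sup>+\<zeta>\<in>ball 0 1. ennreal ((cmod (kern \<zeta> a))\<^sup>2 * pdist a \<zeta> powr (2 * \<delta>)) \<partial>lborel)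
    = (\<integral>\<^sup>+w\<in>half_strip. ennreal ((cmod (kern (disk_polar a w) a))\<^sup>2 * pdist a (disk_polar a w) powr (2 * \<delta>))
       * ennreal ((cmod (deriv (disk_polar a) w))\<^sup>2) \<partial>lborel)"
    by (rule nn_integral_disk_polar[OF a]) measurable
  also have "\<dots> = (\<integral>\<^sup>+w\<in>strip. ennreal (exp ((2 * \<delta>) * Re w)) * indicator {..<0} (Re w) \<partial>lborel)"
  proof (rule nn_integral_cong)
    fix w :: complex
    show "ennreal ((cmod (kern (disk_polar a w) a))\<^sup>2 * pdist a (disk_polar a w) powr (2 * \<delta>))
       * ennreal ((cmod (deriv (disk_polar a) w))\<^sup>2) * indicator half_strip w
       = ennreal (exp ((2 * \<delta>) * Re w)) * indicator {..<0} (Re w) * indicator strip w"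
    proof (cases "w \<in> half_strip")
      case True
      hence w: "Re w < 0" "w \<in> strip" by (auto simp: half_strip_def strip_def)
      have "(cmod (kern (disk_polar a w) a))\<^sup>2 * (cmod (deriv (disk_polar a) w))\<^sup>2 = 1"
        unfolding power_mult_distrib[symmetric] norm_mult[symmetric] disk_polar_facts(5)[OF a w(1)] by simp
      moreover have "pdist a (disk_polar a w) powr (2 * \<delta>) = exp ((2 * \<delta>) * Re w)"
        unfolding disk_polar_facts(2)[OF a w(1)] by (simp add: powr_def)
      moreover have "x * exp y * z = exp y" if "x * z = 1" for x y z :: real
        using that by (metis mult.assoc mult.commute mult.right_neutral)
      ultimately show ?thesis using True w by (simp add: ennreal_mult'[symmetric])
    next
      case False
      thus ?thesis by (auto simp: half_strip_def strip_def indicator_def)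
    qed
  qed
  also have "\<dots> = ennreal (pi / \<delta>)" using \<delta> by (subst nn_integral_strip_exp) auto
  finally show ?thesis .
qed

definition vanishes_at_circle :: "(complex \<Rightarrow> complex) \<Rightarrow> bool" where
  "vanishes_at_circle F \<longleftrightarrow> (\<forall>e>0. \<exists>r<1. \<forall>z. r < cmod z \<and> cmod z < 1 \<longrightarrow> cmod (F z) < e)"

lemma disk_polar_near_circle:
  assumes a: "cmod a < 1" and r: "r < 1"
  shows "\<forall>\<^sub>F t in at_left 0. \<forall>\<theta>. r < cmod (disk_polar a (Complex t \<theta>))"
proof -
  define c where "c = (1 - (cmod a)\<^sup>2) / (1 - cmod a)\<^sup>2"
  have "((\<lambda>t. c * (1 - exp (2 * t))) \<longlongrightarrow> c * (1 - exp (2 * 0))) (at_left 0)"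
    by (intro tendsto_intros)
  hence lim: "((\<lambda>t. c * (1 - exp (2 * t))) \<longlongrightarrow> 0) (at_left 0)" by simp
  define r' where "r' = max r 0"
  have r': "r' < 1" "r' \<ge> 0" "r \<le> r'" using r by (auto simp: r'_def)
  have "0 < 1 - r'\<^sup>2" using r' by (simp add: abs_square_less_1)
  from order_tendstoD(2)[OF lim this] have "\<forall>\<^sub>F t in at_left 0. c * (1 - exp (2 * t)) < 1 - r'\<^sup>2" .
  moreover have "\<forall>\<^sub>F t in at_left (0::real). t < 0" unfolding eventually_at_filter by auto
  ultimately show ?thesis
  proof eventually_elim
    case (elim t)
    show ?case
    proof
      fix \<theta>
      define w where "w = Complex t \<theta>"
      have w: "Re w < 0" using elim by (simp add: w_def)
      have "1 - cmod a \<le> cmod (1 + cnj a * exp w)"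
        using one_minus_mult_norm_ge[of "exp w" "- cnj a" "cmod a"] w by (simp add: mult.commute)
      hence "(1 - cmod a)\<^sup>2 \<le> (cmod (1 + cnj a * exp w))\<^sup>2" using a by (intro power_mono) auto
      moreover have "0 \<le> (1 - (cmod a)\<^sup>2) * (1 - exp (2 * Re w))"
        using a w by (intro mult_nonneg_nonneg) (auto simp: abs_square_le_1)
      ultimately have "1 - (cmod (disk_polar a w))\<^sup>2 \<le> (1 - (cmod a)\<^sup>2) * (1 - exp (2 * Re w)) / (1 - cmod a)\<^sup>2"
        unfolding disk_polar_facts(6)[OF a w] using a by (intro divide_left_mono) (auto intro!: mult_pos_pos zero_less_power dest: order.strict_trans2[rotated])
      also have "\<dots> = c * (1 - exp (2 * t))" by (simp add: c_def w_def)
      also have "\<dots> < 1 - r'\<^sup>2" by (rule elim(1))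
      finally have "r'\<^sup>2 < (cmod (disk_polar a w))\<^sup>2" by simp
      hence "r' < cmod (disk_polar a w)" by (rule power_less_imp_less_base) simp
      thus "r < cmod (disk_polar a (Complex t \<theta>))" using r' by (simp add: w_def)
    qed
  qed
qed

text \<open>
  The inequality on the cylinder, pulled back by \<open>disk_polar a\<close>. The bounds \<open>O(exp (Re w))\<close> at the
  end of the cylinder hold because \<open>G\<close>, \<open>\<phi>\<close> and \<open>H\<close> are bounded near \<open>a\<close> while the derivative of
  \<open>disk_polar a\<close> is \<open>O(exp (Re w))\<close>.
\<close>

lemma disk_energy:
  assumes w: "\<And>z. z \<in> ball 0 1 \<Longrightarrow> wderiv F (G z) (D z) z"
    and c: "continuous_on (ball 0 1) G" "continuous_on (ball 0 1) D" "continuous_on (ball 0 1) \<phi>"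
    and H: "H holomorphic_on ball 0 1" "\<And>z. z \<in> ball 0 1 \<Longrightarrow> D z + \<phi> z = cnj (H z)"
    and bd: "vanishes_at_circle F" and \<delta>: "0 < \<delta>" "\<delta> < 1/2" and a: "cmod a < 1"
  shows "ennreal (1 - 2 * \<delta>) * wnorm \<delta> G a \<le> ennreal (1 + 2 * \<delta>) * wnorm \<delta> \<phi> a"
proof -
  define m where "m = disk_polar a"
  \<comment> \<open>\<open>m1\<close> is the derivative of \<open>mob a\<close>; factoring \<open>exp w\<close> out of the derivative of \<open>disk_polar a\<close>
    exhibits its decay.\<close>
  define m1 where "m1 = (\<lambda>u. (1 - a * cnj a) / (1 + cnj a * u)\<^sup>2)"
  have m': "deriv m w = exp w * m1 (exp w)" if "Re w < 0" for w
    using disk_polar_facts(4)[OF a that] by (simp add: m_def m1_def)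
  have mball: "m w \<in> ball 0 1" if "Re w < 0" for w using disk_polar_facts(1)[OF a that] by (simp add: m_def)
  have dm: "(m has_field_derivative deriv m w) (at w)" if "Re w < 0" for w
    using disk_polar_facts(3)[OF a that] by (simp add: m_def)
  have op: "open {w::complex. Re w < 0}" by (auto intro!: open_Collect_less continuous_intros)
  have mhol: "m holomorphic_on {w. Re w < 0}"
    unfolding holomorphic_on_open[OF op] using dm by blast
  have m'hol: "deriv m holomorphic_on {w. Re w < 0}" by (rule holomorphic_deriv[OF mhol op])
  have cm: "continuous_on {w. Re w < 0} m" "continuous_on {w. Re w < 0} (deriv m)"
    using mhol m'hol by (auto intro: holomorphic_on_imp_continuous_on)
  have comp: "continuous_on {w. Re w < 0} (\<lambda>w. V (m w))" if "continuous_on (ball 0 1) V" for V :: "complex \<Rightarrow> complex"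
    by (rule continuous_on_compose2[OF that cm(1)]) (use mball in auto)
  have nz: "1 + cnj a * u \<noteq> 0" if "cmod u < 1" for u using one_plus_mult_nz[of "cnj a" u] a that by simp
  have cmob: "continuous_on (ball 0 1) (mob a)" by (rule holomorphic_on_imp_continuous_on[OF mob_holomorphic[OF a]])
  have cm1: "continuous_on (ball 0 1) m1" unfolding m1_def using nz by (auto intro!: continuous_intros)
  have Vm: "continuous_on (ball 0 1) (\<lambda>u. V (mob a u))" if "continuous_on (ball 0 1) V" for V :: "complex \<Rightarrow> complex"
    by (rule continuous_on_compose2[OF that cmob]) (use mob_in_disk[OF a] in auto)
  have expC: "exp (Complex t \<theta>) = of_real (exp t) * cis \<theta>" for t \<theta> by (simp add: exp_eq_polar)
  have circ: "\<exists>P. continuous_on (sphere 0 1) P \<and> (\<forall>\<theta>. V (exp (Complex t \<theta>)) = P (cis \<theta>))"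
    if V: "continuous_on (ball 0 1) V" and t: "t < 0" for V :: "complex \<Rightarrow> complex" and t
  proof (intro exI[of _ "\<lambda>\<zeta>. V (of_real (exp t) * \<zeta>)"] conjI allI)
    show "continuous_on (sphere 0 1) (\<lambda>\<zeta>. V (of_real (exp t) * \<zeta>))"
      by (rule continuous_on_compose2[OF V]) (use t in \<open>auto intro!: continuous_intros simp: norm_mult\<close>)
  qed (simp add: expC)
  have bnd: "\<exists>B. \<forall>w. Re w \<le> -1 \<longrightarrow> cmod (exp w * V (exp w)) \<le> B * exp (Re w)" if V: "continuous_on (ball 0 1) V" for V :: "complex \<Rightarrow> complex"
  proof -
    have e1: "exp (-1) < (1::real)" by simp
    have "compact (V ` cball 0 (exp (-1)))"
      by (intro compact_continuous_image continuous_on_subset[OF V]) (use e1 in \<open>auto intro: le_less_trans[OF _ e1]\<close>)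
    then obtain B where B: "\<And>u. u \<in> cball 0 (exp (-1)) \<Longrightarrow> cmod (V u) \<le> B"
      using compact_imp_bounded bounded_iff by (metis imageI)
    have "cmod (exp w * V (exp w)) \<le> B * exp (Re w)" if "Re w \<le> -1" for w
      using B[of "exp w"] that by (simp add: norm_mult mult.commute[of B] mult_left_mono)
    thus ?thesis by blast
  qed
  define Gm where "Gm = (\<lambda>u. G (mob a u) * m1 u)"
  define Pm where "Pm = (\<lambda>u. \<phi> (mob a u) * cnj (m1 u))"
  define Hm where "Hm = (\<lambda>u. H (mob a u) * m1 u)"
  have cV: "continuous_on (ball 0 1) Gm" "continuous_on (ball 0 1) Pm" "continuous_on (ball 0 1) Hm"
    unfolding Gm_def Pm_def Hm_def using c H(1)
    by (intro continuous_on_mult continuous_on_cnj Vm cm1 c holomorphic_on_imp_continuous_on[OF H(1)])+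
  define g where "g = (\<lambda>w. G (m w) * deriv m w)"
  define d where "d = (\<lambda>w. D (m w) * cnj (deriv m w))"
  define p where "p = (\<lambda>w. \<phi> (m w) * cnj (deriv m w))"
  define W where "W = (\<lambda>w. exp w * Hm (exp w))"
  have ge: "g w = exp w * Gm (exp w)" "p w = cnj (exp w) * Pm (exp w)" "W w = H (m w) * deriv m w" if "Re w < 0" for w
    using m'[OF that] by (auto simp: g_def p_def W_def Gm_def Pm_def Hm_def m_def disk_polar_def)
  obtain B1 B2 B3 where B: "\<And>w. Re w \<le> -1 \<Longrightarrow> cmod (exp w * Gm (exp w)) \<le> B1 * exp (Re w)"
    "\<And>w. Re w \<le> -1 \<Longrightarrow> cmod (exp w * Pm (exp w)) \<le> B2 * exp (Re w)"
    "\<And>w. Re w \<le> -1 \<Longrightarrow> cmod (exp w * Hm (exp w)) \<le> B3 * exp (Re w)"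
    using bnd[OF cV(1)] bnd[OF cV(2)] bnd[OF cV(3)] by blast
  define B where "B = \<bar>B1\<bar> + \<bar>B2\<bar> + \<bar>B3\<bar>"
  have BB: "B1 * exp x \<le> B * exp x" "B2 * exp x \<le> B * exp x" "B3 * exp x \<le> B * exp x" for x
    by (auto simp: B_def intro!: mult_right_mono)
  have per: "exp (Complex t (-pi)) = exp (Complex t pi)" for t by (simp add: expC complex_eq_iff)
  have "ennreal (1 - 2 * \<delta>) * (\<integral>\<^sup>+w\<in>half_strip. ennreal ((cmod (g w))\<^sup>2 * exp (- 2 * \<delta> * Re w)) \<partial>lborel)
    \<le> ennreal (1 + 2 * \<delta>) * (\<integral>\<^sup>+w\<in>half_strip. ennreal ((cmod (p w))\<^sup>2 * exp (- 2 * \<delta> * Re w)) \<partial>lborel)"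
  proof (rule cylinder_energy[where u="\<lambda>w. F (m w)" and d=d and W=W and C=B])
    show "wderiv (\<lambda>w. F (m w)) (g w) (d w) w" if "Re w < 0" for w
      unfolding g_def d_def by (rule wderiv_compose[OF w[OF mball[OF that]] dm[OF that]])
    show "continuous_on {w. Re w < 0} g" "continuous_on {w. Re w < 0} d" "continuous_on {w. Re w < 0} p"
      unfolding g_def d_def p_def by (intro continuous_intros comp c cm)+
    show "W holomorphic_on {w. Re w < 0}"
    proof -
      have "(\<lambda>w. H (m w) * deriv m w) holomorphic_on {w. Re w < 0}"
      proof (intro holomorphic_on_mult m'hol)
        have "m ` {w. Re w < 0} \<subseteq> ball 0 1" using mball by blast
        from holomorphic_on_compose_gen[OF mhol H(1) this]
        show "(\<lambda>w. H (m w)) holomorphic_on {w. Re w < 0}" by (simp add: o_def)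
      qed
      thus ?thesis by (rule holomorphic_transform) (simp add: ge)
    qed
    show "d w + p w = cnj (W w)" if "Re w < 0" for w
      using H(2)[OF mball[OF that]] ge(3)[OF that]
      by (simp add: d_def p_def flip: ring_distribs)
    show "\<exists>P. continuous_on (sphere 0 1) P \<and> (\<forall>\<theta>. g (Complex t \<theta>) = P (cis \<theta>))" if "t < 0" for t
      using circ[OF continuous_on_mult[OF continuous_on_id cV(1)] that] that by (simp add: ge)
    show "\<exists>P. continuous_on (sphere 0 1) P \<and> (\<forall>\<theta>. p (Complex t \<theta>) = P (cis \<theta>))" if "t < 0" for t
      using circ[OF continuous_on_mult[OF continuous_on_cnj[OF continuous_on_id] cV(2)] that] that by (simp add: ge)
    show "F (m (Complex t (-pi))) = F (m (Complex t pi))" for t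
      by (simp add: m_def disk_polar_def per)
    show "W (Complex t (-pi)) = W (Complex t pi)" for t by (simp add: W_def per)
    fix w :: complex assume w1: "Re w \<le> -1"
    hence w0: "Re w < 0" by simp
    show "cmod (g w) \<le> B * exp (Re w)" using B(1)[OF w1] BB(1)[of "Re w"] unfolding ge[OF w0] by linarith
    show "cmod (p w) \<le> B * exp (Re w)" using B(2)[OF w1] BB(2)[of "Re w"] unfolding ge[OF w0] norm_mult complex_mod_cnj by linarith
    show "cmod (W w) \<le> B * exp (Re w)" using B(3)[OF w1] BB(3)[of "Re w"] unfolding W_def by linarith
  next
    fix e :: real assume e: "e > 0"
    then obtain r where r: "r < 1" "\<And>z. r < cmod z \<Longrightarrow> cmod z < 1 \<Longrightarrow> cmod (F z) < e"
      using bd unfolding vanishes_at_circle_def by blast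
    have "\<forall>\<^sub>F t in at_left (0::real). t < 0" unfolding eventually_at_filter by auto
    with disk_polar_near_circle[OF a r(1)]
    show "\<forall>\<^sub>F t in at_left 0. \<forall>\<theta>\<in>{-pi..pi}. cmod (F (m (Complex t \<theta>))) \<le> e"
    proof eventually_elim
      case (elim t)
      show ?case
      proof
        fix \<theta>
        have "Re (Complex t \<theta>) < 0" using elim by simp
        from disk_polar_facts(1)[OF a this] elim(1)
        show "cmod (F (m (Complex t \<theta>))) \<le> e" by (auto simp: m_def intro!: less_imp_le r(2))
      qed
    qed
  qed (use \<delta> in auto)
  moreover have "wnorm \<delta> G a = (\<integral>\<^sup>+w\<in>half_strip. ennreal ((cmod (g w))\<^sup>2 * exp (- 2 * \<delta> * Re w)) \<partial>lborel)"
    unfolding wnorm_polar[OF a c(1)] g_def m_def ..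
  moreover have "wnorm \<delta> \<phi> a = (\<integral>\<^sup>+w\<in>half_strip. ennreal ((cmod (p w))\<^sup>2 * exp (- 2 * \<delta> * Re w)) \<partial>lborel)"
    unfolding wnorm_polar[OF a c(3)] p_def m_def by (simp add: norm_mult)
  ultimately show ?thesis by simp
qed

text \<open>
  The two terms of the kernel nearly cancel at the circle: the factor \<open>1 - |z|\<^sup>2\<close> makes \<open>K_op \<phi>\<close>
  vanish there.
\<close>

lemma kern_eq:
  assumes "cmod z < 1" "cmod \<zeta> < 1" "\<zeta> \<noteq> z"
  shows "kern \<zeta> z = (1 - of_real ((cmod z)\<^sup>2)) / ((\<zeta> - z) * (1 - \<zeta> * cnj z))"
proof -
  have nz: "1 - \<zeta> * cnj z \<noteq> 0" using one_minus_mult_nz[of z \<zeta>] assms by simp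
  have "complex_of_real ((cmod z)\<^sup>2) = z * cnj z" by (simp only: complex_norm_square)
  thus ?thesis using nz assms(3) unfolding kern_def by (simp add: divide_simps) (simp add: algebra_simps)
qed

lemma square_integrable_of_wnorm:
  assumes \<phi>: "continuous_on (ball 0 1) \<phi>" and \<delta>: "\<delta> \<ge> 0" and M: "wnorm \<delta> \<phi> a \<le> ennreal M" and a: "cmod a < 1"
  shows "(\<integral>\<^sup>+\<zeta>\<in>ball 0 1. ennreal ((cmod (\<phi> \<zeta>))\<^sup>2) \<partial>lborel) \<le> ennreal M"
    and "integrable lborel (disk_cut \<phi>)"
proof -
  have [measurable]: "disk_cut \<phi> \<in> borel_measurable borel" by (rule disk_cut_measurable[OF \<phi>])
  have "AE \<zeta> in lborel. ennreal ((cmod (\<phi> \<zeta>))\<^sup>2) * indicator (ball 0 1) \<zeta>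
     \<le> ennreal ((cmod (\<phi> \<zeta>))\<^sup>2 * pdist a \<zeta> powr (- 2 * \<delta>)) * indicator (ball 0 1) \<zeta>"
    using AE_lborel_singleton[of a]
  proof eventually_elim
    case (elim \<zeta>)
    show ?case
    proof (cases "\<zeta> \<in> ball 0 1")
      case True
      have "1 - \<zeta> * cnj a \<noteq> 0" using one_minus_mult_nz[of a \<zeta>] a True by simp
      hence "0 < pdist a \<zeta>" using elim by (simp add: pdist_def)
      moreover have "pdist a \<zeta> < 1" using pdist_less_1[OF a, of \<zeta>] True by simp
      ultimately have "1 powr (- 2 * \<delta>) \<le> pdist a \<zeta> powr (- 2 * \<delta>)"
        using \<delta> by (intro powr_mono2') auto
      hence "(cmod (\<phi> \<zeta>))\<^sup>2 * 1 \<le> (cmod (\<phi> \<zeta>))\<^sup>2 * pdist a \<zeta> powr (- 2 * \<delta>)" by (intro mult_left_mono) auto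
      thus ?thesis using True by (simp add: ennreal_leI)
    qed simp
  qed
  from nn_integral_mono_AE[OF this] M
  show 1: "(\<integral>\<^sup>+\<zeta>\<in>ball 0 1. ennreal ((cmod (\<phi> \<zeta>))\<^sup>2) \<partial>lborel) \<le> ennreal M"
    unfolding wnorm_def by (rule order_trans)
  show "integrable lborel (disk_cut \<phi>)"
  proof (rule integrableI_bounded)
    have "(\<integral>\<^sup>+\<zeta>. ennreal (norm (disk_cut \<phi> \<zeta>)) \<partial>lborel)
       \<le> (\<integral>\<^sup>+\<zeta>. indicator (ball 0 1) \<zeta> + ennreal ((cmod (disk_cut \<phi> \<zeta>))\<^sup>2) * indicator (ball 0 1) \<zeta> \<partial>lborel)"
    proof (rule nn_integral_mono)
      fix \<zeta>
      show "ennreal (norm (disk_cut \<phi> \<zeta>)) \<le> indicator (ball 0 1) \<zeta> + ennreal ((cmod (disk_cut \<phi> \<zeta>))\<^sup>2) * indicator (ball 0 1) \<zeta>"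
      proof (cases "\<zeta> \<in> ball 0 1")
        case True
        have "norm (disk_cut \<phi> \<zeta>) \<le> 1 + (norm (disk_cut \<phi> \<zeta>))\<^sup>2"
        proof -
          have "2 * norm (disk_cut \<phi> \<zeta>) \<le> (norm (disk_cut \<phi> \<zeta>))\<^sup>2 + 1"
            using sum_squares_bound[of "norm (disk_cut \<phi> \<zeta>)" 1] by simp
          thus ?thesis using norm_ge_zero[of "disk_cut \<phi> \<zeta>"] by linarith
        qed
        hence "ennreal (norm (disk_cut \<phi> \<zeta>)) \<le> ennreal (1 + (norm (disk_cut \<phi> \<zeta>))\<^sup>2)" by (rule ennreal_leI)
        thus ?thesis using True by simp
      qed (simp add: disk_cut_def)
    qed
    also have "\<dots> = emeasure lborel (ball (0::complex) 1) + (\<integral>\<^sup>+\<zeta>\<in>ball 0 1. ennreal ((cmod (disk_cut \<phi> \<zeta>))\<^sup>2) \<partial>lborel)"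
    proof -
      have [measurable]: "ball (0::complex) 1 \<in> sets borel" by simp
      have "(\<lambda>\<zeta>. ennreal ((cmod (disk_cut \<phi> \<zeta>))\<^sup>2) * indicator (ball 0 1) \<zeta>) \<in> borel_measurable lborel" by measurable
      thus ?thesis by (subst nn_integral_add) auto
    qed
    also have "(\<integral>\<^sup>+\<zeta>\<in>ball 0 1. ennreal ((cmod (disk_cut \<phi> \<zeta>))\<^sup>2) \<partial>lborel) = (\<integral>\<^sup>+\<zeta>\<in>ball 0 1. ennreal ((cmod (\<phi> \<zeta>))\<^sup>2) \<partial>lborel)"
      by (intro nn_integral_cong) (auto simp: disk_cut_def indicator_def)
    also have "emeasure lborel (ball (0::complex) 1) + \<dots> < \<infinity>"
      using emeasure_lborel_ball_finite[of "0::complex" 1] 1 by (simp add: ennreal_add_less_top le_less_trans[OF _ ennreal_less_top])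
    finally show "(\<integral>\<^sup>+\<zeta>. ennreal (norm (disk_cut \<phi> \<zeta>)) \<partial>lborel) < \<infinity>" .
  qed measurable
qed

lemma K_op_norm_le_nn_integral:
  "ennreal (cmod (K_op \<phi> a)) \<le> ennreal (1 / pi) * (\<integral>\<^sup>+\<zeta>\<in>ball 0 1. ennreal (cmod (kern \<zeta> a) * cmod (\<phi> \<zeta>)) \<partial>lborel)"
proof -
  define f where "f = (\<lambda>\<zeta>. indicator (ball 0 1) \<zeta> *\<^sub>R (kern \<zeta> a * \<phi> \<zeta>))"
  have 1: "ennreal (cmod (integral\<^sup>L lebesgue f)) \<le> (\<integral>\<^sup>+\<zeta>. ennreal (norm (f \<zeta>)) \<partial>lborel)"
  proof (cases "integrable lebesgue f")
    case True
    from integral_norm_bound_ennreal[OF this] show ?thesis by (simp add: nn_integral_completion)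
  qed (simp add: not_integrable_integral_eq)
  have 2: "(\<integral>\<^sup>+\<zeta>. ennreal (norm (f \<zeta>)) \<partial>lborel) = (\<integral>\<^sup>+\<zeta>\<in>ball 0 1. ennreal (cmod (kern \<zeta> a) * cmod (\<phi> \<zeta>)) \<partial>lborel)"
    by (intro nn_integral_cong) (auto simp: f_def indicator_def norm_mult)
  have "cmod (K_op \<phi> a) = (1 / pi) * cmod (integral\<^sup>L lebesgue f)"
    by (simp add: K_op_def set_lebesgue_integral_def f_def norm_mult norm_divide)
  moreover have "ennreal ((1 / pi) * cmod (integral\<^sup>L lebesgue f)) = ennreal (1 / pi) * ennreal (cmod (integral\<^sup>L lebesgue f))"
    by (rule ennreal_mult') simp
  ultimately have "ennreal (cmod (K_op \<phi> a)) = ennreal (1 / pi) * ennreal (cmod (integral\<^sup>L lebesgue f))"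
    by simp
  thus ?thesis using 1 2 by (simp add: mult_left_mono)
qed

text \<open>
  A substitute for the Cauchy--Schwarz inequality that is convenient for nonnegative integrals; the
  free constant \<open>c\<close> is chosen where it is used.
\<close>

lemma am_gm_weight:
  fixes k f x y c :: real
  assumes "x * y = 1" "x > 0" "c > 0"
  shows "k * f \<le> c * (k\<^sup>2 * x) + (1 / c) * (f\<^sup>2 * y)"
proof -
  have y: "y = 1 / x" using assms by (simp add: field_simps)
  define s where "s = sqrt (c * x)"
  have s: "s > 0" "s\<^sup>2 = c * x" using assms by (auto simp: s_def)
  have "2 * (s * k) * (f / s) \<le> (s * k)\<^sup>2 + (f / s)\<^sup>2" by (rule sum_squares_bound)
  hence "2 * (k * f) \<le> c * x * k\<^sup>2 + f\<^sup>2 / (c * x)" using s by (simp add: power_mult_distrib power_divide)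
  moreover have "c * x * k\<^sup>2 + f\<^sup>2 / (c * x) \<ge> 0" using assms by (intro add_nonneg_nonneg) auto
  ultimately have "k * f \<le> c * x * k\<^sup>2 + f\<^sup>2 / (c * x)" by linarith
  thus ?thesis by (simp add: y mult_ac)
qed

text \<open>
  The weighted Cauchy--Schwarz inequality, where the kernel has the weighted norm \<open>\<pi> / \<delta>\<close>
  independently of \<open>a\<close>.
\<close>

lemma K_op_bound:
  assumes \<phi>: "continuous_on (ball 0 1) \<phi>" and \<delta>: "\<delta> > 0" and M: "wnorm \<delta> \<phi> a \<le> ennreal M" "M > 0" and a: "cmod a < 1"
  shows "cmod (K_op \<phi> a) \<le> sqrt M * (1 / \<delta> + 1)"
proof -
  have [measurable]: "disk_cut \<phi> \<in> borel_measurable borel" by (rule disk_cut_measurable[OF \<phi>])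
  have [measurable]: "(\<lambda>\<zeta>. kern \<zeta> a) \<in> borel_measurable borel" unfolding kern_def by measurable
  \<comment> \<open>With this constant in the inequality between arithmetic and geometric means, both terms are
    multiples of \<open>sqrt M\<close>.\<close>
  define l where "l = sqrt M"
  have l: "l > 0" "M / l = l" using M(2) by (auto simp: l_def real_div_sqrt)
  have "(\<integral>\<^sup>+\<zeta>\<in>ball 0 1. ennreal (cmod (kern \<zeta> a) * cmod (\<phi> \<zeta>)) \<partial>lborel)
    \<le> (\<integral>\<^sup>+\<zeta>. ennreal l * (ennreal ((cmod (kern \<zeta> a))\<^sup>2 * pdist a \<zeta> powr (2 * \<delta>)) * indicator (ball 0 1) \<zeta>)
        + ennreal (1 / l) * (ennreal ((cmod (disk_cut \<phi> \<zeta>))\<^sup>2 * pdist a \<zeta> powr (- 2 * \<delta>)) * indicator (ball 0 1) \<zeta>) \<partial>lborel)"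
  proof (rule nn_integral_mono_AE)
    show "AE \<zeta> in lborel. ennreal (cmod (kern \<zeta> a) * cmod (\<phi> \<zeta>)) * indicator (ball 0 1) \<zeta>
       \<le> ennreal l * (ennreal ((cmod (kern \<zeta> a))\<^sup>2 * pdist a \<zeta> powr (2 * \<delta>)) * indicator (ball 0 1) \<zeta>)
        + ennreal (1 / l) * (ennreal ((cmod (disk_cut \<phi> \<zeta>))\<^sup>2 * pdist a \<zeta> powr (- 2 * \<delta>)) * indicator (ball 0 1) \<zeta>)"
      using AE_lborel_singleton[of a]
    proof eventually_elim
      case (elim \<zeta>)
      show ?case
      proof (cases "\<zeta> \<in> ball 0 1")
        case True
        have "1 - \<zeta> * cnj a \<noteq> 0" using one_minus_mult_nz[of a \<zeta>] a True by simp
        hence p: "0 < pdist a \<zeta>" using elim by (simp add: pdist_def)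
        have "pdist a \<zeta> powr (2 * \<delta>) * pdist a \<zeta> powr (- 2 * \<delta>) = 1"
          using p by (simp add: powr_add[symmetric])
        from am_gm_weight[OF this _ l(1), of "cmod (kern \<zeta> a)" "cmod (\<phi> \<zeta>)"] p
        have "ennreal (cmod (kern \<zeta> a) * cmod (\<phi> \<zeta>)) \<le> ennreal (l * ((cmod (kern \<zeta> a))\<^sup>2 * pdist a \<zeta> powr (2 * \<delta>))
           + (1 / l) * ((cmod (\<phi> \<zeta>))\<^sup>2 * pdist a \<zeta> powr (- 2 * \<delta>)))"
          by (intro ennreal_leI) simp
        also have "\<dots> = ennreal l * ennreal ((cmod (kern \<zeta> a))\<^sup>2 * pdist a \<zeta> powr (2 * \<delta>))
           + ennreal (1 / l) * ennreal ((cmod (\<phi> \<zeta>))\<^sup>2 * pdist a \<zeta> powr (- 2 * \<delta>))"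
          using l(1) by (subst ennreal_plus) (auto simp: ennreal_mult'[symmetric])
        finally show ?thesis using True by (simp add: disk_cut_def)
      qed simp
    qed
  qed
  also have "\<dots> = ennreal l * (\<integral>\<^sup>+\<zeta>\<in>ball 0 1. ennreal ((cmod (kern \<zeta> a))\<^sup>2 * pdist a \<zeta> powr (2 * \<delta>)) \<partial>lborel)
        + ennreal (1 / l) * wnorm \<delta> (disk_cut \<phi>) a"
  proof -
    have [measurable]: "ball (0::complex) 1 \<in> sets borel" by simp
    have mA: "(\<lambda>\<zeta>. ennreal ((cmod (kern \<zeta> a))\<^sup>2 * pdist a \<zeta> powr (2 * \<delta>)) * indicator (ball 0 1) \<zeta>) \<in> borel_measurable lborel"
      by measurable
    have mB: "(\<lambda>\<zeta>. ennreal ((cmod (disk_cut \<phi> \<zeta>))\<^sup>2 * pdist a \<zeta> powr (- 2 * \<delta>)) * indicator (ball 0 1) \<zeta>) \<in> borel_measurable lborel"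
      by measurable
    show ?thesis unfolding wnorm_def using mA mB by (subst nn_integral_add) (simp_all add: nn_integral_cmult)
  qed
  also have "\<dots> \<le> ennreal l * ennreal (pi / \<delta>) + ennreal (1 / l) * ennreal M"
    unfolding kern_weighted_norm[OF a \<delta>]
    using M wnorm_cong[of "disk_cut \<phi>" \<phi> \<delta> a] by (intro add_mono mult_left_mono) (auto simp: disk_cut_def)
  also have "\<dots> = ennreal (l * (pi / \<delta>) + l)"
    using l \<delta> M by (subst ennreal_plus) (auto simp: ennreal_mult'[symmetric])
  finally have "ennreal (cmod (K_op \<phi> a)) \<le> ennreal (1 / pi) * ennreal (l * (pi / \<delta>) + l)"
    by (intro order_trans[OF K_op_norm_le_nn_integral] mult_left_mono) auto
  hence "ennreal (cmod (K_op \<phi> a)) \<le> ennreal ((1 / pi) * (l * (pi / \<delta>) + l))"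
    by (subst ennreal_mult') simp_all
  hence "cmod (K_op \<phi> a) \<le> (1 / pi) * (l * (pi / \<delta>) + l)"
    using l \<delta> by (subst (asm) ennreal_le_iff) auto
  also have "\<dots> = l * (1 / \<delta>) + l / pi" by (simp add: field_simps)
  also have "l / pi \<le> l" using l pi_gt3 by (simp add: divide_le_eq)
  finally show ?thesis by (simp add: l_def ring_distribs)
qed

lemma square_tail_small:
  fixes \<phi> :: "complex \<Rightarrow> complex"
  assumes \<phi>: "continuous_on (ball 0 1) \<phi>"
    and fin: "(\<integral>\<^sup>+\<zeta>\<in>ball 0 1. ennreal ((cmod (\<phi> \<zeta>))\<^sup>2) \<partial>lborel) < \<infinity>" and e: "e > 0"
  obtains R where "0 < R" "R < 1"
    "(\<integral>\<^sup>+\<zeta>\<in>ball 0 1 - ball 0 R. ennreal ((cmod (\<phi> \<zeta>))\<^sup>2) \<partial>lborel) < ennreal e"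
proof -
  have [measurable]: "disk_cut \<phi> \<in> borel_measurable borel" by (rule disk_cut_measurable[OF \<phi>])
  define f where "f = (\<lambda>\<zeta>. ennreal ((cmod (disk_cut \<phi> \<zeta>))\<^sup>2))"
  have [measurable]: "f \<in> borel_measurable borel" unfolding f_def by measurable
  define R where "R = (\<lambda>n::nat. 1 - 1 / (real n + 2))"
  define A where "A = (\<lambda>n. ball 0 1 - ball (0::complex) (R n))"
  have As: "A n \<in> sets borel" for n by (simp add: A_def)
  have eq: "emeasure (density lborel f) (A n) = (\<integral>\<^sup>+\<zeta>\<in>ball 0 1 - ball 0 (R n). ennreal ((cmod (\<phi> \<zeta>))\<^sup>2) \<partial>lborel)" for n
  proof -
    have "emeasure (density lborel f) (A n) = (\<integral>\<^sup>+\<zeta>\<in>A n. f \<zeta> \<partial>lborel)"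
      using As[of n] by (subst emeasure_density) simp_all
    also have "\<dots> = (\<integral>\<^sup>+\<zeta>\<in>ball 0 1 - ball 0 (R n). ennreal ((cmod (\<phi> \<zeta>))\<^sup>2) \<partial>lborel)"
      by (intro nn_integral_cong) (auto simp: A_def f_def disk_cut_def indicator_def)
    finally show ?thesis .
  qed
  have Rlim: "R \<longlonglongrightarrow> 1"
  proof -
    have "(\<lambda>n. 1 / real (Suc (Suc n))) \<longlonglongrightarrow> 0" by (intro LIMSEQ_Suc lim_1_over_n)
    hence "(\<lambda>n. 1 - 1 / real (Suc (Suc n))) \<longlonglongrightarrow> 1 - 0" by (intro tendsto_intros)
    thus ?thesis by (simp add: R_def[abs_def] add.commute)
  qed
  have "(\<lambda>n. emeasure (density lborel f) (A n)) \<longlonglongrightarrow> emeasure (density lborel f) (\<Inter>n. A n)"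
  proof (rule Lim_emeasure_decseq)
    show "range A \<subseteq> sets (density lborel f)" using As by auto
    show "decseq A"
    proof -
      have "R m \<le> R n" if "m \<le> n" for m n using that by (simp add: R_def frac_le)
      hence "ball 0 (R m) \<subseteq> ball (0::complex) (R n)" if "m \<le> n" for m n using that by (intro subset_ball) auto
      thus ?thesis unfolding A_def decseq_def by blast
    qed
    show "emeasure (density lborel f) (A n) \<noteq> \<infinity>" for n
    proof -
      have "emeasure (density lborel f) (A n) \<le> (\<integral>\<^sup>+\<zeta>\<in>ball 0 1. ennreal ((cmod (\<phi> \<zeta>))\<^sup>2) \<partial>lborel)"
        unfolding eq by (intro nn_integral_mono) (auto simp: indicator_def)
      also have "\<dots> < \<infinity>" by (rule fin)
      finally show ?thesis by simp
    qed
  qed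
  moreover have "(\<Inter>n. A n) = {}"
  proof (rule ccontr)
    assume "(\<Inter>n. A n) \<noteq> {}"
    then obtain z where "\<And>n. z \<in> A n" by blast
    hence z: "cmod z < 1" "\<And>n. R n \<le> cmod z" by (auto simp: A_def not_less)
    have "1 \<le> cmod z" by (rule LIMSEQ_le_const2[OF Rlim]) (use z in auto)
    with z show False by simp
  qed
  ultimately have "(\<lambda>n. emeasure (density lborel f) (A n)) \<longlonglongrightarrow> 0" by simp
  hence "\<forall>\<^sub>F n in sequentially. emeasure (density lborel f) (A n) < ennreal e"
    using e by (intro order_tendstoD(2)) auto
  then obtain n where "emeasure (density lborel f) (A n) < ennreal e"
    by (auto simp: eventually_sequentially)
  moreover have "0 < R n" "R n < 1" by (auto simp: R_def field_simps)
  ultimately show ?thesis using eq that[of "R n"] by simp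
qed

text \<open>
  The kernel is small on a fixed compact disk as \<open>z\<close> approaches the circle, by \<open>kern_eq\<close>. In the
  remaining annulus the plain \<open>L\<^sup>2\<close> norm of \<open>\<phi>\<close> is small, but the weighted one need not be uniformly
  small; a bound for the weight with twice the exponent makes up for this by a second use of the
  weighted inequality between arithmetic and geometric means.
\<close>

lemma K_op_vanishes_at_circle:
  assumes \<phi>: "continuous_on (ball 0 1) \<phi>" and \<delta>: "\<delta> > 0"
    and M: "\<And>a. cmod a < 1 \<Longrightarrow> wnorm (2 * \<delta>) \<phi> a \<le> ennreal M" and M0: "M > 0"
  shows "vanishes_at_circle (K_op \<phi>)"
  unfolding vanishes_at_circle_def
proof (intro allI impI)
  fix e :: real assume e: "e > 0"
  have [measurable]: "disk_cut \<phi> \<in> borel_measurable borel" by (rule disk_cut_measurable[OF \<phi>])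
  have [measurable]: "ball (0::complex) 1 \<in> sets borel" "ball (0::complex) r \<in> sets borel" for r by auto
  have fin: "(\<integral>\<^sup>+\<zeta>\<in>ball 0 1. ennreal ((cmod (\<phi> \<zeta>))\<^sup>2) \<partial>lborel) < \<infinity>" and N: "integrable lborel (disk_cut \<phi>)"
    using square_integrable_of_wnorm[OF \<phi> _ M[of 0]] \<delta> by (auto intro: le_less_trans)
  \<comment> \<open>\<open>l\<close>, \<open>\<eta>\<close>, the radius \<open>R\<close> and finally \<open>r\<close> are chosen such that each of the four integrals below
    is at most \<open>e / 4\<close>.\<close>
  define l where "l = e * \<delta> / (4 * pi)"
  have l: "l > 0" using e \<delta> by (simp add: l_def)
  define \<eta> where "\<eta> = e * l / (4 * M)"
  have \<eta>: "\<eta> > 0" using e l M0 by (simp add: \<eta>_def)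
  obtain R where R: "0 < R" "R < 1"
    "(\<integral>\<^sup>+\<zeta>\<in>ball 0 1 - ball 0 R. ennreal ((cmod (\<phi> \<zeta>))\<^sup>2) \<partial>lborel) < ennreal (e * l * \<eta> / 4)"
    using square_tail_small[OF \<phi> fin, of "e * l * \<eta> / 4"] e l \<eta> by auto
  define I where "I = (\<integral>\<zeta>. cmod (disk_cut \<phi> \<zeta>) \<partial>lborel)"
  have I: "(\<integral>\<^sup>+\<zeta>. ennreal (cmod (disk_cut \<phi> \<zeta>)) \<partial>lborel) = ennreal I"
    unfolding I_def using N by (intro nn_integral_eq_integral integrable_norm) auto
  have "((\<lambda>x. (1 - x\<^sup>2) / (x - R)\<^sup>2 * I) \<longlongrightarrow> (1 - 1\<^sup>2) / (1 - R)\<^sup>2 * I) (at_left (1::real))"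
    using R by (intro tendsto_intros) auto
  hence "((\<lambda>x. (1 - x\<^sup>2) / (x - R)\<^sup>2 * I) \<longlongrightarrow> 0) (at_left (1::real))" by simp
  hence "\<forall>\<^sub>F x in at_left 1. (1 - x\<^sup>2) / (x - R)\<^sup>2 * I < e / 4"
    using e by (intro order_tendstoD(2)) auto
  then obtain r where r: "r < 1" "\<And>x. r < x \<Longrightarrow> x < 1 \<Longrightarrow> (1 - x\<^sup>2) / (x - R)\<^sup>2 * I < e / 4"
    by (auto simp: eventually_at_left[of 0 "1::real"])
  show "\<exists>r<1. \<forall>z. r < cmod z \<and> cmod z < 1 \<longrightarrow> cmod (K_op \<phi> z) < e"
  proof (rule exI[of _ "max r R"], intro conjI allI impI)
    fix z assume z: "max r R < cmod z \<and> cmod z < 1"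
    define c where "c = (1 - (cmod z)\<^sup>2) / (cmod z - R)\<^sup>2"
    have c: "c \<ge> 0" "c * I < e / 4" using z r(2)[of "cmod z"] by (auto simp: c_def abs_square_le_1)
    have [measurable]: "(\<lambda>\<zeta>. kern \<zeta> z) \<in> borel_measurable borel" unfolding kern_def by measurable
    define X1 where "X1 = (\<lambda>\<zeta>. ennreal l * (ennreal ((cmod (kern \<zeta> z))\<^sup>2 * pdist z \<zeta> powr (2 * \<delta>)) * indicator (ball 0 1) \<zeta>))"
    define X2 where "X2 = (\<lambda>\<zeta>. ennreal (\<eta> / l) * (ennreal ((cmod (disk_cut \<phi> \<zeta>))\<^sup>2 * pdist z \<zeta> powr (- 2 * (2 * \<delta>))) * indicator (ball 0 1) \<zeta>))"
    define X3 where "X3 = (\<lambda>\<zeta>. ennreal (1 / (l * \<eta>)) * (ennreal ((cmod (disk_cut \<phi> \<zeta>))\<^sup>2) * indicator (ball 0 1 - ball 0 R) \<zeta>))"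
    define X4 where "X4 = (\<lambda>\<zeta>. ennreal c * ennreal (cmod (disk_cut \<phi> \<zeta>)))"
    have [measurable]: "X1 \<in> borel_measurable borel" "X2 \<in> borel_measurable borel" "X3 \<in> borel_measurable borel" "X4 \<in> borel_measurable borel"
      unfolding X1_def X2_def X3_def X4_def by measurable
    have "(\<integral>\<^sup>+\<zeta>\<in>ball 0 1. ennreal (cmod (kern \<zeta> z) * cmod (\<phi> \<zeta>)) \<partial>lborel)
      \<le> (\<integral>\<^sup>+\<zeta>. X1 \<zeta> + X2 \<zeta> + X3 \<zeta> + X4 \<zeta> \<partial>lborel)"
    proof (rule nn_integral_mono_AE)
      show "AE \<zeta> in lborel. ennreal (cmod (kern \<zeta> z) * cmod (\<phi> \<zeta>)) * indicator (ball 0 1) \<zeta> \<le> X1 \<zeta> + X2 \<zeta> + X3 \<zeta> + X4 \<zeta>"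
        using AE_lborel_singleton[of z]
      proof eventually_elim
        case (elim \<zeta>)
        consider "\<zeta> \<notin> ball 0 1" | "\<zeta> \<in> ball 0 R" | "\<zeta> \<in> ball 0 1 - ball 0 R" by blast
        thus ?case
        proof cases
          case 2
          have 21: "\<zeta> \<in> ball 0 1" using 2 R by auto
          have "cmod z - R \<le> cmod (\<zeta> - z)" using 2 norm_triangle_ineq2[of z \<zeta>] by (simp add: norm_minus_commute)
          moreover have "cmod z - R \<le> cmod (1 - \<zeta> * cnj z)"
            using one_minus_mult_norm_ge[of "cnj z" \<zeta> R] 2 z by (simp add: mult.commute)
          ultimately have "(cmod z - R)\<^sup>2 \<le> cmod (\<zeta> - z) * cmod (1 - \<zeta> * cnj z)"
            unfolding power2_eq_square using z by (intro mult_mono) auto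
          moreover have "cmod (kern \<zeta> z) = (1 - (cmod z)\<^sup>2) / (cmod (\<zeta> - z) * cmod (1 - \<zeta> * cnj z))"
          proof -
            have "cmod (1 - of_real ((cmod z)\<^sup>2)) = 1 - (cmod z)\<^sup>2"
              using z by (metis abs_of_nonneg abs_square_le_1 abs_norm_cancel diff_ge_0_iff_ge less_imp_le norm_of_real of_real_1 of_real_diff)
            thus ?thesis using kern_eq[of z \<zeta>] z 21 elim by (simp add: norm_divide norm_mult)
          qed
          ultimately have "cmod (kern \<zeta> z) \<le> c"
            unfolding c_def using z by (auto intro!: divide_left_mono mult_pos_pos simp: abs_square_le_1)
          hence "ennreal (cmod (kern \<zeta> z) * cmod (\<phi> \<zeta>)) * indicator (ball 0 1) \<zeta> \<le> X4 \<zeta>"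
            using 21 c(1) unfolding X4_def by (simp add: disk_cut_def ennreal_mult'[symmetric] ennreal_leI mult_right_mono)
          also have "\<dots> \<le> X1 \<zeta> + X2 \<zeta> + X3 \<zeta> + X4 \<zeta>" by (simp add: add_increasing)
          finally show ?thesis .
        next
          case 3
          define x where "x = pdist z \<zeta> powr (- 2 * \<delta>)"
          have "1 - \<zeta> * cnj z \<noteq> 0" using one_minus_mult_nz[of z \<zeta>] z 3 by simp
          hence p: "0 < pdist z \<zeta>" using elim by (simp add: pdist_def)
          hence x: "x > 0" by (simp add: x_def)
          have pw: "pdist z \<zeta> powr (2 * \<delta>) * x = 1" "pdist z \<zeta> powr (- 2 * (2 * \<delta>)) = x\<^sup>2"
            using p unfolding x_def by (simp_all add: powr_add[symmetric] power2_eq_square)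
          have "2 * (\<eta> * x) * 1 \<le> (\<eta> * x)\<^sup>2 + 1\<^sup>2" by (rule sum_squares_bound)
          hence "\<eta> * x \<le> \<eta>\<^sup>2 * x\<^sup>2 + 1" using mult_pos_pos[OF \<eta> x] by (simp add: power_mult_distrib)
          hence x2: "x \<le> \<eta> * x\<^sup>2 + 1 / \<eta>" using \<eta> by (simp add: field_simps power2_eq_square)
          have "cmod (kern \<zeta> z) * cmod (\<phi> \<zeta>) \<le> l * ((cmod (kern \<zeta> z))\<^sup>2 * pdist z \<zeta> powr (2 * \<delta>)) + (1 / l) * ((cmod (\<phi> \<zeta>))\<^sup>2 * x)"
            by (rule am_gm_weight) (use pw p l in auto)
          also have "(1 / l) * ((cmod (\<phi> \<zeta>))\<^sup>2 * x) \<le> (1 / l) * ((cmod (\<phi> \<zeta>))\<^sup>2 * (\<eta> * x\<^sup>2 + 1 / \<eta>))"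
            using l x2 by (intro mult_left_mono) auto
          also have "\<dots> = (\<eta> / l) * ((cmod (\<phi> \<zeta>))\<^sup>2 * x\<^sup>2) + (1 / (l * \<eta>)) * (cmod (\<phi> \<zeta>))\<^sup>2"
            using l \<eta> by (simp add: field_simps)
          finally have "ennreal (cmod (kern \<zeta> z) * cmod (\<phi> \<zeta>)) \<le> ennreal (l * ((cmod (kern \<zeta> z))\<^sup>2 * pdist z \<zeta> powr (2 * \<delta>))
             + ((\<eta> / l) * ((cmod (\<phi> \<zeta>))\<^sup>2 * x\<^sup>2) + (1 / (l * \<eta>)) * (cmod (\<phi> \<zeta>))\<^sup>2))"
            by (intro ennreal_leI) simp
          also have "\<dots> = X1 \<zeta> + (X2 \<zeta> + X3 \<zeta>)"
          proof -
            have "X1 \<zeta> = ennreal (l * ((cmod (kern \<zeta> z))\<^sup>2 * pdist z \<zeta> powr (2 * \<delta>)))"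
              using 3 l by (simp add: X1_def ennreal_mult'[symmetric])
            moreover have "X2 \<zeta> = ennreal ((\<eta> / l) * ((cmod (\<phi> \<zeta>))\<^sup>2 * x\<^sup>2))"
              unfolding X2_def pw(2) using 3 l \<eta> by (simp add: disk_cut_def ennreal_mult'[symmetric])
            moreover have "X3 \<zeta> = ennreal ((1 / (l * \<eta>)) * (cmod (\<phi> \<zeta>))\<^sup>2)"
              unfolding X3_def using 3 l \<eta> by (simp add: disk_cut_def ennreal_mult'[symmetric])
            ultimately show ?thesis using l \<eta> by (simp only: ennreal_plus[symmetric] mult_nonneg_nonneg add_nonneg_nonneg
                  divide_nonneg_nonneg less_imp_le zero_le_power2 powr_ge_zero zero_le_one)
          qed
          also have "\<dots> \<le> X1 \<zeta> + X2 \<zeta> + X3 \<zeta> + X4 \<zeta>" by (simp add: add.assoc add_left_mono add_increasing2)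
          finally show ?thesis using 3 by simp
        qed simp
      qed
    qed
    also have "\<dots> = (\<integral>\<^sup>+\<zeta>. X1 \<zeta> \<partial>lborel) + (\<integral>\<^sup>+\<zeta>. X2 \<zeta> \<partial>lborel) + (\<integral>\<^sup>+\<zeta>. X3 \<zeta> \<partial>lborel) + (\<integral>\<^sup>+\<zeta>. X4 \<zeta> \<partial>lborel)"
      by (simp add: nn_integral_add)
    also have "\<dots> \<le> ennreal (e / 4) + ennreal (e / 4) + ennreal (e / 4) + ennreal (e / 4)"
    proof (intro add_mono)
      have "(\<integral>\<^sup>+\<zeta>. X1 \<zeta> \<partial>lborel) = ennreal l * ennreal (pi / \<delta>)"
        unfolding X1_def kern_weighted_norm[of z \<delta>, symmetric, OF conjunct2[OF z] \<delta>] by (rule nn_integral_cmult) measurable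
      also have "\<dots> = ennreal (e / 4)" using l \<delta> by (simp add: ennreal_mult'[symmetric] l_def)
      finally show "(\<integral>\<^sup>+\<zeta>. X1 \<zeta> \<partial>lborel) \<le> ennreal (e / 4)" by simp
      have "(\<integral>\<^sup>+\<zeta>. X2 \<zeta> \<partial>lborel) = ennreal (\<eta> / l) * wnorm (2 * \<delta>) (disk_cut \<phi>) z"
        unfolding X2_def wnorm_def by (rule nn_integral_cmult) measurable
      also have "wnorm (2 * \<delta>) (disk_cut \<phi>) z = wnorm (2 * \<delta>) \<phi> z" by (rule wnorm_cong) (simp add: disk_cut_def)
      also have "ennreal (\<eta> / l) * wnorm (2 * \<delta>) \<phi> z \<le> ennreal (\<eta> / l) * ennreal M"
        using z by (intro mult_left_mono M) auto
      also have "\<dots> = ennreal (\<eta> / l * M)" using l \<eta> by (intro ennreal_mult'[symmetric]) simp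
      also have "\<eta> / l * M = e / 4" using l M0 by (simp add: \<eta>_def)
      finally show "(\<integral>\<^sup>+\<zeta>. X2 \<zeta> \<partial>lborel) \<le> ennreal (e / 4)" .
      have "(\<integral>\<^sup>+\<zeta>. X3 \<zeta> \<partial>lborel) = ennreal (1 / (l * \<eta>)) * (\<integral>\<^sup>+\<zeta>\<in>ball 0 1 - ball 0 R. ennreal ((cmod (disk_cut \<phi> \<zeta>))\<^sup>2) \<partial>lborel)"
        unfolding X3_def by (rule nn_integral_cmult) measurable
      also have "(\<integral>\<^sup>+\<zeta>\<in>ball 0 1 - ball 0 R. ennreal ((cmod (disk_cut \<phi> \<zeta>))\<^sup>2) \<partial>lborel) = (\<integral>\<^sup>+\<zeta>\<in>ball 0 1 - ball 0 R. ennreal ((cmod (\<phi> \<zeta>))\<^sup>2) \<partial>lborel)"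
        by (intro nn_integral_cong) (auto simp: disk_cut_def indicator_def)
      also have "ennreal (1 / (l * \<eta>)) * \<dots> \<le> ennreal (1 / (l * \<eta>)) * ennreal (e * l * \<eta> / 4)"
        using R(3) by (intro mult_left_mono) auto
      also have "\<dots> = ennreal (e / 4)" using l \<eta> by (simp add: ennreal_mult'[symmetric])
      finally show "(\<integral>\<^sup>+\<zeta>. X3 \<zeta> \<partial>lborel) \<le> ennreal (e / 4)" .
      have "(\<integral>\<^sup>+\<zeta>. X4 \<zeta> \<partial>lborel) = ennreal c * ennreal I"
        unfolding X4_def I[symmetric] by (rule nn_integral_cmult) measurable
      also have "\<dots> \<le> ennreal (e / 4)" using c by (simp add: ennreal_mult'[symmetric] ennreal_leI)
      finally show "(\<integral>\<^sup>+\<zeta>. X4 \<zeta> \<partial>lborel) \<le> ennreal (e / 4)" .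
    qed
    also have "\<dots> = ennreal e" using e by (simp add: ennreal_plus[symmetric] del: ennreal_plus)
    finally have "ennreal (cmod (K_op \<phi> z)) \<le> ennreal (1 / pi) * ennreal e"
      by (intro order_trans[OF K_op_norm_le_nn_integral] mult_left_mono) auto
    hence "ennreal (cmod (K_op \<phi> z)) \<le> ennreal ((1 / pi) * e)"
      by (subst ennreal_mult') simp_all
    hence "cmod (K_op \<phi> z) \<le> (1 / pi) * e" using e by (subst (asm) ennreal_le_iff) auto
    also have "\<dots> < e" using e pi_gt3 by (simp add: field_simps)
    finally show "cmod (K_op \<phi> z) < e" .
  qed (use r R in auto)
qed

section \<open>Poisson integrals of Hoelder functions\<close>

lemma sin_ge_third:
  assumes "0 \<le> y" "y \<le> pi / 2"
  shows "y / 3 \<le> sin y"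
proof -
  have "\<bar>sin y - y\<bar> \<le> y ^ 3 / 6"
    using Maclaurin_sin_bound[of y 3] assms by (simp add: numeral_eq_Suc sin_coeff_def fact_numeral field_simps)
  hence 1: "sin y \<ge> y - y ^ 3 / 6" by linarith
  have "y \<le> 2" using assms pi_less_4 by simp
  hence "y\<^sup>2 \<le> 4" using assms power_mono[of y 2 2] by simp
  hence "y * y\<^sup>2 \<le> y * 4" using assms by (intro mult_left_mono)
  thus ?thesis using 1 by (simp add: power3_eq_cube power2_eq_square)
qed

lemma cis_diff_norm:
  fixes s t :: real
  shows "cmod (cis s - cis t) = 2 * \<bar>sin ((s - t) / 2)\<bar>"
proof -
  have "(cmod (cis s - cis t))\<^sup>2 = 2 - 2 * cos (s - t)"
    using sin_cos_squared_add[of s] sin_cos_squared_add[of t]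
    unfolding cmod_power2 by (simp add: power2_diff cos_diff algebra_simps)
  also have "\<dots> = (2 * \<bar>sin ((s - t) / 2)\<bar>)\<^sup>2"
  proof -
    define x where "x = (s - t) / 2"
    have "s - t = 2 * x" by (simp add: x_def)
    thus ?thesis unfolding x_def[symmetric] by (simp add: cos_double_sin power_mult_distrib)
  qed
  finally show ?thesis by (rule power2_eq_imp_eq) auto
qed

lemma cis_diff_norm_ge:
  fixes s t :: real
  assumes "\<bar>s - t\<bar> \<le> 2 * pi"
  shows "min \<bar>s - t\<bar> (min \<bar>s - t - 2 * pi\<bar> \<bar>s - t + 2 * pi\<bar>) / 3 \<le> cmod (cis s - cis t)"
proof -
  define y where "y = \<bar>s - t\<bar> / 2"
  have y: "0 \<le> y" "y \<le> pi" using assms by (auto simp: y_def)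
  have sy: "\<bar>sin ((s - t) / 2)\<bar> = sin y"
  proof -
    have "sin y \<ge> 0" using y by (intro sin_ge_zero)
    moreover have "y = (s - t) / 2 \<or> y = - ((s - t) / 2)" unfolding y_def by linarith
    hence "sin y = sin ((s - t) / 2) \<or> sin y = - sin ((s - t) / 2)" using sin_minus by metis
    ultimately show ?thesis by auto
  qed
  have A: "min y (pi - y) / 3 \<le> sin y"
  proof (cases "y \<le> pi / 2")
    case True thus ?thesis using sin_ge_third[of y] y by auto
  next
    case False thus ?thesis using sin_ge_third[of "pi - y"] y by auto
  qed
  have B: "min \<bar>s - t\<bar> (min \<bar>s - t - 2 * pi\<bar> \<bar>s - t + 2 * pi\<bar>) \<le> 2 * min y (pi - y)"
  proof -
    have "\<bar>s - t - 2 * pi\<bar> = 2 * pi - \<bar>s - t\<bar> \<or> \<bar>s - t + 2 * pi\<bar> = 2 * pi - \<bar>s - t\<bar>"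
      using assms by linarith
    moreover have "2 * min y (pi - y) = min \<bar>s - t\<bar> (2 * pi - \<bar>s - t\<bar>)"
      by (simp add: y_def min_def)
    ultimately show ?thesis by (auto simp: min_def)
  qed
  have "X / 3 \<le> 2 * S" if "X \<le> 2 * Y" "Y / 3 \<le> S" for X Y S :: real using that by simp
  from this[OF B A] show ?thesis unfolding cis_diff_norm sy .
qed

text \<open>
  The rescaled majorant of the kernel on the circle; the factor 6 is produced by the comparison of
  chords and angles below.
\<close>

lemma finite_power_tail:
  assumes a: "a < 1"
  shows "(\<integral>\<^sup>+x. ennreal (max 1 (\<bar>x\<bar> / 6) powr (a - 2)) \<partial>lborel) < \<infinity>"
proof -
  define f where "f = (\<lambda>x::real. ennreal (max 1 (\<bar>x\<bar> / 6) powr (a - 2)))"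
  define g where "g = (\<lambda>x::real. (x / 6) powr (a - 2))"
  have tail: "(\<integral>\<^sup>+x. ennreal (g x) * indicator {6..} x \<partial>lborel) = ennreal (0 - (6 * (6 / 6) powr (a - 1) / (a - 1)))"
  proof (rule nn_integral_FTC_atLeast[where F="\<lambda>x. 6 * (x / 6) powr (a - 1) / (a - 1)"])
    show "((\<lambda>x. 6 * (x / 6) powr (a - 1) / (a - 1)) has_real_derivative g x) (at x)" if "6 \<le> x" for x
    proof -
      have "((\<lambda>x. (x / 6) powr (a - 1)) has_real_derivative (a - 1) * (x / 6) powr (a - 1 - 1) * (1 / 6)) (at x)"
        by (rule DERIV_chain2[OF has_real_derivative_powr]) (use that in \<open>auto intro!: derivative_eq_intros\<close>)
      from DERIV_cdivide[OF DERIV_cmult[OF this, of 6], of "a - 1"] show ?thesis using a by (simp add: g_def)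
    qed
    have "((\<lambda>x::real. (x / 6) powr (a - 1)) \<longlongrightarrow> 0) at_top"
    proof (rule tendsto_neg_powr)
      show "filterlim (\<lambda>x::real. x / 6) at_top at_top"
        using filterlim_tendsto_pos_mult_at_top[OF tendsto_const[of "1/6::real"] _ filterlim_ident] by simp
    qed (use a in auto)
    from tendsto_mult_right_zero[OF this, of "6 / (a - 1)"]
    show "((\<lambda>x. 6 * (x / 6) powr (a - 1) / (a - 1)) \<longlongrightarrow> 0) at_top" by simp
  qed (auto simp: g_def)
  have "(\<integral>\<^sup>+x. f x \<partial>lborel) \<le> (\<integral>\<^sup>+x. indicator {-6..6} x + (ennreal (g x) * indicator {6..} x + ennreal (g (- x)) * indicator {6..} (- x)) \<partial>lborel)"
  proof (rule nn_integral_mono)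
    fix x :: real
    consider "x \<in> {-6..6}" | "x > 6" | "x < -6" by fastforce
    thus "f x \<le> indicator {-6..6} x + (ennreal (g x) * indicator {6..} x + ennreal (g (- x)) * indicator {6..} (- x))"
    proof cases
      case 1
      hence "\<bar>x\<bar> / 6 \<le> 1" by auto
      hence "max 1 (\<bar>x\<bar> / 6) = 1" by (rule max_absorb1)
      hence "f x = 1" by (simp add: f_def)
      thus ?thesis using 1 by (simp add: add_increasing2)
    qed (auto simp: f_def g_def max_def add_increasing2 add_increasing)
  qed
  also have "\<dots> = (\<integral>\<^sup>+x. indicator {-6..6::real} x \<partial>lborel) + ((\<integral>\<^sup>+x. ennreal (g x) * indicator {6..} x \<partial>lborel)
      + (\<integral>\<^sup>+x. ennreal (g (- x)) * indicator {6..} (- x) \<partial>lborel))"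
    by (subst nn_integral_add, simp, simp add: g_def, subst nn_integral_add) (auto simp: g_def)
  also have "(\<integral>\<^sup>+x. ennreal (g (- x)) * indicator {6..} (- x) \<partial>lborel) = (\<integral>\<^sup>+x. ennreal (g x) * indicator {6..} x \<partial>lborel)"
    using nn_integral_real_affine[of "\<lambda>x. ennreal (g x) * indicator {6..} x" "-1" 0] by (simp add: g_def)
  also have "(\<integral>\<^sup>+x. indicator {-6..6::real} x \<partial>lborel) + ((\<integral>\<^sup>+x. ennreal (g x) * indicator {6..} x \<partial>lborel)
      + (\<integral>\<^sup>+x. ennreal (g x) * indicator {6..} x \<partial>lborel)) < \<infinity>"
    unfolding tail by (simp add: ennreal_add_less_top)
  finally show ?thesis by (simp add: f_def)
qed

text \<open>
  With \<open>d = 1 - |z|\<close>, the distance \<open>|cis \<theta> - z|\<close> is at least \<open>d\<close> and at least a fixed multiple of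
  the angle to \<open>z\<close>. Rescaling the angle by \<open>d\<close> gives the power \<open>d powr (\<alpha> - 2) * d\<close>.
\<close>

lemma circle_kernel_integral:
  assumes \<alpha>: "0 < \<alpha>" "\<alpha> < 1"
  obtains K where "K \<ge> 0"
    "\<And>z. cmod z < 1 \<Longrightarrow> integral {0..2*pi} (\<lambda>\<theta>. cmod (cis \<theta> - z) powr (\<alpha> - 2)) \<le> K * (1 - cmod z) powr (\<alpha> - 1)"
proof -
  define f where "f = (\<lambda>x::real. max 1 (\<bar>x\<bar> / 6) powr (\<alpha> - 2))"
  define K where "K = enn2real (\<integral>\<^sup>+x. ennreal (f x) \<partial>lborel)"
  have [measurable]: "f \<in> borel_measurable borel" unfolding f_def by measurable
  have K: "(\<integral>\<^sup>+x. ennreal (f x) \<partial>lborel) = ennreal K" "K \<ge> 0"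
    using finite_power_tail[of \<alpha>] \<alpha> by (auto simp: K_def f_def less_top)
  show ?thesis
  proof
    show "3 * K \<ge> 0" using K by simp
    fix z :: complex assume z: "cmod z < 1"
    define d where "d = 1 - cmod z"
    have d: "d > 0" using z by (simp add: d_def)
    define \<phi> where "\<phi> = Arg2pi z"
    have \<phi>: "0 \<le> \<phi>" "\<phi> < 2 * pi" using Arg2pi[of z] by (auto simp: \<phi>_def)
    have zz: "z = of_real (cmod z) * cis \<phi>" using Arg2pi[of z] by (simp add: \<phi>_def is_Arg_def cis_conv_exp)
    define m where "m = (\<lambda>c \<theta>. f ((\<theta> - c) / d))"
    have scaled: "(\<integral>\<^sup>+\<theta>. ennreal (m c \<theta>) \<partial>lborel) = ennreal (d * K)" for c
    proof -
      have "(\<integral>\<^sup>+\<theta>. ennreal (m c \<theta>) \<partial>lborel) = ennreal d * (\<integral>\<^sup>+x. ennreal (m c (c + d * x)) \<partial>lborel)"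
        using nn_integral_real_affine[of "\<lambda>\<theta>. ennreal (m c \<theta>)" d c] d by (simp add: m_def)
      also have "\<dots> = ennreal d * ennreal K" using d K(1) by (simp add: m_def)
      finally show ?thesis using d by (simp add: ennreal_mult')
    qed
    have pt: "cmod (cis \<theta> - z) powr (\<alpha> - 2) \<le> d powr (\<alpha> - 2) * (m \<phi> \<theta> + m (\<phi> + 2 * pi) \<theta> + m (\<phi> - 2 * pi) \<theta>)"
      if \<theta>: "\<theta> \<in> {0..2*pi}" for \<theta>
    proof -
      define y where "y = min \<bar>\<theta> - \<phi>\<bar> (min \<bar>\<theta> - \<phi> - 2 * pi\<bar> \<bar>\<theta> - \<phi> + 2 * pi\<bar>)"
      have y0: "y \<ge> 0" by (simp add: y_def)
      have d1: "d \<le> cmod (cis \<theta> - z)" using norm_triangle_ineq2[of "cis \<theta>" z] by (simp add: d_def)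
      have "cmod (z - cis \<phi>) = d"
      proof -
        have "z - cis \<phi> = of_real (cmod z - 1) * cis \<phi>" by (subst zz) (simp add: algebra_simps)
        hence "cmod (z - cis \<phi>) = \<bar>cmod z - 1\<bar>" by (simp only: norm_mult norm_of_real norm_cis mult_1_right)
        thus ?thesis using z by (simp add: d_def)
      qed
      hence "cmod (cis \<theta> - cis \<phi>) \<le> 2 * cmod (cis \<theta> - z)"
        using norm_triangle_ineq[of "cis \<theta> - z" "z - cis \<phi>"] d1 by simp
      moreover have "y / 3 \<le> cmod (cis \<theta> - cis \<phi>)" unfolding y_def
        using \<theta> \<phi> by (intro cis_diff_norm_ge) auto
      ultimately have "y / 6 \<le> cmod (cis \<theta> - z)" by simp
      hence le: "d * max 1 (\<bar>y / d\<bar> / 6) \<le> cmod (cis \<theta> - z)"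
        using d d1 y0 by (auto simp: max_def field_simps)
      have "cmod (cis \<theta> - z) powr (\<alpha> - 2) \<le> (d * max 1 (\<bar>y / d\<bar> / 6)) powr (\<alpha> - 2)"
        using le d \<alpha> by (intro powr_mono2') auto
      also have "\<dots> = d powr (\<alpha> - 2) * f (y / d)" using d by (simp add: powr_mult f_def)
      also have "f (y / d) \<le> m \<phi> \<theta> + m (\<phi> + 2 * pi) \<theta> + m (\<phi> - 2 * pi) \<theta>"
      proof -
        have f0: "f x \<ge> 0" "f \<bar>x\<bar> = f x" for x by (auto simp: f_def)
        have fa: "f (\<bar>x\<bar> / d) = f (x / d)" for x using f0(2)[of "x / d"] d by simp
        have "y = \<bar>\<theta> - \<phi>\<bar> \<or> y = \<bar>\<theta> - (\<phi> + 2 * pi)\<bar> \<or> y = \<bar>\<theta> - (\<phi> - 2 * pi)\<bar>"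
          by (auto simp: y_def min_def algebra_simps)
        hence "f (y / d) \<in> {m \<phi> \<theta>, m (\<phi> + 2 * pi) \<theta>, m (\<phi> - 2 * pi) \<theta>}"
          unfolding m_def by (auto simp only: fa insert_iff)
        moreover have "m c \<theta> \<ge> 0" for c by (simp add: m_def f0)
        ultimately show ?thesis by (auto simp: add_increasing add_increasing2 add_nonneg_nonneg)
      qed
      finally show ?thesis by (simp add: mult_left_mono)
    qed
    define I where "I = integral {0..2*pi} (\<lambda>\<theta>. cmod (cis \<theta> - z) powr (\<alpha> - 2))"
    have nz: "cis \<theta> - z \<noteq> 0" for \<theta> using z by (metis eq_iff_diff_eq_0 less_irrefl norm_cis)
    have "((\<lambda>\<theta>. cmod (cis \<theta> - z) powr (\<alpha> - 2)) has_integral I) {0..2*pi}"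
      unfolding I_def using nz by (intro integrable_integral integrable_continuous_interval continuous_intros) auto
    hence "ennreal I = (\<integral>\<^sup>+\<theta>. ennreal (indicator {0..2*pi} \<theta> * cmod (cis \<theta> - z) powr (\<alpha> - 2)) \<partial>lborel)"
      by (intro nn_integral_has_integral_lebesgue[symmetric]) auto
    also have "\<dots> \<le> (\<integral>\<^sup>+\<theta>. ennreal (d powr (\<alpha> - 2)) * (ennreal (m \<phi> \<theta>) + ennreal (m (\<phi> + 2 * pi) \<theta>) + ennreal (m (\<phi> - 2 * pi) \<theta>)) \<partial>lborel)"
    proof (rule nn_integral_mono)
      fix \<theta> :: real
      have m0: "m c \<theta> \<ge> 0" for c by (simp add: m_def f_def)
      have e: "ennreal (d powr (\<alpha> - 2)) * (ennreal (m \<phi> \<theta>) + ennreal (m (\<phi> + 2 * pi) \<theta>) + ennreal (m (\<phi> - 2 * pi) \<theta>))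
         = ennreal (d powr (\<alpha> - 2) * (m \<phi> \<theta> + m (\<phi> + 2 * pi) \<theta> + m (\<phi> - 2 * pi) \<theta>))"
        using m0 by (subst ennreal_mult') (auto simp: ennreal_plus)
      show "ennreal (indicator {0..2*pi} \<theta> * cmod (cis \<theta> - z) powr (\<alpha> - 2)) \<le> ennreal (d powr (\<alpha> - 2)) * (ennreal (m \<phi> \<theta>) + ennreal (m (\<phi> + 2 * pi) \<theta>) + ennreal (m (\<phi> - 2 * pi) \<theta>))"
        unfolding e using pt[of \<theta>] m0 by (intro ennreal_leI) (auto simp: indicator_def)
    qed
    also have "\<dots> = ennreal (d powr (\<alpha> - 2)) * (ennreal (d * K) + ennreal (d * K) + ennreal (d * K))"
    proof -
      have [measurable]: "m c \<in> borel_measurable borel" for c unfolding m_def by measurable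
      show ?thesis by (simp add: nn_integral_cmult nn_integral_add scaled)
    qed
    also have "\<dots> = ennreal (d powr (\<alpha> - 2) * (3 * (d * K)))"
    proof -
      have "ennreal x + ennreal x + ennreal x = ennreal (3 * x)" if "x \<ge> 0" for x
        using that by (simp flip: ennreal_plus)
      thus ?thesis using d K(2) by (subst ennreal_mult') (auto simp del: ennreal_plus)
    qed
    finally have "I \<le> d powr (\<alpha> - 2) * (3 * (d * K))" using d K(2) by (subst (asm) ennreal_le_iff) auto
    also have "\<dots> = 3 * K * (d powr (\<alpha> - 2) * d powr 1)" using d by simp
    also have "d powr (\<alpha> - 2) * d powr 1 = d powr (\<alpha> - 1)" unfolding powr_add[symmetric] by simp
    finally show "integral {0..2*pi} (\<lambda>\<theta>. cmod (cis \<theta> - z) powr (\<alpha> - 2)) \<le> 3 * K * (1 - cmod z) powr (\<alpha> - 1)"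
      by (simp add: I_def d_def)
  qed
qed

lemma contour_integral_unit_circle:
  "contour_integral (circlepath 0 1) g = integral {0..2*pi} (\<lambda>\<theta>. g (cis \<theta>) * (\<i> * cis \<theta>))"
  unfolding circlepath_def by (subst contour_integral_part_circlepath_eq) (auto simp: mult_ac)

definition cauchy_circle :: "(complex \<Rightarrow> complex) \<Rightarrow> complex \<Rightarrow> complex" where
  "cauchy_circle f z = contour_integral (circlepath 0 1) (\<lambda>u. f u / (u - z)) / (2 * of_real pi * \<i>)"

lemma circle_ne: "cmod z < 1 \<Longrightarrow> u \<in> sphere 0 1 \<Longrightarrow> u - z \<noteq> 0"
  by auto

lemma cauchy_circle_deriv:
  assumes f: "continuous_on (sphere 0 1) f" and z: "cmod z < 1"
  shows "(cauchy_circle f has_field_derivative contour_integral (circlepath 0 1) (\<lambda>u. f u / (u - z) ^ 2) / (2 * of_real pi * \<i>)) (at z)"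
proof -
  have "((\<lambda>w. contour_integral (circlepath 0 1) (\<lambda>u. f u / (u - w))) has_field_derivative
      (of_nat 1 * contour_integral (circlepath 0 1) (\<lambda>u. f u / (u - z) ^ Suc 1))) (at z)"
  proof (rule Cauchy_next_derivative_circlepath(2))
    show "continuous_on (path_image (circlepath 0 1)) f" using f by simp
    fix w :: complex assume "w \<in> ball 0 1"
    hence "(\<lambda>u. f u / (u - w)) contour_integrable_on circlepath 0 1"
      using f circle_ne[of w] by (intro contour_integrable_continuous_circlepath) (auto intro!: continuous_intros)
    thus "((\<lambda>u. f u / (u - w) ^ 1) has_contour_integral contour_integral (circlepath 0 1) (\<lambda>u. f u / (u - w))) (circlepath 0 1)"
      by (simp add: has_contour_integral_integral)
  qed (use z in auto)
  from DERIV_cdivide[OF this, of "2 * of_real pi * \<i>"]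
  show ?thesis by (simp add: cauchy_circle_def[abs_def] numeral_2_eq_2)
qed

lemma cauchy_circle_holomorphic:
  "continuous_on (sphere 0 1) f \<Longrightarrow> cauchy_circle f holomorphic_on ball 0 1"
  unfolding holomorphic_on_open[OF open_ball] using cauchy_circle_deriv by (metis mem_ball_0)

lemma cauchy_circle_1: "cmod z < 1 \<Longrightarrow> cauchy_circle (\<lambda>u. 1) z = 1"
  using Cauchy_integral_circlepath[of 0 1 "\<lambda>u. 1" z]
  by (simp add: cauchy_circle_def contour_integral_unique)

lemma contour_integral_inverse_square:
  assumes z: "cmod z < 1"
  shows "contour_integral (circlepath 0 1) (\<lambda>u. 1 / (u - z) ^ 2) = 0"
proof -
  have "(cauchy_circle (\<lambda>u. 1) has_field_derivative contour_integral (circlepath 0 1) (\<lambda>u. 1 / (u - z) ^ 2) / (2 * of_real pi * \<i>)) (at z)"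
    by (rule cauchy_circle_deriv) (use z in auto)
  moreover have "(cauchy_circle (\<lambda>u. 1) has_field_derivative 0) (at z)"
    by (rule has_field_derivative_transform_within_open[of "\<lambda>_. 1" _ _ "ball 0 1"]) (use z cauchy_circle_1 in auto)
  ultimately show ?thesis using DERIV_unique by fastforce
qed

text \<open>
  The second term of the kernel is the conjugate of a Cauchy kernel, as \<open>cnj u = 1 / u\<close> on the
  circle.
\<close>

lemma poisson_split:
  assumes f: "continuous_on (sphere 0 1) f" and z: "cmod z < 1"
  shows "poisson f z = cauchy_circle f z + cnj (z * cauchy_circle (\<lambda>u. cnj (f u) / u) z)"
proof -
  have nz: "1 - u * cnj z \<noteq> 0" if "u \<in> sphere 0 1" for u using one_minus_mult_nz[of z u] z that by simp
  have i1: "(\<lambda>u. f u / (u - z)) contour_integrable_on circlepath 0 1"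
    using f circle_ne[OF z] by (intro contour_integrable_continuous_circlepath) (auto intro!: continuous_intros)
  have i2: "(\<lambda>u. f u * cnj z / (1 - u * cnj z)) contour_integrable_on circlepath 0 1"
    using f nz by (intro contour_integrable_continuous_circlepath) (auto intro!: continuous_intros)
  have I: "contour_integral (circlepath 0 1) (\<lambda>u. kern u z * f u)
     = contour_integral (circlepath 0 1) (\<lambda>u. f u / (u - z)) + contour_integral (circlepath 0 1) (\<lambda>u. f u * cnj z / (1 - u * cnj z))"
    unfolding contour_integral_add[OF i1 i2, symmetric] kern_def by (simp add: ring_distribs mult.commute)
  have J: "cnj (contour_integral (circlepath 0 1) (\<lambda>u. f u * cnj z / (1 - u * cnj z)) / (2 * of_real pi * \<i>))
     = z * cauchy_circle (\<lambda>u. cnj (f u) / u) z"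
  proof -
    have "cnj (contour_integral (circlepath 0 1) (\<lambda>u. f u * cnj z / (1 - u * cnj z)))
       = integral {0..2*pi} (\<lambda>\<theta>. cnj (f (cis \<theta>) * cnj z / (1 - cis \<theta> * cnj z) * (\<i> * cis \<theta>)))"
      unfolding contour_integral_unit_circle by (rule integral_cnj)
    also have "\<dots> = integral {0..2*pi} (\<lambda>\<theta>. (- z) * (cnj (f (cis \<theta>)) / cis \<theta> / (cis \<theta> - z) * (\<i> * cis \<theta>)))"
    proof (rule Henstock_Kurzweil_Integration.integral_cong)
      fix \<theta>
      have c: "cnj (cis \<theta>) = 1 / cis \<theta>" by (simp add: cis_cnj divide_inverse)
      have ez: "cis \<theta> - z \<noteq> 0" by (rule circle_ne[OF z]) simp
      have e0: "cis \<theta> \<noteq> 0" by simp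
      have alg: "F * z / (1 - 1 / e * z) * (- \<i> * (1 / e)) = (- z) * (F / e / (e - z) * (\<i> * e))"
        if "e \<noteq> 0" "e - z \<noteq> 0" for e F :: complex
      proof -
        have "1 - 1 / e * z = (e - z) / e" using that by (simp add: diff_divide_distrib)
        thus ?thesis using that by simp
      qed
      show "cnj (f (cis \<theta>) * cnj z / (1 - cis \<theta> * cnj z) * (\<i> * cis \<theta>)) = (- z) * (cnj (f (cis \<theta>)) / cis \<theta> / (cis \<theta> - z) * (\<i> * cis \<theta>))"
        unfolding alg[OF e0 ez, symmetric] c[symmetric] by simp
    qed
    also have "\<dots> = (- z) * contour_integral (circlepath 0 1) (\<lambda>u. cnj (f u) / u / (u - z))"
      unfolding contour_integral_unit_circle by (rule integral_mult_right)
    finally show ?thesis by (simp add: cauchy_circle_def)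
  qed
  have "contour_integral (circlepath 0 1) (\<lambda>u. f u * cnj z / (1 - u * cnj z)) / (2 * of_real pi * \<i>)
     = cnj (z * cauchy_circle (\<lambda>u. cnj (f u) / u) z)"
    unfolding J[symmetric] complex_cnj_cnj ..
  moreover have "poisson f z = (contour_integral (circlepath 0 1) (\<lambda>u. f u / (u - z))
      + contour_integral (circlepath 0 1) (\<lambda>u. f u * cnj z / (1 - u * cnj z))) / (2 * of_real pi * \<i>)"
    unfolding poisson_def I by simp
  ultimately show ?thesis unfolding add_divide_distrib cauchy_circle_def[of f] by (simp only:)
qed

lemma kern_circle_norm:
  assumes z: "cmod z < 1" and u: "cmod u = 1"
  shows "cmod (kern u z) = (1 - (cmod z)\<^sup>2) / (cmod (u - z))\<^sup>2"
proof -
  have uu: "u * cnj u = 1" using u complex_norm_square[of u] by simp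
  have nz: "u - z \<noteq> 0" using z u by auto
  have "1 - u * cnj z = u * cnj (u - z)" using uu by (simp add: right_diff_distrib)
  moreover have "kern u z = (1 - of_real ((cmod z)\<^sup>2)) / ((u - z) * (1 - u * cnj z))"
  proof -
    have "1 - u * cnj z \<noteq> 0" using one_minus_mult_nz[of z u] z u by simp
    moreover have "complex_of_real ((cmod z)\<^sup>2) = z * cnj z" by (simp only: complex_norm_square)
    ultimately show ?thesis using nz unfolding kern_def by (simp add: divide_simps) (simp add: algebra_simps)
  qed
  moreover have "cmod (1 - of_real ((cmod z)\<^sup>2)) = 1 - (cmod z)\<^sup>2"
  proof -
    have "cmod (of_real (1 - (cmod z)\<^sup>2)) = \<bar>1 - (cmod z)\<^sup>2\<bar>" by (rule norm_of_real)
    thus ?thesis using z by (simp add: abs_square_le_1)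
  qed
  ultimately show ?thesis using u
    by (simp add: norm_divide norm_mult power2_eq_square flip: complex_cnj_diff)
qed

lemma circle_integral_norm_bound:
  assumes g: "continuous_on (sphere 0 1) g" and z: "cmod z < 1"
    and b: "\<And>\<theta>. cmod (g (cis \<theta>)) \<le> C * cmod (cis \<theta> - z) powr (\<alpha> - 2)"
  shows "cmod (contour_integral (circlepath 0 1) g / (2 * of_real pi * \<i>)) \<le> C * integral {0..2*pi} (\<lambda>\<theta>. cmod (cis \<theta> - z) powr (\<alpha> - 2))"
proof -
  have nz: "cis \<theta> - z \<noteq> 0" for \<theta> using circle_ne[OF z] by simp
  have ic: "(\<lambda>\<theta>. cmod (cis \<theta> - z) powr (\<alpha> - 2)) integrable_on {0..2*pi}"
    using nz by (intro integrable_continuous_interval continuous_intros) auto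
  have "continuous_on {0..2*pi} (\<lambda>\<theta>. g (cis \<theta>))"
    by (rule continuous_on_compose2[OF g]) (auto intro!: continuous_intros)
  hence ig: "(\<lambda>\<theta>. g (cis \<theta>) * (\<i> * cis \<theta>)) integrable_on {0..2*pi}"
    by (intro integrable_continuous_interval continuous_intros)
  have "cmod (contour_integral (circlepath 0 1) g) \<le> integral {0..2*pi} (\<lambda>\<theta>. C * cmod (cis \<theta> - z) powr (\<alpha> - 2))"
    unfolding contour_integral_unit_circle
    by (rule Henstock_Kurzweil_Integration.integral_norm_bound_integral[OF ig integrable_on_mult_right[OF ic]])
       (use b in \<open>simp add: norm_mult\<close>)
  hence 1: "cmod (contour_integral (circlepath 0 1) g) \<le> C * integral {0..2*pi} (\<lambda>\<theta>. cmod (cis \<theta> - z) powr (\<alpha> - 2))"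
    by simp
  have "cmod (contour_integral (circlepath 0 1) g / (2 * of_real pi * \<i>)) = cmod (contour_integral (circlepath 0 1) g) / (2 * pi)"
    by (simp add: norm_divide norm_mult)
  also have "\<dots> \<le> cmod (contour_integral (circlepath 0 1) g) / 1"
    using pi_gt3 by (intro divide_left_mono) auto
  finally show ?thesis using 1 by simp
qed

lemma nearest_circle_point:
  assumes "cmod z < 1"
  obtains u where "cmod u = 1" "cmod (z - u) = 1 - cmod z"
proof -
  define \<phi> where "\<phi> = Arg2pi z"
  have zz: "z = of_real (cmod z) * cis \<phi>" using Arg2pi[of z] by (simp add: \<phi>_def is_Arg_def cis_conv_exp)
  have "z - cis \<phi> = of_real (cmod z - 1) * cis \<phi>" by (subst zz) (simp add: algebra_simps)
  hence "cmod (z - cis \<phi>) = \<bar>cmod z - 1\<bar>" by (simp only: norm_mult norm_of_real norm_cis mult_1_right)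
  thus ?thesis using assms by (intro that[of "cis \<phi>"]) auto
qed

text \<open>
  Both integrals are unchanged if \<open>f u\<close> is subtracted from \<open>f\<close> for the point \<open>u\<close> of the circle next
  to \<open>z\<close>: the derivative of the Cauchy integral of a constant is 0, its Poisson integral is the
  constant. Then \<open>|f w - f u| \<le> C (2 |w - z|) powr \<alpha>\<close> reduces both bounds to
  \<open>circle_kernel_integral\<close>.
\<close>

lemma poisson_holder_bounds:
  fixes f :: "complex \<Rightarrow> complex"
  assumes \<alpha>: "0 < \<alpha>" "\<alpha> < 1" and C: "C \<ge> 0"
    and f: "\<And>u v. cmod u = 1 \<Longrightarrow> cmod v = 1 \<Longrightarrow> cmod (f u - f v) \<le> C * cmod (u - v) powr \<alpha>"
    and fc: "continuous_on (sphere 0 1) f"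
  obtains C' where "C' \<ge> 0" "\<And>z. cmod z < 1 \<Longrightarrow> cmod (deriv (cauchy_circle f) z) \<le> C' * (1 - cmod z) powr (\<alpha> - 1)"
    "\<And>z. cmod z < 1 \<Longrightarrow> \<exists>u. cmod u = 1 \<and> cmod (z - u) = 1 - cmod z \<and> cmod (poisson f z - f u) \<le> C' * (1 - cmod z) powr \<alpha>"
proof -
  obtain K where K: "K \<ge> 0"
    "\<And>z. cmod z < 1 \<Longrightarrow> integral {0..2*pi} (\<lambda>\<theta>. cmod (cis \<theta> - z) powr (\<alpha> - 2)) \<le> K * (1 - cmod z) powr (\<alpha> - 1)"
    using circle_kernel_integral[OF \<alpha>] by blast
  define B where "B = C * 2 powr \<alpha>"
  have B: "B \<ge> 0" using C by (simp add: B_def)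
  have hb: "cmod (f w - f u) \<le> B * cmod (w - z) powr \<alpha>"
    if z: "cmod z < 1" and u: "cmod u = 1" "cmod (z - u) = 1 - cmod z" and w: "cmod w = 1" for z u w
  proof -
    have "cmod (w - u) \<le> cmod (w - z) + cmod (z - u)" using norm_triangle_ineq[of "w - z" "z - u"] by simp
    also have "cmod (z - u) \<le> cmod (w - z)" using norm_triangle_ineq2[of w z] u w by simp
    finally have "cmod (w - u) powr \<alpha> \<le> (2 * cmod (w - z)) powr \<alpha>" using \<alpha> by (intro powr_mono2) auto
    hence "C * cmod (w - u) powr \<alpha> \<le> C * (2 * cmod (w - z)) powr \<alpha>" using C by (intro mult_left_mono)
    thus ?thesis using f[OF w u(1)] by (simp add: B_def powr_mult mult.assoc)
  qed
  have pw: "x powr \<alpha> / x\<^sup>2 = x powr (\<alpha> - 2)" if "x > 0" for x :: real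
    using that by (simp add: powr_diff)
  define C' where "C' = 2 * B * K"
  show ?thesis
  proof
    show "C' \<ge> 0" using B K by (simp add: C'_def)
    fix z :: complex assume z: "cmod z < 1"
    obtain u where u: "cmod u = 1" "cmod (z - u) = 1 - cmod z" using nearest_circle_point[OF z] by blast
    have pos: "cmod (cis \<theta> - z) > 0" for \<theta> using circle_ne[OF z, of "cis \<theta>"] by simp
    have d1: "(1 - cmod z) * (1 - cmod z) powr (\<alpha> - 1) = (1 - cmod z) powr \<alpha>"
      using z powr_add[of "1 - cmod z" 1 "\<alpha> - 1"] by simp
    have nzs: "w - z \<noteq> 0" if "w \<in> sphere 0 1" for w using circle_ne[OF z that] .
    have i1: "(\<lambda>w. f w / (w - z)\<^sup>2) contour_integrable_on circlepath 0 1" "(\<lambda>w. f u * (1 / (w - z)\<^sup>2)) contour_integrable_on circlepath 0 1"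
      using fc nzs by (auto intro!: contour_integrable_continuous_circlepath continuous_intros)
    have "contour_integral (circlepath 0 1) (\<lambda>w. f w / (w - z) ^ 2)
       = contour_integral (circlepath 0 1) (\<lambda>w. f w / (w - z)\<^sup>2) - contour_integral (circlepath 0 1) (\<lambda>w. f u * (1 / (w - z)\<^sup>2))"
      using contour_integral_inverse_square[OF z] nzs
      by (subst contour_integral_lmul) (auto intro!: contour_integrable_continuous_circlepath continuous_intros)
    also have "\<dots> = contour_integral (circlepath 0 1) (\<lambda>w. (f w - f u) / (w - z)\<^sup>2)"
      unfolding contour_integral_diff[OF i1, symmetric] by (simp add: diff_divide_distrib)
    finally have "deriv (cauchy_circle f) z = contour_integral (circlepath 0 1) (\<lambda>w. (f w - f u) / (w - z)\<^sup>2) / (2 * of_real pi * \<i>)"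
      using DERIV_imp_deriv[OF cauchy_circle_deriv[OF fc z]] by simp
    also have "cmod \<dots> \<le> B * integral {0..2*pi} (\<lambda>\<theta>. cmod (cis \<theta> - z) powr (\<alpha> - 2))"
    proof (rule circle_integral_norm_bound[OF _ z])
      show "continuous_on (sphere 0 1) (\<lambda>w. (f w - f u) / (w - z)\<^sup>2)" using fc nzs by (auto intro!: continuous_intros)
      fix \<theta>
      have "cmod ((f (cis \<theta>) - f u) / (cis \<theta> - z)\<^sup>2) = cmod (f (cis \<theta>) - f u) / (cmod (cis \<theta> - z))\<^sup>2"
        by (simp add: norm_divide norm_power)
      also have "\<dots> \<le> B * cmod (cis \<theta> - z) powr \<alpha> / (cmod (cis \<theta> - z))\<^sup>2"
        by (intro divide_right_mono hb[OF z u]) auto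
      also have "\<dots> = B * cmod (cis \<theta> - z) powr (\<alpha> - 2)" using pw[OF pos] by (simp flip: times_divide_eq_right)
      finally show "cmod ((f (cis \<theta>) - f u) / (cis \<theta> - z)\<^sup>2) \<le> B * cmod (cis \<theta> - z) powr (\<alpha> - 2)" .
    qed
    also have "\<dots> \<le> B * (K * (1 - cmod z) powr (\<alpha> - 1))" using K(2)[OF z] B by (intro mult_left_mono)
    also have "\<dots> \<le> C' * (1 - cmod z) powr (\<alpha> - 1)"
      using B K(1) by (simp add: C'_def mult_right_mono mult_left_mono flip: mult.assoc)
    finally show "cmod (deriv (cauchy_circle f) z) \<le> C' * (1 - cmod z) powr (\<alpha> - 1)" .
    have knz: "1 - w * cnj z \<noteq> 0" if "w \<in> sphere 0 1" for w using one_minus_mult_nz[of z w] z that by simp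
    have kc: "continuous_on (sphere 0 1) (\<lambda>w. kern w z)"
      unfolding kern_def using nzs knz by (auto intro!: continuous_intros)
    have p1: "poisson (\<lambda>_. 1) z = 1"
    proof -
      have "((\<lambda>w. cnj z / (1 - w * cnj z)) has_contour_integral 0) (circlepath 0 1)"
      proof (rule Cauchy_theorem_disc_simple[of _ 0 "1 / max (cmod z) (1/2)"])
        have "1 - w * cnj z \<noteq> 0" if "w \<in> ball 0 (1 / max (cmod z) (1/2))" for w
        proof
          assume "1 - w * cnj z = 0"
          hence "cmod w * cmod z = 1" by (metis complex_mod_cnj eq_iff_diff_eq_0 norm_mult norm_one)
          moreover have "cmod w * cmod z \<le> cmod w * max (cmod z) (1/2)" by (intro mult_left_mono) auto
          moreover have "cmod w * max (cmod z) (1/2) < 1" using that by (simp add: field_simps)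
          ultimately show False by simp
        qed
        thus "(\<lambda>w. cnj z / (1 - w * cnj z)) holomorphic_on ball 0 (1 / max (cmod z) (1/2))"
          by (auto intro!: holomorphic_intros)
        show "path_image (circlepath 0 1) \<subseteq> ball 0 (1 / max (cmod z) (1/2))"
          using z by (auto simp: field_simps)
      qed auto
      moreover have "((\<lambda>w. 1 / (w - z)) has_contour_integral (2 * of_real pi * \<i> * 1)) (circlepath 0 1)"
        using Cauchy_integral_circlepath[of 0 1 "\<lambda>u. 1" z] z by simp
      ultimately have "((\<lambda>w. 1 / (w - z) + cnj z / (1 - w * cnj z)) has_contour_integral (2 * of_real pi * \<i> * 1 + 0)) (circlepath 0 1)"
        by (intro has_contour_integral_add)
      hence "contour_integral (circlepath 0 1) (\<lambda>w. kern w z * 1) = 2 * of_real pi * \<i>"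
        unfolding kern_def by (simp add: contour_integral_unique)
      thus ?thesis by (simp add: poisson_def)
    qed
    have j1: "(\<lambda>w. kern w z * f w) contour_integrable_on circlepath 0 1" "(\<lambda>w. f u * (kern w z * 1)) contour_integrable_on circlepath 0 1"
      using fc kc by (auto intro!: contour_integrable_continuous_circlepath continuous_intros)
    have "poisson f z - f u = poisson f z - f u * poisson (\<lambda>_. 1) z" by (simp add: p1)
    also have "\<dots> = (contour_integral (circlepath 0 1) (\<lambda>w. kern w z * f w) - contour_integral (circlepath 0 1) (\<lambda>w. f u * (kern w z * 1))) / (2 * of_real pi * \<i>)"
    proof -
      have "contour_integral (circlepath 0 1) (\<lambda>w. f u * (kern w z * 1)) = f u * contour_integral (circlepath 0 1) (\<lambda>w. kern w z * 1)"
        using kc by (intro contour_integral_lmul contour_integrable_continuous_circlepath) auto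
      thus ?thesis by (simp add: poisson_def diff_divide_distrib)
    qed
    also have "\<dots> = contour_integral (circlepath 0 1) (\<lambda>w. kern w z * (f w - f u)) / (2 * of_real pi * \<i>)"
      unfolding contour_integral_diff[OF j1, symmetric] by (simp add: algebra_simps)
    also have "cmod \<dots> \<le> (2 * (1 - cmod z) * B) * integral {0..2*pi} (\<lambda>\<theta>. cmod (cis \<theta> - z) powr (\<alpha> - 2))"
    proof (rule circle_integral_norm_bound[OF _ z])
      show "continuous_on (sphere 0 1) (\<lambda>w. kern w z * (f w - f u))" using fc kc by (auto intro!: continuous_intros)
      fix \<theta>
      have "1 - (cmod z)\<^sup>2 = (1 - cmod z) * (1 + cmod z)" by (simp add: power2_eq_square algebra_simps)
      also have "\<dots> \<le> (1 - cmod z) * 2" using z by (intro mult_left_mono) auto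
      finally have z2: "1 - (cmod z)\<^sup>2 \<le> 2 * (1 - cmod z)" by simp
      have "cmod (kern (cis \<theta>) z * (f (cis \<theta>) - f u)) = (1 - (cmod z)\<^sup>2) / (cmod (cis \<theta> - z))\<^sup>2 * cmod (f (cis \<theta>) - f u)"
        by (simp add: norm_mult kern_circle_norm[OF z])
      also have "\<dots> \<le> (2 * (1 - cmod z)) / (cmod (cis \<theta> - z))\<^sup>2 * (B * cmod (cis \<theta> - z) powr \<alpha>)"
        using z2 z by (intro mult_mono divide_right_mono hb[OF z u]) auto
      also have "\<dots> = (2 * (1 - cmod z) * B) * (cmod (cis \<theta> - z) powr \<alpha> / (cmod (cis \<theta> - z))\<^sup>2)" by simp
      finally show "cmod (kern (cis \<theta>) z * (f (cis \<theta>) - f u)) \<le> (2 * (1 - cmod z) * B) * cmod (cis \<theta> - z) powr (\<alpha> - 2)"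
        unfolding pw[OF pos] .
    qed
    also have "\<dots> \<le> (2 * (1 - cmod z) * B) * (K * (1 - cmod z) powr (\<alpha> - 1))" using K(2)[OF z] B z by (intro mult_left_mono) auto
    also have "\<dots> = C' * ((1 - cmod z) * (1 - cmod z) powr (\<alpha> - 1))" by (simp add: C'_def mult_ac)
    also have "\<dots> = C' * (1 - cmod z) powr \<alpha>" by (simp only: d1)
    finally show "\<exists>u. cmod u = 1 \<and> cmod (z - u) = 1 - cmod z \<and> cmod (poisson f z - f u) \<le> C' * (1 - cmod z) powr \<alpha>"
      using u by blast
  qed
qed

section \<open>Uniform weighted bounds for the iterates\<close>

lemma nn_integral_disk_boundary_power:
  assumes s: "0 \<le> s" "s < 1"
  shows "(\<integral>\<^sup>+\<zeta>\<in>ball 0 1. ennreal ((1 - cmod \<zeta>) powr (- s)) \<partial>lborel) \<le> ennreal (2 * pi / (1 - s))"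
proof -
  define f where "f = (\<lambda>t::real. (1 - exp t) powr (- s) * exp t)"
  have [measurable]: "f \<in> borel_measurable borel" unfolding f_def by measurable
  have dp: "disk_polar 0 = exp" by (simp add: disk_polar_def[abs_def] mob_def)
  have de: "deriv exp w = exp w" for w :: complex by (rule DERIV_imp_deriv) (rule DERIV_exp)
  have m: "(\<lambda>\<zeta>::complex. ennreal ((1 - cmod \<zeta>) powr (- s))) \<in> borel_measurable borel" by measurable
  have "(\<integral>\<^sup>+\<zeta>\<in>ball 0 1. ennreal ((1 - cmod \<zeta>) powr (- s)) \<partial>lborel)
     = (\<integral>\<^sup>+w\<in>half_strip. ennreal ((1 - exp (Re w)) powr (- s)) * ennreal ((exp (Re w))\<^sup>2) \<partial>lborel)"
    using nn_integral_disk_polar[of 0, OF _ m] by (simp add: dp de)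
  also have "\<dots> \<le> (\<integral>\<^sup>+w\<in>half_strip. ennreal (f (Re w)) \<partial>lborel)"
  proof (rule nn_integral_mono)
    fix w :: complex
    show "ennreal ((1 - exp (Re w)) powr (- s)) * ennreal ((exp (Re w))\<^sup>2) * indicator half_strip w \<le> ennreal (f (Re w)) * indicator half_strip w"
    proof (cases "w \<in> half_strip")
      case True
      hence "exp (Re w) * exp (Re w) \<le> 1 * exp (Re w)" by (intro mult_right_mono) (auto simp: half_strip_def)
      hence "(1 - exp (Re w)) powr (- s) * (exp (Re w))\<^sup>2 \<le> f (Re w)"
        unfolding f_def by (intro mult_left_mono) (auto simp: power2_eq_square)
      thus ?thesis using True by (simp add: ennreal_mult'[symmetric] ennreal_leI)
    qed simp
  qed
  also have "\<dots> = (\<integral>\<^sup>+t\<in>{..<0}. (\<integral>\<^sup>+\<theta>\<in>{-pi<..<pi}. ennreal (f t) \<partial>lborel) \<partial>lborel)"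
    by (subst nn_integral_half_strip) auto
  also have "\<dots> = (\<integral>\<^sup>+t\<in>{..<0}. ennreal (f t) * ennreal (2 * pi) \<partial>lborel)"
    by (intro nn_integral_cong) (simp add: nn_integral_cmult)
  also have "\<dots> \<le> ennreal (2 * pi / (1 - s))"
  proof (rule nn_integral_negative_axis_limit)
    fix n :: nat
    define F where "F = (\<lambda>t. - ((1 - exp t) powr (1 - s) / (1 - s)))"
    have T: "- 1 / (real n + 1) < 0" by (simp add: field_simps)
    have le: "- real n - 1 \<le> - 1 / (real n + 1)"
    proof -
      have "1 / (real n + 1) \<le> 1" by simp
      moreover have "- 1 / (real n + 1) = - (1 / (real n + 1))" by simp
      ultimately show ?thesis using of_nat_0_le_iff[of n, where 'a=real] by linarith
    qed
    have "(\<integral>\<^sup>+t\<in>{- real n - 1..- 1 / (real n + 1)}. ennreal (f t) \<partial>lborel) = ennreal (F (- 1 / (real n + 1)) - F (- real n - 1))"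
    proof (rule nn_integral_FTC_Icc)
      fix t assume "t \<in> {- real n - 1..- 1 / (real n + 1)}"
      hence "t \<le> - 1 / (real n + 1)" by simp
      hence t: "t < 0" using T by linarith
      have "((\<lambda>t. (1 - exp t) powr (1 - s)) has_real_derivative (1 - s) * (1 - exp t) powr (1 - s - 1) * (- exp t)) (at t)"
        by (rule DERIV_chain2[OF has_real_derivative_powr]) (use t in \<open>auto intro!: derivative_eq_intros\<close>)
      from DERIV_minus[OF DERIV_cdivide[OF this, of "1 - s"]]
      show "(F has_real_derivative f t) (at t)" using s by (simp add: F_def f_def)
    qed (use le in \<open>auto simp: f_def\<close>)
    also have "\<dots> \<le> ennreal (1 / (1 - s))"
    proof (rule ennreal_leI)
      have "(1 - exp (- real n - 1)) powr (1 - s) \<le> 1" using s by (intro powr_le1) auto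
      hence "- F (- real n - 1) \<le> 1 / (1 - s)" using s unfolding F_def by (simp add: divide_right_mono)
      moreover have "F (- 1 / (real n + 1)) \<le> 0" using s by (simp add: F_def)
      ultimately show "F (- 1 / (real n + 1)) - F (- real n - 1) \<le> 1 / (1 - s)" by simp
    qed
    finally have 1: "(\<integral>\<^sup>+t\<in>{- real n - 1..- 1 / (real n + 1)}. ennreal (f t) \<partial>lborel) \<le> ennreal (1 / (1 - s))" .
    have "(\<integral>\<^sup>+t\<in>{- real n - 1..- 1 / (real n + 1)}. ennreal (f t) * ennreal (2 * pi) \<partial>lborel)
       = (\<integral>\<^sup>+t. ennreal (2 * pi) * (ennreal (f t) * indicator {- real n - 1..- 1 / (real n + 1)} t) \<partial>lborel)"
      by (intro nn_integral_cong) (simp add: mult_ac)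
    also have "\<dots> = ennreal (2 * pi) * (\<integral>\<^sup>+t\<in>{- real n - 1..- 1 / (real n + 1)}. ennreal (f t) \<partial>lborel)"
      by (rule nn_integral_cmult) measurable
    also have "\<dots> \<le> ennreal (2 * pi) * ennreal (1 / (1 - s))" by (intro mult_left_mono 1) simp
    also have "\<dots> = ennreal (2 * pi / (1 - s))" by (subst ennreal_mult'[symmetric]) auto
    finally show "(\<integral>\<^sup>+t\<in>{- real n - 1..- 1 / (real n + 1)}. ennreal (f t) * ennreal (2 * pi) \<partial>lborel) \<le> ennreal (2 * pi / (1 - s))" .
  qed measurable
  finally show ?thesis .
qed

lemma wnorm_mono:
  assumes a: "cmod a < 1" and \<delta>: "\<delta> \<le> \<delta>'"
  shows "wnorm \<delta> \<phi> a \<le> wnorm \<delta>' \<phi> a"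
  unfolding wnorm_def
proof (rule nn_integral_mono)
  fix \<zeta> :: complex
  show "ennreal ((cmod (\<phi> \<zeta>))\<^sup>2 * pdist a \<zeta> powr (- 2 * \<delta>)) * indicator (ball 0 1) \<zeta>
    \<le> ennreal ((cmod (\<phi> \<zeta>))\<^sup>2 * pdist a \<zeta> powr (- 2 * \<delta>')) * indicator (ball 0 1) \<zeta>"
  proof (cases "\<zeta> \<in> ball 0 1")
    case True
    have "pdist a \<zeta> < 1" using pdist_less_1[OF a, of \<zeta>] True by simp
    moreover have "pdist a \<zeta> \<ge> 0" by (simp add: pdist_def)
    ultimately have "pdist a \<zeta> powr (- 2 * \<delta>) \<le> pdist a \<zeta> powr (- 2 * \<delta>')"
      using \<delta> by (cases "pdist a \<zeta> = 0") (auto intro!: powr_mono')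
    thus ?thesis using True by (simp add: ennreal_leI mult_left_mono)
  qed simp
qed

lemma young_powers:
  fixes u v p :: real
  assumes "u > 0" "v > 0" "p > 1"
  shows "u * v \<le> u powr p + v powr (p / (p - 1))"
proof (cases "v \<le> u powr (p - 1)")
  case True
  hence "u * v \<le> u * u powr (p - 1)" using assms by (intro mult_left_mono) auto
  also have "\<dots> = u powr p" using assms powr_add[of u 1 "p - 1"] by simp
  finally show ?thesis by (simp add: add_increasing2)
next
  case False
  hence "(u powr (p - 1)) powr (1 / (p - 1)) \<le> v powr (1 / (p - 1))" using assms by (intro powr_mono2) auto
  hence "u \<le> v powr (1 / (p - 1))" using assms by (simp add: powr_powr)
  hence "u * v \<le> v powr (1 / (p - 1)) * v powr 1" using assms by (simp add: mult_right_mono)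
  also have "\<dots> = v powr (1 / (p - 1) + 1)" by (rule powr_add[symmetric])
  also have "1 / (p - 1) + 1 = p / (p - 1)" using assms by (simp add: field_simps)
  finally show ?thesis by (simp add: add_increasing)
qed

text \<open>
  The square of \<open>G\<close> is integrable with room to spare as \<open>2 \<alpha> - 2 > - 1\<close>. Young inequality separates
  the singularity at the circle from that at \<open>a\<close>; the exponents are chosen such that the first stays
  integrable and the second becomes \<open>|\<zeta> - a| powr (- 1)\<close>.
\<close>

lemma wnorm_boundary_power:
  assumes \<alpha>: "1/2 < \<alpha>" "\<alpha> < 1" and C: "C \<ge> 0"
    and G: "\<And>z. cmod z < 1 \<Longrightarrow> cmod (G z) \<le> C * (1 - cmod z) powr (\<alpha> - 1)"
  obtains \<delta> M where "0 < \<delta>" "\<delta> < 1/2" "M > 0" "\<And>a. cmod a < 1 \<Longrightarrow> wnorm \<delta> G a \<le> ennreal M"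
proof -
  \<comment> \<open>\<open>\<beta> < 1\<close> is the order of the singularity of \<open>|G|\<^sup>2\<close> at the circle. The exponent \<open>p\<close> keeps \<open>\<beta> p < 1\<close>,
    and \<open>\<delta>\<close> turns the conjugate power of the weight into the power \<open>- 1\<close>.\<close>
  define \<beta> where "\<beta> = 2 - 2 * \<alpha>"
  have \<beta>: "0 < \<beta>" "\<beta> < 1" using \<alpha> by (auto simp: \<beta>_def)
  define p where "p = (1 + \<beta>) / (2 * \<beta>)"
  have p: "p > 1" using \<beta> by (simp add: p_def)
  define s where "s = (1 + \<beta>) / 2"
  have s: "0 \<le> s" "s < 1" "\<beta> * p = s" using \<beta> by (auto simp: s_def p_def)
  define \<delta> where "\<delta> = (p - 1) / (2 * p)"
  have "2 * ((p - 1) / (2 * p)) * (p / (p - 1)) = 1" using p by simp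
  hence \<delta>: "0 < \<delta>" "\<delta> < 1/2" "2 * \<delta> * (p / (p - 1)) = 1"
    using p unfolding \<delta>_def by (simp, simp add: field_simps, simp)
  define M where "M = C\<^sup>2 * (2 * pi / (1 - s) + 2 * (2 * pi * 2)) + 1"
  have M: "M > 0" using s by (auto simp: M_def intro!: add_nonneg_pos mult_nonneg_nonneg add_nonneg_nonneg)
  show ?thesis
  proof (rule that[OF \<delta>(1,2) M])
    fix a :: complex assume a: "cmod a < 1"
    have [measurable]: "ball (0::complex) 1 \<in> sets borel" "ball a 2 \<in> sets borel" by auto
    have "wnorm \<delta> G a \<le> (\<integral>\<^sup>+\<zeta>. ennreal (C\<^sup>2) * (ennreal ((1 - cmod \<zeta>) powr (- s)) * indicator (ball 0 1) \<zeta>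
        + ennreal 2 * (ennreal (cmod (\<zeta> - a) powr (- 1)) * indicator (ball a 2) \<zeta>)) \<partial>lborel)"
      unfolding wnorm_def
    proof (rule nn_integral_mono_AE)
      show "AE \<zeta> in lborel. ennreal ((cmod (G \<zeta>))\<^sup>2 * pdist a \<zeta> powr (- 2 * \<delta>)) * indicator (ball 0 1) \<zeta>
        \<le> ennreal (C\<^sup>2) * (ennreal ((1 - cmod \<zeta>) powr (- s)) * indicator (ball 0 1) \<zeta>
        + ennreal 2 * (ennreal (cmod (\<zeta> - a) powr (- 1)) * indicator (ball a 2) \<zeta>))"
        using AE_lborel_singleton[of a]
      proof eventually_elim
        case (elim \<zeta>)
        show ?case
        proof (cases "\<zeta> \<in> ball 0 1")
          case True
          hence z1: "cmod \<zeta> < 1" by simp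
          have nz: "1 - \<zeta> * cnj a \<noteq> 0" using one_minus_mult_nz[of a \<zeta>] a z1 by simp
          hence pd: "0 < pdist a \<zeta>" using elim by (simp add: pdist_def)
          define u where "u = (1 - cmod \<zeta>) powr (- \<beta>)"
          define v where "v = pdist a \<zeta> powr (- 2 * \<delta>)"
          have uv: "u > 0" "v > 0" using z1 pd by (auto simp: u_def v_def)
          have "(cmod (G \<zeta>))\<^sup>2 \<le> (C * (1 - cmod \<zeta>) powr (\<alpha> - 1))\<^sup>2" by (intro power_mono G z1) auto
          also have "\<dots> = C\<^sup>2 * u" unfolding u_def \<beta>_def
            by (simp add: power_mult_distrib power2_eq_square powr_add[symmetric])
          finally have "(cmod (G \<zeta>))\<^sup>2 * v \<le> C\<^sup>2 * u * v" using uv by (intro mult_right_mono) auto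
          also have "\<dots> = C\<^sup>2 * (u * v)" by simp
          also have "\<dots> \<le> C\<^sup>2 * (u powr p + v powr (p / (p - 1)))"
            by (intro mult_left_mono young_powers uv p) auto
          also have "u powr p = (1 - cmod \<zeta>) powr (- s)" using s(3) by (simp add: u_def powr_powr)
          also have "v powr (p / (p - 1)) = pdist a \<zeta> powr (- 1)"
          proof -
            have "- 2 * \<delta> * (p / (p - 1)) = -1" using \<delta>(3) by (simp only: mult_minus_left)
            thus ?thesis unfolding v_def powr_powr by metis
          qed
          also have "pdist a \<zeta> powr (- 1) \<le> 2 * cmod (\<zeta> - a) powr (- 1)"
          proof -
            have "cmod (1 - \<zeta> * cnj a) \<le> 1 + cmod (\<zeta> * cnj a)" using norm_triangle_ineq4[of 1 "\<zeta> * cnj a"] by simp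
            also have "cmod (\<zeta> * cnj a) \<le> 1 * 1" unfolding norm_mult using z1 a by (intro mult_mono) auto
            finally have "cmod (1 - \<zeta> * cnj a) \<le> 2" by simp
            hence "cmod (1 - \<zeta> * cnj a) / cmod (\<zeta> - a) \<le> 2 / cmod (\<zeta> - a)" by (intro divide_right_mono) auto
            moreover have "pdist a \<zeta> powr (- 1) = cmod (1 - \<zeta> * cnj a) / cmod (\<zeta> - a)"
              using pd nz elim by (simp add: powr_minus pdist_def norm_divide)
            ultimately show ?thesis by (simp add: powr_minus divide_inverse)
          qed
          finally have "(cmod (G \<zeta>))\<^sup>2 * v \<le> C\<^sup>2 * ((1 - cmod \<zeta>) powr (- s) + 2 * cmod (\<zeta> - a) powr (- 1))"
            by (simp add: mult_left_mono)
          hence "ennreal ((cmod (G \<zeta>))\<^sup>2 * v) \<le> ennreal (C\<^sup>2 * ((1 - cmod \<zeta>) powr (- s) + 2 * cmod (\<zeta> - a) powr (- 1)))"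
            by (rule ennreal_leI)
          also have "\<dots> = ennreal (C\<^sup>2) * (ennreal ((1 - cmod \<zeta>) powr (- s)) + ennreal 2 * ennreal (cmod (\<zeta> - a) powr (- 1)))"
            by (subst ennreal_mult', simp, subst ennreal_plus, simp, simp, subst ennreal_mult', simp, simp)
          finally have "ennreal ((cmod (G \<zeta>))\<^sup>2 * v) \<le> ennreal (C\<^sup>2) * (ennreal ((1 - cmod \<zeta>) powr (- s)) + ennreal 2 * ennreal (cmod (\<zeta> - a) powr (- 1)))" .
          moreover have "\<zeta> \<in> ball a 2" using norm_triangle_ineq4[of a \<zeta>] z1 a by (simp add: dist_norm)
          ultimately show ?thesis using True by (simp add: v_def)
        qed simp
      qed
    qed
    also have "\<dots> = ennreal (C\<^sup>2) * ((\<integral>\<^sup>+\<zeta>\<in>ball 0 1. ennreal ((1 - cmod \<zeta>) powr (- s)) \<partial>lborel)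
        + ennreal 2 * (\<integral>\<^sup>+\<zeta>\<in>ball a 2. ennreal (cmod (\<zeta> - a) powr (- 1)) \<partial>lborel))"
    proof -
      have m1: "(\<lambda>\<zeta>. ennreal ((1 - cmod \<zeta>) powr (- s)) * indicator (ball 0 1) \<zeta>) \<in> borel_measurable lborel" by measurable
      have m2: "(\<lambda>\<zeta>. ennreal (cmod (\<zeta> - a) powr (- 1)) * indicator (ball a 2) \<zeta>) \<in> borel_measurable lborel" by measurable
      show ?thesis using m1 m2 by (simp add: nn_integral_cmult nn_integral_add)
    qed
    also have "\<dots> \<le> ennreal (C\<^sup>2) * (ennreal (2 * pi / (1 - s)) + ennreal 2 * ennreal (2 * pi * 2 powr (2 - 1) / (2 - 1)))"
    proof -
      have A: "(\<integral>\<^sup>+\<zeta>\<in>ball a 2. ennreal (cmod (\<zeta> - a) powr (- 1)) \<partial>lborel) = ennreal (2 * pi * 2 powr (2 - 1) / (2 - 1))"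
        by (rule nn_integral_ball_powr) auto
      show ?thesis unfolding A by (intro mult_left_mono add_mono nn_integral_disk_boundary_power s order_refl) auto
    qed
    also have "\<dots> = ennreal (C\<^sup>2 * (2 * pi / (1 - s) + 2 * (2 * pi * 2)))"
    proof -
      have "ennreal 2 * ennreal (2 * pi * 2 powr (2 - 1) / (2 - 1)) = ennreal (2 * (2 * pi * 2))"
        by (subst ennreal_mult'[symmetric]) simp_all
      moreover have "ennreal (2 * pi / (1 - s)) + ennreal (2 * (2 * pi * 2)) = ennreal (2 * pi / (1 - s) + 2 * (2 * pi * 2))"
        using s by (intro ennreal_plus[symmetric]) auto
      ultimately show ?thesis by (simp only: ennreal_mult'[symmetric] zero_le_power2)
    qed
    also have "\<dots> \<le> ennreal M" by (intro ennreal_leI) (simp add: M_def)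
    finally show "wnorm \<delta> G a \<le> ennreal M" .
  qed
qed

text \<open>
  Boundary values taken at the nearest boundary point suffice for continuity, because the boundary
  function is uniformly continuous.
\<close>

lemma continuous_disk_extension:
  fixes F L :: "complex \<Rightarrow> complex"
  assumes F: "continuous_on (ball 0 1) F" and L: "continuous_on (sphere 0 1) L"
    and near: "\<And>e. e > 0 \<Longrightarrow> \<exists>r<1. \<forall>z. r < cmod z \<and> cmod z < 1 \<longrightarrow>
        (\<exists>u. cmod u = 1 \<and> cmod (z - u) = 1 - cmod z \<and> cmod (F z - L u) < e)"
  defines "E \<equiv> (\<lambda>z. if z \<in> ball 0 1 then F z else L z)"
  shows "continuous_on (cball 0 1) E"
    and "\<And>\<xi>. cmod \<xi> = 1 \<Longrightarrow> Lim (at \<xi> within ball 0 1) F = L \<xi>"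
proof -
  have at_sphere: "(E \<longlongrightarrow> L \<xi>) (at \<xi> within cball 0 1)" if \<xi>: "cmod \<xi> = 1" for \<xi>
    unfolding Lim_within
  proof (intro allI impI)
    fix e :: real assume e: "e > 0"
    have "uniformly_continuous_on (sphere 0 1) L" using L by (intro compact_uniformly_continuous) auto
    then obtain d where d: "d > 0" "\<And>u v. u \<in> sphere 0 1 \<Longrightarrow> v \<in> sphere 0 1 \<Longrightarrow> dist v u < d \<Longrightarrow> dist (L v) (L u) < e / 2"
      using e unfolding uniformly_continuous_on_def by (meson half_gt_zero)
    obtain r where r: "r < 1" "\<And>z. r < cmod z \<Longrightarrow> cmod z < 1 \<Longrightarrow>
        \<exists>u. cmod u = 1 \<and> cmod (z - u) = 1 - cmod z \<and> cmod (F z - L u) < e / 2"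
      using near[of "e / 2"] e by auto
    define d' where "d' = min (d / 2) (1 - r)"
    have d': "d' > 0" "d' \<le> d / 2" "d' \<le> 1 - r"
      subgoal unfolding d'_def using d(1) r(1) by simp
      subgoal unfolding d'_def by (rule min.cobounded1)
      subgoal unfolding d'_def by (rule min.cobounded2)
      done
    show "\<exists>d>0. \<forall>x\<in>cball 0 1. 0 < dist x \<xi> \<and> dist x \<xi> < d \<longrightarrow> dist (E x) (L \<xi>) < e"
    proof (intro exI[of _ d'] conjI ballI impI)
      fix x assume x: "x \<in> cball 0 1" "0 < dist x \<xi> \<and> dist x \<xi> < d'"
      show "dist (E x) (L \<xi>) < e"
      proof (cases "x \<in> ball 0 1")
        case False
        hence "x \<in> sphere 0 1" using x by auto
        hence "dist (L x) (L \<xi>) < e / 2" using \<xi> x d' d(1) by (intro d(2)) auto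
        thus ?thesis using False e by (simp add: E_def)
      next
        case True
        have "1 - cmod x \<le> dist x \<xi>" using norm_triangle_ineq2[of \<xi> x] \<xi> by (simp add: dist_norm norm_minus_commute)
        hence 1: "1 - cmod x < d'" using x by simp
        hence "r < cmod x" using d' by simp
        then obtain u where u: "cmod u = 1" "cmod (x - u) = 1 - cmod x" "cmod (F x - L u) < e / 2"
          using r(2)[of x] True by auto
        have "dist u \<xi> \<le> dist u x + dist x \<xi>" by (rule dist_triangle)
        also have "\<dots> < d' + d'" using u 1 x by (simp add: dist_norm norm_minus_commute)
        finally have "dist u \<xi> < d" using d' by simp
        hence "dist (L u) (L \<xi>) < e / 2" using u \<xi> by (intro d(2)) auto
        thus ?thesis using True u(3) dist_triangle[of "F x" "L \<xi>" "L u"] by (simp add: E_def dist_norm)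
      qed
    qed (use d' in auto)
  qed
  show "continuous_on (cball 0 1) E"
    unfolding continuous_on_def
  proof
    fix x :: complex assume x: "x \<in> cball 0 1"
    show "(E \<longlongrightarrow> E x) (at x within cball 0 1)"
    proof (cases "x \<in> ball 0 1")
      case True
      have "isCont F x" using F True by (simp add: continuous_on_eq_continuous_at)
      hence "(F \<longlongrightarrow> F x) (at x)" by (simp add: isCont_def)
      hence "(E \<longlongrightarrow> F x) (at x)"
        by (rule Lim_transform_within_open[of _ _ _ _ "ball 0 1"]) (use True in \<open>auto simp: E_def\<close>)
      thus ?thesis using True by (auto simp: E_def intro: tendsto_within_subset)
    next
      case False
      thus ?thesis using at_sphere[of x] x by (simp add: E_def)
    qed
  qed
  fix \<xi> :: complex assume \<xi>: "cmod \<xi> = 1"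
  have "(E \<longlongrightarrow> L \<xi>) (at \<xi> within ball 0 1)"
    using at_sphere[OF \<xi>] by (rule tendsto_within_subset) auto
  hence "(F \<longlongrightarrow> L \<xi>) (at \<xi> within ball 0 1)"
    by (rule Lim_transform_eventually) (auto simp: E_def eventually_at_filter)
  moreover have "at \<xi> within ball 0 1 \<noteq> bot"
    using \<xi> islimpt_ball[of \<xi> 0 1] by (simp add: trivial_limit_within)
  ultimately show "Lim (at \<xi> within ball 0 1) F = L \<xi>" by (intro tendsto_Lim)
qed

lemma beltrami_norm:
  "deriv \<omega> z \<noteq> 0 \<Longrightarrow> cmod (beltrami_dz \<omega> F z) = cmod (d_z F z)"
  by (simp add: beltrami_dz_def norm_mult norm_divide)

lemma beltrami_continuous:
  assumes \<omega>: "\<omega> holomorphic_on ball 0 1" "\<And>z. z \<in> ball 0 1 \<Longrightarrow> deriv \<omega> z \<noteq> 0" and F: "polyan \<omega> F"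
  shows "continuous_on (ball 0 1) (beltrami_dz \<omega> F)"
  unfolding beltrami_dz_def[abs_def]
  by (intro continuous_intros holomorphic_on_imp_continuous_on[OF holomorphic_deriv[OF \<omega>(1) open_ball]]
       polyan_wderiv(2)[OF \<omega>(1) F]) (use \<omega>(2) in auto)

text \<open>
  One step of the iteration. A bound for the exponent \<open>\<delta>\<close> at all points \<open>a\<close> gives sense to \<open>K_op \<phi>\<close>
  and controls its values and boundary values; the energy estimate propagates a bound for any
  exponent \<open>\<delta>'\<close>, which may be much smaller, so that the constant is close to 1.
\<close>

lemma K_op_step:
  assumes \<omega>: "\<omega> holomorphic_on ball 0 1" "\<And>z. z \<in> ball 0 1 \<Longrightarrow> deriv \<omega> z \<noteq> 0" and F: "polyan \<omega> F"
    and \<delta>: "0 < \<delta>" "\<delta> < 1/2" and M: "M > 0"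
    and wn: "\<And>a. cmod a < 1 \<Longrightarrow> wnorm \<delta> (d_z F) a \<le> ennreal M"
  defines "\<phi> \<equiv> beltrami_dz \<omega> F"
  shows "integrable lborel (disk_cut \<phi>)"
    and "vanishes_at_circle (K_op \<phi>)"
    and "\<And>a. cmod a < 1 \<Longrightarrow> cmod (K_op \<phi> a) \<le> sqrt M * (1 / \<delta> + 1)"
    and "\<And>a \<delta>' M'. cmod a < 1 \<Longrightarrow> 0 < \<delta>' \<Longrightarrow> \<delta>' < 1/2 \<Longrightarrow> M' > 0 \<Longrightarrow> wnorm \<delta>' (d_z F) a \<le> ennreal M' \<Longrightarrow>
           wnorm \<delta>' (d_z (K_op \<phi>)) a \<le> ennreal ((1 + 2 * \<delta>') / (1 - 2 * \<delta>') * M')"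
proof -
  have \<phi>c: "continuous_on (ball 0 1) \<phi>" unfolding \<phi>_def by (rule beltrami_continuous[OF \<omega> F])
  have wn\<phi>: "wnorm \<delta>' \<phi> a = wnorm \<delta>' (d_z F) a" for \<delta>' a
    unfolding \<phi>_def by (rule wnorm_cong) (use beltrami_norm \<omega>(2) in auto)
  show N: "integrable lborel (disk_cut \<phi>)"
    by (rule square_integrable_of_wnorm(2)[OF \<phi>c _ _, of \<delta> 0 M]) (use wn[of 0] \<delta> wn\<phi> in auto)
  show van: "vanishes_at_circle (K_op \<phi>)"
    by (rule K_op_vanishes_at_circle[OF \<phi>c _ _ M, of "\<delta> / 2"]) (use wn \<delta> wn\<phi> in auto)
  show "cmod (K_op \<phi> a) \<le> sqrt M * (1 / \<delta> + 1)" if "cmod a < 1" for a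
    by (rule K_op_bound[OF \<phi>c \<delta>(1) _ M that]) (use wn[OF that] wn\<phi> in auto)
  have P: "polyan \<omega> (K_op \<phi>)" "\<And>z. z \<in> ball 0 1 \<Longrightarrow> d_zbar (K_op \<phi>) z + \<phi> z = cnj (deriv (antihol_part \<phi>) z)"
    using polyan_K_op(1,3)[OF \<omega> F N[unfolded \<phi>_def]] unfolding \<phi>_def by auto
  note w = polyan_wderiv[OF \<omega>(1) P(1)]
  have H: "deriv (antihol_part \<phi>) holomorphic_on ball 0 1"
    by (rule holomorphic_deriv[OF antihol_part_facts(1)[OF N] open_ball])
  fix a :: complex and \<delta>' M' :: real
  assume a: "cmod a < 1" and \<delta>': "0 < \<delta>'" "\<delta>' < 1/2" and M': "M' > 0" "wnorm \<delta>' (d_z F) a \<le> ennreal M'"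
  have "ennreal (1 - 2 * \<delta>') * wnorm \<delta>' (d_z (K_op \<phi>)) a \<le> ennreal (1 + 2 * \<delta>') * wnorm \<delta>' \<phi> a"
    by (rule disk_energy[OF w \<phi>c H P(2) van \<delta>' a])
  also have "\<dots> \<le> ennreal (1 + 2 * \<delta>') * ennreal M'" unfolding wn\<phi> by (intro mult_left_mono M') simp
  finally have 1: "ennreal (1 - 2 * \<delta>') * wnorm \<delta>' (d_z (K_op \<phi>)) a \<le> ennreal ((1 + 2 * \<delta>') * M')"
    using \<delta>' by (subst ennreal_mult') auto
  have "wnorm \<delta>' (d_z (K_op \<phi>)) a = ennreal (1 / (1 - 2 * \<delta>')) * (ennreal (1 - 2 * \<delta>') * wnorm \<delta>' (d_z (K_op \<phi>)) a)"
    using \<delta>' by (simp add: mult.assoc[symmetric] ennreal_mult'[symmetric])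
  also have "\<dots> \<le> ennreal (1 / (1 - 2 * \<delta>')) * ennreal ((1 + 2 * \<delta>') * M')" by (intro mult_left_mono 1) simp
  also have "\<dots> = ennreal ((1 + 2 * \<delta>') / (1 - 2 * \<delta>') * M')" using \<delta>' by (subst ennreal_mult'[symmetric]) auto
  finally show "wnorm \<delta>' (d_z (K_op \<phi>)) a \<le> ennreal ((1 + 2 * \<delta>') / (1 - 2 * \<delta>') * M')" .
qed

text \<open>
  The Poisson integral belongs to the class with the polynomial degree 0 in \<open>cnj \<omega>\<close>.
\<close>

lemma poisson_polyan:
  fixes f :: "complex \<Rightarrow> complex"
  assumes f: "continuous_on (sphere 0 1) f"
  shows "polyan \<omega> (poisson f)" and "\<And>z. z \<in> ball 0 1 \<Longrightarrow> d_z (poisson f) z = deriv (cauchy_circle f) z"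
    and "\<And>z. z \<in> ball 0 1 \<Longrightarrow> d_zbar (poisson f) z = cnj (deriv (\<lambda>z. z * cauchy_circle (\<lambda>u. cnj (f u) / u) z) z)"
    and "(\<lambda>z. z * cauchy_circle (\<lambda>u. cnj (f u) / u) z) holomorphic_on ball 0 1"
proof -
  define B where "B = (\<lambda>z. z * cauchy_circle (\<lambda>u. cnj (f u) / u) z)"
  have A: "cauchy_circle f holomorphic_on ball 0 1" by (rule cauchy_circle_holomorphic[OF f])
  have "continuous_on (sphere 0 1) (\<lambda>u. cnj (f u) / u)" using f by (auto intro!: continuous_intros)
  hence B: "B holomorphic_on ball 0 1" unfolding B_def by (intro holomorphic_intros cauchy_circle_holomorphic)
  have eq: "poisson f z = cauchy_circle f z + cnj (B z)" if "z \<in> ball 0 1" for z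
    using poisson_split[OF f, of z] that by (simp add: B_def)
  show "(\<lambda>z. z * cauchy_circle (\<lambda>u. cnj (f u) / u) z) holomorphic_on ball 0 1" using B by (simp add: B_def)
  show "polyan \<omega> (poisson f)"
    unfolding polyan_def
    by (rule exI[of _ 0], rule exI[of _ "\<lambda>_. cauchy_circle f"], rule exI[of _ B]) (use A B eq in auto)
  fix z :: complex assume z: "z \<in> ball 0 1"
  have "wderiv (\<lambda>z. cauchy_circle f z + cnj (B z)) (deriv (cauchy_circle f) z + cnj 0) (0 + cnj (deriv B z)) z"
    using A B z by (intro wderiv_add wderiv_cnj wderiv_holomorphic holomorphic_derivI[of _ "ball 0 1"]) auto
  hence "wderiv (poisson f) (deriv (cauchy_circle f) z + cnj 0) (0 + cnj (deriv B z)) z"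
    by (rule wderiv_transform[OF _ open_ball z]) (use eq in auto)
  from wderiv_partial(3,4)[OF this]
  show "d_z (poisson f) z = deriv (cauchy_circle f) z"
    and "d_zbar (poisson f) z = cnj (deriv (\<lambda>z. z * cauchy_circle (\<lambda>u. cnj (f u) / u) z) z)" by (simp_all add: B_def)
qed

text \<open>
  A bound with one exponent \<open>\<delta>0\<close> implies bounds with all smaller ones, and the growth factor tends
  to 1 as \<open>\<delta>\<close> tends to 0.
\<close>

lemma F_seq_induction:
  assumes \<omega>: "\<omega> holomorphic_on ball 0 1" "\<And>z. z \<in> ball 0 1 \<Longrightarrow> deriv \<omega> z \<noteq> 0"
    and F0: "polyan \<omega> (poisson (h \<circ> \<omega>))"
    and \<delta>0: "0 < \<delta>0" "\<delta>0 < 1/2" and M: "M > 0"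
    and wn: "\<And>a. cmod a < 1 \<Longrightarrow> wnorm \<delta>0 (d_z (poisson (h \<circ> \<omega>))) a \<le> ennreal M"
  shows "polyan \<omega> (F_seq \<omega> h n) \<and> (\<forall>\<delta> a. 0 < \<delta> \<longrightarrow> \<delta> \<le> \<delta>0 \<longrightarrow> cmod a < 1 \<longrightarrow>
      wnorm \<delta> (d_z (F_seq \<omega> h n)) a \<le> ennreal (((1 + 2 * \<delta>) / (1 - 2 * \<delta>)) ^ n * M))"
proof (induction n)
  case 0
  have "wnorm \<delta> (d_z (poisson (h \<circ> \<omega>))) a \<le> ennreal M" if "\<delta> \<le> \<delta>0" "cmod a < 1" for \<delta> a
    by (rule order_trans[OF wnorm_mono[OF that(2,1)] wn[OF that(2)]])
  thus ?case using F0 by simp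
next
  case (Suc n)
  define \<kappa> where "\<kappa> = (\<lambda>\<delta>::real. (1 + 2 * \<delta>) / (1 - 2 * \<delta>))"
  have \<kappa>: "\<kappa> \<delta> > 0" if "0 < \<delta>" "\<delta> \<le> \<delta>0" for \<delta> using that \<delta>0 by (simp add: \<kappa>_def)
  have P: "polyan \<omega> (F_seq \<omega> h n)" using Suc by blast
  have W: "wnorm \<delta> (d_z (F_seq \<omega> h n)) a \<le> ennreal (\<kappa> \<delta> ^ n * M)" if "0 < \<delta>" "\<delta> \<le> \<delta>0" "cmod a < 1" for \<delta> a
    using Suc that by (simp add: \<kappa>_def)
  have M0: "\<kappa> \<delta> ^ n * M > 0" if "0 < \<delta>" "\<delta> \<le> \<delta>0" for \<delta> using \<kappa>[OF that] M by simp
  note st = K_op_step[OF \<omega> P \<delta>0 M0[OF \<delta>0(1) order_refl] W[OF \<delta>0(1) order_refl]]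
  have "polyan \<omega> (F_seq \<omega> h (Suc n))"
    using polyan_K_op(1)[OF \<omega> P st(1)] by simp
  moreover have "wnorm \<delta> (d_z (F_seq \<omega> h (Suc n))) a \<le> ennreal (\<kappa> \<delta> ^ Suc n * M)" if d: "0 < \<delta>" "\<delta> \<le> \<delta>0" "cmod a < 1" for \<delta> a
  proof -
    have "wnorm \<delta> (d_z (K_op (beltrami_dz \<omega> (F_seq \<omega> h n)))) a \<le> ennreal ((1 + 2 * \<delta>) / (1 - 2 * \<delta>) * (\<kappa> \<delta> ^ n * M))"
      by (rule K_op_step(4)[OF \<omega> P \<delta>0 M0[OF \<delta>0(1) order_refl] W[OF \<delta>0(1) order_refl]]) (use d \<delta>0 M0[OF d(1,2)] W[OF d] in auto)
    thus ?thesis by (simp add: \<kappa>_def mult.assoc)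
  qed
  ultimately show ?case by (simp only: \<kappa>_def) blast
qed

section \<open>Limits of functions with small antiholomorphic derivative\<close>

lemma continuous_nn_integral_zero:
  fixes f :: "complex \<Rightarrow> complex"
  assumes U: "open U" and f: "continuous_on U f" and 0: "(\<integral>\<^sup>+z\<in>U. ennreal (cmod (f z)) \<partial>lborel) = 0" and z: "z \<in> U"
  shows "f z = 0"
proof -
  have m: "(\<lambda>z. ennreal (cmod (if z \<in> U then f z else 0))) \<in> borel_measurable lborel"
    using borel_measurable_if_continuous[OF U f] by measurable
  have "(\<integral>\<^sup>+z. ennreal (cmod (if z \<in> U then f z else 0)) \<partial>lborel) = 0"
    unfolding 0[symmetric] by (intro nn_integral_cong) (auto simp: indicator_def)
  hence ae: "AE z in lborel. (if z \<in> U then f z else 0) = 0"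
    using nn_integral_0_iff_AE[OF m] by (simp add: ennreal_eq_0_iff)
  define V where "V = {z \<in> U. f z \<noteq> 0}"
  have "open V"
  proof -
    have "V = U \<inter> f -` (- {0})" by (auto simp: V_def)
    thus ?thesis using continuous_open_preimage[OF f U open_Compl[OF closed_singleton[of 0]]] by simp
  qed
  moreover have "negligible V"
  proof -
    have "AE z in lborel. z \<notin> V" using ae by eventually_elim (auto simp: V_def)
    hence "V \<in> null_sets lborel" using \<open>open V\<close> by (subst AE_iff_null_sets) auto
    thus ?thesis by (simp add: negligible_iff_null_sets null_sets_completionI)
  qed
  ultimately have "V = {}" using open_not_negligible by blast
  thus ?thesis using z by (auto simp: V_def)
qed

text \<open>
  A quantitative form of the statement that a distributional solution of \<open>dbar R = 0\<close> is
  holomorphic. Near a point, \<open>\<rho> N\<close> is represented by the Cauchy--Pompeiu formula for its product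
  with a cut-off function \<open>ct\<close>. The term with \<open>dbar ct\<close> is holomorphic near the point and converges
  uniformly to a function \<open>h\<close> of the same form built from \<open>R\<close>; the term with \<open>d N\<close> tends to 0 in
  \<open>L\<^sup>1\<close>, as the Cauchy kernel is integrable. Hence \<open>R = h\<close>.
\<close>

lemma dbar_L1_limit_holomorphic:
  fixes \<rho> g d :: "nat \<Rightarrow> complex \<Rightarrow> complex" and R :: "complex \<Rightarrow> complex"
  assumes U: "open U"
    and w: "\<And>N z. z \<in> U \<Longrightarrow> wderiv (\<rho> N) (g N z) (d N z) z"
    and gc: "\<And>N. continuous_on U (g N)" and dc: "\<And>N. continuous_on U (d N)"
    and lim: "\<And>z. z \<in> U \<Longrightarrow> \<exists>r>0. ball z r \<subseteq> U \<and> uniform_limit (ball z r) \<rho> R sequentially"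
    and small: "(\<lambda>N. \<integral>\<^sup>+z\<in>U. ennreal (cmod (d N z)) \<partial>lborel) \<longlonglongrightarrow> 0"
  shows "R holomorphic_on U"
  unfolding holomorphic_on_def
proof
  fix z0 assume "z0 \<in> U"
  then obtain r where r: "r > 0" "ball z0 r \<subseteq> U" "uniform_limit (ball z0 r) \<rho> R sequentially" using lim by blast
  define r2 where "r2 = r / 2"
  define r1 where "r1 = r2 / 2"
  have r12: "0 < r1" "r1 < r2" "r2 < r" using r(1) by (auto simp: r1_def r2_def)
  have sub2: "cball z0 r2 \<subseteq> ball z0 r" using r12 by auto
  have \<rho>c: "continuous_on U (\<rho> N)" for N using w by (rule wderiv_continuous_on)
  have Rc: "continuous_on (ball z0 r) R"
    by (rule uniform_limit_theorem[OF _ r(3)]) (auto intro!: always_eventually continuous_on_subset[OF \<rho>c r(2)])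
  obtain ct Gc Dc where ct: "\<And>z. wderiv ct (Gc z) (Dc z) z" "continuous_on UNIV Gc" "continuous_on UNIV Dc"
    "\<And>z. z \<in> cball z0 r1 \<Longrightarrow> ct z = 1" "\<And>z. z \<in> ball z0 r1 \<Longrightarrow> Dc z = 0"
    "\<And>z. z \<notin> cball z0 r2 \<Longrightarrow> ct z = 0 \<and> Gc z = 0 \<and> Dc z = 0"
    using cutoff_exists[OF r12(1,2)] by metis
  have cc: "continuous_on UNIV ct" using ct(1) by (rule wderiv_continuous_on)
  have ct0: "ct z = 0" and c0: "Dc z = 0" if "z \<notin> cball z0 r2" for z using ct(6)[OF that] by blast+
  define \<Omega> where "\<Omega> = ball z0 r"
  have op: "open \<Omega>" by (simp add: \<Omega>_def)
  have \<Omega>U: "\<Omega> \<subseteq> U" using r(2) by (simp add: \<Omega>_def)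
  have cut: "continuous_on UNIV (\<lambda>z. if z \<in> \<Omega> then f z * k z else 0)"
    if "continuous_on \<Omega> f" "continuous_on UNIV k" "\<And>z. z \<notin> cball z0 r2 \<Longrightarrow> k z = 0" for f k :: "complex \<Rightarrow> complex"
  proof (rule continuous_on_UNIV_cutoff[OF op _ closed_cball])
    show "continuous_on \<Omega> (\<lambda>z. f z * k z)" by (intro continuous_on_mult that(1) continuous_on_subset[OF that(2)]) auto
    show "cball z0 r2 \<subseteq> \<Omega>" using sub2 by (simp add: \<Omega>_def)
  qed (use that(3) in auto)
  define a where "a = (\<lambda>N z. if z \<in> \<Omega> then \<rho> N z * Dc z else 0)"
  define a0 where "a0 = (\<lambda>z. if z \<in> \<Omega> then R z * Dc z else 0)"
  define b where "b = (\<lambda>N z. if z \<in> \<Omega> then d N z * ct z else 0)"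
  have ac: "continuous_on UNIV (a N)" and bc: "continuous_on UNIV (b N)" and a0c: "continuous_on UNIV a0" for N
    unfolding a_def b_def a0_def
    by (rule cut[OF continuous_on_subset[OF \<rho>c \<Omega>U] ct(3) c0], assumption,
        rule cut[OF continuous_on_subset[OF dc \<Omega>U] cc ct0], assumption,
        rule cut[OF Rc[folded \<Omega>_def] ct(3) c0])
  define \<Psi> where "\<Psi> = (\<lambda>N z. if z \<in> \<Omega> then \<rho> N z * ct z else 0)"
  define G\<Psi> where "G\<Psi> = (\<lambda>N z. if z \<in> \<Omega> then \<rho> N z * Gc z + g N z * ct z else 0)"
  have ab: "(if z \<in> \<Omega> then \<rho> N z * Dc z + d N z * ct z else 0) = a N z + b N z" for N z by (simp add: a_def b_def)
  have w\<Omega>: "wderiv (\<rho> N) (g N z) (d N z) z" if "z \<in> \<Omega>" for N z using w \<Omega>U that by blast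
  have \<Omega>2: "cball z0 r2 \<subseteq> \<Omega>" using sub2 by (simp add: \<Omega>_def)
  note cp = wderiv_cutoff_product[OF op w\<Omega> continuous_on_subset[OF gc \<Omega>U] continuous_on_subset[OF dc \<Omega>U] closed_cball \<Omega>2 ct(1-3,6), unfolded ab]
  have w\<Psi>: "wderiv (\<Psi> N) (G\<Psi> N z) (a N z + b N z) z" for N z unfolding \<Psi>_def G\<Psi>_def by (rule cp(1))
  have G\<Psi>c: "continuous_on UNIV (G\<Psi> N)" for N unfolding G\<Psi>_def by (rule cp(2))
  define S where "S = cmod z0 + r2 + 1"
  have far: "z \<notin> cball z0 r2" if "z \<notin> ball 0 S" for z
    using that norm_triangle_ineq2[of z z0] by (auto simp: S_def dist_norm norm_minus_commute)
  note pom = pompeiu[of "\<Psi> N" "G\<Psi> N" "\<lambda>z. a N z + b N z" S for N, OF w\<Psi> G\<Psi>c continuous_on_add[OF ac bc]]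
  have supp: "\<Psi> N z = 0" if "z \<notin> ball 0 S" for N z using ct0[OF far[OF that]] by (simp add: \<Psi>_def)
  have a_supp: "a N z = 0" "a0 z = 0" if "z \<notin> cball z0 r2" for N z using c0[OF that] by (simp_all add: a_def a0_def)
  have a_in: "a N z = 0" "a0 z = 0" if "z \<in> ball z0 r1" for N z using ct(5)[OF that] by (simp_all add: a_def a0_def)
  have ai: "integrable lborel (a N)" "integrable lborel a0" for N by (intro integrable_continuous_compact_support[OF _ compact_cball[of z0 r2]] ac a0c a_supp; assumption)+
  define B where "B = ball z0 (r1 / 2)"
  have ke: "r1 / 2 \<le> cmod (\<zeta> - 1 * z)" if "\<zeta> \<notin> ball z0 r1" "z \<in> ball z0 (r1 / 2)" for \<zeta> z
    using that dist_triangle[of z0 \<zeta> z] by (auto simp: dist_norm norm_minus_commute)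
  define h where "h = (\<lambda>z. - (1 / of_real pi) * (\<integral>\<zeta>. a0 \<zeta> / (\<zeta> - z) \<partial>lborel))"
  define hN where "hN = (\<lambda>N z. - (1 / of_real pi) * (\<integral>\<zeta>. a N \<zeta> / (\<zeta> - z) \<partial>lborel))"
  define X where "X = (\<lambda>N z. (1 / of_real pi) * (\<integral>\<zeta>. b N \<zeta> / (\<zeta> - z) \<partial>lborel))"
  have ki: "integrable lborel (\<lambda>\<zeta>. k \<zeta> / (\<zeta> - 1 * z))" "(\<lambda>z. \<integral>\<zeta>. k \<zeta> / (\<zeta> - 1 * z) \<partial>lborel) holomorphic_on B"
    if k: "integrable lborel k" "\<And>z. z \<in> ball z0 r1 \<Longrightarrow> k z = 0" and z: "z \<in> B" for k z
  proof -
    have ke': "r1 / 2 \<le> cmod (\<zeta> - 1 * z)" if "k \<zeta> \<noteq> 0" "z \<in> ball z0 (r1 / 2)" for \<zeta> z using that k(2) ke by blast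
    show "integrable lborel (\<lambda>\<zeta>. k \<zeta> / (\<zeta> - 1 * z))"
      by (rule kernel_integral_holomorphic(1)[OF k(1) _ _ _ _ ke' z[unfolded B_def]]) (use r12 in auto)
    show "(\<lambda>z. \<integral>\<zeta>. k \<zeta> / (\<zeta> - 1 * z) \<partial>lborel) holomorphic_on B"
      unfolding B_def by (rule kernel_integral_holomorphic(2)[OF k(1) _ _ _ _ ke']) (use r12 in auto)
  qed
  \<comment> \<open>\<open>a0\<close> vanishes on the larger disk with radius \<open>r1\<close>, so that the kernel is regular on \<open>B\<close>.\<close>
  have hhol: "h holomorphic_on B"
    unfolding h_def using ki(2)[OF ai(2) a_in(2), of z0] r12 by (auto simp: B_def intro!: holomorphic_intros)
  have split: "\<rho> N z = hN N z - X N z" if z: "z \<in> B" for N z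
  proof -
    have z1: "z \<in> cball z0 r1" "z \<in> \<Omega>" using z r12 by (auto simp: B_def \<Omega>_def)
    have i1: "integrable lborel (\<lambda>\<zeta>. a N \<zeta> / (\<zeta> - z))" using ki(1)[OF ai(1) a_in(1) z] by simp
    have i: "integrable lborel (\<lambda>\<zeta>. (a N \<zeta> + b N \<zeta>) / (\<zeta> - z))" by (rule pom(1)) (rule supp)
    have i2: "integrable lborel (\<lambda>\<zeta>. b N \<zeta> / (\<zeta> - z))"
      using Bochner_Integration.integrable_diff[OF i i1] by (simp add: add_divide_distrib)
    have "\<Psi> N z = - (1 / of_real pi) * (\<integral>\<zeta>. (a N \<zeta> + b N \<zeta>) / (\<zeta> - z) \<partial>lborel)" by (rule pom(2)) (rule supp)
    also have "(\<integral>\<zeta>. (a N \<zeta> + b N \<zeta>) / (\<zeta> - z) \<partial>lborel) = (\<integral>\<zeta>. a N \<zeta> / (\<zeta> - z) \<partial>lborel) + (\<integral>\<zeta>. b N \<zeta> / (\<zeta> - z) \<partial>lborel)"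
      unfolding add_divide_distrib by (rule Bochner_Integration.integral_add[OF i1 i2])
    finally show ?thesis using z1 ct(4)[OF z1(1)] by (simp add: \<Psi>_def hN_def X_def algebra_simps add_divide_distrib)
  qed
  have "bounded (Dc ` cball z0 r2)" "bounded (ct ` cball z0 r2)"
    using continuous_on_subset[OF ct(3)] continuous_on_subset[OF cc]
    by (auto intro!: compact_imp_bounded compact_continuous_image)
  then obtain K0 K1 where K0: "\<And>z. z \<in> cball z0 r2 \<Longrightarrow> cmod (Dc z) \<le> K0" and K1: "\<And>z. z \<in> cball z0 r2 \<Longrightarrow> cmod (ct z) \<le> K1"
    unfolding bounded_iff by (metis imageI)
  define K where "K = max 1 (max K0 K1)"
  have K: "K > 0" "\<And>z. cmod (Dc z) \<le> K" "\<And>z. cmod (ct z) \<le> K"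
  proof -
    show "K > 0" by (simp add: K_def)
    show "cmod (Dc z) \<le> K" for z using K0[of z] c0[of z] by (cases "z \<in> cball z0 r2") (auto simp: K_def)
    show "cmod (ct z) \<le> K" for z using K1[of z] ct0[of z] by (cases "z \<in> cball z0 r2") (auto simp: K_def)
  qed
  define A where "A = measure lborel (cball z0 r2)"
  have A0: "A \<ge> 0" by (simp add: A_def)
  have hdiff: "cmod (hN N z - h z) \<le> e * (K * (2 / r1) * A)"
    if e: "e \<ge> 0" "\<And>x. x \<in> \<Omega> \<Longrightarrow> cmod (\<rho> N x - R x) \<le> e" and z: "z \<in> B" for N e z
  proof -
    have i1: "integrable lborel (\<lambda>\<zeta>. a N \<zeta> / (\<zeta> - z))" using ki(1)[OF ai(1) a_in(1) z] by simp
    have i0: "integrable lborel (\<lambda>\<zeta>. a0 \<zeta> / (\<zeta> - z))" using ki(1)[OF ai(2) a_in(2) z] by simp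
    have "cmod (\<integral>\<zeta>. a N \<zeta> / (\<zeta> - z) - a0 \<zeta> / (\<zeta> - z) \<partial>lborel) \<le> (\<integral>\<zeta>. indicator (cball z0 r2) \<zeta> * (e * K * (2 / r1)) \<partial>lborel)"
    proof (rule Bochner_Integration.integral_norm_bound_integral)
      show "integrable lborel (\<lambda>\<zeta>. a N \<zeta> / (\<zeta> - z) - a0 \<zeta> / (\<zeta> - z))" by (intro Bochner_Integration.integrable_diff i1 i0)
      show "integrable lborel (\<lambda>\<zeta>. indicator (cball z0 r2) \<zeta> * (e * K * (2 / r1)))"
        using emeasure_lborel_cball_finite by (intro integrable_mult_left integrable_real_indicator) auto
      fix \<zeta>
      show "cmod (a N \<zeta> / (\<zeta> - z) - a0 \<zeta> / (\<zeta> - z)) \<le> indicator (cball z0 r2) \<zeta> * (e * K * (2 / r1))"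
      proof (cases "\<zeta> \<in> cball z0 r2 - ball z0 r1")
        case True
        hence "\<zeta> \<in> \<Omega>" using sub2 by (auto simp: \<Omega>_def)
        hence "a N \<zeta> / (\<zeta> - z) - a0 \<zeta> / (\<zeta> - z) = (\<rho> N \<zeta> - R \<zeta>) * Dc \<zeta> / (\<zeta> - z)"
          by (simp add: a_def a0_def algebra_simps diff_divide_distrib)
        hence "cmod (a N \<zeta> / (\<zeta> - z) - a0 \<zeta> / (\<zeta> - z)) = cmod (\<rho> N \<zeta> - R \<zeta>) * cmod (Dc \<zeta>) / cmod (\<zeta> - z)"
          by (simp add: norm_mult norm_divide)
        also have "\<dots> \<le> e * K / (r1 / 2)"
          using e(2)[OF \<open>\<zeta> \<in> \<Omega>\<close>] K e(1) ke[of \<zeta> z] True z r12 by (intro frac_le mult_mono) (auto simp: B_def)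
        finally show ?thesis using True by simp
      next
        case False
        hence "\<zeta> \<in> ball z0 r1 \<or> \<zeta> \<notin> cball z0 r2" by blast
        hence "a N \<zeta> = 0" "a0 \<zeta> = 0" using a_in a_supp by blast+
        thus ?thesis using e(1) K r12 by (simp add: indicator_def)
      qed
    qed
    also have "\<dots> = e * K * (2 / r1) * A" by (simp add: A_def)
    finally have "cmod ((\<integral>\<zeta>. a N \<zeta> / (\<zeta> - z) \<partial>lborel) - (\<integral>\<zeta>. a0 \<zeta> / (\<zeta> - z) \<partial>lborel)) \<le> e * K * (2 / r1) * A"
      using i1 i0 by simp
    moreover have "hN N z - h z = - (1 / of_real pi) * ((\<integral>\<zeta>. a N \<zeta> / (\<zeta> - z) \<partial>lborel) - (\<integral>\<zeta>. a0 \<zeta> / (\<zeta> - z) \<partial>lborel))"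
      by (simp add: hN_def h_def algebra_simps)
    moreover have "cmod (- (1 / of_real pi) * Q) \<le> cmod Q" for Q
      using pi_gt3 by (simp add: norm_divide norm_mult divide_le_eq mult_le_cancel_left1)
    ultimately show ?thesis by (metis (no_types, lifting) order_trans mult.assoc)
  qed
  define c where "c = (\<lambda>N. \<integral>\<^sup>+z\<in>U. ennreal (cmod (d N z)) \<partial>lborel)"
  define dU where "dU = (\<lambda>N \<zeta>. if \<zeta> \<in> U then d N \<zeta> else 0)"
  have [measurable]: "dU N \<in> borel_measurable borel" for N unfolding dU_def by (rule borel_measurable_if_continuous[OF U dc])
  have [measurable]: "U \<in> sets borel" using U by simp
  have Xbound: "(\<integral>\<^sup>+z\<in>B. ennreal (cmod (X N z)) \<partial>lborel) \<le> ennreal (K * (2 * pi * (2 * r2))) * c N" for N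
  proof -
    have bm[measurable]: "b N \<in> borel_measurable borel" using bc by (rule borel_measurable_continuous_onI)
    have [measurable]: "B \<in> sets borel" by (simp add: B_def)
    have "(\<integral>\<^sup>+z\<in>B. ennreal (cmod (X N z)) \<partial>lborel) \<le> (\<integral>\<^sup>+z. (\<integral>\<^sup>+\<zeta>. ennreal (cmod (b N \<zeta>)) * (ennreal (cmod (z - \<zeta>) powr (- 1)) * indicator B z) \<partial>lborel) \<partial>lborel)"
    proof (rule nn_integral_mono)
      fix z :: complex
      show "ennreal (cmod (X N z)) * indicator B z \<le> (\<integral>\<^sup>+\<zeta>. ennreal (cmod (b N \<zeta>)) * (ennreal (cmod (z - \<zeta>) powr (- 1)) * indicator B z) \<partial>lborel)"
      proof (cases "z \<in> B")
        case True
        have "cmod (X N z) \<le> cmod (\<integral>\<zeta>. b N \<zeta> / (\<zeta> - z) \<partial>lborel)"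
          using pi_gt3 by (simp add: X_def norm_divide norm_mult divide_le_eq mult_le_cancel_left1)
        hence "ennreal (cmod (X N z)) \<le> ennreal (cmod (\<integral>\<zeta>. b N \<zeta> / (\<zeta> - z) \<partial>lborel))" by (rule ennreal_leI)
        also have "\<dots> \<le> (\<integral>\<^sup>+\<zeta>. ennreal (norm (b N \<zeta> / (\<zeta> - z))) \<partial>lborel)"
        proof (cases "integrable lborel (\<lambda>\<zeta>. b N \<zeta> / (\<zeta> - z))")
          case True thus ?thesis by (rule integral_norm_bound_ennreal)
        qed (simp add: not_integrable_integral_eq)
        also have "\<dots> = (\<integral>\<^sup>+\<zeta>. ennreal (cmod (b N \<zeta>)) * (ennreal (cmod (z - \<zeta>) powr (- 1)) * indicator B z) \<partial>lborel)"
          using True by (intro nn_integral_cong) (simp add: norm_mult norm_inverse powr_minus divide_inverse ennreal_mult' norm_minus_commute)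
        finally show ?thesis using True by simp
      qed simp
    qed
    also have "\<dots> = (\<integral>\<^sup>+\<zeta>. (\<integral>\<^sup>+z. ennreal (cmod (b N \<zeta>)) * (ennreal (cmod (z - \<zeta>) powr (- 1)) * indicator B z) \<partial>lborel) \<partial>lborel)"
      by (rule lborel_pair.Fubini') measurable
    also have "\<dots> \<le> (\<integral>\<^sup>+\<zeta>. ennreal (K * (2 * pi * (2 * r2))) * (ennreal (cmod (dU N \<zeta>)) * indicator U \<zeta>) \<partial>lborel)"
    proof (rule nn_integral_mono)
      fix \<zeta> :: complex
      show "(\<integral>\<^sup>+z. ennreal (cmod (b N \<zeta>)) * (ennreal (cmod (z - \<zeta>) powr (- 1)) * indicator B z) \<partial>lborel)
        \<le> ennreal (K * (2 * pi * (2 * r2))) * (ennreal (cmod (dU N \<zeta>)) * indicator U \<zeta>)"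
      proof (cases "\<zeta> \<in> cball z0 r2")
        case True
        hence \<zeta>: "\<zeta> \<in> \<Omega>" "\<zeta> \<in> U" using sub2 \<Omega>U by (auto simp: \<Omega>_def)
        have BB: "B \<subseteq> ball \<zeta> (2 * r2)"
        proof
          fix z assume "z \<in> B"
          thus "z \<in> ball \<zeta> (2 * r2)" using True dist_triangle[of \<zeta> z z0] r12 by (auto simp: B_def dist_commute)
        qed
        have "(\<integral>\<^sup>+z. ennreal (cmod (b N \<zeta>)) * (ennreal (cmod (z - \<zeta>) powr (- 1)) * indicator B z) \<partial>lborel)
           = ennreal (cmod (b N \<zeta>)) * (\<integral>\<^sup>+z\<in>B. ennreal (cmod (z - \<zeta>) powr (- 1)) \<partial>lborel)"
          by (rule nn_integral_cmult) measurable
        also have "(\<integral>\<^sup>+z\<in>B. ennreal (cmod (z - \<zeta>) powr (- 1)) \<partial>lborel) \<le> (\<integral>\<^sup>+z\<in>ball \<zeta> (2 * r2). ennreal (cmod (z - \<zeta>) powr (- 1)) \<partial>lborel)"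
          using BB by (intro nn_integral_mono mult_left_mono) (auto simp: indicator_def)
        also have "\<dots> = ennreal (2 * pi * (2 * r2))"
          using nn_integral_ball_powr[of 1 "2 * r2" \<zeta>] r12 by simp
        also have "ennreal (cmod (b N \<zeta>)) * ennreal (2 * pi * (2 * r2)) \<le> ennreal (K * cmod (d N \<zeta>)) * ennreal (2 * pi * (2 * r2))"
        proof (intro mult_right_mono ennreal_leI)
          have "cmod (b N \<zeta>) = cmod (d N \<zeta>) * cmod (ct \<zeta>)" using \<zeta> by (simp add: b_def norm_mult)
          also have "\<dots> \<le> cmod (d N \<zeta>) * K" by (intro mult_left_mono K) auto
          finally show "cmod (b N \<zeta>) \<le> K * cmod (d N \<zeta>)" by (simp add: mult.commute)
        qed simp
        also have "\<dots> = ennreal (K * (2 * pi * (2 * r2)) * cmod (d N \<zeta>))"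
          using K(1) r12 by (subst ennreal_mult''[symmetric]) (auto simp: mult_ac)
        also have "\<dots> = ennreal (K * (2 * pi * (2 * r2))) * ennreal (cmod (d N \<zeta>))"
          using K(1) r12 by (subst ennreal_mult'') auto
        finally show ?thesis using \<zeta> by (simp add: mult_left_mono dU_def)
      next
        case False
        hence "b N \<zeta> = 0" using ct0 by (simp add: b_def)
        thus ?thesis by simp
      qed
    qed
    also have "\<dots> = ennreal (K * (2 * pi * (2 * r2))) * (\<integral>\<^sup>+\<zeta>. ennreal (cmod (dU N \<zeta>)) * indicator U \<zeta> \<partial>lborel)"
      using U by (intro nn_integral_cmult) measurable
    also have "(\<integral>\<^sup>+\<zeta>. ennreal (cmod (dU N \<zeta>)) * indicator U \<zeta> \<partial>lborel) = c N"
      unfolding c_def by (intro nn_integral_cong) (auto simp: indicator_def dU_def)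
    finally show ?thesis .
  qed
  have z0B: "z0 \<in> B" using r12 by (simp add: B_def)
  have Bsub: "B \<subseteq> ball z0 r" using r12 by (auto simp: B_def)
  have RhB: "continuous_on B (\<lambda>z. R z - h z)"
    by (intro continuous_intros continuous_on_subset[OF Rc Bsub] holomorphic_on_imp_continuous_on[OF hhol])
  have "(\<integral>\<^sup>+z\<in>B. ennreal (cmod (R z - h z)) \<partial>lborel) \<le> 0"
  proof (rule ennreal_le_epsilon)
    fix e :: real assume e: "e > 0"
    define A' where "A' = measure lborel B"
    have A': "emeasure lborel B = ennreal A'" "A' \<ge> 0"
      using emeasure_lborel_ball_finite[of z0 "r1/2"] by (auto simp: A'_def B_def emeasure_eq_ennreal_measure)
    define q where "q = (1 + K * (2 / r1) * A) * A' + 1"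
    have q: "q > 0" using K(1) r12 A0 A' by (auto simp: q_def intro!: add_nonneg_pos mult_nonneg_nonneg add_nonneg_nonneg)
    define e1 where "e1 = e / (2 * q)"
    have e1: "e1 > 0" using e q by (simp add: e1_def)
    have "\<forall>\<^sub>F N in sequentially. \<forall>x\<in>ball z0 r. dist (\<rho> N x) (R x) < e1"
      using r(3) e1 by (rule uniform_limitD)
    moreover have "\<forall>\<^sub>F N in sequentially. ennreal (K * (2 * pi * (2 * r2))) * c N < ennreal (e / 2)"
    proof -
      have "(\<lambda>N. ennreal (K * (2 * pi * (2 * r2))) * c N) \<longlonglongrightarrow> ennreal (K * (2 * pi * (2 * r2))) * 0"
        using small unfolding c_def by (intro ennreal_tendsto_cmult) auto
      thus ?thesis using e by (intro order_tendstoD(2)) auto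
    qed
    ultimately have "\<forall>\<^sub>F N in sequentially. (\<integral>\<^sup>+z\<in>B. ennreal (cmod (R z - h z)) \<partial>lborel) \<le> 0 + ennreal e"
    proof eventually_elim
      case (elim N)
      have un: "cmod (\<rho> N x - R x) \<le> e1" if "x \<in> \<Omega>" for x using elim(1) that by (auto simp: \<Omega>_def dist_norm less_imp_le)
      define m where "m = e1 * (1 + K * (2 / r1) * A)"
      have m0: "m \<ge> 0" using e1 K(1) r12 A0 by (auto simp: m_def)
      have hNc: "continuous_on B (\<lambda>z. hN N z - \<rho> N z)"
      proof -
        have "(\<lambda>z. \<integral>\<zeta>. a N \<zeta> / (\<zeta> - 1 * z) \<partial>lborel) holomorphic_on B" by (rule ki(2)[OF ai(1) a_in(1) z0B])
        hence "continuous_on B (hN N)" unfolding hN_def by (intro continuous_intros holomorphic_on_imp_continuous_on) simp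
        thus ?thesis by (intro continuous_intros continuous_on_subset[OF \<rho>c]) (use Bsub r(2) in auto)
      qed
      define hh where "hh = (\<lambda>z. if z \<in> B then hN N z - \<rho> N z else 0)"
      have [measurable]: "B \<in> sets borel" by (simp add: B_def)
      have Xm: "(\<lambda>z. ennreal (cmod (hh z)) * indicator B z) \<in> borel_measurable lborel"
      proof -
        have "open B" by (simp add: B_def)
        from borel_measurable_if_continuous[OF this hNc] have [measurable]: "hh \<in> borel_measurable borel" by (simp add: hh_def)
        show ?thesis by measurable
      qed
      have "(\<integral>\<^sup>+z\<in>B. ennreal (cmod (R z - h z)) \<partial>lborel) \<le> (\<integral>\<^sup>+z. ennreal m * indicator B z + ennreal (cmod (hh z)) * indicator B z \<partial>lborel)"
      proof (rule nn_integral_mono)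
        fix z :: complex
        show "ennreal (cmod (R z - h z)) * indicator B z \<le> ennreal m * indicator B z + ennreal (cmod (hh z)) * indicator B z"
        proof (cases "z \<in> B")
          case True
          have "R z - h z = - (\<rho> N z - R z) + (hN N z - h z) - (hN N z - \<rho> N z)" by simp
          hence "cmod (R z - h z) \<le> cmod (\<rho> N z - R z) + cmod (hN N z - h z) + cmod (hN N z - \<rho> N z)"
            using norm_triangle_ineq4[of "- (\<rho> N z - R z) + (hN N z - h z)" "hN N z - \<rho> N z"]
              norm_triangle_ineq[of "- (\<rho> N z - R z)" "hN N z - h z"] by (simp add: norm_minus_commute)
          also have "\<dots> \<le> e1 + e1 * (K * (2 / r1) * A) + cmod (hN N z - \<rho> N z)"
            using un[of z] hdiff[OF _ un True] e1 True Bsub by (intro add_mono) (auto simp: \<Omega>_def)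
          finally have "ennreal (cmod (R z - h z)) \<le> ennreal (m + cmod (hN N z - \<rho> N z))"
            by (intro ennreal_leI) (simp add: m_def ring_distribs)
          thus ?thesis using True m0 by (simp add: ennreal_plus hh_def)
        qed simp
      qed
      also have "\<dots> = ennreal m * emeasure lborel B + (\<integral>\<^sup>+z\<in>B. ennreal (cmod (hh z)) \<partial>lborel)"
        using Xm by (subst nn_integral_add) (auto simp: nn_integral_cmult_indicator)
      also have "(\<integral>\<^sup>+z\<in>B. ennreal (cmod (hh z)) \<partial>lborel) = (\<integral>\<^sup>+z\<in>B. ennreal (cmod (X N z)) \<partial>lborel)"
        by (intro nn_integral_cong) (auto simp: indicator_def split hh_def)
      also have "\<dots> \<le> ennreal (e / 2)" using Xbound[of N] elim(2) by (meson less_imp_le order_trans)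
      also have "ennreal m * emeasure lborel B = ennreal (m * A')" using m0 unfolding A'(1) by (rule ennreal_mult'[symmetric])
      also have "ennreal (m * A') \<le> ennreal (e / 2)"
      proof (rule ennreal_leI)
        have "m * A' \<le> e1 * q" using e1 by (simp add: m_def q_def mult.assoc)
        also have "\<dots> = e / 2" using q by (simp add: e1_def)
        finally show "m * A' \<le> e / 2" .
      qed
      also have "ennreal (e / 2) + ennreal (e / 2) = ennreal e" using e by (simp flip: ennreal_plus)
      finally show ?case by (simp add: add_right_mono)
    qed
    thus "(\<integral>\<^sup>+z\<in>B. ennreal (cmod (R z - h z)) \<partial>lborel) \<le> 0 + ennreal e"
      by (auto simp: eventually_sequentially)
  qed
  hence "(\<integral>\<^sup>+z\<in>B. ennreal (cmod (R z - h z)) \<partial>lborel) = 0" by simp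
  hence eq: "R z - h z = 0" if "z \<in> B" for z
    by (rule continuous_nn_integral_zero[rotated 2, OF _ that]) (use RhB in \<open>auto simp: B_def\<close>)
  have "R holomorphic_on B" by (rule holomorphic_transform[OF hhol]) (use eq in auto)
  hence "R field_differentiable at z0"
    using r12 by (intro holomorphic_on_imp_differentiable_at[of R B]) (auto simp: B_def)
  thus "R field_differentiable at z0 within U" by (rule field_differentiable_at_within)
qed

section \<open>From the series to a classical solution\<close>

text \<open>
  Needed for the real linear map \<open>z \<mapsto> z - \<tau> cnj z\<close> and for its inverse.
\<close>

lemma wderiv_linear:
  assumes "wderiv F G D (p * z + q * cnj z)"
  shows "wderiv (\<lambda>z. F (p * z + q * cnj z)) (p * G + cnj q * D) (q * G + cnj p * D) z"
proof -
  have "((\<lambda>z. p * z + q * cnj z) has_derivative (\<lambda>h. p * h + q * cnj h)) (at z)"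
    by (auto intro!: derivative_eq_intros)
  from has_derivative_compose[OF this assms[unfolded wderiv_def]] show ?thesis
    unfolding wderiv_def by (rule has_derivative_eq_rhs) (auto simp: fun_eq_iff algebra_simps)
qed

lemma wderiv_C1_on:
  assumes "\<And>z. z \<in> S \<Longrightarrow> wderiv F (G z) (D z) z" "continuous_on S G" "continuous_on S D"
  shows "C1_on F S"
proof -
  have "continuous_on S (\<lambda>z. G z + D z)" "continuous_on S (\<lambda>z. \<i> * (G z - D z))"
    using assms(2,3) by (auto intro!: continuous_intros)
  hence "continuous_on S (partial_x F)" "continuous_on S (partial_y F)"
    using wderiv_partial(1,2)[OF assms(1)] by (auto elim: continuous_on_eq)
  thus ?thesis unfolding C1_on_def using wderiv_partial(5,6)[OF assms(1)] by blast
qed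

lemma wderiv2_C2_on:
  assumes S: "open S" and F: "\<And>z. z \<in> S \<Longrightarrow> wderiv F (G z) (D z) z"
    and G: "\<And>z. z \<in> S \<Longrightarrow> wderiv G (G1 z) (G2 z) z" "continuous_on S G1" "continuous_on S G2"
    and D: "\<And>z. z \<in> S \<Longrightarrow> wderiv D (D1 z) (D2 z) z" "continuous_on S D1" "continuous_on S D2"
  shows "C2_on F S" and "\<And>z. z \<in> S \<Longrightarrow> d_z (d_z F) z = G1 z" and "\<And>z. z \<in> S \<Longrightarrow> d_z (d_zbar F) z = D1 z"
proof -
  have cG: "continuous_on S G" and cD: "continuous_on S D"
    using wderiv_continuous_on[of S G] wderiv_continuous_on[of S D] G(1) D(1) by blast+
  note p = wderiv_partial[OF F]
  have x: "wderiv (partial_x F) (G1 z + D1 z) (G2 z + D2 z) z" if "z \<in> S" for z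
    by (rule wderiv_transform[OF wderiv_add[OF G(1) D(1)] S that]) (use that p(1) in auto)
  have y: "wderiv (partial_y F) (\<i> * (G1 z - D1 z)) (\<i> * (G2 z - D2 z)) z" if "z \<in> S" for z
  proof -
    have "wderiv (\<lambda>z. \<i> * (G z - D z)) (\<i> * (G1 z - D1 z) + 0 * (G z - D z)) (\<i> * (G2 z - D2 z) + 0 * (G z - D z)) z"
      by (rule wderiv_mult[OF wderiv_const wderiv_diff[OF G(1)[OF that] D(1)[OF that]]])
    hence "wderiv (partial_y F) (\<i> * (G1 z - D1 z) + 0 * (G z - D z)) (\<i> * (G2 z - D2 z) + 0 * (G z - D z)) z"
      by (rule wderiv_transform[OF _ S that]) (use p(2) in auto)
    thus ?thesis by simp
  qed
  have "C1_on F S" by (rule wderiv_C1_on[OF F cG cD])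
  moreover have "C1_on (partial_x F) S" by (rule wderiv_C1_on[OF x]) (use G D in \<open>auto intro!: continuous_intros\<close>)
  moreover have "C1_on (partial_y F) S" by (rule wderiv_C1_on[OF y]) (use G D in \<open>auto intro!: continuous_intros\<close>)
  ultimately show "C2_on F S" unfolding C2_on_def by blast
  fix z assume z: "z \<in> S"
  have "wderiv (d_z F) (G1 z) (G2 z) z" by (rule wderiv_transform[OF G(1)[OF z] S z]) (use p(3) in auto)
  thus "d_z (d_z F) z = G1 z" by (rule wderiv_partial)
  have "wderiv (d_zbar F) (D1 z) (D2 z) z" by (rule wderiv_transform[OF D(1)[OF z] S z]) (use p(4) in auto)
  thus "d_z (d_zbar F) z = D1 z" by (rule wderiv_partial)
qed

text \<open>
  Both summands are annihilated for the reason that \<open>\<partial>\<close> kills \<open>cnj b\<close> and \<open>dbar + \<tau> \<partial>\<close> kills every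
  holomorphic function of \<open>z - \<tau> cnj z\<close>.
\<close>

lemma classical_solution_split:
  fixes \<tau> :: real
  assumes \<Omega>: "open \<Omega>" and V: "open V" and b: "b holomorphic_on \<Omega>" and s: "s holomorphic_on V"
    and V\<Omega>: "\<And>z. z \<in> \<Omega> \<Longrightarrow> z - of_real \<tau> * cnj z \<in> V"
    and f: "\<And>z. z \<in> \<Omega> \<Longrightarrow> f z = cnj (b z) + s (z - of_real \<tau> * cnj z)"
  shows "classical_solution \<tau> \<Omega> f"
proof -
  define \<Lambda> where "\<Lambda> = (\<lambda>z. z - of_real \<tau> * cnj z)"
  have \<Lambda>c: "continuous_on \<Omega> \<Lambda>" unfolding \<Lambda>_def by (intro continuous_intros)
  have \<Lambda>V: "\<Lambda> z \<in> V" if "z \<in> \<Omega>" for z using V\<Omega> that by (simp add: \<Lambda>_def)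
  have comp: "wderiv (\<lambda>z. g (\<Lambda> z)) (deriv g (\<Lambda> z)) (- of_real \<tau> * deriv g (\<Lambda> z)) z"
    if g: "g holomorphic_on V" and z: "z \<in> \<Omega>" for g z
  proof -
    have "wderiv g (deriv g (\<Lambda> z)) 0 (1 * z + (- of_real \<tau>) * cnj z)"
      using holomorphic_derivI[OF g V \<Lambda>V[OF z]] by (intro wderiv_holomorphic) (simp add: \<Lambda>_def)
    from wderiv_linear[OF this] show ?thesis by (simp add: \<Lambda>_def)
  qed
  have bb: "wderiv (\<lambda>z. cnj (g z)) 0 (cnj (deriv g z)) z" if "g holomorphic_on \<Omega>" "z \<in> \<Omega>" for g z
    using wderiv_cnj[OF wderiv_holomorphic[OF holomorphic_derivI[OF that(1) \<Omega> that(2)]]] by simp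
  note s' = holomorphic_deriv[OF s V] and b' = holomorphic_deriv[OF b \<Omega>]
  have c: "continuous_on \<Omega> (\<lambda>z. deriv (deriv s) (\<Lambda> z))" "continuous_on \<Omega> (deriv (deriv b))"
    using continuous_on_compose2[OF holomorphic_on_imp_continuous_on[OF holomorphic_deriv[OF s' V]] \<Lambda>c] \<Lambda>V
      holomorphic_on_imp_continuous_on[OF holomorphic_deriv[OF b' \<Omega>]] by auto
  have 0: "wderiv f (deriv s (\<Lambda> z)) (cnj (deriv b z) - of_real \<tau> * deriv s (\<Lambda> z)) z" if z: "z \<in> \<Omega>" for z
  proof -
    have "wderiv (\<lambda>z. cnj (b z) + s (\<Lambda> z)) (0 + deriv s (\<Lambda> z)) (cnj (deriv b z) + - of_real \<tau> * deriv s (\<Lambda> z)) z"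
      by (intro wderiv_add bb comp b s z)
    hence "wderiv f (0 + deriv s (\<Lambda> z)) (cnj (deriv b z) + - of_real \<tau> * deriv s (\<Lambda> z)) z"
      by (rule wderiv_transform[OF _ \<Omega> z]) (use f in \<open>auto simp: \<Lambda>_def\<close>)
    thus ?thesis by simp
  qed
  have 1: "wderiv (\<lambda>z. deriv s (\<Lambda> z)) (deriv (deriv s) (\<Lambda> z)) (- of_real \<tau> * deriv (deriv s) (\<Lambda> z)) z" if z: "z \<in> \<Omega>" for z
    by (rule comp[OF s' z])
  have 2: "wderiv (\<lambda>z. cnj (deriv b z) - of_real \<tau> * deriv s (\<Lambda> z)) (- of_real \<tau> * deriv (deriv s) (\<Lambda> z))
      (cnj (deriv (deriv b) z) + of_real (\<tau>\<^sup>2) * deriv (deriv s) (\<Lambda> z)) z" if z: "z \<in> \<Omega>" for z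
    by (rule wderiv_cong[OF wderiv_diff[OF bb[OF b' z] wderiv_mult[OF wderiv_const 1[OF z]]]])
       (auto simp: power2_eq_square)
  have C: "continuous_on \<Omega> (\<lambda>z. - of_real \<tau> * deriv (deriv s) (\<Lambda> z))"
    "continuous_on \<Omega> (\<lambda>z. cnj (deriv (deriv b) z) + of_real (\<tau>\<^sup>2) * deriv (deriv s) (\<Lambda> z))"
    by (intro continuous_intros c)+
  note r = wderiv2_C2_on[OF \<Omega> 0 1 c(1) C(1) 2 C]
  show ?thesis unfolding classical_solution_def L_op_def using r by simp
qed

lemma nn_integral_axis_scaling:
  fixes f :: "complex \<Rightarrow> ennreal" and a b :: real
  assumes f: "f \<in> borel_measurable borel" and ab: "a > 0" "b > 0"
  shows "(\<integral>\<^sup>+z. f (Complex (a * Re z) (b * Im z)) \<partial>lborel) = ennreal (1 / (a * b)) * (\<integral>\<^sup>+w. f w \<partial>lborel)"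
proof -
  define c where "c = (\<lambda>j::complex. if j = 1 then a else b)"
  define T where "T = (\<lambda>x::complex. 0 + (\<Sum>j\<in>Basis. (c j * (x \<bullet> j)) *\<^sub>R j))"
  have T: "T z = Complex (a * Re z) (b * Im z)" for z
    by (simp add: T_def c_def Basis_complex_def complex_eq_iff)
  have P: "(\<Prod>j\<in>Basis. \<bar>c j\<bar>) = a * b" using ab by (simp add: c_def Basis_complex_def)
  have Tm: "T \<in> borel_measurable borel" unfolding T_def by measurable
  have "lborel = density (distr lborel borel T) (\<lambda>_. (\<Prod>j\<in>Basis. \<bar>c j\<bar>))"
    unfolding T_def by (rule lborel_affine_euclidean) (use ab in \<open>auto simp: c_def\<close>)
  hence "(\<integral>\<^sup>+w. f w \<partial>lborel) = (\<integral>\<^sup>+w. f w \<partial>density (distr lborel borel T) (\<lambda>_. ennreal (a * b)))" by (simp add: P)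
  also have "\<dots> = ennreal (a * b) * (\<integral>\<^sup>+z. f (T z) \<partial>lborel)"
    using f Tm by (simp add: nn_integral_density nn_integral_distr nn_integral_cmult)
  finally have "ennreal (1 / (a * b)) * (\<integral>\<^sup>+w. f w \<partial>lborel) = (ennreal (1 / (a * b)) * ennreal (a * b)) * (\<integral>\<^sup>+z. f (T z) \<partial>lborel)"
    by (simp add: mult.assoc)
  also have "ennreal (1 / (a * b)) * ennreal (a * b) = 1" using ab by (subst ennreal_mult'[symmetric]) auto
  finally show ?thesis by (simp add: T)
qed

text \<open>
  The scale \<open>L\<close> distributes a geometric decay of \<open>g\<close> evenly: if the integral of the square of \<open>g\<close>
  decays like \<open>L\<^sup>2\<close>, then the integral of the product decays like \<open>L\<close>.
\<close>

lemma nn_integral_young: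
  fixes g w :: "complex \<Rightarrow> complex" and L M A :: real
  assumes g: "continuous_on (ball 0 1) g" and w: "continuous_on (ball 0 1) w" and L: "L > 0" and MA: "M \<ge> 0" "A \<ge> 0"
    and gM: "(\<integral>\<^sup>+z\<in>ball 0 1. ennreal ((cmod (g z))\<^sup>2) \<partial>lborel) \<le> ennreal (M * L\<^sup>2)"
    and wA: "(\<integral>\<^sup>+z\<in>ball 0 1. ennreal ((cmod (w z))\<^sup>2) \<partial>lborel) \<le> ennreal A"
  shows "(\<integral>\<^sup>+z\<in>ball 0 1. ennreal (cmod (g z) * cmod (w z)) \<partial>lborel) \<le> ennreal (L * (M + A))"
proof -
  note [measurable] = disk_cut_measurable[OF g] disk_cut_measurable[OF w]
  have e: "(\<integral>\<^sup>+z\<in>ball 0 1. ennreal ((cmod (\<phi> z))\<^sup>2) \<partial>lborel) = (\<integral>\<^sup>+z. ennreal ((cmod (disk_cut \<phi> z))\<^sup>2) \<partial>lborel)" for \<phi>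
    by (intro nn_integral_cong) (auto simp: disk_cut_def indicator_def)
  have "(\<integral>\<^sup>+z\<in>ball 0 1. ennreal (cmod (g z) * cmod (w z)) \<partial>lborel)
     \<le> (\<integral>\<^sup>+z. ennreal (1 / L) * ennreal ((cmod (disk_cut g z))\<^sup>2) + ennreal L * ennreal ((cmod (disk_cut w z))\<^sup>2) \<partial>lborel)"
  proof (rule nn_integral_mono)
    fix z :: complex
    have "cmod (g z) * cmod (w z) \<le> 1 / L * (cmod (g z))\<^sup>2 + L * (cmod (w z))\<^sup>2"
    proof -
      have "0 \<le> (cmod (g z) - L * cmod (w z))\<^sup>2" by simp
      hence "2 * L * (cmod (g z) * cmod (w z)) \<le> (cmod (g z))\<^sup>2 + L\<^sup>2 * (cmod (w z))\<^sup>2"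
        by (simp add: power2_eq_square algebra_simps)
      moreover have "0 \<le> L * (cmod (g z) * cmod (w z))" using L by simp
      ultimately have "L * (cmod (g z) * cmod (w z)) \<le> (cmod (g z))\<^sup>2 + L\<^sup>2 * (cmod (w z))\<^sup>2" by linarith
      hence "L * (cmod (g z) * cmod (w z)) / L \<le> ((cmod (g z))\<^sup>2 + L\<^sup>2 * (cmod (w z))\<^sup>2) / L"
        using L by (intro divide_right_mono) auto
      thus ?thesis using L by (simp add: add_divide_distrib power2_eq_square)
    qed
    hence "ennreal (cmod (g z) * cmod (w z)) \<le> ennreal (1 / L * (cmod (g z))\<^sup>2 + L * (cmod (w z))\<^sup>2)" by (rule ennreal_leI)
    also have "\<dots> = ennreal (1 / L * (cmod (g z))\<^sup>2) + ennreal (L * (cmod (w z))\<^sup>2)"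
      using L by (intro ennreal_plus) auto
    also have "\<dots> = ennreal (1 / L) * ennreal ((cmod (g z))\<^sup>2) + ennreal L * ennreal ((cmod (w z))\<^sup>2)"
      using L ennreal_mult'[of "1 / L"] ennreal_mult'[of L] by (metis less_imp_le zero_le_divide_1_iff)
    finally have "ennreal (cmod (g z) * cmod (w z)) \<le> ennreal (1 / L) * ennreal ((cmod (g z))\<^sup>2) + ennreal L * ennreal ((cmod (w z))\<^sup>2)" .
    thus "ennreal (cmod (g z) * cmod (w z)) * indicator (ball 0 1) z \<le> ennreal (1 / L) * ennreal ((cmod (disk_cut g z))\<^sup>2) + ennreal L * ennreal ((cmod (disk_cut w z))\<^sup>2)"
      by (auto simp: disk_cut_def indicator_def)
  qed
  also have "\<dots> = ennreal (1 / L) * (\<integral>\<^sup>+z\<in>ball 0 1. ennreal ((cmod (g z))\<^sup>2) \<partial>lborel) + ennreal L * (\<integral>\<^sup>+z\<in>ball 0 1. ennreal ((cmod (w z))\<^sup>2) \<partial>lborel)"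
    unfolding e by (simp add: nn_integral_add nn_integral_cmult)
  also have "\<dots> \<le> ennreal (1 / L) * ennreal (M * L\<^sup>2) + ennreal L * ennreal A"
    by (intro add_mono mult_left_mono gM wA) auto
  also have "ennreal (1 / L) * ennreal (M * L\<^sup>2) = ennreal (L * M)"
    using L by (subst ennreal_mult'[symmetric]) (auto simp: power2_eq_square mult.commute)
  also have "ennreal L * ennreal A = ennreal (L * A)" using L by (intro ennreal_mult'[symmetric]) auto
  also have "ennreal (L * M) + ennreal (L * A) = ennreal (L * (M + A))"
    using L MA by (subst ennreal_plus[symmetric]) (auto simp: ring_distribs)
  finally show ?thesis .
qed

lemma uniform_limit_inner:
  assumes u: "uniform_limit A f l F" and g: "\<And>x. x \<in> B \<Longrightarrow> g x \<in> A"
  shows "uniform_limit B (\<lambda>n x. f n (g x)) (\<lambda>x. l (g x)) F"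
proof (rule uniform_limitI)
  fix e :: real assume "e > 0"
  from uniform_limitD[OF u this] show "\<forall>\<^sub>F n in F. \<forall>x\<in>B. dist (f n (g x)) (l (g x)) < e"
    by (rule eventually_mono) (use g in blast)
qed

text \<open>
  The antiholomorphic parts of the iterates are not controlled up to the circle, but geometric decay
  with a bound depending on the distance to the circle is enough for a holomorphic sum.
\<close>

lemma locally_uniform_series_holomorphic:
  fixes B :: "nat \<Rightarrow> complex \<Rightarrow> complex" and C q :: real
  assumes B: "\<And>n. B n holomorphic_on ball 0 1" and q: "0 < q" "q < 1"
    and bound: "\<And>n z. cmod z < 1 \<Longrightarrow> cmod (B (Suc n) z) \<le> C * q ^ n / (1 - cmod z)"
  defines "S \<equiv> (\<lambda>z. \<Sum>n. B n z)"
  shows "S holomorphic_on ball 0 1"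
    and "\<And>r. r < 1 \<Longrightarrow> uniform_limit (cball 0 r) (\<lambda>N z. \<Sum>n<N. B n z) S sequentially"
proof -
  have C: "C \<ge> 0" using order_trans[OF norm_ge_zero bound[of 0 0]] by simp
  show u: "uniform_limit (cball 0 r) (\<lambda>N z. \<Sum>n<N. B n z) S sequentially" if r: "r < 1" for r
  proof -
    have "continuous_on (cball 0 r) (B 0)"
      using holomorphic_on_imp_continuous_on[OF B[of 0]] by (rule continuous_on_subset) (use r in auto)
    hence "bounded (B 0 ` cball 0 r)" by (intro compact_imp_bounded compact_continuous_image) auto
    then obtain K where K: "\<And>z. z \<in> cball 0 r \<Longrightarrow> cmod (B 0 z) \<le> K" unfolding bounded_iff by blast
    define m where "m = (\<lambda>n. case n of 0 \<Rightarrow> K | Suc n \<Rightarrow> C / (1 - r) * q ^ n)"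
    show ?thesis unfolding S_def
    proof (rule Weierstrass_m_test)
      fix n z assume z: "z \<in> cball (0::complex) r"
      show "norm (B n z) \<le> m n"
      proof (cases n)
        case (Suc k)
        have "cmod (B (Suc k) z) \<le> C * q ^ k / (1 - cmod z)" using z r by (intro bound) auto
        also have "\<dots> \<le> C * q ^ k / (1 - r)" using z r C q by (intro divide_left_mono) auto
        finally show ?thesis by (simp add: m_def Suc)
      qed (use K z in \<open>simp add: m_def\<close>)
    next
      have "summable (\<lambda>n. m (Suc n))" using q by (simp add: m_def summable_mult summable_geometric)
      thus "summable m" by (simp only: summable_Suc_iff)
    qed
  qed
  show "S holomorphic_on ball 0 1"
  proof (rule holomorphic_uniform_sequence[OF open_ball])
    show "(\<lambda>z. \<Sum>n<N. B n z) holomorphic_on ball 0 1" for N by (intro holomorphic_intros B)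
    fix x :: complex assume x: "x \<in> ball 0 1"
    define d where "d = (1 - cmod x) / 2"
    have "cball x d \<subseteq> cball 0 ((1 + cmod x) / 2)"
    proof
      fix y assume "y \<in> cball x d"
      thus "y \<in> cball 0 ((1 + cmod x) / 2)" using norm_triangle_ineq2[of y x]
        by (simp add: d_def dist_norm norm_minus_commute field_simps)
    qed
    moreover from this have "cball x d \<subseteq> ball 0 1" using x by auto
    ultimately show "\<exists>d>0. cball x d \<subseteq> ball 0 1 \<and> uniform_limit (cball x d) (\<lambda>N z. \<Sum>n<N. B n z) S sequentially"
      using x uniform_limit_on_subset[OF u[of "(1 + cmod x) / 2"]] by (intro exI[of _ d]) (auto simp: d_def)
  qed
qed

text \<open>
  The passage from the series to the equation. On the disk, \<open>D\<close> of the partial sums without their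
  antiholomorphic parts telescopes to \<open>- \<tau> (cnj \<omega>' / \<omega>')\<close> times \<open>G\<close> of the same partial sums, except
  for the last term. After composition with \<open>\<psi>\<close> and with the inverse \<open>\<chi>'\<close> of \<open>w \<mapsto> w - \<tau> cnj w\<close>, only
  this last term is left in the antiholomorphic derivative, and its \<open>L\<^sup>1\<close> norm is \<open>O(q ^ N)\<close> by the
  energy bound and the finite area of \<open>\<Omega>\<close>. The limit is therefore holomorphic in the new coordinate.
\<close>

lemma iterated_series_solution:
  fixes F G D B :: "nat \<Rightarrow> complex \<Rightarrow> complex" and \<tau> q C M :: real
  assumes \<omega>: "\<omega> holomorphic_on ball 0 1" "\<And>z. z \<in> ball 0 1 \<Longrightarrow> deriv \<omega> z \<noteq> 0"
    and \<psi>: "\<And>z. z \<in> ball 0 1 \<Longrightarrow> \<psi> (\<omega> z) = z" and \<Omega>: "\<Omega> = \<omega> ` ball 0 1" "open \<Omega>" "bounded \<Omega>"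
    and \<tau>: "0 \<le> \<tau>" "\<tau> < 1" and q: "0 < q" "q < 1" and M: "M \<ge> 0"
    and F: "\<And>n z. z \<in> ball 0 1 \<Longrightarrow> wderiv (F n) (G n z) (D n z) z"
    and Gc: "\<And>n. continuous_on (ball 0 1) (G n)"
    and Dc: "\<And>n. continuous_on (ball 0 1) (D n)"
    and B: "\<And>n. B n holomorphic_on ball 0 1"
    and D0: "\<And>z. z \<in> ball 0 1 \<Longrightarrow> D 0 z = cnj (deriv (B 0) z)"
    and DS: "\<And>n z. z \<in> ball 0 1 \<Longrightarrow> D (Suc n) z + cnj (deriv \<omega> z) / deriv \<omega> z * G n z = cnj (deriv (B (Suc n)) z)"
    and Bb: "\<And>n z. cmod z < 1 \<Longrightarrow> cmod (B (Suc n) z * of_real \<tau> ^ Suc n) \<le> C * q ^ n / (1 - cmod z)"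
    and GM: "\<And>n. (\<integral>\<^sup>+z\<in>ball 0 1. ennreal ((cmod (G n z * of_real \<tau> ^ n))\<^sup>2) \<partial>lborel) \<le> ennreal (M * (q ^ n)\<^sup>2)"
    and lim: "uniform_limit (ball 0 1) (\<lambda>N z. \<Sum>n<N. F n z * of_real \<tau> ^ n) \<Phi> sequentially"
  shows "classical_solution \<tau> \<Omega> (\<lambda>w. \<Phi> (\<psi> w))"
proof -
  define k where "k = 1 - \<tau>\<^sup>2"
  have k: "k > 0" using \<tau> by (simp add: k_def abs_square_less_1)
  \<comment> \<open>The inverse of \<open>w \<mapsto> w - \<tau> cnj w\<close>, which exists because \<open>k \<noteq> 0\<close>.\<close>
  define \<chi>' where "\<chi>' = (\<lambda>\<xi>::complex. of_real (1 / k) * \<xi> + of_real (\<tau> / k) * cnj \<xi>)"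
  define V where "V = \<chi>' -` \<Omega>"
  have \<chi>c: "continuous_on UNIV \<chi>'" unfolding \<chi>'_def by (intro continuous_intros)
  have V: "open V" unfolding V_def by (rule open_vimage[OF \<Omega>(2) \<chi>c])
  have \<chi>\<Lambda>: "\<chi>' (w - of_real \<tau> * cnj w) = w" for w
  proof -
    have "\<chi>' (w - of_real \<tau> * cnj w) = of_real (1 / k - \<tau>\<^sup>2 / k) * w"
      unfolding \<chi>'_def using k by (simp add: divide_simps power2_eq_square) (simp add: algebra_simps)
    also have "1 / k - \<tau>\<^sup>2 / k = 1" using k by (simp add: k_def flip: diff_divide_distrib)
    finally show ?thesis by simp
  qed
  have inj: "inj_on \<omega> (ball 0 1)" by (rule inj_on_inverseI[of _ \<psi>]) (rule \<psi>)
  have \<psi>\<Omega>: "\<psi> w \<in> ball 0 1" "\<omega> (\<psi> w) = w" if "w \<in> \<Omega>" for w using that \<psi> \<Omega>(1) by auto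
  have \<psi>im: "\<psi> ` \<Omega> \<subseteq> ball 0 1" using \<psi>\<Omega> by blast
  have \<psi>d: "(\<psi> has_field_derivative inverse (deriv \<omega> (\<psi> w))) (at w)" if "w \<in> \<Omega>" for w
  proof -
    have "(\<psi> has_field_derivative inverse (deriv \<omega> (\<psi> w))) (at (\<omega> (\<psi> w)))"
      by (rule has_field_derivative_inverse_strong[of \<omega> _ "\<psi> w" "ball 0 1" \<psi>])
        (use \<psi>\<Omega>[OF that] \<omega> \<psi> in \<open>auto intro!: holomorphic_derivI[of _ "ball 0 1"] holomorphic_on_imp_continuous_on\<close>)
    thus ?thesis using \<psi>\<Omega>[OF that] by simp
  qed
  have \<psi>h: "\<psi> holomorphic_on \<Omega>" unfolding holomorphic_on_open[OF \<Omega>(2)] using \<psi>d by blast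
  have \<psi>c: "continuous_on \<Omega> \<psi>" using \<psi>h by (rule holomorphic_on_imp_continuous_on)
  define B\<tau> where "B\<tau> = (\<lambda>n z. B n z * of_real \<tau> ^ n)"
  have B\<tau>: "B\<tau> n holomorphic_on ball 0 1" for n unfolding B\<tau>_def by (intro holomorphic_intros B)
  define Bs where "Bs = (\<lambda>z. \<Sum>n. B\<tau> n z)"
  have B\<tau>b: "cmod (B\<tau> (Suc n) z) \<le> C * q ^ n / (1 - cmod z)" if "cmod z < 1" for n z
    unfolding B\<tau>_def by (rule Bb[OF that])
  have BB1: "Bs holomorphic_on ball 0 1"
    unfolding Bs_def by (rule locally_uniform_series_holomorphic(1)[OF B\<tau> q B\<tau>b])
  have BB2: "uniform_limit (cball 0 r) (\<lambda>N z. \<Sum>n<N. B\<tau> n z) Bs sequentially" if "r < 1" for r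
    unfolding Bs_def by (rule locally_uniform_series_holomorphic(2)[OF B\<tau> q B\<tau>b that])
  define P where "P = (\<lambda>N z. (\<Sum>n<Suc N. F n z * of_real \<tau> ^ n) - cnj (\<Sum>n<Suc N. B\<tau> n z))"
  define GS where "GS = (\<lambda>N z. \<Sum>n<Suc N. G n z * of_real \<tau> ^ n)"
  define DSS where "DSS = (\<lambda>N z. (\<Sum>n<Suc N. D n z * of_real \<tau> ^ n) - cnj (\<Sum>n<Suc N. deriv (B n) z * of_real \<tau> ^ n))"
  \<comment> \<open>\<open>G n\<close> enters through the summand with index \<open>Suc n\<close>, hence the missing last term.\<close>
  have telescope: "DSS N z = - of_real \<tau> * (cnj (deriv \<omega> z) / deriv \<omega> z) * (GS N z - G N z * of_real \<tau> ^ N)" if z: "z \<in> ball 0 1" for N z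
  proof (induction N)
    case 0
    show ?case using D0[OF z] by (simp add: DSS_def GS_def)
  next
    case (Suc N)
    have "DSS (Suc N) z = DSS N z + (D (Suc N) z - cnj (deriv (B (Suc N)) z)) * of_real \<tau> ^ Suc N"
      by (simp add: DSS_def algebra_simps)
    also have "D (Suc N) z - cnj (deriv (B (Suc N)) z) = - (cnj (deriv \<omega> z) / deriv \<omega> z * G N z)"
      using DS[OF z, of N] by (simp add: algebra_simps)
    finally show ?case unfolding Suc by (simp add: GS_def algebra_simps)
  qed
  have Pw: "wderiv (P N) (GS N z) (DSS N z) z" if z: "z \<in> ball 0 1" for N z
  proof -
    have 1: "wderiv (\<lambda>z. F n z * of_real \<tau> ^ n) (G n z * of_real \<tau> ^ n) (D n z * of_real \<tau> ^ n) z" for n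
      by (rule wderiv_cong[OF wderiv_mult[OF F[OF z] wderiv_const]]) auto
    have "(B\<tau> n has_field_derivative deriv (B n) z * of_real \<tau> ^ n) (at z)" for n
      unfolding B\<tau>_def by (rule DERIV_cmult_right[OF holomorphic_derivI[OF B open_ball z]])
    hence "((\<lambda>z. \<Sum>n<Suc N. B\<tau> n z) has_field_derivative (\<Sum>n<Suc N. deriv (B n) z * of_real \<tau> ^ n)) (at z)"
      by (intro DERIV_sum) auto
    from wderiv_diff[OF wderiv_sum[of "{..<Suc N}", OF 1] wderiv_cnj[OF wderiv_holomorphic[OF this]]]
    show ?thesis unfolding P_def GS_def DSS_def by simp
  qed
  have GSc: "continuous_on (ball 0 1) (GS N)" for N unfolding GS_def by (intro continuous_intros Gc)
  have DSc: "continuous_on (ball 0 1) (DSS N)" for N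
    unfolding DSS_def using holomorphic_on_imp_continuous_on[OF holomorphic_deriv[OF B open_ball]] Dc
    by (intro continuous_intros) auto
  define \<rho> where "\<rho> = (\<lambda>N \<xi>. P N (\<psi> (\<chi>' \<xi>)))"
  define j where "j = (\<lambda>w. inverse (deriv \<omega> (\<psi> w)))"
  define gg where "gg = (\<lambda>N \<xi>. of_real (1 / k) * (GS N (\<psi> (\<chi>' \<xi>)) * j (\<chi>' \<xi>)) + of_real (\<tau> / k) * (DSS N (\<psi> (\<chi>' \<xi>)) * cnj (j (\<chi>' \<xi>))))"
  define dd where "dd = (\<lambda>N w. of_real (\<tau> / k) * (G N (\<psi> w) * of_real \<tau> ^ N * j w))"
  have \<rho>w: "wderiv (\<rho> N) (gg N \<xi>) (dd N (\<chi>' \<xi>)) \<xi>" if \<xi>: "\<xi> \<in> V" for N \<xi>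
  proof -
    have w: "\<chi>' \<xi> \<in> \<Omega>" using \<xi> by (simp add: V_def)
    note z = \<psi>\<Omega>(1)[OF w]
    have "wderiv (\<lambda>w. P N (\<psi> w)) (GS N (\<psi> (\<chi>' \<xi>)) * j (\<chi>' \<xi>)) (DSS N (\<psi> (\<chi>' \<xi>)) * cnj (j (\<chi>' \<xi>))) (of_real (1 / k) * \<xi> + of_real (\<tau> / k) * cnj \<xi>)"
      using wderiv_compose[OF Pw[OF z] \<psi>d[OF w]] by (simp add: \<chi>'_def j_def)
    from wderiv_linear[OF this]
    have W: "wderiv (\<rho> N) (gg N \<xi>) (of_real (\<tau> / k) * (GS N (\<psi> (\<chi>' \<xi>)) * j (\<chi>' \<xi>)) + of_real (1 / k) * (DSS N (\<psi> (\<chi>' \<xi>)) * cnj (j (\<chi>' \<xi>)))) \<xi>"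
      unfolding \<rho>_def gg_def by (simp add: \<chi>'_def)
    have e: "DSS N (\<psi> (\<chi>' \<xi>)) * cnj (j (\<chi>' \<xi>)) = - of_real \<tau> * (GS N (\<psi> (\<chi>' \<xi>)) - G N (\<psi> (\<chi>' \<xi>)) * of_real \<tau> ^ N) * j (\<chi>' \<xi>)"
      unfolding telescope[OF z] j_def using \<omega>(2)[OF z] by (simp add: field_simps)
    have d: "of_real (\<tau> / k) * (GS N (\<psi> (\<chi>' \<xi>)) * j (\<chi>' \<xi>)) + of_real (1 / k) * (DSS N (\<psi> (\<chi>' \<xi>)) * cnj (j (\<chi>' \<xi>))) = dd N (\<chi>' \<xi>)"
      unfolding e dd_def using k by (simp add: divide_simps) (simp add: algebra_simps)
    show ?thesis using W unfolding d .
  qed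
  have jc: "continuous_on \<Omega> j" unfolding j_def
    using continuous_on_compose2[OF holomorphic_on_imp_continuous_on[OF holomorphic_deriv[OF \<omega>(1) open_ball]] \<psi>c \<psi>im] \<psi>\<Omega>(1) \<omega>(2)
    by (intro continuous_intros) auto
  have ddc: "continuous_on \<Omega> (dd N)" for N unfolding dd_def
    using continuous_on_compose2[OF Gc \<psi>c \<psi>im] by (intro continuous_intros jc) auto
  have V\<chi>: "continuous_on V \<chi>'" "\<And>\<xi>. \<xi> \<in> V \<Longrightarrow> \<chi>' \<xi> \<in> \<Omega>" using continuous_on_subset[OF \<chi>c] by (auto simp: V_def)
  have \<psi>\<chi>: "continuous_on V (\<lambda>\<xi>. \<psi> (\<chi>' \<xi>))" using continuous_on_compose2[OF \<psi>c V\<chi>(1)] V\<chi>(2) by blast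
  have ggc: "continuous_on V (gg N)" for N unfolding gg_def
    using continuous_on_compose2[OF GSc \<psi>\<chi>] continuous_on_compose2[OF DSc \<psi>\<chi>] continuous_on_compose2[OF jc V\<chi>(1)] \<psi>\<Omega> V\<chi>(2)
    by (intro continuous_intros) (auto simp: image_subset_iff)
  define R where "R = (\<lambda>\<xi>. \<Phi> (\<psi> (\<chi>' \<xi>)) - cnj (Bs (\<psi> (\<chi>' \<xi>))))"
  have "R holomorphic_on V"
  proof (rule dbar_L1_limit_holomorphic[OF V \<rho>w ggc])
    show "continuous_on V (\<lambda>\<xi>. dd N (\<chi>' \<xi>))" for N using continuous_on_compose2[OF ddc V\<chi>(1)] V\<chi>(2) by blast
    fix \<xi> assume \<xi>: "\<xi> \<in> V"
    define r where "r = (1 + cmod (\<psi> (\<chi>' \<xi>))) / 2"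
    have r: "cmod (\<psi> (\<chi>' \<xi>)) < r" "r < 1" using \<psi>\<Omega>(1)[OF V\<chi>(2)[OF \<xi>]] by (auto simp: r_def)
    have "open ((\<lambda>\<xi>. \<psi> (\<chi>' \<xi>)) -` ball 0 r \<inter> V)" using continuous_on_open_vimage[OF V] \<psi>\<chi> open_ball by blast
    then obtain e where e: "e > 0" "ball \<xi> e \<subseteq> (\<lambda>\<xi>. \<psi> (\<chi>' \<xi>)) -` ball 0 r \<inter> V"
      using \<xi> r unfolding open_contains_ball by (metis IntI mem_ball_0 vimageI2)
    have 1: "uniform_limit (ball \<xi> e) (\<lambda>N \<xi>. \<Sum>n<Suc N. F n (\<psi> (\<chi>' \<xi>)) * of_real \<tau> ^ n) (\<lambda>\<xi>. \<Phi> (\<psi> (\<chi>' \<xi>))) sequentially"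
      by (rule uniform_limit_inner[OF filterlim_compose[OF lim filterlim_Suc]]) (use e(2) r(2) in auto)
    have 2: "uniform_limit (ball \<xi> e) (\<lambda>N \<xi>. \<Sum>n<Suc N. B\<tau> n (\<psi> (\<chi>' \<xi>))) (\<lambda>\<xi>. Bs (\<psi> (\<chi>' \<xi>))) sequentially"
      by (rule uniform_limit_inner[OF filterlim_compose[OF BB2[OF r(2)] filterlim_Suc]]) (use e(2) in auto)
    have "uniform_limit (ball \<xi> e) \<rho> R sequentially" unfolding \<rho>_def P_def R_def
      by (intro uniform_limit_minus 1 bounded_linear.uniform_limit[OF bounded_linear_cnj 2])
    thus "\<exists>r>0. ball \<xi> r \<subseteq> V \<and> uniform_limit (ball \<xi> r) \<rho> R sequentially" using e by blast
  next
    \<comment> \<open>This integral is the area of \<open>\<Omega>\<close>.\<close>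
    obtain A where A: "A \<ge> 0" "(\<integral>\<^sup>+z\<in>ball 0 1. ennreal ((cmod (deriv \<omega> z))\<^sup>2) \<partial>lborel) \<le> ennreal A"
    proof -
      have "emeasure lborel \<Omega> < \<infinity>" using \<Omega>(3) by (rule emeasure_bounded_finite)
      moreover have "emeasure lborel \<Omega> = (\<integral>\<^sup>+w\<in>\<omega> ` ball 0 1. 1 \<partial>lborel)" using \<Omega> by simp
      moreover have "\<dots> = (\<integral>\<^sup>+z\<in>ball 0 1. 1 * ennreal ((cmod (deriv \<omega> z))\<^sup>2) \<partial>lborel)"
        by (rule nn_integral_holomorphic_subst[OF open_ball \<omega>(1) inj]) simp
      ultimately have "(\<integral>\<^sup>+z\<in>ball 0 1. ennreal ((cmod (deriv \<omega> z))\<^sup>2) \<partial>lborel) = ennreal (enn2real (emeasure lborel \<Omega>))" by simp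
      thus ?thesis using that[of "enn2real (emeasure lborel \<Omega>)"] by simp
    qed
    define K where "K = \<tau> / k * (k * (M + A))"
    have a: "1 / (1 - \<tau>) > 0" "1 / (1 + \<tau>) > 0" using \<tau> by auto
    have bound: "(\<integral>\<^sup>+\<xi>\<in>V. ennreal (cmod (dd N (\<chi>' \<xi>))) \<partial>lborel) \<le> ennreal (K * q ^ N)" for N
    proof -
      define d0 where "d0 = (\<lambda>w. ennreal (cmod (if w \<in> \<Omega> then dd N w else 0)))"
      have m: "d0 \<in> borel_measurable borel"
        using borel_measurable_if_continuous[OF \<Omega>(2) ddc[of N]] unfolding d0_def by measurable
      have kk: "1 / (1 - \<tau>) * (1 / (1 + \<tau>)) = 1 / k" by (simp add: k_def power2_eq_square algebra_simps)
      have \<chi>C: "\<chi>' \<xi> = Complex (1 / (1 - \<tau>) * Re \<xi>) (1 / (1 + \<tau>) * Im \<xi>)" for \<xi>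
      proof -
        have kf: "k = (1 - \<tau>) * (1 + \<tau>)" by (simp add: k_def power2_eq_square algebra_simps)
        have "1 / k + \<tau> / k = 1 / (1 - \<tau>)" "1 / k - \<tau> / k = 1 / (1 + \<tau>)"
          using \<tau> unfolding kf add_divide_distrib[symmetric] diff_divide_distrib[symmetric] by auto
        moreover have "\<chi>' \<xi> = Complex ((1 / k + \<tau> / k) * Re \<xi>) ((1 / k - \<tau> / k) * Im \<xi>)"
          by (simp add: \<chi>'_def complex_eq_iff algebra_simps)
        ultimately show ?thesis by simp
      qed
      have "(\<integral>\<^sup>+\<xi>\<in>V. ennreal (cmod (dd N (\<chi>' \<xi>))) \<partial>lborel) = (\<integral>\<^sup>+\<xi>. d0 (\<chi>' \<xi>) \<partial>lborel)"
        by (intro nn_integral_cong) (auto simp: d0_def V_def indicator_def)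
      also have "\<dots> = ennreal k * (\<integral>\<^sup>+w. d0 w \<partial>lborel)"
        unfolding \<chi>C nn_integral_axis_scaling[OF m a] kk using k by simp
      also have "(\<integral>\<^sup>+w. d0 w \<partial>lborel) = (\<integral>\<^sup>+w\<in>\<omega> ` ball 0 1. d0 w \<partial>lborel)"
        unfolding \<Omega>(1)[symmetric] by (intro nn_integral_cong) (auto simp: d0_def indicator_def)
      also have "\<dots> = (\<integral>\<^sup>+z\<in>ball 0 1. d0 (\<omega> z) * ennreal ((cmod (deriv \<omega> z))\<^sup>2) \<partial>lborel)"
        by (rule nn_integral_holomorphic_subst[OF open_ball \<omega>(1) inj m])
      also have "\<dots> = (\<integral>\<^sup>+z. ennreal (\<tau> / k) * (ennreal (cmod (G N z * of_real \<tau> ^ N) * cmod (deriv \<omega> z)) * indicator (ball 0 1) z) \<partial>lborel)"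
      proof (rule nn_integral_cong)
        fix z :: complex
        show "d0 (\<omega> z) * ennreal ((cmod (deriv \<omega> z))\<^sup>2) * indicator (ball 0 1) z
          = ennreal (\<tau> / k) * (ennreal (cmod (G N z * of_real \<tau> ^ N) * cmod (deriv \<omega> z)) * indicator (ball 0 1) z)"
        proof (cases "z \<in> ball 0 1")
          case True
          hence "\<omega> z \<in> \<Omega>" using \<Omega>(1) by blast
          moreover have "cmod (dd N (\<omega> z)) * (cmod (deriv \<omega> z))\<^sup>2 = \<tau> / k * (cmod (G N z * of_real \<tau> ^ N) * cmod (deriv \<omega> z))"
            using \<psi>[OF True] \<omega>(2)[OF True] \<tau> k
            by (simp add: dd_def j_def norm_mult norm_inverse norm_divide power2_eq_square)
          ultimately show ?thesis using True \<tau> k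
            by (simp add: d0_def ennreal_mult'[symmetric] ennreal_mult''[symmetric] del: norm_mult)
        qed simp
      qed
      also have "\<dots> = ennreal (\<tau> / k) * (\<integral>\<^sup>+z\<in>ball 0 1. ennreal (cmod (G N z * of_real \<tau> ^ N) * cmod (deriv \<omega> z)) \<partial>lborel)"
      proof (rule nn_integral_cmult)
        have "continuous_on (ball 0 1) (\<lambda>z. G N z * of_real \<tau> ^ N * deriv \<omega> z)"
          by (intro continuous_on_mult continuous_on_const Gc holomorphic_on_imp_continuous_on[OF holomorphic_deriv[OF \<omega>(1) open_ball]])
        from borel_measurable_if_continuous[OF open_ball this]
        have "(\<lambda>z. cmod (if z \<in> ball 0 1 then G N z * of_real \<tau> ^ N * deriv \<omega> z else 0)) \<in> borel_measurable borel"
          by (rule measurable_compose[OF _ borel_measurable_norm])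
        moreover have "(\<lambda>z. ennreal (cmod (G N z * of_real \<tau> ^ N) * cmod (deriv \<omega> z)) * indicator (ball 0 1) z)
           = (\<lambda>z. ennreal (cmod (if z \<in> ball 0 1 then G N z * of_real \<tau> ^ N * deriv \<omega> z else 0)))"
          by (auto simp: fun_eq_iff indicator_def norm_mult)
        ultimately show "(\<lambda>z. ennreal (cmod (G N z * of_real \<tau> ^ N) * cmod (deriv \<omega> z)) * indicator (ball 0 1) z) \<in> borel_measurable lborel"
          by simp
      qed
      also have "\<dots> \<le> ennreal (\<tau> / k) * ennreal (q ^ N * (M + A))"
        by (intro mult_left_mono nn_integral_young GM A M)
           (use q Gc in \<open>auto intro!: continuous_intros holomorphic_on_imp_continuous_on[OF holomorphic_deriv[OF \<omega>(1) open_ball]]\<close>)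
      also have "\<dots> = ennreal (\<tau> / k * (q ^ N * (M + A)))" using \<tau> k by (subst ennreal_mult'[symmetric]) auto
      finally have "(\<integral>\<^sup>+\<xi>\<in>V. ennreal (cmod (dd N (\<chi>' \<xi>))) \<partial>lborel) \<le> ennreal k * ennreal (\<tau> / k * (q ^ N * (M + A)))"
        by (simp add: mult_left_mono)
      also have "\<dots> = ennreal (k * (\<tau> / k * (q ^ N * (M + A))))" using k by (intro ennreal_mult'[symmetric]) simp
      also have "k * (\<tau> / k * (q ^ N * (M + A))) = K * q ^ N" by (simp add: K_def)
      finally show ?thesis .
    qed
    have "(\<lambda>N. K * q ^ N) \<longlonglongrightarrow> K * 0" using q by (intro tendsto_mult tendsto_const LIMSEQ_power_zero) auto
    hence "(\<lambda>N. ennreal (K * q ^ N)) \<longlonglongrightarrow> ennreal 0" by (intro tendsto_ennrealI) simp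
    hence K0: "(\<lambda>N. ennreal (K * q ^ N)) \<longlonglongrightarrow> 0" by simp
    show "(\<lambda>N. \<integral>\<^sup>+\<xi>\<in>V. ennreal (cmod (dd N (\<chi>' \<xi>))) \<partial>lborel) \<longlonglongrightarrow> 0"
      by (rule tendsto_sandwich[OF _ _ tendsto_const K0]) (use bound in auto)
  qed
  have "(\<lambda>w. Bs (\<psi> w)) holomorphic_on \<Omega>"
    using holomorphic_on_compose_gen[OF \<psi>h BB1] \<psi>\<Omega> by (auto simp: o_def image_subset_iff)
  from classical_solution_split[OF \<Omega>(2) V this \<open>R holomorphic_on V\<close>] show ?thesis
    by (simp add: V_def \<chi>\<Lambda> R_def)
qed

section \<open>Convergence of the iteration\<close>

theorem theorem1:
  fixes \<Omega> :: "complex set" and \<omega> \<psi> h :: "complex \<Rightarrow> complex" and \<alpha> :: real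
  assumes "jordan_domain \<Omega>"
    and "\<omega> holomorphic_on ball 0 1" and "bij_betw \<omega> (ball 0 1) \<Omega>"
    and "homeomorphism (cball 0 1) (closure \<Omega>) \<omega> \<psi>"
    and "continuous_on (frontier \<Omega>) h"
    and "1/2 < \<alpha>" and "\<alpha> < 1" and "holder_on \<alpha> (sphere 0 1) (h \<circ> \<omega>)"
  shows "(\<forall>n. F_seq \<omega> h n differentiable_on ball 0 1 \<and>
              (\<forall>z\<in>ball 0 1. set_integrable lebesgue (ball 0 1)
                 (\<lambda>\<zeta>. kern \<zeta> z * beltrami_dz \<omega> (F_seq \<omega> h n) \<zeta>)) \<and>
              continuous_on (cball 0 1) (F_ext \<omega> h n)) \<and>
         (\<forall>\<tau>::real. 0 \<le> \<tau> \<and> \<tau> < 1 \<longrightarrow>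
            (\<exists>f. uniform_limit (closure \<Omega>)
                   (\<lambda>N z. \<Sum>n<N. (F_ext \<omega> h n \<circ> \<psi>) z * of_real \<tau> ^ n) f sequentially \<and>
                 continuous_on (closure \<Omega>) f \<and>
                 classical_solution \<tau> \<Omega> f \<and>
                 (\<forall>z\<in>frontier \<Omega>. f z = h z)))"
proof -
  note \<omega> = assms(2)
  have \<Omega>: "open \<Omega>" "bounded \<Omega>" using assms(1) by (auto simp: jordan_domain_def)
  have inj: "inj_on \<omega> (ball 0 1)" and im: "\<omega> ` ball 0 1 = \<Omega>" using assms(3) by (auto simp: bij_betw_def)
  have \<psi>\<omega>: "\<psi> (\<omega> z) = z" if "z \<in> cball 0 1" for z using assms(4) that by (rule homeomorphism_apply1)
  have \<omega>\<psi>: "\<omega> (\<psi> w) = w" "\<psi> w \<in> cball 0 1" if "w \<in> closure \<Omega>" for w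
    using homeomorphism_apply2[OF assms(4) that] homeomorphism_image2[OF assms(4)] that by auto
  have \<omega>c: "continuous_on (cball 0 1) \<omega>" and \<psi>c: "continuous_on (closure \<Omega>) \<psi>"
    using assms(4) by (auto simp: homeomorphism_def)
  have fr: "frontier \<Omega> = closure \<Omega> - \<Omega>" using \<Omega>(1) by (simp add: frontier_def interior_open)
  have \<omega>fr: "\<omega> u \<in> frontier \<Omega>" if u: "cmod u = 1" for u
  proof -
    have "\<omega> u \<noteq> \<omega> z" if z: "z \<in> ball 0 1" for z
    proof
      assume "\<omega> u = \<omega> z"
      moreover have "u \<in> cball 0 1" "z \<in> cball 0 1" using u z by auto
      ultimately have "u = z" using \<psi>\<omega> by metis
      thus False using u z by simp
    qed
    hence "\<omega> u \<notin> \<Omega>" unfolding im[symmetric] by blast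
    moreover have "\<omega> u \<in> closure \<Omega>" using homeomorphism_image1[OF assms(4)] u by auto
    ultimately show ?thesis unfolding fr by blast
  qed
  have \<psi>fr: "cmod (\<psi> w) = 1" if "w \<in> frontier \<Omega>" for w
  proof -
    have w: "w \<in> closure \<Omega>" "w \<notin> \<Omega>" using that unfolding fr by auto
    have "\<psi> w \<notin> ball 0 1" using w(2) \<omega>\<psi>(1)[OF w(1)] unfolding im[symmetric] by (metis imageI)
    thus ?thesis using \<omega>\<psi>(2)[OF w(1)] by auto
  qed
  have d\<omega>: "deriv \<omega> z \<noteq> 0" if "z \<in> ball 0 1" for z
    by (rule holomorphic_injective_imp_regular[OF \<omega> open_ball inj that])
  define f where "f = h \<circ> \<omega>"
  have fc: "continuous_on (sphere 0 1) f"
    unfolding f_def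
    by (intro continuous_on_compose continuous_on_subset[OF \<omega>c] continuous_on_subset[OF assms(5)]) (use \<omega>fr in auto)
  obtain C where C: "C \<ge> 0" "\<And>u v. cmod u = 1 \<Longrightarrow> cmod v = 1 \<Longrightarrow> cmod (f u - f v) \<le> C * cmod (u - v) powr \<alpha>"
  proof -
    obtain K where K: "\<And>u v. cmod u = 1 \<Longrightarrow> cmod v = 1 \<Longrightarrow> u \<noteq> v \<Longrightarrow> cmod (f u - f v) / cmod (u - v) powr \<alpha> \<le> K"
      using assms(8) unfolding holder_on_def bdd_above_def f_def by (auto simp: mem_sphere_0)
    have "cmod (f u - f v) \<le> max K 0 * cmod (u - v) powr \<alpha>" if "cmod u = 1" "cmod v = 1" for u v
    proof (cases "u = v")
      case False
      have "cmod (f u - f v) \<le> K * cmod (u - v) powr \<alpha>" using K[OF that False] False by (simp add: divide_le_eq)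
      also have "\<dots> \<le> max K 0 * cmod (u - v) powr \<alpha>" by (intro mult_right_mono) auto
      finally show ?thesis .
    qed simp
    thus ?thesis using that[of "max K 0"] by simp
  qed
  have \<alpha>: "0 < \<alpha>" using assms(6) by simp
  obtain C' where C': "C' \<ge> 0"
    "\<And>z. cmod z < 1 \<Longrightarrow> cmod (deriv (cauchy_circle f) z) \<le> C' * (1 - cmod z) powr (\<alpha> - 1)"
    "\<And>z. cmod z < 1 \<Longrightarrow> \<exists>u. cmod u = 1 \<and> cmod (z - u) = 1 - cmod z \<and> cmod (poisson f z - f u) \<le> C' * (1 - cmod z) powr \<alpha>"
    using poisson_holder_bounds[OF \<alpha> assms(7) C fc] by blast
  obtain \<delta>0 M where \<delta>0: "0 < \<delta>0" "\<delta>0 < 1/2" and M: "M > 0"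
    and wn: "\<And>a. cmod a < 1 \<Longrightarrow> wnorm \<delta>0 (deriv (cauchy_circle f)) a \<le> ennreal M"
    using wnorm_boundary_power[OF assms(6,7) C'(1,2)] by blast
  note F0 = poisson_polyan[OF fc]
  have wn0: "wnorm \<delta>0 (d_z (poisson (h \<circ> \<omega>))) a \<le> ennreal M" if "cmod a < 1" for a
    using wn[OF that] wnorm_cong[of "d_z (poisson f)" "deriv (cauchy_circle f)" \<delta>0 a] F0(2) by (simp add: f_def)
  define \<kappa> where "\<kappa> = (\<lambda>\<delta>::real. (1 + 2 * \<delta>) / (1 - 2 * \<delta>))"
  define F where "F = F_seq \<omega> h"
  have P: "polyan \<omega> (F n)"
    and W: "\<And>\<delta> a. 0 < \<delta> \<Longrightarrow> \<delta> \<le> \<delta>0 \<Longrightarrow> cmod a < 1 \<Longrightarrow> wnorm \<delta> (d_z (F n)) a \<le> ennreal (\<kappa> \<delta> ^ n * M)" for n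
    using F_seq_induction[OF \<omega> d\<omega> F0(1)[unfolded f_def] \<delta>0 M wn0] unfolding \<kappa>_def F_def by blast+
  have \<kappa>: "\<kappa> \<delta> > 0" if "0 < \<delta>" "\<delta> \<le> \<delta>0" for \<delta> using that \<delta>0 by (simp add: \<kappa>_def)
  have \<kappa>M: "\<kappa> \<delta> ^ n * M > 0" if "0 < \<delta>" "\<delta> \<le> \<delta>0" for \<delta> n using \<kappa>[OF that] M by simp
  define \<phi> where "\<phi> = (\<lambda>n. beltrami_dz \<omega> (F n))"
  have F_0: "F 0 = poisson f" by (simp add: F_def f_def)
  have F_Suc: "K_op (beltrami_dz \<omega> (F n)) = F (Suc n)" for n by (simp add: F_def)
  note step = K_op_step[OF \<omega> d\<omega> P _ _ \<kappa>M W, unfolded F_Suc]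
  have N: "integrable lborel (disk_cut (\<phi> n))" for n
    using step(1)[of \<delta>0] \<delta>0 by (simp add: \<phi>_def)
  have van: "vanishes_at_circle (F (Suc n))" for n
    using step(2)[of \<delta>0] \<delta>0 by simp
  have bd: "cmod (F (Suc n) a) \<le> sqrt (\<kappa> \<delta> ^ n * M) * (1 / \<delta> + 1)" if "0 < \<delta>" "\<delta> \<le> \<delta>0" "cmod a < 1" for n a \<delta>
    using step(3)[of \<delta>] \<delta>0 that by simp
  note w = polyan_wderiv[OF \<omega> P]
  \<comment> \<open>The boundary values of the iterates.\<close>
  define L where "L = (\<lambda>n::nat. if n = 0 then f else (\<lambda>_. 0))"
  have near: "\<exists>r<1. \<forall>z. r < cmod z \<and> cmod z < 1 \<longrightarrow>
        (\<exists>u. cmod u = 1 \<and> cmod (z - u) = 1 - cmod z \<and> cmod (F n z - L n u) < e)" if e: "e > 0" for n e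
  proof (cases n)
    case 0
    define \<epsilon> where "\<epsilon> = (e / (C' + 1)) powr (1 / \<alpha>)"
    have \<epsilon>: "\<epsilon> > 0" using e C'(1) by (simp add: \<epsilon>_def)
    have lt: "C' * (1 - cmod z) powr \<alpha> < e" if "1 - \<epsilon> < cmod z" "cmod z < 1" for z :: complex
    proof -
      have "(1 - cmod z) powr \<alpha> < \<epsilon> powr \<alpha>" using that \<alpha> by (intro powr_less_mono2) auto
      also have "\<epsilon> powr \<alpha> = e / (C' + 1)" using \<alpha> e C'(1) by (simp add: \<epsilon>_def powr_powr)
      finally have "(C' + 1) * (1 - cmod z) powr \<alpha> < e" using C'(1) by (simp add: field_simps)
      moreover have "C' * (1 - cmod z) powr \<alpha> \<le> (C' + 1) * (1 - cmod z) powr \<alpha>" by (intro mult_right_mono) auto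
      ultimately show ?thesis by simp
    qed
    show ?thesis
      by (rule exI[of _ "1 - \<epsilon>"]) (use \<epsilon> C'(3) lt 0 in \<open>fastforce simp: L_def F_0\<close>)
  next
    case (Suc k)
    from van[of k] e obtain r where r: "r < 1" "\<And>z. r < cmod z \<Longrightarrow> cmod z < 1 \<Longrightarrow> cmod (F (Suc k) z) < e"
      unfolding vanishes_at_circle_def by blast
    show ?thesis
    proof (intro exI[of _ r] conjI allI impI r(1))
      fix z assume z: "r < cmod z \<and> cmod z < 1"
      then obtain u where "cmod u = 1" "cmod (z - u) = 1 - cmod z" using nearest_circle_point by blast
      thus "\<exists>u. cmod u = 1 \<and> cmod (z - u) = 1 - cmod z \<and> cmod (F n z - L n u) < e"
        using r(2)[of z] z by (auto simp: L_def Suc)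
    qed
  qed
  have Lc: "continuous_on (sphere 0 1) (L n)" for n using fc by (simp add: L_def)
  have Fc: "continuous_on (ball 0 1) (F n)" for n by (rule wderiv_continuous_on[OF w(1)])
  have extc: "continuous_on (cball 0 1) (\<lambda>z. if z \<in> ball 0 1 then F n z else L n z)" for n
    by (rule continuous_disk_extension(1)[OF Fc Lc near])
  have extL: "Lim (at \<xi> within ball 0 1) (F n) = L n \<xi>" if "cmod \<xi> = 1" for n \<xi>
    by (rule continuous_disk_extension(2)[OF Fc Lc near that])
  have E: "F_ext \<omega> h n z = (if z \<in> ball 0 1 then F n z else L n z)" if "z \<in> cball 0 1" for n z
  proof (cases "z \<in> ball 0 1")
    case False
    hence "cmod z = 1" using that by auto
    from extL[OF this, of n] show ?thesis using False by (simp add: F_ext_def F_def)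
  qed (simp add: F_ext_def F_def)
  have Ec: "continuous_on (cball 0 1) (F_ext \<omega> h n)" for n
    by (rule continuous_on_eq[OF extc]) (rule E[symmetric])
  have part1: "F n differentiable_on ball 0 1 \<and>
      (\<forall>z\<in>ball 0 1. set_integrable lebesgue (ball 0 1) (\<lambda>\<zeta>. kern \<zeta> z * beltrami_dz \<omega> (F n) \<zeta>)) \<and>
      continuous_on (cball 0 1) (F_ext \<omega> h n)" for n
    using wderiv_differentiable_on[OF w(1)] polyan_K_op(2)[OF \<omega> d\<omega> P N[unfolded \<phi>_def]] Ec by blast
  have part2: "\<exists>g. uniform_limit (closure \<Omega>) (\<lambda>N z. \<Sum>n<N. (F_ext \<omega> h n \<circ> \<psi>) z * of_real \<tau> ^ n) g sequentially \<and>
                 continuous_on (closure \<Omega>) g \<and> classical_solution \<tau> \<Omega> g \<and> (\<forall>z\<in>frontier \<Omega>. g z = h z)"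
    if \<tau>: "0 \<le> \<tau>" "\<tau> < 1" for \<tau> :: real
  proof -
    \<comment> \<open>Any \<open>q\<close> between \<open>\<tau>\<close> and 1 would do; then \<open>\<delta>\<close> is so small that \<open>\<tau>\<^sup>2 (1 + 2\<delta>) / (1 - 2\<delta>) \<le> q\<^sup>2\<close>,
      with the squares because \<open>wnorm\<close> is quadratic.\<close>
    define q where "q = (1 + \<tau>) / 2"
    have q: "0 < q" "q < 1" "\<tau> < q" using \<tau> by (auto simp: q_def)
    define \<delta> where "\<delta> = min \<delta>0 ((q\<^sup>2 - \<tau>\<^sup>2) / 4)"
    have "\<tau>\<^sup>2 < q\<^sup>2" using q \<tau> by (intro power_strict_mono) auto
    hence "0 < \<delta>" using \<delta>0 by (simp add: \<delta>_def)
    moreover have "\<delta> \<le> \<delta>0" unfolding \<delta>_def by (rule min.cobounded1)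
    moreover have "\<delta> \<le> (q\<^sup>2 - \<tau>\<^sup>2) / 4" unfolding \<delta>_def by (rule min.cobounded2)
    ultimately have \<delta>: "0 < \<delta>" "\<delta> \<le> \<delta>0" "\<delta> \<le> (q\<^sup>2 - \<tau>\<^sup>2) / 4" by blast+
    have \<tau>\<kappa>: "\<tau>\<^sup>2 * \<kappa> \<delta> \<le> q\<^sup>2"
    proof -
      have "\<tau>\<^sup>2 \<le> 1" "q\<^sup>2 \<le> 1" using \<tau> q by (auto simp: power_le_one)
      hence "2 * \<delta> * (\<tau>\<^sup>2 + q\<^sup>2) \<le> 2 * \<delta> * 2" using \<delta> by (intro mult_left_mono) auto
      hence "\<tau>\<^sup>2 * (1 + 2 * \<delta>) \<le> q\<^sup>2 * (1 - 2 * \<delta>)" using \<delta>(3) by (simp add: algebra_simps)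
      thus ?thesis using \<delta> \<delta>0 by (simp add: \<kappa>_def field_simps)
    qed
    have \<tau>q: "(\<tau> ^ n)\<^sup>2 * (\<kappa> \<delta> ^ n * M) \<le> M * (q ^ n)\<^sup>2" for n
    proof -
      have "(\<tau>\<^sup>2 * \<kappa> \<delta>) ^ n * M \<le> (q\<^sup>2) ^ n * M"
        using M \<tau>\<kappa> \<kappa>[OF \<delta>(1,2)] by (intro mult_right_mono power_mono) auto
      thus ?thesis by (simp add: power_mult_distrib mult_ac flip: power_mult)
    qed
    define Q where "Q = sqrt M * (1 / \<delta> + 1)"
    have Fb: "cmod (F (Suc n) z * of_real \<tau> ^ Suc n) \<le> Q * q ^ n" if "cmod z < 1" for n z
    proof -
      have "\<tau> ^ n * sqrt (\<kappa> \<delta> ^ n * M) = sqrt ((\<tau> ^ n)\<^sup>2 * (\<kappa> \<delta> ^ n * M))" using \<tau> by (simp add: real_sqrt_mult)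
      also have "\<dots> \<le> sqrt (M * (q ^ n)\<^sup>2)" using \<tau>q by (intro real_sqrt_le_mono)
      also have "\<dots> = sqrt M * q ^ n" using q by (simp add: real_sqrt_mult)
      finally have 1: "\<tau> ^ n * sqrt (\<kappa> \<delta> ^ n * M) \<le> sqrt M * q ^ n" .
      have "cmod (F (Suc n) z * of_real \<tau> ^ Suc n) = \<tau> * (\<tau> ^ n * cmod (F (Suc n) z))" using \<tau> by (simp add: norm_mult norm_power)
      also have "\<dots> \<le> 1 * (\<tau> ^ n * (sqrt (\<kappa> \<delta> ^ n * M) * (1 / \<delta> + 1)))"
        using \<tau> bd[OF \<delta>(1,2) that, of n] by (intro mult_mono) auto
      also have "\<dots> = (\<tau> ^ n * sqrt (\<kappa> \<delta> ^ n * M)) * (1 / \<delta> + 1)" by simp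
      also have "\<dots> \<le> (sqrt M * q ^ n) * (1 / \<delta> + 1)" using 1 \<delta> by (intro mult_right_mono) auto
      finally show ?thesis by (simp add: Q_def mult_ac)
    qed
    have GM: "(\<integral>\<^sup>+z\<in>ball 0 1. ennreal ((cmod (d_z (F n) z * of_real \<tau> ^ n))\<^sup>2) \<partial>lborel) \<le> ennreal (M * (q ^ n)\<^sup>2)" for n
    proof -
      have mb: "(\<lambda>z. ennreal ((cmod (disk_cut (d_z (F n)) z))\<^sup>2)) \<in> borel_measurable borel"
        using disk_cut_measurable[OF w(2)[of n]] by measurable
      have "(\<integral>\<^sup>+z\<in>ball 0 1. ennreal ((cmod (d_z (F n) z * of_real \<tau> ^ n))\<^sup>2) \<partial>lborel)
         = (\<integral>\<^sup>+z. ennreal ((\<tau> ^ n)\<^sup>2) * ennreal ((cmod (disk_cut (d_z (F n)) z))\<^sup>2) \<partial>lborel)"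
      proof (rule nn_integral_cong)
        fix z :: complex
        have "(cmod (d_z (F n) z * of_real \<tau> ^ n))\<^sup>2 = (\<tau> ^ n)\<^sup>2 * (cmod (d_z (F n) z))\<^sup>2"
          using \<tau> by (simp add: norm_mult norm_power power_mult_distrib)
        moreover have "ennreal ((\<tau> ^ n)\<^sup>2 * (cmod (d_z (F n) z))\<^sup>2) = ennreal ((\<tau> ^ n)\<^sup>2) * ennreal ((cmod (d_z (F n) z))\<^sup>2)"
          by (rule ennreal_mult') simp
        ultimately show "ennreal ((cmod (d_z (F n) z * of_real \<tau> ^ n))\<^sup>2) * indicator (ball 0 1) z
          = ennreal ((\<tau> ^ n)\<^sup>2) * ennreal ((cmod (disk_cut (d_z (F n)) z))\<^sup>2)"
          by (simp add: disk_cut_def indicator_def)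
      qed
      also have "\<dots> = ennreal ((\<tau> ^ n)\<^sup>2) * (\<integral>\<^sup>+z. ennreal ((cmod (disk_cut (d_z (F n)) z))\<^sup>2) \<partial>lborel)"
        using mb by (intro nn_integral_cmult) simp
      also have "(\<integral>\<^sup>+z. ennreal ((cmod (disk_cut (d_z (F n)) z))\<^sup>2) \<partial>lborel) = (\<integral>\<^sup>+z\<in>ball 0 1. ennreal ((cmod (d_z (F n) z))\<^sup>2) \<partial>lborel)"
        by (intro nn_integral_cong) (auto simp: disk_cut_def indicator_def)
      also have "ennreal ((\<tau> ^ n)\<^sup>2) * \<dots> \<le> ennreal ((\<tau> ^ n)\<^sup>2) * ennreal (\<kappa> \<delta> ^ n * M)"
        by (intro mult_left_mono square_integrable_of_wnorm(1)[OF w(2) _ W[OF \<delta>(1,2), of 0]]) (use \<delta> in auto)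
      also have "\<dots> = ennreal ((\<tau> ^ n)\<^sup>2 * (\<kappa> \<delta> ^ n * M))" by (rule ennreal_mult'[symmetric]) simp
      also have "\<dots> \<le> ennreal (M * (q ^ n)\<^sup>2)" by (rule ennreal_leI[OF \<tau>q])
      finally show ?thesis .
    qed
    define B where "B = (\<lambda>n. case n of 0 \<Rightarrow> (\<lambda>z. z * cauchy_circle (\<lambda>u. cnj (f u) / u) z) | Suc n \<Rightarrow> antihol_part (\<phi> n))"
    have Bh: "B n holomorphic_on ball 0 1" for n
      using F0(4) antihol_part_facts(1)[OF N] by (cases n) (auto simp: B_def)
    have Bb: "cmod (B (Suc n) z * of_real \<tau> ^ Suc n) \<le> (M + pi) * q ^ n / (1 - cmod z)" if z: "cmod z < 1" for n z
    proof -
      define I where "I = (\<integral>\<zeta>. cmod (disk_cut (\<phi> n) \<zeta>) \<partial>lborel)"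
      have "ennreal (\<tau> ^ n * I) = ennreal (\<tau> ^ n) * (\<integral>\<^sup>+\<zeta>. ennreal (cmod (disk_cut (\<phi> n) \<zeta>)) \<partial>lborel)"
        using nn_integral_eq_integral[OF integrable_norm[OF N[of n]]] \<tau> by (simp add: I_def ennreal_mult')
      also have "\<dots> = (\<integral>\<^sup>+\<zeta>. ennreal (\<tau> ^ n) * ennreal (cmod (disk_cut (\<phi> n) \<zeta>)) \<partial>lborel)"
        using borel_measurable_integrable[OF N[of n]] by (intro nn_integral_cmult[symmetric]) simp
      also have "\<dots> = (\<integral>\<^sup>+z\<in>ball 0 1. ennreal (cmod (d_z (F n) z * of_real \<tau> ^ n) * cmod 1) \<partial>lborel)"
      proof (rule nn_integral_cong)
        fix \<zeta> :: complex
        have "ennreal (\<tau> ^ n) * ennreal (cmod (d_z (F n) \<zeta>)) = ennreal (\<tau> ^ n * cmod (d_z (F n) \<zeta>))"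
          using \<tau> by (intro ennreal_mult'[symmetric]) simp
        thus "ennreal (\<tau> ^ n) * ennreal (cmod (disk_cut (\<phi> n) \<zeta>)) = ennreal (cmod (d_z (F n) \<zeta> * of_real \<tau> ^ n) * cmod 1) * indicator (ball 0 1) \<zeta>"
          using \<tau> beltrami_norm[OF d\<omega>, of \<zeta> "F n"]
          by (auto simp: disk_cut_def indicator_def \<phi>_def norm_mult norm_power mult.commute)
      qed
      also have "\<dots> \<le> ennreal (q ^ n * (M + pi))"
      proof (rule nn_integral_young)
        have "emeasure lborel (ball (0::complex) 1) = ennreal pi" using emeasure_ball[of 1 "0::complex"] by (simp add: unit_ball_vol_2 eval_nat_numeral)
        thus "(\<integral>\<^sup>+z\<in>ball (0::complex) 1. ennreal ((cmod 1)\<^sup>2) \<partial>lborel) \<le> ennreal pi" by simp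
      qed (use GM q M w(2) in \<open>auto intro!: continuous_intros\<close>)
      finally have I: "\<tau> ^ n * I \<le> (M + pi) * q ^ n" using q M by (simp add: mult.commute)
      have "cmod (B (Suc n) z * of_real \<tau> ^ Suc n) = \<tau> * (\<tau> ^ n * cmod (antihol_part (\<phi> n) z))"
        using \<tau> by (simp add: B_def norm_mult norm_power)
      also have "\<dots> \<le> 1 * (\<tau> ^ n * (I / (1 - cmod z)))"
        using \<tau> antihol_part_facts(3)[OF N[of n], of z] z by (intro mult_mono) (auto simp: I_def)
      also have "\<dots> = \<tau> ^ n * I / (1 - cmod z)" by simp
      also have "\<dots> \<le> (M + pi) * q ^ n / (1 - cmod z)" using I z by (intro divide_right_mono) auto
      finally show ?thesis .
    qed
    define \<Phi> where "\<Phi> = (\<lambda>z. \<Sum>n. F_ext \<omega> h n z * of_real \<tau> ^ n)"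
    have ul: "uniform_limit (cball 0 1) (\<lambda>N z. \<Sum>n<N. F_ext \<omega> h n z * of_real \<tau> ^ n) \<Phi> sequentially"
    proof -
      have "bounded (F_ext \<omega> h 0 ` cball 0 1)" by (intro compact_imp_bounded compact_continuous_image Ec) simp
      then obtain K where K: "\<And>z. z \<in> cball 0 1 \<Longrightarrow> cmod (F_ext \<omega> h 0 z) \<le> K" unfolding bounded_iff by blast
      define m where "m = (\<lambda>n. case n of 0 \<Rightarrow> K | Suc n \<Rightarrow> Q * q ^ n)"
      have Q0: "Q \<ge> 0" using M \<delta> by (simp add: Q_def)
      show ?thesis unfolding \<Phi>_def
      proof (rule Weierstrass_m_test)
        fix n z assume z: "z \<in> cball (0::complex) 1"
        show "norm (F_ext \<omega> h n z * of_real \<tau> ^ n) \<le> m n"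
        proof (cases n)
          case (Suc k)
          show ?thesis using E[OF z, of n] Fb[of z k] Q0 q unfolding Suc m_def by (auto simp: L_def)
        qed (use K z in \<open>simp add: m_def\<close>)
      next
        have "summable (\<lambda>n. m (Suc n))" using q by (simp add: m_def summable_mult summable_geometric)
        thus "summable m" by (simp only: summable_Suc_iff)
      qed
    qed
    have \<Phi>c: "continuous_on (cball 0 1) \<Phi>"
      by (rule uniform_limit_theorem[OF _ ul]) (auto intro!: always_eventually continuous_intros Ec)
    have lim: "uniform_limit (ball 0 1) (\<lambda>N z. \<Sum>n<N. F n z * of_real \<tau> ^ n) \<Phi> sequentially"
      using uniform_limit_on_subset[OF ul ball_subset_cball] by (rule uniform_limit_cong'[THEN iffD1, rotated 2]) (auto simp: E)
    have sol: "classical_solution \<tau> \<Omega> (\<lambda>w. \<Phi> (\<psi> w))"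
    proof (rule iterated_series_solution[OF \<omega> d\<omega> _ im[symmetric] \<Omega> \<tau> q(1,2) _ w Bh _ _ Bb GM lim])
      show "\<psi> (\<omega> z) = z" if "z \<in> ball 0 1" for z using \<psi>\<omega> that by simp
      show "M \<ge> 0" using M by simp
      show "d_zbar (F 0) z = cnj (deriv (B 0) z)" if "z \<in> ball 0 1" for z using F0(3)[OF that] by (simp add: F_0 B_def)
      show "d_zbar (F (Suc n)) z + cnj (deriv \<omega> z) / deriv \<omega> z * d_z (F n) z = cnj (deriv (B (Suc n)) z)" if "z \<in> ball 0 1" for n z
        using polyan_K_op(3)[OF \<omega> d\<omega> P N[unfolded \<phi>_def] that, of n, unfolded F_Suc] by (simp add: B_def \<phi>_def beltrami_dz_def)
    qed
    have "uniform_limit (closure \<Omega>) (\<lambda>N z. \<Sum>n<N. (F_ext \<omega> h n \<circ> \<psi>) z * of_real \<tau> ^ n) (\<lambda>w. \<Phi> (\<psi> w)) sequentially"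
      unfolding o_def by (rule uniform_limit_inner[OF ul]) (rule \<omega>\<psi>(2))
    moreover have "continuous_on (closure \<Omega>) (\<lambda>w. \<Phi> (\<psi> w))"
      by (rule continuous_on_compose2[OF \<Phi>c \<psi>c]) (use \<omega>\<psi>(2) in blast)
    moreover have "\<Phi> (\<psi> w) = h w" if w: "w \<in> frontier \<Omega>" for w
    proof -
      have c: "cmod (\<psi> w) = 1" "w \<in> closure \<Omega>" using \<psi>fr[OF w] w fr by auto
      hence "\<Phi> (\<psi> w) = (\<Sum>n. L n (\<psi> w) * of_real \<tau> ^ n)" unfolding \<Phi>_def by (simp add: E)
      also have "\<dots> = (\<Sum>n\<in>{0}. L n (\<psi> w) * of_real \<tau> ^ n)" by (rule suminf_finite) (auto simp: L_def)
      also have "\<dots> = h w" using \<omega>\<psi>(1)[OF c(2)] by (simp add: L_def f_def)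
      finally show ?thesis .
    qed
    ultimately show ?thesis using sol by blast
  qed
  show ?thesis using part1 part2 unfolding F_def by blast
qed

end
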